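(* $3$-Regular List Colouring is NP-complete when restricted to planar graphs that contain no cycle of length $4$, no cycle of length $5$ (as subgraphs), and no intersecting triangles.
   Context: A colouring of a graph $G=(V,E)$ is a map $c:V\to\{1,2,\dots\}$ with $c(u)\neq c(v)$ for every edge $uv$. A list assignment $L$ gives each vertex $u$ a set $L(u)\subseteq\{1,2,\dots\}$; a colouring $c$ respects $L$ if $c(u)\in L(u)$ for all $u$. $L$ is $3$-regular if $|L(u)|=3$ for every vertex $u$. The problem $3$-Regular List Colouring takes as input a graph $G$ with a $3$-regular list assignment $L$ and asks whether $G$ has a colouring respecting $L$. A graph has intersecting triangles if it contains two distinct triangles (cycles of length $3$) sharing a vertex. *)

theory Defs
  imports "HOL-Analysis.Analysis" "HOL-Computational_Algebra.Polynomial"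
begin

section \<open>Deterministic multi-tape Turing machines\<close>

text \<open>Symbols and states are natural numbers. Symbol 0 is the blank, 1 and 2 are the two bits, and
  further symbols below \<open>symbols M\<close> are work symbols. The start state is 0, and \<open>states M\<close> itself
  is the halting state. Tapes are infinite in both directions. Only the finitely many values of
  \<open>delta\<close> constrained by \<open>wf_tm\<close> are ever used.\<close>

datatype move = Move_Left | Stay | Move_Right

record tm =
  tapes :: nat
  symbols :: nat
  states :: nat
  delta :: "nat \<Rightarrow> nat list \<Rightarrow> nat \<times> (nat \<times> move) list"

definition wf_tm :: "tm \<Rightarrow> bool" where
  "wf_tm M \<longleftrightarrow> tapes M \<ge> 1 \<and> symbols M \<ge> 3 \<and>
     (\<forall>q < states M. \<forall>ss. length ss = tapes M \<and> set ss \<subseteq> {..<symbols M} \<longrightarrow>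
        (case delta M q ss of (q', acts) \<Rightarrow>
           q' \<le> states M \<and> length acts = tapes M \<and> fst ` set acts \<subseteq> {..<symbols M}))"

type_synonym tape = "(int \<Rightarrow> nat) \<times> int"
type_synonym config = "nat \<times> tape list"

fun offset :: "move \<Rightarrow> int" where
  "offset Move_Left = -1"
| "offset Stay = 0"
| "offset Move_Right = 1"

fun read_tape :: "tape \<Rightarrow> nat" where
  "read_tape (t, h) = t h"

fun act_tape :: "nat \<times> move \<Rightarrow> tape \<Rightarrow> tape" where
  "act_tape (s, d) (t, h) = (t(h := s), h + offset d)"

fun step :: "tm \<Rightarrow> config \<Rightarrow> config" where
  "step M (q, ts) =
     (if q < states M
      then (case delta M q (map read_tape ts) of (q', acts) \<Rightarrow> (q', map2 act_tape acts ts))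
      else (q, ts))"

definition bit_symbol :: "bool \<Rightarrow> nat" where
  "bit_symbol b = (if b then 2 else 1)"

definition word_tape :: "bool list \<Rightarrow> tape" where
  "word_tape w =
     ((\<lambda>p. if 0 \<le> p \<and> p < int (length w) then bit_symbol (w ! nat p) else 0), 0)"

text \<open>The \<open>i\<close>-th input word is written on the \<open>i\<close>-th tape; all other tapes are blank.\<close>

definition init_config :: "tm \<Rightarrow> bool list list \<Rightarrow> config" where
  "init_config M ws =
     (0, map (\<lambda>i. word_tape (if i < length ws then ws ! i else [])) [0..<tapes M])"

definition tape_output :: "tape \<Rightarrow> bool list \<Rightarrow> bool" where
  "tape_output t w \<longleftrightarrow>
     (\<forall>i < length w. fst t (int i) = bit_symbol (w ! i)) \<and> fst t (int (length w)) = 0"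

text \<open>Since \<open>step\<close> fixes halting configurations, this says that \<open>M\<close> halts after at most
  \<open>t\<close> steps, with output \<open>y\<close> on its first tape.\<close>

definition computes_within :: "tm \<Rightarrow> bool list list \<Rightarrow> nat \<Rightarrow> bool list \<Rightarrow> bool" where
  "computes_within M ws t y \<longleftrightarrow>
     (case (step M ^^ t) (init_config M ws) of (q, ts) \<Rightarrow>
        q = states M \<and> tape_output (ts ! 0) y)"


section \<open>NP and NP-completeness\<close>

type_synonym language = "bool list set"

definition polytime_computable :: "(bool list \<Rightarrow> bool list) \<Rightarrow> bool" where
  "polytime_computable f \<longleftrightarrow>
     (\<exists>M (p :: nat poly). wf_tm M \<and>
        (\<forall>w. computes_within M [w] (poly p (length w)) (f w)))"

definition polytime_decidable2 :: "(bool list \<Rightarrow> bool list \<Rightarrow> bool) \<Rightarrow> bool" where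
  "polytime_decidable2 R \<longleftrightarrow>
     (\<exists>M (p :: nat poly). wf_tm M \<and> tapes M \<ge> 2 \<and>
        (\<forall>x u. computes_within M [x, u] (poly p (length x + length u)) [R x u]))"

definition NP :: "language set" where
  "NP = {A. \<exists>R (q :: nat poly). polytime_decidable2 R \<and>
          (\<forall>x. x \<in> A \<longleftrightarrow> (\<exists>u. length u \<le> poly q (length x) \<and> R x u))}"

text \<open>A decision problem is given by its set \<open>I\<close> of instances, the set \<open>Y\<close> of inputs with answer
  yes, and an encoding of inputs by words. Restricting a problem to a class of inputs means shrinking
  \<open>I\<close>: an algorithm for the restricted problem has to be correct on the codes of instances, and a
  reduction to it has to produce codes of instances on every input.\<close>

definition in_NP :: "('i \<Rightarrow> bool list) \<Rightarrow> 'i set \<Rightarrow> 'i set \<Rightarrow> bool" where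
  "in_NP enc I Y \<longleftrightarrow> (\<exists>A \<in> NP. \<forall>x \<in> I. enc x \<in> A \<longleftrightarrow> x \<in> Y)"

definition NP_hard :: "('i \<Rightarrow> bool list) \<Rightarrow> 'i set \<Rightarrow> 'i set \<Rightarrow> bool" where
  "NP_hard enc I Y \<longleftrightarrow>
     (\<forall>A \<in> NP. \<exists>f. polytime_computable f \<and>
        (\<forall>w. \<exists>x \<in> I. f w = enc x \<and> (w \<in> A \<longleftrightarrow> x \<in> Y)))"

definition NP_complete :: "('i \<Rightarrow> bool list) \<Rightarrow> 'i set \<Rightarrow> 'i set \<Rightarrow> bool" where
  "NP_complete enc I Y \<longleftrightarrow> in_NP enc I Y \<and> NP_hard enc I Y"


section \<open>Graphs\<close>

definition simple_graph :: "'a set \<Rightarrow> 'a set set \<Rightarrow> bool" where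
  "simple_graph V E \<longleftrightarrow> finite V \<and> (\<forall>e \<in> E. e \<subseteq> V \<and> card e = 2)"

definition is_cycle :: "'a set set \<Rightarrow> 'a list \<Rightarrow> bool" where
  "is_cycle E xs \<longleftrightarrow> length xs \<ge> 3 \<and> distinct xs \<and>
     (\<forall>i < length xs. {xs ! i, xs ! ((i + 1) mod length xs)} \<in> E)"

definition has_cycle_of_length :: "'a set set \<Rightarrow> nat \<Rightarrow> bool" where
  "has_cycle_of_length E k \<longleftrightarrow> (\<exists>xs. is_cycle E xs \<and> length xs = k)"

text \<open>In a simple graph a triangle is determined by its vertex set.\<close>

definition triangles :: "'a set set \<Rightarrow> 'a set set" where
  "triangles E = {set xs | xs. is_cycle E xs \<and> length xs = 3}"

definition intersecting_triangles :: "'a set set \<Rightarrow> bool" where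
  "intersecting_triangles E \<longleftrightarrow>
     (\<exists>S \<in> triangles E. \<exists>T \<in> triangles E. S \<noteq> T \<and> S \<inter> T \<noteq> {})"

definition planar :: "'a set \<Rightarrow> 'a set set \<Rightarrow> bool" where
  "planar V E \<longleftrightarrow>
     (\<exists>(pos :: 'a \<Rightarrow> real \<times> real) (\<gamma> :: 'a set \<Rightarrow> real \<Rightarrow> real \<times> real).
        inj_on pos V \<and>
        (\<forall>e \<in> E. arc (\<gamma> e) \<and> {pathstart (\<gamma> e), pathfinish (\<gamma> e)} = pos ` e \<and>
                  path_image (\<gamma> e) \<inter> pos ` V = pos ` e) \<and>
        (\<forall>e \<in> E. \<forall>f \<in> E. e \<noteq> f \<longrightarrow>
           path_image (\<gamma> e) \<inter> path_image (\<gamma> f) = pos ` (e \<inter> f)))"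


section \<open>List colouring\<close>

definition colouring :: "'a set \<Rightarrow> 'a set set \<Rightarrow> ('a \<Rightarrow> nat) \<Rightarrow> bool" where
  "colouring V E c \<longleftrightarrow> (\<forall>u \<in> V. c u \<ge> 1) \<and> (\<forall>u v. {u, v} \<in> E \<longrightarrow> c u \<noteq> c v)"

definition list_assignment :: "'a set \<Rightarrow> ('a \<Rightarrow> nat set) \<Rightarrow> bool" where
  "list_assignment V L \<longleftrightarrow> (\<forall>u \<in> V. L u \<subseteq> {1..})"

definition regular_assignment :: "nat \<Rightarrow> 'a set \<Rightarrow> ('a \<Rightarrow> nat set) \<Rightarrow> bool" where
  "regular_assignment k V L \<longleftrightarrow> (\<forall>u \<in> V. finite (L u) \<and> card (L u) = k)"

definition respects_lists :: "'a set \<Rightarrow> ('a \<Rightarrow> nat) \<Rightarrow> ('a \<Rightarrow> nat set) \<Rightarrow> bool" where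
  "respects_lists V c L \<longleftrightarrow> (\<forall>u \<in> V. c u \<in> L u)"

text \<open>As inputs, graphs have vertex set \<open>{..<n}\<close>; an input is a triple \<open>(n, E, L)\<close>.\<close>

type_synonym list_colouring_input = "nat \<times> nat set set \<times> (nat \<Rightarrow> nat set)"

definition regular_list_colouring_instances :: "nat \<Rightarrow> list_colouring_input set" where
  "regular_list_colouring_instances k =
     {(n, E, L). simple_graph {..<n} E \<and> list_assignment {..<n} L \<and> regular_assignment k {..<n} L}"

definition list_colourable :: "list_colouring_input set" where
  "list_colourable = {(n, E, L). \<exists>c. colouring {..<n} E c \<and> respects_lists {..<n} c L}"

definition restricted_to :: "list_colouring_input set \<Rightarrow> (nat set \<Rightarrow> nat set set \<Rightarrow> bool)
    \<Rightarrow> list_colouring_input set" where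
  "restricted_to I P = {(n, E, L). (n, E, L) \<in> I \<and> P {..<n} E}"

text \<open>Numbers are written in binary (least significant bit first), each digit preceded by
  \<open>True\<close>, with \<open>False\<close> as terminator. The code of an input consists of the number of vertices in
  unary, the adjacency matrix row by row, and for each vertex the size of its list followed by its
  colours in increasing order.\<close>

fun encode_nat :: "nat \<Rightarrow> bool list" where
  "encode_nat n = (if n = 0 then [False] else True # odd n # encode_nat (n div 2))"

declare encode_nat.simps [simp del]

definition encode_nat_set :: "nat set \<Rightarrow> bool list" where
  "encode_nat_set A = encode_nat (card A) @ concat (map encode_nat (sorted_list_of_set A))"

fun encode_input :: "list_colouring_input \<Rightarrow> bool list" where
  "encode_input (n, E, L) =
     replicate n True @ [False] @
     concat (map (\<lambda>i. map (\<lambda>j. {i, j} \<in> E) [0..<n]) [0..<n]) @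
     concat (map (\<lambda>u. encode_nat_set (L u)) [0..<n])"

end

theory Submission
  imports Defs
begin

text \<open>Membership: a certificate picks one of the three colours of every list, and a machine that carries a
  step counter counts the monochromatic edges.

  Hardness: a computation is described by clauses over a square of times and tape positions, of bounded size
  and with a bounded number of variables at each position. Clauses become rows and variables become columns
  of a constraint satisfaction problem on a square lattice in which only neighbouring sites constrain each
  other; a site has three values, so the crossing of a row and a column takes a block of several sites. Each
  forbidden pair of values at neighbouring sites is imposed by a copy of one planar gadget that forbids a single
  pair of colours at its two ends, has lists of size 3, and contains no 4-cycle, no 5-cycle and no two
  intersecting triangles. The clauses, and hence the lists, are computed from digit patterns
  that depend only on the differences of positions, so that the instance can be printed by nested
  loops of a machine.\<close>

text \<open>What shapes the proof is the crossing of wires. Sites with three values enforce only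
  implications there, so a variable is transmitted reliably only if its positive occurrences lie
  above its negative ones. Hence the clauses are ordered by time: apart from the padding and the few
  that guess the certificate, every conclusion lies one time step after the premises. A satisfying
  assignment need not describe a computation exactly; it is enough that it contains every true fact
  of one, which Horn clauses guarantee.

  So each piece of the code depends on boundedly many symbols under the heads.

  NP demands a machine that answers on all pairs of words, also on those that encode nothing. The
  step counter cuts off the verifier there and is too generous to matter on codes.

  Turing machines are not written by hand: a small language with loops is compiled to them.\<close>

abbreviation (input) "Rt == Move_Right"
abbreviation (input) "Lt == Move_Left"

section \<open>Structured programs and their compilation to Turing machines\<close>

definition ntapes :: nat where "ntapes = 24"
definition nsyms :: nat where "nsyms = 8"

type_synonym mem = "nat => tape"
type_synonym view = "nat => nat"

definition view :: "mem => view" where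
	"view T = (%i. if i < ntapes then read_tape (T i) else 0)"

text \<open>Tests and actions are arbitrary functions of the symbols under the heads. Any finite
  table can thus be one instruction, which later lets a machine look up lists and adjacencies
  without computing them.\<close>

datatype prog =
	Op nat "view => nat \<times> move"
	| Seq prog prog (infixr ";;" 60)
	| Cond "view => bool" prog prog
	| While "view => bool" prog

inductive exec :: "prog => mem => nat => mem => bool" where
	Op: "exec (Op i g) T 1 (T(i := act_tape (g (view T)) (T i)))"
| Seq: "exec a T s T' ==> exec b T' t T'' ==> exec (a ;; b) T (s + t) T''"
| CondT: "c (view T) ==> exec a T t T' ==> exec (Cond c a b) T (Suc t) T'"
| CondF: "~ c (view T) ==> exec b T t T' ==> exec (Cond c a b) T (Suc t) T'"
| WhileF: "~ c (view T) ==> exec (While c a) T 1 T"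
| WhileT: "c (view T) ==> exec a T s T' ==> exec (While c a) T' t T'' ==>
				 exec (While c a) T (Suc (s + t)) T''"

fun psize :: "prog => nat" where
	"psize (Op i g) = 1"
| "psize (a ;; b) = psize a + psize b"
| "psize (Cond c a b) = Suc (psize a + psize b)"
| "psize (While c a) = Suc (psize a)"

definition lview :: "nat list => view" where
	"lview ss = (%i. if i < ntapes then ss ! i else 0)"

definition stay :: "nat list => (nat \<times> move) list" where
	"stay ss = map (%s. (s, Stay)) ss"

text \<open>The program occupies the \<open>psize p\<close> states from \<open>s\<close> on and
  leaves through \<open>e\<close>. The body of a loop gets the loop test as its exit, so no extra
  states are spent on jumps.\<close>

fun trans :: "prog => nat => nat => nat => nat list => nat \<times> (nat \<times> move) list" where
	"trans (Op i g) s e q ss = (e, (stay ss)[i := g (lview ss)])"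
| "trans (a ;; b) s e q ss =
	 (if q < s + psize a then trans a s (s + psize a) q ss else trans b (s + psize a) e q ss)"
| "trans (Cond c a b) s e q ss =
	 (if q = s then (if c (lview ss) then Suc s else Suc s + psize a, stay ss)
		else if q < Suc s + psize a then trans a (Suc s) e q ss
		else trans b (Suc s + psize a) e q ss)"
| "trans (While c a) s e q ss =
	 (if q = s then (if c (lview ss) then Suc s else e, stay ss)
		else trans a (Suc s) s q ss)"

fun wf_prog :: "prog => bool" where
	"wf_prog (Op i g) \<longleftrightarrow> i < ntapes & (ALL v. (ALL j. v j < nsyms) --> fst (g v) < nsyms)"
| "wf_prog (a ;; b) \<longleftrightarrow> wf_prog a & wf_prog b"
| "wf_prog (Cond c a b) \<longleftrightarrow> wf_prog a & wf_prog b"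
| "wf_prog (While c a) \<longleftrightarrow> wf_prog a"

definition machine :: "prog => tm" where
	"machine p = \<lparr>tapes = ntapes, symbols = nsyms, states = psize p, delta = trans p 0 (psize p)\<rparr>"

lemma psize_pos [simp]: "0 < psize p" by (induction p) auto

lemma trans_wf:
	assumes "wf_prog p" "length ss = ntapes" "set ss \<subseteq> {..<nsyms}" "s <= q" "q < s + psize p"
	shows "case trans p s e q ss of (q', acts) =>
	(q' = e | s <= q' & q' < s + psize p) & length acts = ntapes & fst ` set acts \<subseteq> {..<nsyms}" using assms
proof (induction p arbitrary: s e)
	case (Op i g)
	have "ss ! j < nsyms" if "j < ntapes" for j using Op(2,3) that nth_mem[of j ss] by (metis lessThan_iff subsetD)
	then have "ALL j. lview ss j < nsyms" by (simp add: lview_def nsyms_def)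
	with Op(1) have "fst (g (lview ss)) < nsyms" by auto
	moreover have "fst ` set (stay ss) \<subseteq> {..<nsyms}" using Op(3) by (auto simp: stay_def)
	ultimately have "fst ` set ((stay ss)[i := g (lview ss)]) \<subseteq> {..<nsyms}"
	using set_update_subset_insert[of "stay ss" i "g (lview ss)"] by blast
	then show ?case using Op(2) by (simp add: stay_def)
next
	case (Seq a b)
	show ?case
	proof (cases "q < s + psize a")
	case True
	then show ?thesis using Seq.IH(1)[of s "s + psize a"] Seq.prems by (auto split: prod.splits)
	next
	case False
	then show ?thesis using Seq.IH(2)[of "s + psize a" e] Seq.prems by (auto split: prod.splits)
	qed
next
	case (Cond c a b)
	consider "q = s" | "q ~= s" "q < Suc s + psize a" | "q ~= s" "~ q < Suc s + psize a" by blast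
	then show ?case
	proof cases
	case 1 then show ?thesis using Cond.prems by (auto simp: stay_def)
	next
	case 2 then show ?thesis using Cond.IH(1)[of "Suc s" e] Cond.prems by (auto split: prod.splits)
	next
	case 3 then show ?thesis using Cond.IH(2)[of "Suc s + psize a" e] Cond.prems by (auto split: prod.splits)
	qed
next
	case (While c a)
	show ?case
	proof (cases "q = s")
	case True then show ?thesis using While.prems by (auto simp: stay_def)
	next
	case False then show ?thesis using While.IH[of "Suc s" s] While.prems by (auto split: prod.splits)
	qed
qed

lemma wf_machine: "wf_prog p ==> wf_tm (machine p)"
proof -
	assume "wf_prog p"
	then have "case trans p 0 (psize p) q ss of (q', acts) =>
		q' <= psize p & length acts = ntapes & fst ` set acts \<subseteq> {..<nsyms}"
	if "q < psize p" "length ss = ntapes" "set ss \<subseteq> {..<nsyms}" for q ss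
	using trans_wf[of p ss 0 q "psize p"] that by (auto split: prod.splits)
	then show ?thesis by (simp add: wf_tm_def machine_def ntapes_def nsyms_def)
qed

definition tape_list :: "mem => tape list" where
	"tape_list T = map T [0..<ntapes]"

lemma lview_tape_list [simp]: "lview (map read_tape (tape_list T)) = view T" by (auto simp: lview_def view_def tape_list_def fun_eq_iff)

lemma act_stay: "map2 act_tape (stay (map read_tape ts)) ts = ts" by (induction ts) (auto simp: stay_def)

lemma act_update:
	assumes "i < length ts"
	shows "map2 act_tape ((stay (map read_tape ts))[i := a]) ts = ts[i := act_tape a (ts ! i)]"
proof (rule nth_equalityI)
	fix j assume "j < length (map2 act_tape ((stay (map read_tape ts))[i := a]) ts)"
	then show "map2 act_tape ((stay (map read_tape ts))[i := a]) ts ! j = ts[i := act_tape a (ts ! i)] ! j"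
	by (cases "ts ! j"; cases "i = j") (auto simp: stay_def)
qed (simp add: stay_def)

lemma funpow_trans: "(f ^^ a) x = y ==> (f ^^ b) y = z ==> (f ^^ (a + b)) x = z" by (induction a arbitrary: x) (auto simp: funpow_swap1)

lemma funpow_first: "f x = y ==> (f ^^ b) y = z ==> (f ^^ Suc b) x = z" by (simp add: funpow_swap1)

text \<open>Formulated for any machine whose table agrees with \<open>trans\<close> on the states of
  the program, because in the induction the parts of a program run inside the table of the
  whole.\<close>

lemma exec_steps:
	assumes "exec p T t T'" "wf_prog p" "tapes M = ntapes" "s + psize p <= states M"
	and "\<And>q ss. s <= q ==> q < s + psize p ==> delta M q ss = trans p s e q ss"
	shows "(step M ^^ t) (s, tape_list T) = (e, tape_list T')" using assms
proof (induction arbitrary: s e rule: exec.induct)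
	case (Op i g T)
	have "(tape_list T)[i := act_tape (g (view T)) (T i)] = tape_list (T(i := act_tape (g (view T)) (T i)))"
	using Op by (auto simp: tape_list_def intro!: nth_equalityI simp: nth_list_update)
	moreover have "i < length (tape_list T)" "tape_list T ! i = T i" using Op by (auto simp: tape_list_def)
	moreover have "delta M s (map read_tape (tape_list T)) =
		(e, (stay (map read_tape (tape_list T)))[i := g (view T)])" "s < states M" using Op by auto
	ultimately show ?case by (simp add: act_update fun_upd_def)
next
	case (Seq a T k T' b t T'')
	have "(step M ^^ k) (s, tape_list T) = (s + psize a, tape_list T')" using Seq.prems by (intro Seq.IH(1)) auto
	moreover have "(step M ^^ t) (s + psize a, tape_list T') = (e, tape_list T'')" using Seq.prems by (intro Seq.IH(2)) auto
	ultimately show ?case by (rule funpow_trans)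
next
	case (CondT c T a t T' b)
	have "step M (s, tape_list T) = (Suc s, tape_list T)" using CondT by (simp add: act_stay)
	moreover have "(step M ^^ t) (Suc s, tape_list T) = (e, tape_list T')" using CondT.prems by (intro CondT.IH) auto
	ultimately show ?case by (rule funpow_first)
next
	case (CondF c T b t T' a)
	have "step M (s, tape_list T) = (Suc s + psize a, tape_list T)" using CondF by (simp add: act_stay)
	moreover have "(step M ^^ t) (Suc s + psize a, tape_list T) = (e, tape_list T')" using CondF.prems by (intro CondF.IH) auto
	ultimately show ?case by (rule funpow_first)
next
	case (WhileF c T a)
	then show ?case by (simp add: act_stay)
next
	case (WhileT c T a k T' t T'')
	have "step M (s, tape_list T) = (Suc s, tape_list T)" using WhileT by (simp add: act_stay)
	moreover have "(step M ^^ k) (Suc s, tape_list T) = (s, tape_list T')" using WhileT.prems by (intro WhileT.IH(1)) auto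
	moreover have "(step M ^^ t) (s, tape_list T') = (e, tape_list T'')" using WhileT.prems by (intro WhileT.IH(2)) auto
	ultimately show ?case by (blast intro: funpow_first funpow_trans)
qed

definition runs :: "prog => mem => nat => mem => bool" where
	"runs p T t T' \<longleftrightarrow> (EX s<=t. exec p T s T')"

lemma step_halted: "(step M ^^ t) (states M, ts) = (states M, ts)" by (induction t) auto

definition init_mem :: "bool list list => mem" where
	"init_mem ws = (%i. word_tape (if i < length ws then ws ! i else []))"

lemma runs_computes:
	assumes "runs p (init_mem ws) t T'" "wf_prog p" "tape_output (T' 0) y"
	shows "computes_within (machine p) ws t y"
proof -
	obtain s where s: "s <= t" "exec p (init_mem ws) s T'" using assms by (auto simp: runs_def)
	have "init_config (machine p) ws = (0, tape_list (init_mem ws))" by (simp add: init_config_def machine_def tape_list_def init_mem_def)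
	moreover have "(step (machine p) ^^ s) (0, tape_list (init_mem ws)) = (psize p, tape_list T')"
	using s assms by (intro exec_steps) (auto simp: machine_def)
	moreover have "(step (machine p) ^^ (t - s)) (psize p, tape_list T') = (psize p, tape_list T')"
	using step_halted[where M = "machine p" and t = "t - s"] by (simp add: machine_def)
	ultimately have "(step (machine p) ^^ t) (init_config (machine p) ws) = (psize p, tape_list T')"
	using s(1) funpow_add[of "t - s" s "step (machine p)"] by simp
	then show ?thesis using assms by (simp add: computes_within_def machine_def tape_list_def ntapes_def)
qed

section \<open>A gadget forbidding one pair of colours\<close>

text \<open>Vertices 0 to 55 are private to a copy of the gadget. The ends 56 and 57, which copies
  share as hubs, are joined to \<open>left_ends\<close> and \<open>right_ends\<close>.\<close>

definition inner_edges :: "(nat \<times> nat) list" where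
	"inner_edges = [
	(0,1), (0,2), (1,2), (1,6), (3,4), (3,5), (4,5), (4,13), (5,6), (5,10), (6,7), (7,8),
	(7,9), (8,9), (8,12), (10,11), (10,12), (11,12), (11,15), (13,14), (13,15), (13,18),
	(14,15), (14,21), (15,24), (15,27), (16,17), (16,18), (17,18), (17,19), (19,20), (19,21),
	(20,21), (20,22), (22,23), (22,24), (23,24), (25,26), (25,27), (26,27), (26,54), (28,29),
	(28,30), (29,30), (29,34), (31,32), (31,33), (32,33), (32,38), (33,34), (34,35), (35,36),
	(35,37), (35,40), (36,37), (36,43), (38,39), (38,40), (39,40), (39,41), (41,42), (41,43),
	(41,50), (41,53), (42,43), (42,47), (43,44), (44,45), (44,46), (45,46), (45,49), (47,48),
	(47,49), (48,49), (48,52), (50,51), (50,52), (51,52), (53,54), (53,55), (54,55)]"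

definition left_ends :: "nat list" where
	"left_ends = [0, 3, 16, 23, 25, 28, 31, 41]"

definition right_ends :: "nat list" where
	"right_ends = [2, 9, 15, 30, 37, 46, 51, 55]"

text \<open>\<open>(a, b)\<close> is the pair to be forbidden; \<open>a\<close> is entered exactly
  in the lists of the left ends and \<open>b\<close> in those of the right ends. Each pair of
  colours from 10 upwards is private to one triangle. Such a triangle acts as a clause: one of its
  three vertices must take its remaining colour. The colours 4, 5, 6 pass the consequences
  on.\<close>

definition gadget_lists :: "nat => nat => nat list list" where
	"gadget_lists a b = [
	[a,10,11], [4,10,11], [b,10,11], [a,4,6], [4,5,6], [4,5,6], [4,5,6], [6,12,13], [4,12,13],
	[b,12,13], [5,14,15], [4,14,15], [4,14,15], [4,5,6], [4,5,6], [b,4,6], [a,16,17],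
	[4,16,17], [6,16,17], [4,18,19], [4,18,19], [5,18,19], [4,20,21], [a,20,21], [4,20,21],
	[a,22,23], [4,22,23], [6,22,23], [a,24,25], [5,24,25], [b,24,25], [a,26,27], [5,26,27],
	[6,26,27], [4,5,6], [4,5,6], [4,5,6], [b,5,6], [5,28,29], [5,28,29], [4,28,29], [a,4,5],
	[4,5,6], [4,5,6], [6,30,31], [5,30,31], [b,30,31], [4,32,33], [5,32,33], [5,32,33],
	[5,34,35], [b,34,35], [5,34,35], [4,5,6], [4,5,6], [b,5,6]]"

text \<open>\<open>qk_c\<close> stands for vertex k having colour c, where the left ends have lost
  \<open>a\<close> and the right ends \<open>b\<close>. The clauses are the remaining lists and, for
  each edge, the colours that its two lists share. With free propositions the statement is purely
  propositional and independent of \<open>a\<close> and \<open>b\<close>.\<close>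

lemma gadget_refutation:
	assumes
	"q0_10 | q0_11"
	"q1_4 | q1_10 | q1_11"
	"q2_10 | q2_11"
	"q3_4 | q3_6"
	"q4_4 | q4_5 | q4_6"
	"q5_4 | q5_5 | q5_6"
	"q6_4 | q6_5 | q6_6"
	"q7_6 | q7_12 | q7_13"
	"q8_4 | q8_12 | q8_13"
	"q9_12 | q9_13"
	"q10_5 | q10_14 | q10_15"
	"q11_4 | q11_14 | q11_15"
	"q12_4 | q12_14 | q12_15"
	"q13_4 | q13_5 | q13_6"
	"q14_4 | q14_5 | q14_6"
	"q15_4 | q15_6"
	"q16_16 | q16_17"
	"q17_4 | q17_16 | q17_17"
	"q18_6 | q18_16 | q18_17"
	"q19_4 | q19_18 | q19_19"
	"q20_4 | q20_18 | q20_19"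
	"q21_5 | q21_18 | q21_19"
	"q22_4 | q22_20 | q22_21"
	"q23_20 | q23_21"
	"q24_4 | q24_20 | q24_21"
	"q25_22 | q25_23"
	"q26_4 | q26_22 | q26_23"
	"q27_6 | q27_22 | q27_23"
	"q28_24 | q28_25"
	"q29_5 | q29_24 | q29_25"
	"q30_24 | q30_25"
	"q31_26 | q31_27"
	"q32_5 | q32_26 | q32_27"
	"q33_6 | q33_26 | q33_27"
	"q34_4 | q34_5 | q34_6"
	"q35_4 | q35_5 | q35_6"
	"q36_4 | q36_5 | q36_6"
	"q37_5 | q37_6"
	"q38_5 | q38_28 | q38_29"
	"q39_5 | q39_28 | q39_29"
	"q40_4 | q40_28 | q40_29"
	"q41_4 | q41_5"
	"q42_4 | q42_5 | q42_6"
	"q43_4 | q43_5 | q43_6"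
	"q44_6 | q44_30 | q44_31"
	"q45_5 | q45_30 | q45_31"
	"q46_30 | q46_31"
	"q47_4 | q47_32 | q47_33"
	"q48_5 | q48_32 | q48_33"
	"q49_5 | q49_32 | q49_33"
	"q50_5 | q50_34 | q50_35"
	"q51_34 | q51_35"
	"q52_5 | q52_34 | q52_35"
	"q53_4 | q53_5 | q53_6"
	"q54_4 | q54_5 | q54_6"
	"q55_5 | q55_6"
	"~ (q0_10 & q1_10)"
	"~ (q0_11 & q1_11)"
	"~ (q0_10 & q2_10)"
	"~ (q0_11 & q2_11)"
	"~ (q1_10 & q2_10)"
	"~ (q1_11 & q2_11)"
	"~ (q1_4 & q6_4)"
	"~ (q3_4 & q4_4)"
	"~ (q3_6 & q4_6)"
	"~ (q3_4 & q5_4)"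
	"~ (q3_6 & q5_6)"
	"~ (q4_4 & q5_4)"
	"~ (q4_5 & q5_5)"
	"~ (q4_6 & q5_6)"
	"~ (q4_4 & q13_4)"
	"~ (q4_5 & q13_5)"
	"~ (q4_6 & q13_6)"
	"~ (q5_4 & q6_4)"
	"~ (q5_5 & q6_5)"
	"~ (q5_6 & q6_6)"
	"~ (q5_5 & q10_5)"
	"~ (q6_6 & q7_6)"
	"~ (q7_12 & q8_12)"
	"~ (q7_13 & q8_13)"
	"~ (q7_12 & q9_12)"
	"~ (q7_13 & q9_13)"
	"~ (q8_12 & q9_12)"
	"~ (q8_13 & q9_13)"
	"~ (q8_4 & q12_4)"
	"~ (q10_14 & q11_14)"
	"~ (q10_15 & q11_15)"
	"~ (q10_14 & q12_14)"
	"~ (q10_15 & q12_15)"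
	"~ (q11_4 & q12_4)"
	"~ (q11_14 & q12_14)"
	"~ (q11_15 & q12_15)"
	"~ (q11_4 & q15_4)"
	"~ (q13_4 & q14_4)"
	"~ (q13_5 & q14_5)"
	"~ (q13_6 & q14_6)"
	"~ (q13_4 & q15_4)"
	"~ (q13_6 & q15_6)"
	"~ (q13_6 & q18_6)"
	"~ (q14_4 & q15_4)"
	"~ (q14_6 & q15_6)"
	"~ (q14_5 & q21_5)"
	"~ (q15_4 & q24_4)"
	"~ (q15_6 & q27_6)"
	"~ (q16_16 & q17_16)"
	"~ (q16_17 & q17_17)"
	"~ (q16_16 & q18_16)"
	"~ (q16_17 & q18_17)"
	"~ (q17_16 & q18_16)"
	"~ (q17_17 & q18_17)"
	"~ (q17_4 & q19_4)"
	"~ (q19_4 & q20_4)"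
	"~ (q19_18 & q20_18)"
	"~ (q19_19 & q20_19)"
	"~ (q19_18 & q21_18)"
	"~ (q19_19 & q21_19)"
	"~ (q20_18 & q21_18)"
	"~ (q20_19 & q21_19)"
	"~ (q20_4 & q22_4)"
	"~ (q22_20 & q23_20)"
	"~ (q22_21 & q23_21)"
	"~ (q22_4 & q24_4)"
	"~ (q22_20 & q24_20)"
	"~ (q22_21 & q24_21)"
	"~ (q23_20 & q24_20)"
	"~ (q23_21 & q24_21)"
	"~ (q25_22 & q26_22)"
	"~ (q25_23 & q26_23)"
	"~ (q25_22 & q27_22)"
	"~ (q25_23 & q27_23)"
	"~ (q26_22 & q27_22)"
	"~ (q26_23 & q27_23)"
	"~ (q26_4 & q54_4)"
	"~ (q28_24 & q29_24)"
	"~ (q28_25 & q29_25)"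
	"~ (q28_24 & q30_24)"
	"~ (q28_25 & q30_25)"
	"~ (q29_24 & q30_24)"
	"~ (q29_25 & q30_25)"
	"~ (q29_5 & q34_5)"
	"~ (q31_26 & q32_26)"
	"~ (q31_27 & q32_27)"
	"~ (q31_26 & q33_26)"
	"~ (q31_27 & q33_27)"
	"~ (q32_26 & q33_26)"
	"~ (q32_27 & q33_27)"
	"~ (q32_5 & q38_5)"
	"~ (q33_6 & q34_6)"
	"~ (q34_4 & q35_4)"
	"~ (q34_5 & q35_5)"
	"~ (q34_6 & q35_6)"
	"~ (q35_4 & q36_4)"
	"~ (q35_5 & q36_5)"
	"~ (q35_6 & q36_6)"
	"~ (q35_5 & q37_5)"
	"~ (q35_6 & q37_6)"
	"~ (q35_4 & q40_4)"
	"~ (q36_5 & q37_5)"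
	"~ (q36_6 & q37_6)"
	"~ (q36_4 & q43_4)"
	"~ (q36_5 & q43_5)"
	"~ (q36_6 & q43_6)"
	"~ (q38_5 & q39_5)"
	"~ (q38_28 & q39_28)"
	"~ (q38_29 & q39_29)"
	"~ (q38_28 & q40_28)"
	"~ (q38_29 & q40_29)"
	"~ (q39_28 & q40_28)"
	"~ (q39_29 & q40_29)"
	"~ (q39_5 & q41_5)"
	"~ (q41_4 & q42_4)"
	"~ (q41_5 & q42_5)"
	"~ (q41_4 & q43_4)"
	"~ (q41_5 & q43_5)"
	"~ (q41_5 & q50_5)"
	"~ (q41_4 & q53_4)"
	"~ (q41_5 & q53_5)"
	"~ (q42_4 & q43_4)"
	"~ (q42_5 & q43_5)"
	"~ (q42_6 & q43_6)"
	"~ (q42_4 & q47_4)"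
	"~ (q43_6 & q44_6)"
	"~ (q44_30 & q45_30)"
	"~ (q44_31 & q45_31)"
	"~ (q44_30 & q46_30)"
	"~ (q44_31 & q46_31)"
	"~ (q45_30 & q46_30)"
	"~ (q45_31 & q46_31)"
	"~ (q45_5 & q49_5)"
	"~ (q47_32 & q48_32)"
	"~ (q47_33 & q48_33)"
	"~ (q47_32 & q49_32)"
	"~ (q47_33 & q49_33)"
	"~ (q48_5 & q49_5)"
	"~ (q48_32 & q49_32)"
	"~ (q48_33 & q49_33)"
	"~ (q48_5 & q52_5)"
	"~ (q50_34 & q51_34)"
	"~ (q50_35 & q51_35)"
	"~ (q50_5 & q52_5)"
	"~ (q50_34 & q52_34)"
	"~ (q50_35 & q52_35)"
	"~ (q51_34 & q52_34)"
	"~ (q51_35 & q52_35)"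
	"~ (q53_4 & q54_4)"
	"~ (q53_5 & q54_5)"
	"~ (q53_6 & q54_6)"
	"~ (q53_5 & q55_5)"
	"~ (q53_6 & q55_6)"
	"~ (q54_5 & q55_5)"
	"~ (q54_6 & q55_6)"
	shows False using assms by sat

definition gadget_colouring :: "nat => nat => (nat => nat) => bool" where
	"gadget_colouring a b f \<longleftrightarrow>
	 list_all2 (%k l. f k : set l) [0..<56] (gadget_lists a b) &
	 list_all (%(k, l). f k ~= f l) inner_edges"

lemma upt56: "[0..<56::nat] = [0, 1, 2, 3, 4, 5, 6, 7, 8, 9, 10, 11, 12, 13, 14, 15, 16, 17, 18, 19, 20, 21, 22, 23, 24, 25, 26, 27, 28, 29, 30, 31, 32, 33, 34, 35, 36, 37, 38, 39, 40, 41, 42, 43, 44, 45, 46, 47, 48, 49, 50, 51, 52, 53, 54, 55]"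
	by code_simp

lemma gadget_blocked:
	assumes "gadget_colouring a b f" "ALL k : set left_ends. f k ~= a" "ALL k : set right_ends. f k ~= b"
	shows False
proof -
	have "list_all2 (%k l. f k : set l) [0..<56] (gadget_lists a b)"
	and "list_all (%(k, l). f k ~= f l) inner_edges" using assms(1) by (auto simp: gadget_colouring_def)
	note L = this(1)[unfolded upt56 gadget_lists_def, simplified]
	and E = this(2)[unfolded inner_edges_def, simplified]
	and U = assms(2,3)[unfolded left_ends_def right_ends_def, simplified]
	have m:
	"f 0 = 10 | f 0 = 11"
	"f 1 = 4 | f 1 = 10 | f 1 = 11"
	"f 2 = 10 | f 2 = 11"
	"f 3 = 4 | f 3 = 6"
	"f 4 = 4 | f 4 = 5 | f 4 = 6"
	"f 5 = 4 | f 5 = 5 | f 5 = 6"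
	"f 6 = 4 | f 6 = 5 | f 6 = 6"
	"f 7 = 6 | f 7 = 12 | f 7 = 13"
	"f 8 = 4 | f 8 = 12 | f 8 = 13"
	"f 9 = 12 | f 9 = 13"
	"f 10 = 5 | f 10 = 14 | f 10 = 15"
	"f 11 = 4 | f 11 = 14 | f 11 = 15"
	"f 12 = 4 | f 12 = 14 | f 12 = 15"
	"f 13 = 4 | f 13 = 5 | f 13 = 6"
	"f 14 = 4 | f 14 = 5 | f 14 = 6"
	"f 15 = 4 | f 15 = 6"
	"f 16 = 16 | f 16 = 17"
	"f 17 = 4 | f 17 = 16 | f 17 = 17"
	"f 18 = 6 | f 18 = 16 | f 18 = 17"
	"f 19 = 4 | f 19 = 18 | f 19 = 19"
	"f 20 = 4 | f 20 = 18 | f 20 = 19"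
	"f 21 = 5 | f 21 = 18 | f 21 = 19"
	"f 22 = 4 | f 22 = 20 | f 22 = 21"
	"f 23 = 20 | f 23 = 21"
	"f 24 = 4 | f 24 = 20 | f 24 = 21"
	"f 25 = 22 | f 25 = 23"
	"f 26 = 4 | f 26 = 22 | f 26 = 23"
	"f 27 = 6 | f 27 = 22 | f 27 = 23"
	"f 28 = 24 | f 28 = 25"
	"f 29 = 5 | f 29 = 24 | f 29 = 25"
	"f 30 = 24 | f 30 = 25"
	"f 31 = 26 | f 31 = 27"
	"f 32 = 5 | f 32 = 26 | f 32 = 27"
	"f 33 = 6 | f 33 = 26 | f 33 = 27"
	"f 34 = 4 | f 34 = 5 | f 34 = 6"
	"f 35 = 4 | f 35 = 5 | f 35 = 6"
	"f 36 = 4 | f 36 = 5 | f 36 = 6"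
	"f 37 = 5 | f 37 = 6"
	"f 38 = 5 | f 38 = 28 | f 38 = 29"
	"f 39 = 5 | f 39 = 28 | f 39 = 29"
	"f 40 = 4 | f 40 = 28 | f 40 = 29"
	"f 41 = 4 | f 41 = 5"
	"f 42 = 4 | f 42 = 5 | f 42 = 6"
	"f 43 = 4 | f 43 = 5 | f 43 = 6"
	"f 44 = 6 | f 44 = 30 | f 44 = 31"
	"f 45 = 5 | f 45 = 30 | f 45 = 31"
	"f 46 = 30 | f 46 = 31"
	"f 47 = 4 | f 47 = 32 | f 47 = 33"
	"f 48 = 5 | f 48 = 32 | f 48 = 33"
	"f 49 = 5 | f 49 = 32 | f 49 = 33"
	"f 50 = 5 | f 50 = 34 | f 50 = 35"
	"f 51 = 34 | f 51 = 35"
	"f 52 = 5 | f 52 = 34 | f 52 = 35"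
	"f 53 = 4 | f 53 = 5 | f 53 = 6"
	"f 54 = 4 | f 54 = 5 | f 54 = 6"
	"f 55 = 5 | f 55 = 6" using L U by simp_all
	have e:
	"f 0 ~= f 1"
	"f 0 ~= f 2"
	"f 1 ~= f 2"
	"f 1 ~= f 6"
	"f 3 ~= f 4"
	"f 3 ~= f 5"
	"f 4 ~= f 5"
	"f 4 ~= f 13"
	"f 5 ~= f 6"
	"f 5 ~= f 10"
	"f 6 ~= f 7"
	"f 7 ~= f 8"
	"f 7 ~= f 9"
	"f 8 ~= f 9"
	"f 8 ~= f 12"
	"f 10 ~= f 11"
	"f 10 ~= f 12"
	"f 11 ~= f 12"
	"f 11 ~= f 15"
	"f 13 ~= f 14"
	"f 13 ~= f 15"
	"f 13 ~= f 18"
	"f 14 ~= f 15"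
	"f 14 ~= f 21"
	"f 15 ~= f 24"
	"f 15 ~= f 27"
	"f 16 ~= f 17"
	"f 16 ~= f 18"
	"f 17 ~= f 18"
	"f 17 ~= f 19"
	"f 19 ~= f 20"
	"f 19 ~= f 21"
	"f 20 ~= f 21"
	"f 20 ~= f 22"
	"f 22 ~= f 23"
	"f 22 ~= f 24"
	"f 23 ~= f 24"
	"f 25 ~= f 26"
	"f 25 ~= f 27"
	"f 26 ~= f 27"
	"f 26 ~= f 54"
	"f 28 ~= f 29"
	"f 28 ~= f 30"
	"f 29 ~= f 30"
	"f 29 ~= f 34"
	"f 31 ~= f 32"
	"f 31 ~= f 33"
	"f 32 ~= f 33"
	"f 32 ~= f 38"
	"f 33 ~= f 34"
	"f 34 ~= f 35"
	"f 35 ~= f 36"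
	"f 35 ~= f 37"
	"f 35 ~= f 40"
	"f 36 ~= f 37"
	"f 36 ~= f 43"
	"f 38 ~= f 39"
	"f 38 ~= f 40"
	"f 39 ~= f 40"
	"f 39 ~= f 41"
	"f 41 ~= f 42"
	"f 41 ~= f 43"
	"f 41 ~= f 50"
	"f 41 ~= f 53"
	"f 42 ~= f 43"
	"f 42 ~= f 47"
	"f 43 ~= f 44"
	"f 44 ~= f 45"
	"f 44 ~= f 46"
	"f 45 ~= f 46"
	"f 45 ~= f 49"
	"f 47 ~= f 48"
	"f 47 ~= f 49"
	"f 48 ~= f 49"
	"f 48 ~= f 52"
	"f 50 ~= f 51"
	"f 50 ~= f 52"
	"f 51 ~= f 52"
	"f 53 ~= f 54"
	"f 53 ~= f 55"
	"f 54 ~= f 55" using E by simp_all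
	have neq_pair: "x ~= y ==> ~ (x = c & y = c)" for x y c :: nat by auto
	show False by (rule gadget_refutation[of "f 0 = 10"
		"f 0 = 11"
		"f 1 = 4"
		"f 1 = 10"
		"f 1 = 11"
		"f 2 = 10"
		"f 2 = 11"
		"f 3 = 4"
		"f 3 = 6"
		"f 4 = 4"
		"f 4 = 5"
		"f 4 = 6"
		"f 5 = 4"
		"f 5 = 5"
		"f 5 = 6"
		"f 6 = 4"
		"f 6 = 5"
		"f 6 = 6"
		"f 7 = 6"
		"f 7 = 12"
		"f 7 = 13"
		"f 8 = 4"
		"f 8 = 12"
		"f 8 = 13"
		"f 9 = 12"
		"f 9 = 13"
		"f 10 = 5"
		"f 10 = 14"
		"f 10 = 15"
		"f 11 = 4"
		"f 11 = 14"
		"f 11 = 15"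
		"f 12 = 4"
		"f 12 = 14"
		"f 12 = 15"
		"f 13 = 4"
		"f 13 = 5"
		"f 13 = 6"
		"f 14 = 4"
		"f 14 = 5"
		"f 14 = 6"
		"f 15 = 4"
		"f 15 = 6"
		"f 16 = 16"
		"f 16 = 17"
		"f 17 = 4"
		"f 17 = 16"
		"f 17 = 17"
		"f 18 = 6"
		"f 18 = 16"
		"f 18 = 17"
		"f 19 = 4"
		"f 19 = 18"
		"f 19 = 19"
		"f 20 = 4"
		"f 20 = 18"
		"f 20 = 19"
		"f 21 = 5"
		"f 21 = 18"
		"f 21 = 19"
		"f 22 = 4"
		"f 22 = 20"
		"f 22 = 21"
		"f 23 = 20"
		"f 23 = 21"
		"f 24 = 4"
		"f 24 = 20"
		"f 24 = 21"
		"f 25 = 22"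
		"f 25 = 23"
		"f 26 = 4"
		"f 26 = 22"
		"f 26 = 23"
		"f 27 = 6"
		"f 27 = 22"
		"f 27 = 23"
		"f 28 = 24"
		"f 28 = 25"
		"f 29 = 5"
		"f 29 = 24"
		"f 29 = 25"
		"f 30 = 24"
		"f 30 = 25"
		"f 31 = 26"
		"f 31 = 27"
		"f 32 = 5"
		"f 32 = 26"
		"f 32 = 27"
		"f 33 = 6"
		"f 33 = 26"
		"f 33 = 27"
		"f 34 = 4"
		"f 34 = 5"
		"f 34 = 6"
		"f 35 = 4"
		"f 35 = 5"
		"f 35 = 6"
		"f 36 = 4"
		"f 36 = 5"
		"f 36 = 6"
		"f 37 = 5"
		"f 37 = 6"
		"f 38 = 5"
		"f 38 = 28"
		"f 38 = 29"
		"f 39 = 5"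
		"f 39 = 28"
		"f 39 = 29"
		"f 40 = 4"
		"f 40 = 28"
		"f 40 = 29"
		"f 41 = 4"
		"f 41 = 5"
		"f 42 = 4"
		"f 42 = 5"
		"f 42 = 6"
		"f 43 = 4"
		"f 43 = 5"
		"f 43 = 6"
		"f 44 = 6"
		"f 44 = 30"
		"f 44 = 31"
		"f 45 = 5"
		"f 45 = 30"
		"f 45 = 31"
		"f 46 = 30"
		"f 46 = 31"
		"f 47 = 4"
		"f 47 = 32"
		"f 47 = 33"
		"f 48 = 5"
		"f 48 = 32"
		"f 48 = 33"
		"f 49 = 5"
		"f 49 = 32"
		"f 49 = 33"
		"f 50 = 5"
		"f 50 = 34"
		"f 50 = 35"
		"f 51 = 34"
		"f 51 = 35"
		"f 52 = 5"
		"f 52 = 34"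
		"f 52 = 35"
		"f 53 = 4"
		"f 53 = 5"
		"f 53 = 6"
		"f 54 = 4"
		"f 54 = 5"
		"f 54 = 6"
		"f 55 = 5"
		"f 55 = 6"]) (fact m | rule neq_pair, fact e)+
qed

lemma gadget_extends:
	assumes "i : {1,2,3}" "j : {1,2,3}" "a : {1,2,3,7}" "b : {1,2,3,7}" "i ~= a | j ~= b"
	obtains f where "gadget_colouring a b f" "ALL k : set left_ends. f k ~= i" "ALL k : set right_ends. f k ~= j"
proof (cases "i = a")
	case False
	\<comment> \<open>As \<open>i\<close> differs from \<open>a\<close>, all left ends may take
	  \<open>a\<close>. The right ends get colours above 3, so one colouring serves every
	  \<open>j\<close>.\<close>
	let ?f = "%k. [a,11,10,a,5,6,5,6,12,13,5,14,4,4,5,6,a,17,16,4,19,18,20,a,21,a,22,23,a,24,25,a,27,26,5,6,4,5,5,29,4,a,6,5,6,5,30,4,33,32,5,34,35,5,4,6] ! k"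
	have "gadget_colouring a b ?f" using assms(3,4) unfolding gadget_colouring_def upt56 gadget_lists_def inner_edges_def by auto
	moreover have "ALL k : set left_ends. ?f k ~= i" "ALL k : set right_ends. ?f k ~= j"
	using assms(1,2) False unfolding left_ends_def right_ends_def by auto
	ultimately show thesis by (rule that)
next
	case True
	\<comment> \<open>The opposite choice: here \<open>j\<close> differs from \<open>b\<close>, all
	  right ends take \<open>b\<close>, and the left ends get colours above 3.\<close>
	let ?f = "%k. [10,11,b,4,6,5,6,12,13,b,14,4,15,5,4,b,17,4,6,18,19,5,4,21,20,23,4,6,25,24,b,26,27,6,4,6,4,b,5,28,4,4,6,5,31,30,b,4,5,33,35,b,34,6,5,b] ! k"
	have "gadget_colouring a b ?f" using assms(3,4) unfolding gadget_colouring_def upt56 gadget_lists_def inner_edges_def by auto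
	moreover have "ALL k : set left_ends. ?f k ~= i" "ALL k : set right_ends. ?f k ~= j"
	using assms(1,2,5) True unfolding left_ends_def right_ends_def by auto
	ultimately show thesis by (rule that)
qed

section \<open>Short cycles and triangles of the gadget\<close>

definition gnbrs :: "nat list list" where
	"gnbrs = [
	[1,2,56], [0,2,6], [0,1,57], [4,5,56], [3,5,13], [3,4,6,10], [1,5,7], [6,8,9], [7,9,12],
	[7,8,57], [5,11,12], [10,12,15], [8,10,11], [4,14,15,18], [13,15,21], [11,13,14,24,27,57],
	[17,18,56], [16,18,19], [13,16,17], [17,20,21], [19,21,22], [14,19,20], [20,23,24],
	[22,24,56], [15,22,23], [26,27,56], [25,27,54], [15,25,26], [29,30,56], [28,30,34],
	[28,29,57], [32,33,56], [31,33,38], [31,32,34], [29,33,35], [34,36,37,40], [35,37,43],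
	[35,36,57], [32,39,40], [38,40,41], [35,38,39], [39,42,43,50,53,56], [41,43,47],
	[36,41,42,44], [43,45,46], [44,46,49], [44,45,57], [42,48,49], [47,49,52], [45,47,48],
	[41,51,52], [50,52,57], [48,50,51], [41,54,55], [26,53,55], [53,54,57],
	[0,3,16,23,25,28,31,41], [2,9,15,30,37,46,51,55]]"

lemma gn0: "gnbrs ! 0 = [1,2,56]" by (simp add: gnbrs_def)
lemma gn1: "gnbrs ! 1 = [0,2,6]" by (simp add: gnbrs_def)
lemma gn2: "gnbrs ! 2 = [0,1,57]" by (simp add: gnbrs_def)
lemma gn3: "gnbrs ! 3 = [4,5,56]" by (simp add: gnbrs_def)
lemma gn4: "gnbrs ! 4 = [3,5,13]" by (simp add: gnbrs_def)
lemma gn5: "gnbrs ! 5 = [3,4,6,10]" by (simp add: gnbrs_def)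
lemma gn6: "gnbrs ! 6 = [1,5,7]" by (simp add: gnbrs_def)
lemma gn7: "gnbrs ! 7 = [6,8,9]" by (simp add: gnbrs_def)
lemma gn8: "gnbrs ! 8 = [7,9,12]" by (simp add: gnbrs_def)
lemma gn9: "gnbrs ! 9 = [7,8,57]" by (simp add: gnbrs_def)
lemma gn10: "gnbrs ! 10 = [5,11,12]" by (simp add: gnbrs_def)
lemma gn11: "gnbrs ! 11 = [10,12,15]" by (simp add: gnbrs_def)
lemma gn12: "gnbrs ! 12 = [8,10,11]" by (simp add: gnbrs_def)
lemma gn13: "gnbrs ! 13 = [4,14,15,18]" by (simp add: gnbrs_def)
lemma gn14: "gnbrs ! 14 = [13,15,21]" by (simp add: gnbrs_def)
lemma gn15: "gnbrs ! 15 = [11,13,14,24,27,57]" by (simp add: gnbrs_def)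
lemma gn16: "gnbrs ! 16 = [17,18,56]" by (simp add: gnbrs_def)
lemma gn17: "gnbrs ! 17 = [16,18,19]" by (simp add: gnbrs_def)
lemma gn18: "gnbrs ! 18 = [13,16,17]" by (simp add: gnbrs_def)
lemma gn19: "gnbrs ! 19 = [17,20,21]" by (simp add: gnbrs_def)
lemma gn20: "gnbrs ! 20 = [19,21,22]" by (simp add: gnbrs_def)
lemma gn21: "gnbrs ! 21 = [14,19,20]" by (simp add: gnbrs_def)
lemma gn22: "gnbrs ! 22 = [20,23,24]" by (simp add: gnbrs_def)
lemma gn23: "gnbrs ! 23 = [22,24,56]" by (simp add: gnbrs_def)
lemma gn24: "gnbrs ! 24 = [15,22,23]" by (simp add: gnbrs_def)
lemma gn25: "gnbrs ! 25 = [26,27,56]" by (simp add: gnbrs_def)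
lemma gn26: "gnbrs ! 26 = [25,27,54]" by (simp add: gnbrs_def)
lemma gn27: "gnbrs ! 27 = [15,25,26]" by (simp add: gnbrs_def)
lemma gn28: "gnbrs ! 28 = [29,30,56]" by (simp add: gnbrs_def)
lemma gn29: "gnbrs ! 29 = [28,30,34]" by (simp add: gnbrs_def)
lemma gn30: "gnbrs ! 30 = [28,29,57]" by (simp add: gnbrs_def)
lemma gn31: "gnbrs ! 31 = [32,33,56]" by (simp add: gnbrs_def)
lemma gn32: "gnbrs ! 32 = [31,33,38]" by (simp add: gnbrs_def)
lemma gn33: "gnbrs ! 33 = [31,32,34]" by (simp add: gnbrs_def)
lemma gn34: "gnbrs ! 34 = [29,33,35]" by (simp add: gnbrs_def)
lemma gn35: "gnbrs ! 35 = [34,36,37,40]" by (simp add: gnbrs_def)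
lemma gn36: "gnbrs ! 36 = [35,37,43]" by (simp add: gnbrs_def)
lemma gn37: "gnbrs ! 37 = [35,36,57]" by (simp add: gnbrs_def)
lemma gn38: "gnbrs ! 38 = [32,39,40]" by (simp add: gnbrs_def)
lemma gn39: "gnbrs ! 39 = [38,40,41]" by (simp add: gnbrs_def)
lemma gn40: "gnbrs ! 40 = [35,38,39]" by (simp add: gnbrs_def)
lemma gn41: "gnbrs ! 41 = [39,42,43,50,53,56]" by (simp add: gnbrs_def)
lemma gn42: "gnbrs ! 42 = [41,43,47]" by (simp add: gnbrs_def)
lemma gn43: "gnbrs ! 43 = [36,41,42,44]" by (simp add: gnbrs_def)
lemma gn44: "gnbrs ! 44 = [43,45,46]" by (simp add: gnbrs_def)
lemma gn45: "gnbrs ! 45 = [44,46,49]" by (simp add: gnbrs_def)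
lemma gn46: "gnbrs ! 46 = [44,45,57]" by (simp add: gnbrs_def)
lemma gn47: "gnbrs ! 47 = [42,48,49]" by (simp add: gnbrs_def)
lemma gn48: "gnbrs ! 48 = [47,49,52]" by (simp add: gnbrs_def)
lemma gn49: "gnbrs ! 49 = [45,47,48]" by (simp add: gnbrs_def)
lemma gn50: "gnbrs ! 50 = [41,51,52]" by (simp add: gnbrs_def)
lemma gn51: "gnbrs ! 51 = [50,52,57]" by (simp add: gnbrs_def)
lemma gn52: "gnbrs ! 52 = [48,50,51]" by (simp add: gnbrs_def)
lemma gn53: "gnbrs ! 53 = [41,54,55]" by (simp add: gnbrs_def)
lemma gn54: "gnbrs ! 54 = [26,53,55]" by (simp add: gnbrs_def)
lemma gn55: "gnbrs ! 55 = [53,54,57]" by (simp add: gnbrs_def)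
lemma gn56: "gnbrs ! 56 = [0,3,16,23,25,28,31,41]" by (simp add: gnbrs_def)
lemma gn57: "gnbrs ! 57 = [2,9,15,30,37,46,51,55]" by (simp add: gnbrs_def)
text \<open>The simplifier turns the index 1 into \<open>Suc 0\<close>, after which only this form
  matches.\<close>

lemma gn1a: "gnbrs ! Suc 0 = [0,2,6]" by (simp add: gnbrs_def)
lemmas gn = gn1a gn0 gn1 gn2 gn3 gn4 gn5 gn6 gn7 gn8 gn9 gn10 gn11 gn12 gn13 gn14 gn15 gn16 gn17 gn18 gn19 gn20 gn21 gn22 gn23 gn24 gn25 gn26 gn27 gn28 gn29 gn30 gn31 gn32 gn33 gn34 gn35 gn36 gn37 gn38 gn39 gn40 gn41 gn42 gn43 gn44 gn45 gn46 gn47 gn48 gn49 gn50 gn51 gn52 gn53 gn54 gn55 gn56 gn57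

text \<open>Walks from \<open>a\<close> are unfolded along the neighbour lists, so that the check is
  a finite computation: \<open>d\<close> next to \<open>a\<close> would close a 4-cycle,
  \<open>e\<close> next to \<open>a\<close> a 5-cycle.\<close>

definition no45 :: "nat => bool" where
	"no45 a \<longleftrightarrow> list_all (%b. list_all (%c. c = a | list_all (%d. d = b | d = a |
	 (a \<notin> set (gnbrs ! d) & list_all (%e. e = c | e = b | e = a | a \<notin> set (gnbrs ! e))
			(gnbrs ! d)))
	 (gnbrs ! c)) (gnbrs ! b)) (gnbrs ! a)"

lemma gadget_no_short_cycle: "list_all no45 [0,1,2,3,4,5,6,7,8,9,10,11,12,13,14,15,16,17,18,19,20,21,22,23,24,25,26,27,28,29,30,31,32,33,34,35,36,37,38,39,40,41,42,43,44,45,46,47,48,49,50,51,52,53,54,55,56,57]"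
	by (simp add: no45_def gn)

text \<open>A second triangle at \<open>a\<close> would have a vertex \<open>d\<close> outside the
  first triangle \<open>a\<close>, \<open>b\<close>, \<open>c\<close>; the check excludes that such
  a \<open>d\<close> closes a triangle with \<open>a\<close>.\<close>

definition tri_ok :: "nat => bool" where
	"tri_ok a \<longleftrightarrow> list_all (%b. list_all (%c. c = a | a \<notin> set (gnbrs ! c) |
		list_all (%d. d = b | d = c | list_all (%e. e = a | a \<notin> set (gnbrs ! e)) (gnbrs ! d)) (gnbrs ! a))
	 (gnbrs ! b)) (gnbrs ! a)"

lemma gadget_triangles: "list_all tri_ok [0,1,2,3,4,5,6,7,8,9,10,11,12,13,14,15,16,17,18,19,20,21,22,23,24,25,26,27,28,29,30,31,32,33,34,35,36,37,38,39,40,41,42,43,44,45,46,47,48,49,50,51,52,53,54,55,56,57]"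
	by (simp add: tri_ok_def gn)

section \<open>An integer certificate for a straight-line drawing of the gadget\<close>

definition gadget_points :: "(int \<times> int) list" where
	"gadget_points = [
	(800,600), (2022,484), (3200,600), (984,67), (1361,78), (1592,124), (2067,252), (2586,150),
	(2623,110), (3070,86), (1955,97), (2060,74), (2212,94), (1507,42), (1613,34), (2012,31),
	(666,17), (954,23), (1042,27), (1155,25), (1191,24), (1320,27), (1099,20), (801,14),
	(1304,21), (1086,6), (1669,5), (1589,14), (800,-600), (1978,-484), (3200,-600), (930,-86),
	(1377,-110), (1414,-150), (1933,-252), (2408,-124), (2639,-78), (3016,-67), (1788,-94),
	(1940,-74), (2045,-97), (1988,-31), (2387,-34), (2493,-42), (2958,-27), (3046,-23),
	(3334,-17), (2680,-27), (2809,-24), (2845,-25), (2696,-21), (3199,-14), (2901,-20),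
	(2411,-14), (2331,-5), (2914,-6), (0,0), (4000,0)]"

type_synonym seg = "nat \<times> nat \<times> int \<times> int \<times> int \<times> int"
definition orient :: "int => int => int => int => int => int => int" where
	"orient x1 y1 x2 y2 x3 y3 = (x2 - x1) * (y3 - y1) - (y2 - y1) * (x3 - x1)"
text \<open>Segments are listed from left to right, so \<open>x2 < x3\<close> separates them
  vertically. Two segments with a common end meet nowhere else if the three points are not
  collinear; otherwise one segment has to lie strictly on one side of the line through the
  other.\<close>

fun seg_ok :: "seg => seg => bool" where
	"seg_ok (i,j,x1,y1,x2,y2) (k,l,x3,y3,x4,y4) \<longleftrightarrow>
	 (if x2 < x3 then True
		else if i = k then orient x1 y1 x2 y2 x4 y4 ~= 0 & j ~= l
		else if i = l then orient x1 y1 x2 y2 x3 y3 ~= 0 & j ~= k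
		else if j = k then orient x1 y1 x2 y2 x4 y4 ~= 0
		else if j = l then orient x1 y1 x2 y2 x3 y3 ~= 0
		else orient x1 y1 x2 y2 x3 y3 * orient x1 y1 x2 y2 x4 y4 > 0 |
				 orient x3 y3 x4 y4 x1 y1 * orient x3 y3 x4 y4 x2 y2 > 0)"
fun pairs_ok :: "seg list => bool" where
	"pairs_ok [] = True" | "pairs_ok (s # ss) \<longleftrightarrow> list_all (seg_ok s) ss & pairs_ok ss"

definition gadget_segs :: "seg list" where
	"gadget_segs = [
	(56,0,0,0,800,600), (56,3,0,0,984,67), (56,16,0,0,666,17), (56,23,0,0,801,14),
	(56,25,0,0,1086,6), (56,28,0,0,800,-600), (56,31,0,0,930,-86), (56,41,0,0,1988,-31),
	(16,17,666,17,954,23), (16,18,666,17,1042,27), (0,1,800,600,2022,484),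
	(0,2,800,600,3200,600), (28,29,800,-600,1978,-484), (28,30,800,-600,3200,-600),
	(23,22,801,14,1099,20), (23,24,801,14,1304,21), (31,32,930,-86,1377,-110),
	(31,33,930,-86,1414,-150), (17,18,954,23,1042,27), (17,19,954,23,1155,25),
	(3,4,984,67,1361,78), (3,5,984,67,1592,124), (18,13,1042,27,1507,42),
	(25,26,1086,6,1669,5), (25,27,1086,6,1589,14), (22,20,1099,20,1191,24),
	(22,24,1099,20,1304,21), (19,20,1155,25,1191,24), (19,21,1155,25,1320,27),
	(20,21,1191,24,1320,27), (24,15,1304,21,2012,31), (21,14,1320,27,1613,34),
	(4,5,1361,78,1592,124), (4,13,1361,78,1507,42), (32,33,1377,-110,1414,-150),
	(32,38,1377,-110,1788,-94), (33,34,1414,-150,1933,-252), (13,14,1507,42,1613,34),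
	(13,15,1507,42,2012,31), (27,15,1589,14,2012,31), (27,26,1589,14,1669,5),
	(5,6,1592,124,2067,252), (5,10,1592,124,1955,97), (14,15,1613,34,2012,31),
	(26,54,1669,5,2331,-5), (38,39,1788,-94,1940,-74), (38,40,1788,-94,2045,-97),
	(34,29,1933,-252,1978,-484), (34,35,1933,-252,2408,-124), (39,40,1940,-74,2045,-97),
	(39,41,1940,-74,1988,-31), (10,11,1955,97,2060,74), (10,12,1955,97,2212,94),
	(29,30,1978,-484,3200,-600), (41,42,1988,-31,2387,-34), (41,43,1988,-31,2493,-42),
	(41,50,1988,-31,2696,-21), (41,53,1988,-31,2411,-14), (15,11,2012,31,2060,74),
	(15,57,2012,31,4000,0), (1,2,2022,484,3200,600), (1,6,2022,484,2067,252),
	(40,35,2045,-97,2408,-124), (11,12,2060,74,2212,94), (6,7,2067,252,2586,150),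
	(12,8,2212,94,2623,110), (54,53,2331,-5,2411,-14), (54,55,2331,-5,2914,-6),
	(42,43,2387,-34,2493,-42), (42,47,2387,-34,2680,-27), (35,36,2408,-124,2639,-78),
	(35,37,2408,-124,3016,-67), (53,55,2411,-14,2914,-6), (43,36,2493,-42,2639,-78),
	(43,44,2493,-42,2958,-27), (7,8,2586,150,2623,110), (7,9,2586,150,3070,86),
	(8,9,2623,110,3070,86), (36,37,2639,-78,3016,-67), (47,48,2680,-27,2809,-24),
	(47,49,2680,-27,2845,-25), (50,51,2696,-21,3199,-14), (50,52,2696,-21,2901,-20),
	(48,49,2809,-24,2845,-25), (48,52,2809,-24,2901,-20), (49,45,2845,-25,3046,-23),
	(52,51,2901,-20,3199,-14), (55,57,2914,-6,4000,0), (44,45,2958,-27,3046,-23),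
	(44,46,2958,-27,3334,-17), (37,57,3016,-67,4000,0), (45,46,3046,-23,3334,-17),
	(9,57,3070,86,4000,0), (51,57,3199,-14,4000,0), (2,57,3200,600,4000,0),
	(30,57,3200,-600,4000,0), (46,57,3334,-17,4000,0)]"

lemma gadget_segs_ok: "pairs_ok gadget_segs" by code_simp

definition gadget_edges :: "(nat \<times> nat) list" where
	"gadget_edges = inner_edges @ map (%k. (k, 56)) left_ends @ map (%k. (k, 57)) right_ends"

lemma inner_edges_bound: "list_all (%(k, l). k < 56 & l < 56) inner_edges" by (simp add: inner_edges_def)

lemma ends_bound: "k : set left_ends ==> k < 56" "k : set right_ends ==> k < 56" by (auto simp: left_ends_def right_ends_def)

lemma gadget_edges_nbrs:
	"list_all (%(k, l). k ~= l & l : set (gnbrs ! k) & k : set (gnbrs ! l)) gadget_edges"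
	by (simp add: gadget_edges_def inner_edges_def left_ends_def right_ends_def gn)

lemma gadget_edge_bounds:
	"(k, l) : set gadget_edges ==> k < 56 & l < 58" using inner_edges_bound by (auto simp: gadget_edges_def list_all_iff dest!: ends_bound)

lemma gadget_edge_nbr:
	"(k, l) : set gadget_edges ==> k ~= l & l : set (gnbrs ! k) & k : set (gnbrs ! l)" using gadget_edges_nbrs by (auto simp: list_all_iff)

lemma gadget_edge_cases:
	assumes "(k, l) : set gadget_edges"
	obtains "l < 56" "(k, l) : set inner_edges" | "l = 56" "k : set left_ends" | "l = 57" "k : set right_ends"
	using assms inner_edges_bound by (auto simp: gadget_edges_def list_all_iff)

lemma upt_58: "[0..<58::nat] = [0,1,2,3,4,5,6,7,8,9,10,11,12,13,14,15,16,17,18,19,20,21,22,23,24,25,26,27,28,29,30,31,32,33,34,35,36,37,38,39,40,41,42,43,44,45,46,47,48,49,50,51,52,53,54,55,56,57]"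
	by code_simp

lemma less_58: "(a::nat) < 58 ==> a : set [0,1,2,3,4,5,6,7,8,9,10,11,12,13,14,15,16,17,18,19,20,21,22,23,24,25,26,27,28,29,30,31,32,33,34,35,36,37,38,39,40,41,42,43,44,45,46,47,48,49,50,51,52,53,54,55,56,57]"
	unfolding upt_58[symmetric] by simp

abbreviation gnb :: "nat => nat set" where "gnb k \<equiv> set (gnbrs ! k)"

lemma no45_at:
	assumes "a < 58" "b : gnb a" "c : gnb b" "c ~= a" "d : gnb c" "d ~= b" "d ~= a"
	shows "a \<notin> gnb d" "e : gnb d ==> e ~= c ==> e ~= b ==> e ~= a ==> a \<notin> gnb e"
proof -
	have "no45 a" using gadget_no_short_cycle less_58[OF assms(1)] by (simp only: list_all_iff)
	then have "d = b | d = a | (a \<notin> gnb d & (ALL e : gnb d. e = c | e = b | e = a | a \<notin> gnb e))"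
	using assms(2-5) unfolding no45_def list_all_iff by metis
	with assms(6,7) show "a \<notin> gnb d" "e : gnb d ==> e ~= c ==> e ~= b ==> e ~= a ==> a \<notin> gnb e" by blast+
qed

lemma no_4_cycle:
	assumes "a < 58" "b : gnb a" "c : gnb b" "d : gnb c" "a : gnb d" "distinct [a,b,c,d]"
	shows False using no45_at(1)[of a b c d] assms by auto

lemma no_5_cycle:
	assumes "a < 58" "b : gnb a" "c : gnb b" "d : gnb c" "e : gnb d" "a : gnb e" "distinct [a,b,c,d,e]"
	shows False using no45_at(2)[of a b c d e] assms by auto

lemma one_triangle:
	assumes "a < 58" "b : gnb a" "c : gnb b" "a : gnb c" "c ~= a"
	"d : gnb a" "d ~= b" "d ~= c" "e : gnb d" "e ~= a" "a : gnb e"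
	shows False
proof -
	have "tri_ok a" using gadget_triangles less_58[OF assms(1)] by (simp only: list_all_iff)
	then show False using assms(2-) unfolding tri_ok_def list_all_iff by metis
qed

lemma no_triangle_at_end:
	assumes "a : {56, 57}" "b : gnb a" "c : gnb b" "a : gnb c" "c ~= a"
	shows False using assms by (auto simp: gn)

lemma ends_disjoint: "k : gnb 56 ==> k : gnb 57 ==> False" by (auto simp: gn)

section \<open>The lattice graph and its vertex numbering\<close>

text \<open>A gadget \<open>(y, x, e)\<close> starts at site \<open>(y, x)\<close>; the copies \<open>e < 9\<close> lead to the right, the
	copies \<open>9 <= e < 18\<close> down, one for each pair of colours. Every site owns a block of
	\<open>1 + 18 * 56 = 1009\<close> vertices, the first of which is its hub.\<close>

type_synonym gadget = "nat \<times> nat \<times> nat"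

definition hub :: "nat => nat \<times> nat => nat" where
	"hub S = (%(y, x). (y * S + x) * 1009)"

fun target :: "gadget => nat \<times> nat" where
	"target (y, x, e) = (if e < 9 then (y, Suc x) else (Suc y, x))"

fun vtx :: "nat => gadget => nat => nat" where
	"vtx S (y, x, e) k =
	 (if k < 56 then (y * S + x) * 1009 + Suc (e * 56 + k)
		else if k = 56 then hub S (y, x) else hub S (target (y, x, e)))"

declare vtx.simps [simp del]

definition sites :: "nat => (nat \<times> nat) set" where
	"sites S = {..<S} \<times> {..<S}"

definition gadgets :: "nat => gadget set" where
	"gadgets S = {(y, x, e). y < S & x < S & e < 18}"

text \<open>A gadget whose target would fall outside the lattice keeps its 56 inner vertices and its
  first end, and only loses end 57. This keeps all blocks equal.\<close>

definition node_ok :: "nat => gadget => nat => bool" where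
	"node_ok S g k \<longleftrightarrow> g : gadgets S & k < 58 & (k = 57 --> target g : sites S)"

definition lattice_edges :: "nat => nat set set" where
	"lattice_edges S = {{vtx S g k, vtx S g l} | g k l. (k, l) : set gadget_edges & node_ok S g k & node_ok S g l}"

lemma hub_inj: "p : sites S ==> q : sites S ==> hub S p = hub S q \<longleftrightarrow> p = q"
proof -
	assume "p : sites S" "q : sites S"
	moreover obtain y x y' x' where "p = (y, x)" "q = (y', x')" by (metis surj_pair)
	moreover have "y = y' & x = x'" if "y * S + x = y' * S + x'" "x < S" "x' < S"
	proof -
	have "(y * S + x) div S = y" "(y' * S + x') div S = y'" using that(2,3) by auto
	with that(1) have "y = y'" by simp
	with that(1) show ?thesis by simp
	qed
	ultimately show ?thesis by (auto simp: hub_def sites_def)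
qed

lemma vtx_inner_decode:
	assumes "k < 56" "e < 18"
	shows "vtx S (y, x, e) k div 1009 = y * S + x" "vtx S (y, x, e) k mod 1009 = Suc (e * 56 + k)"
proof -
	have "Suc (e * 56 + k) < 1009" using assms by linarith
	then show "vtx S (y, x, e) k div 1009 = y * S + x" "vtx S (y, x, e) k mod 1009 = Suc (e * 56 + k)"
	proof -
	have v: "vtx S (y, x, e) k = Suc (e * 56 + k) + (y * S + x) * 1009" using assms by (simp add: vtx.simps)
	show "vtx S (y, x, e) k div 1009 = y * S + x" "vtx S (y, x, e) k mod 1009 = Suc (e * 56 + k)"
		unfolding v div_mult_self1[of 1009, simplified] mod_mult_self1 using \<open>Suc (e * 56 + k) < 1009\<close> by simp_all
	qed
qed

lemma hub_mod: "hub S p mod 1009 = 0" by (cases p) (simp add: hub_def)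

lemma vtx_inner_inj:
	assumes "g : gadgets S" "g' : gadgets S" "k < 56" "k' < 56" "vtx S g k = vtx S g' k'"
	shows "g = g' & k = k'"
proof -
	obtain y x e y' x' e' where g: "g = (y, x, e)" "g' = (y', x', e')" by (metis prod_cases3)
	with assms have e: "e < 18" "e' < 18" "x < S" "x' < S" "y < S" "y' < S" by (auto simp: gadgets_def)
	note d = vtx_inner_decode[OF assms(3) e(1), of S y x] vtx_inner_decode[OF assms(4) e(2), of S y' x']
	have eq: "vtx S (y, x, e) k = vtx S (y', x', e') k'" using assms(5) g by simp
	have "y * S + x = y' * S + x'" using d(1,3) eq by metis
	then have "hub S (y, x) = hub S (y', x')" by (simp add: hub_def)
	then have yx: "y = y'" "x = x'" using hub_inj[of "(y, x)" S "(y', x')"] e by (auto simp: sites_def)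
	have "Suc (e * 56 + k) = Suc (e' * 56 + k')" using d(2,4) eq by metis
	moreover have "(e * 56 + k) div 56 = e" "(e' * 56 + k') div 56 = e'" using assms(3,4) by auto
	ultimately have "e = e'" "k = k'" by auto
	then show ?thesis using yx g by simp
qed

lemma vtx_not_hub: "g : gadgets S ==> k < 56 ==> vtx S g k ~= hub S p"
	using vtx_inner_decode(2)[of k "snd (snd g)" S "fst g" "fst (snd g)"] hub_mod[of S p] by (cases g) (auto simp: gadgets_def)

lemma vtx_56: "vtx S (y, x, e) 56 = hub S (y, x)" and vtx_57: "vtx S g 57 = hub S (target g)"
	by (simp_all add: vtx.simps) (cases g; simp add: vtx.simps)

lemma vtx_end: "node_ok S g k ==> ~ k < 56 ==> k = 56 | k = 57" by (auto simp: node_ok_def)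

lemma target_site: "node_ok S g 57 ==> target g : sites S" by (simp add: node_ok_def)

lemma vtx_end_hub:
	assumes "node_ok S g k" "~ k < 56"
	shows "EX p : sites S. vtx S g k = hub S p"
proof -
	obtain y x e where g: "g = (y, x, e)" by (metis prod_cases3)
	consider "k = 56" | "k = 57" using vtx_end[OF assms] by blast
	then show ?thesis
	proof cases
	case 1
	have "(y, x) : sites S" using assms(1) g by (simp add: node_ok_def gadgets_def sites_def)
	then show ?thesis using 1 g vtx_56 by metis
	next
	case 2
	then show ?thesis using assms(1) vtx_57 target_site by metis
	qed
qed

lemma vtx_inj:
	assumes "node_ok S g k" "node_ok S g l" "vtx S g k = vtx S g l"
	shows "k = l"
proof (cases "k < 56"; cases "l < 56")
	have g: "g : gadgets S" using assms(1) by (simp add: node_ok_def)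
	{ assume "k < 56" "l < 56" then show ?thesis using vtx_inner_inj[OF g g _ _ assms(3)] by blast }
	{ assume k: "k < 56" "~ l < 56"
	then obtain p where "vtx S g l = hub S p" using vtx_end_hub[OF assms(2)] by blast
	then show ?thesis using vtx_not_hub[OF g k(1), of p] assms(3) by simp }
	{ assume k: "~ k < 56" "l < 56"
	then obtain p where "vtx S g k = hub S p" using vtx_end_hub[OF assms(1)] by blast
	then show ?thesis using vtx_not_hub[OF g k(2), of p] assms(3) by simp }
	{ assume k: "~ k < 56" "~ l < 56"
	obtain y x e where ge: "g = (y, x, e)" by (metis prod_cases3)
	have p: "(y, x) : sites S" using g ge by (simp add: gadgets_def sites_def)
	have t: "target g ~= (y, x)" using ge by simp
	have ne: "vtx S g 56 ~= vtx S g 57" if "target g : sites S" using hub_inj[OF p that] t ge vtx_56[of S y x e] vtx_57[of S g] by auto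
	consider "k = l" | "k = 56" "l = 57" | "k = 57" "l = 56" using vtx_end[OF assms(1) k(1)] vtx_end[OF assms(2) k(2)] by blast
	then show ?thesis
	proof cases
		case 2 then show ?thesis using ne target_site assms by metis
	next
		case 3 then show ?thesis using ne target_site assms by metis
	qed }
qed

lemma vtx_less: "node_ok S g k ==> vtx S g k < S * S * 1009"
proof -
	assume k: "node_ok S g k"
	have site: "(y * S + x) < S * S" if "y < S" "x < S" for y x
	proof -
	have "y * S + x < Suc y * S" using that by simp
	also have "\<dots> <= S * S" using that by (intro mult_le_mono1) simp
	finally show ?thesis .
	qed
	obtain y x e where g: "g = (y, x, e)" by (metis prod_cases3)
	show ?thesis
	proof (cases "k < 56")
	case True
	then have "vtx S g k div 1009 < S * S" using site k g by (simp add: vtx_inner_decode node_ok_def gadgets_def)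
	then show ?thesis by (simp add: div_less_iff_less_mult)
	next
	case False
	then obtain p where "p : sites S" "vtx S g k = hub S p" using vtx_end_hub[OF k] by auto
	then have "vtx S g k = (fst p * S + snd p) * 1009" "fst p < S" "snd p < S" by (auto simp: hub_def sites_def)
	then show ?thesis using site[of "fst p" "snd p"] by simp
	qed
qed

lemma lattice_simple: "simple_graph {..<S * S * 1009} (lattice_edges S)"
proof -
	have "card {vtx S g k, vtx S g l} = 2" if "(k, l) : set gadget_edges" "node_ok S g k" "node_ok S g l" for g k l
	using vtx_inj[OF that(2,3)] gadget_edge_nbr[OF that(1)] by (metis card_2_iff)
	then show ?thesis by (auto simp: simple_graph_def lattice_edges_def vtx_less)
qed

section \<open>Short cycles and triangles of the lattice\<close>

definition adj :: "nat => nat => nat => bool" where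
	"adj S u v \<longleftrightarrow> {u, v} : lattice_edges S"

lemma adj_sym: "adj S u v ==> adj S v u" by (simp add: adj_def insert_commute)

lemma adjE:
	assumes "adj S u v"
	obtains g k l where "node_ok S g k" "node_ok S g l" "k < 56 | l < 56" "l : gnb k" "k : gnb l"
	"u = vtx S g k" "v = vtx S g l"
proof -
	obtain g k l where *: "{u, v} = {vtx S g k, vtx S g l}" "(k, l) : set gadget_edges" "node_ok S g k" "node_ok S g l"
	using assms by (auto simp: adj_def lattice_edges_def)
	have k: "l : gnb k" "k : gnb l" "k < 56" using gadget_edge_nbr[OF *(2)] gadget_edge_bounds[OF *(2)] by auto
	from *(1) consider "u = vtx S g k" "v = vtx S g l" | "u = vtx S g l" "v = vtx S g k" by (auto simp: doubleton_eq_iff)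
	then show thesis by cases (use that * k in blast)+
qed

lemma node_gadget: "node_ok S g k ==> g : gadgets S" by (simp add: node_ok_def)

lemma adj_inner:
	assumes "adj S (vtx S g k) v" "node_ok S g k" "k < 56"
	obtains l where "node_ok S g l" "l : gnb k" "k : gnb l" "v = vtx S g l"
proof -
	obtain g' k' l' where *: "node_ok S g' k'" "node_ok S g' l'" "l' : gnb k'" "k' : gnb l'"
	"vtx S g k = vtx S g' k'" "v = vtx S g' l'" using assms(1) by (rule adjE)
	have "k' < 56"
	proof (rule ccontr)
	assume "~ k' < 56"
	then obtain p where "vtx S g' k' = hub S p" using vtx_end_hub[OF *(1)] by blast
	then show False using vtx_not_hub[OF node_gadget[OF assms(2)] assms(3), of p] *(5) by simp
	qed
	then have "g = g' & k = k'" using vtx_inner_inj[OF node_gadget[OF assms(2)] node_gadget[OF *(1)] assms(3) _ *(5)] by blast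
	then show thesis using that * by blast
qed

lemma adj_hub:
	assumes "adj S (hub S p) v"
	obtains g k l where "node_ok S g k" "k < 56" "v = vtx S g k" "node_ok S g l" "~ l < 56" "hub S p = vtx S g l"
	"l : gnb k" "k : gnb l"
proof -
	obtain g k l where *: "node_ok S g k" "node_ok S g l" "k < 56 | l < 56" "l : gnb k" "k : gnb l"
	"hub S p = vtx S g k" "v = vtx S g l" using assms by (rule adjE)
	then have "~ k < 56" using vtx_not_hub[OF node_gadget[OF *(1)], of k p] by auto
	with * show thesis using that by blast
qed

text \<open>An inner vertex is adjacent to at most one hub, so two steps from a hub stay inside a gadget.\<close>

lemma two_steps_from_hub:
	assumes "node_ok S g l" "~ l < 56" "node_ok S g k" "k < 56" "l : gnb k" "k : gnb l"
	"adj S (vtx S g k) r" "r ~= vtx S g l"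
	obtains m where "node_ok S g m" "m < 56" "r = vtx S g m" "m : gnb k" "k : gnb m"
proof -
	obtain m where m: "node_ok S g m" "m : gnb k" "k : gnb m" "r = vtx S g m" by (rule adj_inner[OF assms(7,3,4)])
	have "m < 56"
	proof (rule ccontr)
	assume nm: "~ m < 56"
	have "m ~= l" using m(4) assms(8) by auto
	then consider "m = 56" "l = 57" | "m = 57" "l = 56" using vtx_end[OF m(1) nm] vtx_end[OF assms(1,2)] by blast
	then show False by cases (use ends_disjoint[of k] m(3) assms(6) in auto)
	qed
	with m show thesis using that by blast
qed

definition is_hub :: "nat => nat => bool" where
	"is_hub S v \<longleftrightarrow> (EX p. v = hub S p)"

lemma inner_or_hub:
	assumes "adj S u v" "~ is_hub S u"
	obtains g k where "node_ok S g k" "k < 56" "u = vtx S g k"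
proof -
	obtain g k where "node_ok S g k" "u = vtx S g k" using assms(1) by (rule adjE)
	moreover have "k < 56" using calculation vtx_end_hub[of S g k] assms(2) unfolding is_hub_def by metis
	ultimately show thesis using that by blast
qed

lemma path_in_gadget:
	assumes "adj S u v" "~ is_hub S v" "node_ok S g k" "k < 56" "u = vtx S g k"
	obtains l where "node_ok S g l" "l < 56" "v = vtx S g l" "l : gnb k" "k : gnb l"
proof -
	obtain l where l: "node_ok S g l" "l : gnb k" "k : gnb l" "v = vtx S g l" by (rule adj_inner[OF assms(1)[unfolded assms(5)] assms(3,4)])
	moreover have "l < 56" using l vtx_end_hub[of S g l] assms(2) unfolding is_hub_def by metis
	ultimately show thesis using that by blast
qed

lemma hub_gadget:
	assumes "adj S u v" "is_hub S u"
	obtains g k l where "node_ok S g k" "k < 56" "v = vtx S g k" "node_ok S g l" "~ l < 56" "u = vtx S g l"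
	"l : gnb k" "k : gnb l"
proof -
	obtain p where p: "u = hub S p" using assms(2) by (auto simp: is_hub_def)
	show thesis using assms(1) unfolding p by (rule adj_hub) (use that p in blast)
qed

lemma inner_not_hub: "node_ok S g k ==> k < 56 ==> ~ is_hub S (vtx S g k)" using vtx_not_hub[OF node_gadget] by (auto simp: is_hub_def)

text \<open>Edges between inner vertices never leave a gadget. This closes up the cycles: walks that
  start in a gadget and meet again at inner vertices lie in the same copy.\<close>

lemma back_in_gadget:
	assumes "adj S v w" "node_ok S g k" "k < 56" "v = vtx S g k" "node_ok S g' l" "w = vtx S g' l" "l < 56"
	shows "g' = g & l : gnb k & k : gnb l"
proof -
	have nh: "~ is_hub S w" using inner_not_hub[OF assms(5,7)] assms(6) by simp
	obtain l' where l': "node_ok S g l'" "l' < 56" "w = vtx S g l'" "l' : gnb k" "k : gnb l'" by (rule path_in_gadget[OF assms(1) nh assms(2,3,4)])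
	have "vtx S g l' = vtx S g' l" using l'(3) assms(6) by simp
	then have "g = g' & l' = l" using vtx_inner_inj[OF node_gadget[OF l'(1)] node_gadget[OF assms(5)] l'(2) assms(7)] by blast
	then show ?thesis using l' by blast
qed

lemma hub_return:
	assumes "adj S v h" "node_ok S g k" "k < 56" "v = vtx S g k" "node_ok S g l" "h = vtx S g l"
	shows "l : gnb k & k : gnb l"
proof -
	have "adj S (vtx S g k) h" using assms(1,4) by simp
	then obtain l' where l': "node_ok S g l'" "l' : gnb k" "k : gnb l'" "h = vtx S g l'" by (rule adj_inner[OF _ assms(2,3)])
	have "vtx S g l' = vtx S g l" using l'(4) assms(6) by simp
	then have "l' = l" by (rule vtx_inj[OF l'(1) assms(5)])
	then show ?thesis using l' by blast
qed

lemma node_less: "node_ok S g k ==> k < 58" by (simp add: node_ok_def)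

lemma no_hub_3:
	assumes "adj S h p" "adj S p q" "adj S q h" "distinct [h,p,q]" "is_hub S h"
	shows False
proof -
	obtain g k l where *: "node_ok S g k" "k < 56" "p = vtx S g k" "node_ok S g l" "~ l < 56" "h = vtx S g l"
	"l : gnb k" "k : gnb l" by (rule hub_gadget[OF assms(1,5)])
	have "adj S (vtx S g k) q" "q ~= vtx S g l" using assms(2,4) *(3,6) by auto
	then obtain m where m: "node_ok S g m" "m < 56" "q = vtx S g m" "m : gnb k" "k : gnb m" by (rule two_steps_from_hub[OF *(4,5,1,2,7,8)])
	have "l : gnb m" using hub_return[OF assms(3) m(1,2,3) *(4,6)] by simp
	moreover have "l : {56, 57}" using vtx_end[OF *(4,5)] by simp
	moreover have "m ~= l" using *(5) m(2) by auto
	ultimately show False using no_triangle_at_end[OF _ *(8) m(4)] by metis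
qed

text \<open>\<open>p\<close> and \<open>r\<close> are inner vertices of one gadget, by two steps
  from the hub. \<open>q\<close> is next to a hub and hence inner, so the edge from \<open>r\<close>
  keeps it in that gadget; the cycle would be one of the gadget itself.\<close>

lemma no_hub_4:
	assumes "adj S h p" "adj S p r" "adj S r q" "adj S q h" "distinct [h,p,r,q]" "is_hub S h"
	shows False
proof -
	obtain g k l where *: "node_ok S g k" "k < 56" "p = vtx S g k" "node_ok S g l" "~ l < 56" "h = vtx S g l"
	"l : gnb k" "k : gnb l" by (rule hub_gadget[OF assms(1,6)])
	have "adj S (vtx S g k) r" "r ~= vtx S g l" using assms(2,5) *(3,6) by auto
	then obtain m where m: "node_ok S g m" "m < 56" "r = vtx S g m" "m : gnb k" "k : gnb m" by (rule two_steps_from_hub[OF *(4,5,1,2,7,8)])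
	have nq: "~ is_hub S q" by (rule hub_gadget[OF adj_sym[OF assms(4)] assms(6)]) (simp add: inner_not_hub)
	obtain j where j: "node_ok S g j" "j < 56" "q = vtx S g j" "j : gnb m" "m : gnb j" by (rule path_in_gadget[OF assms(3) nq m(1,2,3)])
	have "l : gnb j" using hub_return[OF assms(4) j(1,2,3) *(4,6)] by simp
	moreover have "distinct [l, k, m, j]" using assms(5) unfolding *(3,6) m(3) j(3) by (simp, metis)
	ultimately show False using no_4_cycle[OF node_less[OF *(4)] *(8) m(4) j(4)] by metis
qed

text \<open>The cycle is followed for two steps in both directions from the hub, which gives inner
  vertices \<open>p\<close>, \<open>r\<close> of one gadget and \<open>q\<close>, \<open>s\<close>
  of another. The edge between \<open>r\<close> and \<open>s\<close> identifies the gadgets. Length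
  5 is the largest that these two walks cover.\<close>

lemma no_hub_5:
	assumes "adj S h p" "adj S p r" "adj S r s" "adj S s q" "adj S q h" "distinct [h,p,r,s,q]" "is_hub S h"
	shows False
proof -
	obtain g k l where *: "node_ok S g k" "k < 56" "p = vtx S g k" "node_ok S g l" "~ l < 56" "h = vtx S g l"
	"l : gnb k" "k : gnb l" by (rule hub_gadget[OF assms(1,7)])
	have "adj S (vtx S g k) r" "r ~= vtx S g l" using assms(2,6) *(3,6) by auto
	then obtain m where m: "node_ok S g m" "m < 56" "r = vtx S g m" "m : gnb k" "k : gnb m" by (rule two_steps_from_hub[OF *(4,5,1,2,7,8)])
	obtain g' k' l' where **: "node_ok S g' k'" "k' < 56" "q = vtx S g' k'" "node_ok S g' l'" "~ l' < 56" "h = vtx S g' l'"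
	"l' : gnb k'" "k' : gnb l'" by (rule hub_gadget[OF adj_sym[OF assms(5)] assms(7)])
	have "adj S (vtx S g' k') s" "s ~= vtx S g' l'" using assms(6) adj_sym[OF assms(4)] **(3,6) by auto
	then obtain m' where m': "node_ok S g' m'" "m' < 56" "s = vtx S g' m'" "m' : gnb k'" "k' : gnb m'" by (rule two_steps_from_hub[OF **(4,5,1,2,7,8)])
	have b: "g' = g" "m' : gnb m" using back_in_gadget[OF assms(3) m(1,2,3) m'(1,3,2)] by simp_all
	have "vtx S g l' = vtx S g l" using *(6) **(6) b(1) by simp
	then have "l' = l" by (rule vtx_inj[OF **(4)[unfolded b(1)] *(4)])
	moreover have "distinct [l, k, m, m', k']" using assms(6) unfolding *(3,6) m(3) m'(3) **(3) b(1) by (simp, metis)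
	ultimately show False using no_5_cycle[OF node_less[OF *(4)] *(8) m(4) b(2) m'(5) **(7)[unfolded \<open>l' = l\<close>]] by metis
qed

lemma lattice_no_4:
	assumes "adj S a b" "adj S b c" "adj S c d" "adj S d a" "distinct [a,b,c,d]"
	shows False
proof -
	have ds: "distinct [b,c,d,a]" "distinct [c,d,a,b]" "distinct [d,a,b,c]" using assms(5) by auto
	have nh: "~ is_hub S a" "~ is_hub S b" "~ is_hub S c" "~ is_hub S d"
	using no_hub_4[OF assms] no_hub_4[OF assms(2,3,4,1) ds(1)] no_hub_4[OF assms(3,4,1,2) ds(2)]
	no_hub_4[OF assms(4,1,2,3) ds(3)] by blast+
	obtain k g where k: "node_ok S g k" "k < 56" "a = vtx S g k" by (rule inner_or_hub[OF assms(1) nh(1)])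
	obtain l where l: "node_ok S g l" "l < 56" "b = vtx S g l" "l : gnb k" by (rule path_in_gadget[OF assms(1) nh(2) k])
	obtain m where m: "node_ok S g m" "m < 56" "c = vtx S g m" "m : gnb l" by (rule path_in_gadget[OF assms(2) nh(3) l(1-3)])
	obtain j where j: "node_ok S g j" "j < 56" "d = vtx S g j" "j : gnb m" by (rule path_in_gadget[OF assms(3) nh(4) m(1-3)])
	have "k : gnb j" using back_in_gadget[OF assms(4) j(1-3) k(1,3,2)] by simp
	moreover have "distinct [k,l,m,j]" using assms(5) unfolding k(3) l(3) m(3) j(3) by (simp, metis)
	ultimately show False using no_4_cycle[OF node_less[OF k(1)] l(4) m(4) j(4)] by metis
qed

lemma lattice_no_5:
	assumes "adj S a b" "adj S b c" "adj S c d" "adj S d e" "adj S e a" "distinct [a,b,c,d,e]"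
	shows False
proof -
	have ds: "distinct [b,c,d,e,a]" "distinct [c,d,e,a,b]" "distinct [d,e,a,b,c]" "distinct [e,a,b,c,d]" using assms(6) by auto
	have nh: "~ is_hub S a" "~ is_hub S b" "~ is_hub S c" "~ is_hub S d" "~ is_hub S e"
	using no_hub_5[OF assms] no_hub_5[OF assms(2,3,4,5,1) ds(1)] no_hub_5[OF assms(3,4,5,1,2) ds(2)]
	no_hub_5[OF assms(4,5,1,2,3) ds(3)] no_hub_5[OF assms(5,1,2,3,4) ds(4)] by blast+
	obtain k g where k: "node_ok S g k" "k < 56" "a = vtx S g k" by (rule inner_or_hub[OF assms(1) nh(1)])
	obtain l where l: "node_ok S g l" "l < 56" "b = vtx S g l" "l : gnb k" by (rule path_in_gadget[OF assms(1) nh(2) k])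
	obtain m where m: "node_ok S g m" "m < 56" "c = vtx S g m" "m : gnb l" by (rule path_in_gadget[OF assms(2) nh(3) l(1-3)])
	obtain j where j: "node_ok S g j" "j < 56" "d = vtx S g j" "j : gnb m" by (rule path_in_gadget[OF assms(3) nh(4) m(1-3)])
	obtain i where i: "node_ok S g i" "i < 56" "e = vtx S g i" "i : gnb j" by (rule path_in_gadget[OF assms(4) nh(5) j(1-3)])
	have "k : gnb i" using back_in_gadget[OF assms(5) i(1-3) k(1,3,2)] by simp
	moreover have "distinct [k,l,m,j,i]" using assms(6) unfolding k(3) l(3) m(3) j(3) i(3) by (simp, metis)
	ultimately show False using no_5_cycle[OF node_less[OF k(1)] l(4) m(4) j(4) i(4)] by metis
qed

text \<open>No triangle passes through a hub, so both triangles lie in the gadget of the inner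
  vertex \<open>a\<close>, and \<open>one_triangle\<close> applies.\<close>

lemma lattice_triangles:
	assumes "adj S a b" "adj S b c" "adj S c a" "distinct [a,b,c]"
	and "adj S a d" "adj S d e" "adj S e a" "distinct [a,d,e]"
	shows "{b, c} = {d, e}"
proof (rule ccontr)
	assume ne: "{b, c} ~= {d, e}"
	have ds: "distinct [b,c,a]" "distinct [c,a,b]" "distinct [d,e,a]" "distinct [e,a,d]" using assms(4,8) by auto
	have nh: "~ is_hub S a" "~ is_hub S b" "~ is_hub S c" "~ is_hub S d" "~ is_hub S e"
	using no_hub_3[OF assms(1-4)] no_hub_3[OF assms(2,3,1) ds(1)] no_hub_3[OF assms(3,1,2) ds(2)]
	no_hub_3[OF assms(6,7,5) ds(3)] no_hub_3[OF assms(7,5,6) ds(4)] by blast+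
	obtain k g where k: "node_ok S g k" "k < 56" "a = vtx S g k" by (rule inner_or_hub[OF assms(1) nh(1)])
	obtain l where l: "node_ok S g l" "l < 56" "b = vtx S g l" "l : gnb k" "k : gnb l" by (rule path_in_gadget[OF assms(1) nh(2) k])
	obtain m where m: "node_ok S g m" "m < 56" "c = vtx S g m" "m : gnb l" "l : gnb m" by (rule path_in_gadget[OF assms(2) nh(3) l(1-3)])
	have km: "k : gnb m" using back_in_gadget[OF assms(3) m(1-3) k(1,3,2)] by simp
	obtain i where i: "node_ok S g i" "i < 56" "d = vtx S g i" "i : gnb k" "k : gnb i" by (rule path_in_gadget[OF assms(5) nh(4) k])
	obtain j where j: "node_ok S g j" "j < 56" "e = vtx S g j" "j : gnb i" "i : gnb j" by (rule path_in_gadget[OF assms(6) nh(5) i(1-3)])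
	have kj: "k : gnb j" "j : gnb k" using back_in_gadget[OF assms(7) j(1-3) k(1,3,2)] by simp_all
	have dist: "m ~= k" "j ~= k" "i ~= k" using assms(4,8) k(3) m(3) j(3) i(3) by auto
	have d: "d = b | d = c"
	proof (rule ccontr)
	assume "~ (d = b | d = c)"
	then have "i ~= l" "i ~= m" using i(3) l(3) m(3) by auto
	then show False by (rule one_triangle[OF node_less[OF k(1)] l(4) m(4) km dist(1) i(4) _ _ j(4) dist(2) kj(1)])
	qed
	have e: "e = b | e = c"
	proof (rule ccontr)
	assume "~ (e = b | e = c)"
	then have "j ~= l" "j ~= m" using j(3) l(3) m(3) by auto
	then show False by (rule one_triangle[OF node_less[OF k(1)] l(4) m(4) km dist(1) kj(2) _ _ j(5) dist(3) i(5)])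
	qed
	from d e ne assms(4,8) show False by auto
qed

lemma cycle_3:
	assumes "is_cycle E xs" "length xs = 3"
	shows "EX a b c. xs = [a,b,c] & {a,b} : E & {b,c} : E & {c,a} : E & distinct [a,b,c]"
proof -
	obtain a b c where xs: "xs = [a,b,c]" using assms(2) by (auto simp: length_Suc_conv numeral_eq_Suc)
	have e: "i < 3 ==> {xs ! i, xs ! ((i + 1) mod 3)} : E" for i using assms by (simp add: is_cycle_def)
	have "distinct [a,b,c]" using assms(1) xs by (simp add: is_cycle_def)
	moreover have "{a,b} : E & {b,c} : E & {c,a} : E" using e[of 0] e[of 1] e[of 2] by (simp add: xs)
	ultimately show ?thesis using xs by blast
qed

lemma cycle_4:
	assumes "is_cycle E xs" "length xs = 4"
	shows "EX a b c d. xs = [a,b,c,d] & {a,b} : E & {b,c} : E & {c,d} : E & {d,a} : E & distinct [a,b,c,d]"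
proof -
	obtain a b c d where xs: "xs = [a,b,c,d]" using assms(2) by (auto simp: length_Suc_conv numeral_eq_Suc)
	have e: "i < 4 ==> {xs ! i, xs ! ((i + 1) mod 4)} : E" for i using assms by (simp add: is_cycle_def)
	have "distinct [a,b,c,d]" using assms(1) xs by (simp add: is_cycle_def)
	moreover have "{a,b} : E & {b,c} : E & {c,d} : E & {d,a} : E" using e[of 0] e[of 1] e[of 2] e[of 3] by (simp add: xs)
	ultimately show ?thesis using xs by blast
qed

lemma cycle_5:
	assumes "is_cycle E xs" "length xs = 5"
	shows "EX a b c d e. xs = [a,b,c,d,e] & {a,b} : E & {b,c} : E & {c,d} : E & {d,e} : E & {e,a} : E & distinct [a,b,c,d,e]"
proof -
	obtain a b c d e where xs: "xs = [a,b,c,d,e]" using assms(2) by (auto simp: length_Suc_conv numeral_eq_Suc)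
	have e: "i < 5 ==> {xs ! i, xs ! ((i + 1) mod 5)} : E" for i using assms by (simp add: is_cycle_def)
	have "distinct [a,b,c,d,e]" using assms(1) xs by (simp add: is_cycle_def)
	moreover have "{a,b} : E & {b,c} : E & {c,d} : E & {d,e} : E & {e,a} : E" using e[of 0] e[of 1] e[of 2] e[of 3] e[of 4] by (simp add: xs)
	ultimately show ?thesis using xs by blast
qed

lemma lattice_no_short_cycles:
	"~ has_cycle_of_length (lattice_edges S) 4" "~ has_cycle_of_length (lattice_edges S) 5"
proof -
	show "~ has_cycle_of_length (lattice_edges S) 4"
	proof
	assume "has_cycle_of_length (lattice_edges S) 4"
	then obtain xs where "is_cycle (lattice_edges S) xs" "length xs = 4" by (auto simp: has_cycle_of_length_def)
	from cycle_4[OF this] obtain a b c d where "adj S a b" "adj S b c" "adj S c d" "adj S d a" "distinct [a,b,c,d]" unfolding adj_def by metis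
	then show False by (rule lattice_no_4)
	qed
	show "~ has_cycle_of_length (lattice_edges S) 5"
	proof
	assume "has_cycle_of_length (lattice_edges S) 5"
	then obtain xs where "is_cycle (lattice_edges S) xs" "length xs = 5" by (auto simp: has_cycle_of_length_def)
	from cycle_5[OF this] obtain a b c d e where "adj S a b" "adj S b c" "adj S c d" "adj S d e" "adj S e a" "distinct [a,b,c,d,e]"
		unfolding adj_def by metis
	then show False by (rule lattice_no_5)
	qed
qed

lemma triangle_at:
	assumes "T : triangles (lattice_edges S)" "a : T"
	obtains b c where "T = {a, b, c}" "adj S a b" "adj S b c" "adj S c a" "distinct [a,b,c]"
proof -
	obtain xs where "T = set xs" "is_cycle (lattice_edges S) xs" "length xs = 3" using assms by (auto simp: triangles_def)
	from cycle_3[OF this(2,3)] this(1) obtain x y z where *: "T = {x, y, z}" "adj S x y" "adj S y z" "adj S z x" "distinct [x,y,z]"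
	by (auto simp: adj_def)
	then show thesis using assms(2) that[of y z] that[of z x] that[of x y] by auto
qed

lemma lattice_no_intersecting: "~ intersecting_triangles (lattice_edges S)"
proof
	assume "intersecting_triangles (lattice_edges S)"
	then obtain T U a where T: "T : triangles (lattice_edges S)" "U : triangles (lattice_edges S)" "T ~= U" "a : T" "a : U"
	by (auto simp: intersecting_triangles_def)
	obtain b c where 1: "T = {a, b, c}" "adj S a b" "adj S b c" "adj S c a" "distinct [a,b,c]" by (rule triangle_at[OF T(1,4)])
	obtain d e where 2: "U = {a, d, e}" "adj S a d" "adj S d e" "adj S e a" "distinct [a,d,e]" by (rule triangle_at[OF T(2,5)])
	have "{b, c} = {d, e}" using lattice_triangles[OF 1(2-5) 2(2-5)] .
	with 1 2 T(3) show False by auto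
qed

section \<open>Constraint satisfaction on the lattice as list colouring\<close>

text \<open>Colour 7 occurs in no hub list, so a gadget for the pair \<open>(7, 7)\<close> imposes nothing.\<close>

definition pair_colours :: "(nat \<times> nat) set => nat => nat \<times> nat" where
	"pair_colours A c = (if (c div 3 + 1, c mod 3 + 1) : A then (c div 3 + 1, c mod 3 + 1) else (7, 7))"

definition block_list :: "(nat \<times> nat) set => (nat \<times> nat) set => nat => nat list" where
	"block_list A B r =
	 (if r = 0 then [1, 2, 3]
		else case pair_colours (if (r - 1) div 56 < 9 then A else B) ((r - 1) div 56 mod 9) of
			(a, b) => gadget_lists a b ! ((r - 1) mod 56))"

type_synonym constraint_grid = "nat => nat => nat => (nat \<times> nat) set"

definition lattice_lists :: "nat => constraint_grid => nat => nat set" where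
	"lattice_lists S F v =
	 (let y = v div 1009 div S; x = v div 1009 mod S in set (block_list (F y x 0) (F y x 1) (v mod 1009)))"

definition csp_solution :: "nat => constraint_grid => (nat => nat => nat) => bool" where
	"csp_solution S F h \<longleftrightarrow> (ALL y<S. ALL x<S. h y x : {1,2,3}) &
	 (ALL y<S. ALL x. Suc x < S --> (h y x, h y (Suc x)) \<notin> F y x 0) &
	 (ALL y. Suc y < S --> (ALL x<S. (h y x, h (Suc y) x) \<notin> F y x 1))"

fun gadget_pair :: "constraint_grid => gadget => nat \<times> nat" where
	"gadget_pair F (y, x, e) = pair_colours (if e < 9 then F y x 0 else F y x 1) (e mod 9)"

lemma pair_colours_range:
	assumes "c < 9" "pair_colours A c = (a, b)"
	shows "a : {1,2,3,7}" "b : {1,2,3,7}"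
proof -
	define i where "i = c div 3 + 1"
	define j where "j = c mod 3 + 1"
	have "c div 3 < 3" using assms(1) by (simp add: div_less_iff_less_mult)
	then have i: "i = 1 | i = 2 | i = 3" unfolding i_def by linarith
	have "c mod 3 < 3" by simp
	then have j: "j = 1 | j = 2 | j = 3" unfolding j_def by linarith
	have "(a, b) = (i, j) | (a, b) = (7, 7)" using assms(2) unfolding pair_colours_def i_def[symmetric] j_def[symmetric] by (metis (full_types))
	then show "a : {1,2,3,7}" "b : {1,2,3,7}" using i j by auto
qed

lemma length_gadget_lists: "length (gadget_lists a b) = 56" by (simp add: gadget_lists_def)

lemma gadget_lists_ok:
	assumes "a : {1,2,3,7}" "b : {1,2,3,7}"
	shows "list_all (%l. distinct l & length l = 3 & 0 \<notin> set l) (gadget_lists a b)"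
proof -
	have "ALL a : {1,2,3,7}. ALL b : {1,2,3,7}.
		list_all (%l. distinct l & length l = 3 & 0 \<notin> set l) (gadget_lists a b)" by (simp add: gadget_lists_def)
	with assms show ?thesis by blast
qed

lemma block_list_ok: "r < 1009 ==> distinct (block_list A B r) & length (block_list A B r) = 3 & 0 \<notin> set (block_list A B r)"
proof (cases "r = 0")
	case False
	obtain a b where ab: "pair_colours (if (r - 1) div 56 < 9 then A else B) ((r - 1) div 56 mod 9) = (a, b)" by (metis surj_pair)
	have "(r - 1) div 56 mod 9 < 9" by simp
	from pair_colours_range[OF this ab]
	have "list_all (%l. distinct l & length l = 3 & 0 \<notin> set l) (gadget_lists a b)" by (rule gadget_lists_ok)
	moreover have "(r - 1) mod 56 < length (gadget_lists a b)" by (simp add: length_gadget_lists)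
	ultimately show ?thesis using False ab by (simp add: block_list_def list_all_length)
qed (simp add: block_list_def)

lemma lattice_regular:
	"list_assignment {..<S * S * 1009} (lattice_lists S F)"
	"regular_assignment 3 {..<S * S * 1009} (lattice_lists S F)"
proof -
	have "finite (lattice_lists S F v) & card (lattice_lists S F v) = 3 & lattice_lists S F v \<subseteq> {1..}" for v
	proof -
	let ?l = "block_list (F (v div 1009 div S) (v div 1009 mod S) 0) (F (v div 1009 div S) (v div 1009 mod S) 1) (v mod 1009)"
	have l: "distinct ?l" "length ?l = 3" "0 \<notin> set ?l" using block_list_ok[of "v mod 1009"] by simp_all
	have v: "lattice_lists S F v = set ?l" by (simp add: lattice_lists_def Let_def)
	have "x : {1..}" if "x : set ?l" for x using l(3) that by (cases x) auto
	then show ?thesis unfolding v using l(1,2) distinct_card[of ?l] by auto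
	qed
	then show "list_assignment {..<S * S * 1009} (lattice_lists S F)"
	"regular_assignment 3 {..<S * S * 1009} (lattice_lists S F)" by (auto simp: list_assignment_def regular_assignment_def)
qed

lemma site_decode:
	fixes x y S :: nat
	assumes "x < S"
	shows "(y * S + x) div S = y" "(y * S + x) mod S = x" using assms by auto

lemma block_list_Suc:
	"block_list A B (Suc r) = (case pair_colours (if r div 56 < 9 then A else B) (r div 56 mod 9) of
	 (a, b) => gadget_lists a b ! (r mod 56))" by (simp add: block_list_def)

lemma block_list_inner:
	assumes "k < 56" "pair_colours (if e < 9 then A else B) (e mod 9) = (a, b)"
	shows "block_list A B (Suc (e * 56 + k)) = gadget_lists a b ! k"
proof -
	have "(e * 56 + k) div 56 = e" "(e * 56 + k) mod 56 = k" using assms(1) by simp_all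
	then show ?thesis unfolding block_list_Suc by (simp only: assms(2) prod.case)
qed

lemma lattice_lists_inner:
	assumes "(y, x, e) : gadgets S" "k < 56" "gadget_pair F (y, x, e) = (a, b)"
	shows "lattice_lists S F (vtx S (y, x, e) k) = set (gadget_lists a b ! k)"
proof -
	have e: "e < 18" "x < S" using assms(1) by (auto simp: gadgets_def)
	show ?thesis unfolding lattice_lists_def Let_def vtx_inner_decode[OF assms(2) e(1)] site_decode[OF e(2)]
	using block_list_inner[OF assms(2), of e "F y x 0" "F y x 1" a b] assms(3) by simp
qed

lemma hub_decode: "(y, x) : sites S ==> hub S (y, x) div 1009 = y * S + x" by (simp add: hub_def)

lemma lattice_lists_hub: "lattice_lists S F (hub S p) = {1, 2, 3}" using hub_mod[of S p] by (auto simp: lattice_lists_def block_list_def Let_def)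

lemma gadget_edge_lattice:
	assumes "(k, l) : set gadget_edges" "node_ok S g k" "node_ok S g l"
	shows "{vtx S g k, vtx S g l} : lattice_edges S" using assms unfolding lattice_edges_def by blast

lemma node_inner: "g : gadgets S ==> k < 56 ==> node_ok S g k" by (simp add: node_ok_def)

lemma gadget_colouring_iff:
	"gadget_colouring a b f \<longleftrightarrow> (ALL k<56. f k : set (gadget_lists a b ! k)) & (ALL (k, l) : set inner_edges. f k ~= f l)"
	by (auto simp: gadget_colouring_def list_all2_conv_all_nth length_gadget_lists list_all_iff)

lemma inner_edges_edges: "(k, l) : set inner_edges ==> (k, l) : set gadget_edges & k < 56 & l < 56"
	using inner_edges_bound by (auto simp: gadget_edges_def list_all_iff)

text \<open>If the hubs carried the pair of the gadget, its left ends would avoid the first colour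
  and its right ends the second, against \<open>gadget_blocked\<close>.\<close>

lemma gadget_effective:
	assumes c: "colouring {..<S * S * 1009} (lattice_edges S) c" "respects_lists {..<S * S * 1009} c (lattice_lists S F)"
	and g: "g = (y, x, e)" "g : gadgets S" "target g : sites S"
	shows "gadget_pair F g ~= (c (hub S (y, x)), c (hub S (target g)))"
proof
	assume eq: "gadget_pair F g = (c (hub S (y, x)), c (hub S (target g)))"
	let ?a = "c (hub S (y, x))" and ?b = "c (hub S (target g))"
	let ?f = "%k. c (vtx S g k)"
	have edge: "c u ~= c v" if "{u, v} : lattice_edges S" for u v using c(1) that by (auto simp: colouring_def)
	have ends: "node_ok S g 56" "node_ok S g 57" using g by (auto simp: node_ok_def)
	have "?f k : set (gadget_lists ?a ?b ! k)" if "k < 56" for k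
	proof -
	have "vtx S g k < S * S * 1009" using vtx_less[OF node_inner[OF g(2) that]] .
	then have "?f k : lattice_lists S F (vtx S g k)" using c(2) by (auto simp: respects_lists_def)
	then show ?thesis using lattice_lists_inner[of y x e S k F ?a ?b] g eq that by simp
	qed
	moreover have "?f k ~= ?f l" if "(k, l) : set inner_edges" for k l
	using inner_edges_edges[OF that] g(2) by (intro edge gadget_edge_lattice) (auto intro: node_inner)
	ultimately have "gadget_colouring ?a ?b ?f" unfolding gadget_colouring_iff by blast
	moreover have "?f k ~= ?a" if "k : set left_ends" for k
	proof -
	have "(k, 56) : set gadget_edges" using that by (auto simp: gadget_edges_def)
	then have "{vtx S g k, vtx S g 56} : lattice_edges S" using ends node_inner[OF g(2) ends_bound(1)[OF that]] by (intro gadget_edge_lattice)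
	from edge[OF this] show ?thesis by (simp add: g(1) vtx_56)
	qed
	moreover have "?f k ~= ?b" if "k : set right_ends" for k
	proof -
	have "(k, 57) : set gadget_edges" using that by (auto simp: gadget_edges_def)
	then have "{vtx S g k, vtx S g 57} : lattice_edges S" using ends node_inner[OF g(2) ends_bound(2)[OF that]] by (intro gadget_edge_lattice)
	from edge[OF this] show ?thesis by (simp add: vtx_57)
	qed
	ultimately show False using gadget_blocked by blast
qed

text \<open>The nine copies in one direction are numbered by pairs of base 3 digits; this finds the
  copy that is in charge of a given forbidden pair.\<close>

lemma pair_colours_hit:
	assumes "(i, j) : A" "i : {1,2,3}" "j : {1,2,3}"
	shows "pair_colours A ((i - 1) * 3 + (j - 1)) = (i, j)" "(i - 1) * 3 + (j - 1) < 9"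
proof -
	have ij: "1 <= i" "1 <= j" "i - 1 < 3" "j - 1 < 3" using assms(2,3) by auto
	have "((i - 1) * 3 + (j - 1)) div 3 = i - 1" "((i - 1) * 3 + (j - 1)) mod 3 = j - 1" using ij(4) by simp_all
	then show "pair_colours A ((i - 1) * 3 + (j - 1)) = (i, j)" unfolding pair_colours_def using ij(1,2) assms(1) by simp
	show "(i - 1) * 3 + (j - 1) < 9" using ij by linarith
qed

lemma csp_of_colouring:
	assumes c: "colouring {..<S * S * 1009} (lattice_edges S) c" "respects_lists {..<S * S * 1009} c (lattice_lists S F)"
	shows "csp_solution S F (%y x. c (hub S (y, x)))" unfolding csp_solution_def
proof (intro conjI allI impI)
	have range: "c (hub S (y, x)) : {1,2,3}" if "y < S" "x < S" for y x
	proof -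
	have "node_ok S (y, x, 0) 56" using that by (simp add: node_ok_def gadgets_def)
	from vtx_less[OF this] have "hub S (y, x) < S * S * 1009" by (simp add: vtx_56)
	then have "c (hub S (y, x)) : lattice_lists S F (hub S (y, x))" using c(2) unfolding respects_lists_def by blast
	then show ?thesis by (simp only: lattice_lists_hub)
	qed
	then show "c (hub S (y, x)) : {1,2,3}" if "y < S" "x < S" for y x using that by blast
	show "(c (hub S (y, x)), c (hub S (y, Suc x))) \<notin> F y x 0" if "y < S" "Suc x < S" for y x
	proof
	assume f: "(c (hub S (y, x)), c (hub S (y, Suc x))) : F y x 0"
	let ?e = "(c (hub S (y, x)) - 1) * 3 + (c (hub S (y, Suc x)) - 1)"
	have r: "c (hub S (y, x)) : {1,2,3}" "c (hub S (y, Suc x)) : {1,2,3}" using range that Suc_lessD by blast+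
	note h = pair_colours_hit[OF f r]
	have "(y, x, ?e) : gadgets S" "target (y, x, ?e) = (y, Suc x)" "(y, Suc x) : sites S" using that h(2) by (auto simp: gadgets_def sites_def)
	then show False using gadget_effective[OF c refl, of y x ?e] h by simp
	qed
	show "(c (hub S (y, x)), c (hub S (Suc y, x))) \<notin> F y x 1" if "Suc y < S" "x < S" for y x
	proof
	assume f: "(c (hub S (y, x)), c (hub S (Suc y, x))) : F y x 1"
	let ?c = "(c (hub S (y, x)) - 1) * 3 + (c (hub S (Suc y, x)) - 1)"
	let ?e = "9 + ?c"
	have r: "c (hub S (y, x)) : {1,2,3}" "c (hub S (Suc y, x)) : {1,2,3}" using range that Suc_lessD by blast+
	note h = pair_colours_hit[OF f r]
	have "(y, x, ?e) : gadgets S" "target (y, x, ?e) = (Suc y, x)" "(Suc y, x) : sites S" using that h(2) by (auto simp: gadgets_def sites_def)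
	moreover have "gadget_pair F (y, x, ?e) = (c (hub S (y, x)), c (hub S (Suc y, x)))" using h by simp
	ultimately show False using gadget_effective[OF c refl, of y x ?e] by simp
	qed
qed

lemma gadget_filling:
	assumes h: "csp_solution S F h" and g: "(y, x, e) : gadgets S" "gadget_pair F (y, x, e) = (a, b)"
	shows "EX f. gadget_colouring a b f & (ALL k : set left_ends. f k ~= h y x) &
	(ALL y' x'. target (y, x, e) = (y', x') & (y', x') : sites S --> (ALL k : set right_ends. f k ~= h y' x'))"
proof -
	have e: "e < 18" "y < S" "x < S" using g(1) by (auto simp: gadgets_def)
	have r: "h y x : {1,2,3}" if "y < S" "x < S" for y x using h that by (simp add: csp_solution_def)
	have m: "e mod 9 < 9" by simp
	have ab: "a : {1,2,3,7}" "b : {1,2,3,7}" using pair_colours_range[OF m] g(2) by auto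
	obtain y' x' where t: "target (y, x, e) = (y', x')" by (metis surj_pair)
	show ?thesis
	proof (cases "(y', x') : sites S")
	case True
	then have t': "y' < S" "x' < S" by (auto simp: sites_def)
	have *: "(h y x, h y' x') \<notin> (if e < 9 then F y x 0 else F y x 1)"
	proof (cases "e < 9")
		case True
		then have "y' = y" "x' = Suc x" using t by auto
		then show ?thesis using h True t' unfolding csp_solution_def by simp
	next
		case False
		then have "y' = Suc y" "x' = x" using t by auto
		then show ?thesis using h False t' unfolding csp_solution_def by simp
	qed
	have "(a, b) : (if e < 9 then F y x 0 else F y x 1) | (a, b) = (7, 7)"
		using g(2) unfolding gadget_pair.simps pair_colours_def by (metis (full_types))
	moreover have "h y x ~= 7" using r[OF e(2,3)] by auto
	ultimately have "h y x ~= a | h y' x' ~= b" using * by auto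
	then obtain f where "gadget_colouring a b f" "ALL k:set left_ends. f k ~= h y x" "ALL k:set right_ends. f k ~= h y' x'"
		by (rule gadget_extends[OF r[OF e(2,3)] r[OF t'] ab])
	then show ?thesis using t by auto
	next
	case False
	\<comment> \<open>There is no hub at the second end; any colour other than \<open>b\<close> can
	  stand in for one.\<close>
	define j :: nat where "j = (if b = 1 then 2 else 1)"
	have j: "j : {1,2,3}" "h y x ~= a | j ~= b" by (auto simp: j_def)
	obtain f where "gadget_colouring a b f" "ALL k:set left_ends. f k ~= h y x" "ALL k:set right_ends. f k ~= j"
		by (rule gadget_extends[OF r[OF e(2,3)] j(1) ab j(2)])
	then show ?thesis using False t by auto
	qed
qed

lemma colouring_of_csp:
	assumes h: "csp_solution S F h"
	shows "EX c. colouring {..<S * S * 1009} (lattice_edges S) c & respects_lists {..<S * S * 1009} c (lattice_lists S F)"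
proof -
	define P where "P = (%(y, x, e) f. gadget_colouring (fst (gadget_pair F (y, x, e))) (snd (gadget_pair F (y, x, e))) f &
	(ALL k : set left_ends. f k ~= h y x) &
	(ALL y' x'. target (y, x, e) = (y', x') & (y', x') : sites S --> (ALL k : set right_ends. f k ~= h y' x')))"
	have "EX f. P g f" if "g : gadgets S" for g
	proof -
	obtain y x e where ge: "g = (y, x, e)" by (metis prod_cases3)
	from gadget_filling[OF h that[unfolded ge] prod.collapse[symmetric]]
	show ?thesis by (simp add: P_def ge)
	qed
	then obtain f where f: "\<And>g. g : gadgets S ==> P g (f g)" by metis
	\<comment> \<open>This inverts the vertex numbering: in a block, remainder 0 is the hub, and
	  remainder \<open>r\<close> otherwise is vertex \<open>(r - 1) mod 56\<close> of copy
	  \<open>(r - 1) div 56\<close>.\<close>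
	define c where "c = (%v. let y = v div 1009 div S; x = v div 1009 mod S; r = v mod 1009 in
	 if r = 0 then h y x else f (y, x, (r - 1) div 56) ((r - 1) mod 56))"
	have c_hub: "c (hub S (y, x)) = h y x" if "(y, x) : sites S" for y x
	proof -
	have "x < S" using that by (simp add: sites_def)
	then show ?thesis using hub_mod[of S "(y, x)"] hub_decode[OF that] by (simp add: c_def Let_def)
	qed
	have c_inner: "c (vtx S g k) = f g k" if "g : gadgets S" "k < 56" for g k
	proof -
	obtain y x e where ge: "g = (y, x, e)" by (metis prod_cases3)
	have e: "e < 18" "x < S" using that(1) ge by (auto simp: gadgets_def)
	have "(e * 56 + k) div 56 = e" "(e * 56 + k) mod 56 = k" using that(2) by auto
	then show ?thesis using vtx_inner_decode[OF that(2) e(1), of S y x] site_decode[OF e(2), of y] ge by (simp add: c_def Let_def)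
	qed
	have proper: "c (vtx S g k) ~= c (vtx S g l)"
	if "(k, l) : set gadget_edges" "node_ok S g k" "node_ok S g l" for g k l
	proof -
	obtain y x e where ge: "g = (y, x, e)" by (metis prod_cases3)
	have gg: "g : gadgets S" using that(2) by (rule node_gadget)
	have k: "k < 56" using gadget_edge_bounds[OF that(1)] by simp
	note p = f[OF gg, unfolded P_def ge prod.case, folded ge]
	from that(1) show ?thesis
	proof (rule gadget_edge_cases)
		assume l: "l < 56" "(k, l) : set inner_edges"
		then have "f g k ~= f g l" using p unfolding gadget_colouring_iff by blast
		then show ?thesis using c_inner[OF gg] k l(1) by simp
	next
		assume l: "l = 56" "k : set left_ends"
		have "(y, x) : sites S" using gg ge by (simp add: gadgets_def sites_def)
		then have "c (vtx S g l) = h y x" using c_hub l(1) ge by (simp add: vtx_56)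
		moreover have "f g k ~= h y x" using p l(2) by blast
		ultimately show ?thesis using c_inner[OF gg k] by simp
	next
		assume l: "l = 57" "k : set right_ends"
		obtain y' x' where t: "target g = (y', x')" by (metis surj_pair)
		have ts: "(y', x') : sites S" using that(3) l(1) t by (simp add: node_ok_def)
		then have "c (vtx S g l) = h y' x'" using c_hub l(1) t by (simp add: vtx_57)
		moreover have "f g k ~= h y' x'" using p l(2) t ts by blast
		ultimately show ?thesis using c_inner[OF gg k] by simp
	qed
	qed
	have "c u ~= c v" if uv: "{u, v} : lattice_edges S" for u v
	proof -
	obtain g k l where "{u, v} = {vtx S g k, vtx S g l}" "(k, l) : set gadget_edges" "node_ok S g k" "node_ok S g l"
		using uv unfolding lattice_edges_def by blast
	with proper[OF this(2-4)] show ?thesis by (auto simp: doubleton_eq_iff)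
	qed
	moreover have lists: "c v : lattice_lists S F v" if "v < S * S * 1009" for v
	proof -
	define s where "s = v div 1009"
	have "s < S * S" using that by (simp add: s_def div_less_iff_less_mult)
	then have S: "s div S < S" "s mod S < S" "(s div S) * S + s mod S = s"
		using less_mult_imp_div_less[of s S S] by (auto intro!: mod_less_divisor gr0I)
	show ?thesis
	proof (cases "v mod 1009 = 0")
		case True
		then have "c v = h (s div S) (s mod S)" by (simp add: c_def Let_def s_def)
		moreover have "lattice_lists S F v = {1,2,3}" using True by (auto simp: lattice_lists_def block_list_def Let_def)
		ultimately show ?thesis using h S by (simp add: csp_solution_def)
	next
		case False
		define e where "e = (v mod 1009 - 1) div 56"
		define k where "k = (v mod 1009 - 1) mod 56"
		have "v mod 1009 - 1 < 1008" using mod_less_divisor[of 1009 v] False by linarith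
		then have "e < 18" by (simp add: e_def div_less_iff_less_mult)
		then have g: "(s div S, s mod S, e) : gadgets S" using S by (simp add: gadgets_def)
		have k: "k < 56" by (simp add: k_def)
		have "c v = f (s div S, s mod S, e) k" using False by (simp add: c_def Let_def s_def e_def k_def)
		moreover have "lattice_lists S F v =
				set (gadget_lists (fst (gadget_pair F (s div S, s mod S, e))) (snd (gadget_pair F (s div S, s mod S, e))) ! k)"
			using False by (simp add: lattice_lists_def block_list_def Let_def s_def e_def k_def case_prod_beta)
		moreover have "f (s div S, s mod S, e) k : set (gadget_lists (fst (gadget_pair F (s div S, s mod S, e))) (snd (gadget_pair F (s div S, s mod S, e))) ! k)"
			using f[OF g] k unfolding P_def prod.case gadget_colouring_iff by blast
		ultimately show ?thesis by simp
	qed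
	qed
	moreover have "1 <= c v" if "v < S * S * 1009" for v using lists[OF that] lattice_regular(1)[of S F] that by (auto simp: list_assignment_def)
	ultimately have "colouring {..<S * S * 1009} (lattice_edges S) c & respects_lists {..<S * S * 1009} c (lattice_lists S F)"
	by (auto simp: colouring_def respects_lists_def)
	then show ?thesis by blast
qed

lemma lattice_colourable_iff:
	"(S * S * 1009, lattice_edges S, lattice_lists S F) : list_colourable \<longleftrightarrow> (EX h. csp_solution S F h)"
proof
	assume "(S * S * 1009, lattice_edges S, lattice_lists S F) : list_colourable"
	then obtain c where "colouring {..<S * S * 1009} (lattice_edges S) c" "respects_lists {..<S * S * 1009} c (lattice_lists S F)"
	unfolding list_colourable_def by blast
	from csp_of_colouring[OF this] show "EX h. csp_solution S F h" by blast
next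
	assume "EX h. csp_solution S F h"
	then obtain h where "csp_solution S F h" by blast
	from colouring_of_csp[OF this] show "(S * S * 1009, lattice_edges S, lattice_lists S F) : list_colourable" unfolding list_colourable_def by blast
qed

section \<open>Satisfiability as constraint satisfaction on the lattice\<close>

text \<open>Rows of cells are clauses and columns of cells are variables; a cell takes 3 rows and 2 columns of
	sites. A wire \<open>v\<close> carries the value of the variable downwards, a wire \<open>h\<close> (in two copies) the
	information to the right that the clause is already satisfied; colour 1 means true. With \<open>t\<close>, \<open>b\<close>, \<open>l\<close>,
	\<open>r\<close> the values at the four sides of the cell, the crossing site \<open>x\<^sub>1\<close> has the colours 1 (\<open>~ t\<close> and \<open>l\<close>),
	2 (\<open>~ t\<close> and \<open>~ r\<close>) and 3 (idle), and \<open>x\<^sub>2\<close> has the colours 1 (\<open>b\<close> and \<open>l\<close>), 2 (\<open>b\<close> and \<open>~ r\<close>) and 3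
	(idle); one of them is not idle. So \<open>t\<close> implies \<open>b\<close>, and \<open>r\<close> implies \<open>l\<close> except where a literal
	switches off the conditions on \<open>l\<close> and \<open>r\<close>. A wire may therefore change from false to true on its way,
	which is why positive occurrences have to precede the negative ones.\<close>

datatype cell = Blank | Positive | Negative | Source | Sink

text \<open>\<open>(a, b)\<close> is the row and column of a site in its cell, and \<open>d\<close>
  is 0 for the pair with the right neighbour, 1 for the pair with the lower one. Column 0 has the
  two copies of the wire \<open>h\<close> in rows 1 and 2, its row 0 being free; column 1 has the
  wire \<open>v\<close> and below it the two crossing sites. A source makes \<open>h\<close> leave
  untrue, a sink requires it to arrive true.\<close>

definition cell_forbidden :: "cell => nat => nat => nat => (nat \<times> nat) set" where
	"cell_forbidden t a b d =
	 (if (a, b, d) = (0, 1, 1) then {(1, 1), (1, 2)}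
		else if (a, b, d) = (1, 0, 0) then
			(if t = Negative then {} else if t = Sink then {2, 3} \<times> {1, 2, 3} else {2, 3} \<times> {1})
		else if (a, b, d) = (1, 1, 0) then
			(if t = Negative then {} else if t = Source then {1, 2, 3} \<times> {1} else {(2, 1)})
		else if (a, b, d) = (2, 0, 0) then (if t = Positive then {} else {2, 3} \<times> {1})
		else if (a, b, d) = (2, 1, 0) then (if t = Positive then {} else {(2, 1)})
		else if (a, b, d) = (2, 1, 1) then {1, 2} \<times> {2, 3}
		else if (a, b, d) = (1, 1, 1) then {(3, 3)}
		else if (a, b, d) = (1, 0, 1) then {(1, 2), (1, 3), (2, 1), (3, 1)}
		else {})"

definition cell_grid :: "(nat => nat => cell) => constraint_grid" where
	"cell_grid c y x d = cell_forbidden (c (y div 3) (x div 2)) (y mod 3) (x mod 2) d"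

definition literal_holds :: "(nat => bool) => (nat => nat => cell) => nat => nat => bool" where
	"literal_holds \<sigma> c i j \<longleftrightarrow> c i j = Positive & \<sigma> j | c i j = Negative & ~ \<sigma> j"

lemma cell_arith:
	fixes i j a b :: nat
	shows "a < 3 ==> (3 * i + a) div 3 = i" "a < 3 ==> (3 * i + a) mod 3 = a"
	"b < 2 ==> (2 * j + b) div 2 = j" "b < 2 ==> (2 * j + b) mod 2 = b" by auto

lemma cell_grid_at:
	"a < 3 ==> b < 2 ==> cell_grid c (3 * i + a) (2 * j + b) d = cell_forbidden (c i j) a b d" by (simp only: cell_grid_def cell_arith)

text \<open>A variable counts as true if its wire is true just below some positive cell. Since true
  wires stay true and positive cells come first, a negative cell entered by a wire that is not true
  shows that its variable is false in this sense.\<close>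

lemma csp_satisfies:
	assumes S: "S = 3 * R" "S = 2 * C" and C: "0 < C"
	and ord: "\<And>i i' j. i < R ==> i' < R ==> j < C ==> c i j = Positive ==> c i' j = Negative ==> i < i'"
	and src: "\<And>i. i < R ==> c i 0 = Source" and snk: "\<And>i. i < R ==> c i (C - 1) = Sink"
	and h: "csp_solution S (cell_grid c) h"
	shows "EX \<sigma>. ALL i<R. EX j<C. literal_holds \<sigma> c i j"
proof -
	define v where "v i j = h (3 * i + 0) (2 * j + 1)" for i j
	define x1 where "x1 i j = h (3 * i + 1) (2 * j + 1)" for i j
	define x2 where "x2 i j = h (3 * i + 2) (2 * j + 1)" for i j
	define h1 where "h1 i j = h (3 * i + 1) (2 * j + 0)" for i j
	define h2 where "h2 i j = h (3 * i + 2) (2 * j + 0)" for i j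
	\<comment> \<open>The value that leaves the cell downwards. Below the last row there is no wire,
	  and the condition holds vacuously.\<close>
	define b where "b i j \<longleftrightarrow> (Suc i < R --> v (Suc i) j = 1)" for i j
	have range: "h y x : {1, 2, 3}" if "y < S" "x < S" for y x using h that by (simp add: csp_solution_def)
	have right: "(h (3 * i + a) (2 * j + b'), h (3 * i + a) (Suc (2 * j + b'))) \<notin> cell_forbidden (c i j) a b' 0"
	if "a < 3" "b' < 2" "i < R" "Suc (2 * j + b') < S" for i j a b'
	proof -
	have "3 * i + a < S" using that S by linarith
	then have "(h (3 * i + a) (2 * j + b'), h (3 * i + a) (Suc (2 * j + b'))) \<notin> cell_grid c (3 * i + a) (2 * j + b') 0"
		using h that by (simp add: csp_solution_def)
	then show ?thesis unfolding cell_grid_at[OF that(1,2)] .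
	qed
	have down: "(h (3 * i + a) (2 * j + b'), h (Suc (3 * i + a)) (2 * j + b')) \<notin> cell_forbidden (c i j) a b' 1"
	if "a < 3" "b' < 2" "j < C" "Suc (3 * i + a) < S" for i j a b'
	proof -
	have "2 * j + b' < S" using that S by linarith
	then have "(h (3 * i + a) (2 * j + b'), h (Suc (3 * i + a)) (2 * j + b')) \<notin> cell_grid c (3 * i + a) (2 * j + b') 1"
		using h that by (simp add: csp_solution_def)
	then show ?thesis unfolding cell_grid_at[OF that(1,2)] .
	qed
	have rng: "v i j : {1,2,3}" "x1 i j : {1,2,3}" "x2 i j : {1,2,3}" "h1 i j : {1,2,3}" "h2 i j : {1,2,3}"
	if "i < R" "j < C" for i j unfolding v_def x1_def x2_def h1_def h2_def by (rule range; use that S in linarith)+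
	have cell: "(v i j = 1 --> b i j) &
		(Suc j < C & h1 i (Suc j) = 1 --> h1 i j = 1 | c i j = Positive & b i j | c i j = Negative & v i j ~= 1)"
	if ij: "i < R" "j < C" for i j
	proof -
	have c1: "(v i j, x1 i j) \<notin> {(1, 1), (1, 2)}" using down[of 0 1 j i] ij S by (simp add: cell_forbidden_def v_def x1_def)
	have c2: "(x1 i j, x2 i j) ~= (3, 3)" using down[of 1 1 j i] ij S by (simp add: cell_forbidden_def x1_def x2_def)
	have c3: "b i j" if "x2 i j ~= 3"
	proof -
		have "v (Suc i) j = 1" if i: "Suc i < R"
		proof -
			have e: "Suc (3 * i + 2) = 3 * Suc i + 0" by simp
			have "Suc (3 * i + 2) < S" using i S by linarith
			then have "(x2 i j, v (Suc i) j) \<notin> {1, 2} \<times> {2, 3}"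
				using down[of 2 1 j i] ij unfolding e by (simp add: cell_forbidden_def v_def x2_def)
			then show ?thesis using rng[OF i ij(2)] rng[OF ij] \<open>x2 i j ~= 3\<close> by auto
		qed
		then show ?thesis by (simp add: b_def)
	qed
	have c4: "(h1 i j, h2 i j) \<notin> {(1, 2), (1, 3), (2, 1), (3, 1)}" using down[of 1 0 j i] ij S by (simp add: cell_forbidden_def h1_def h2_def)
	have c5: "c i j ~= Negative ==> x1 i j = 1 ==> h1 i j = 1" using right[of 1 0 i j] ij S rng[OF ij]
		by (cases "c i j") (auto simp: cell_forbidden_def h1_def x1_def)
	have c6: "c i j ~= Positive ==> x2 i j = 1 ==> h2 i j = 1" using right[of 2 0 i j] ij S rng[OF ij]
		by (cases "c i j") (auto simp: cell_forbidden_def h2_def x2_def)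
	have tb: "v i j = 1 --> b i j" using c1 c2 c3 rng[OF ij] by auto
	have "h1 i j = 1 | c i j = Positive & b i j | c i j = Negative & v i j ~= 1"
		if j: "Suc j < C" and r: "h1 i (Suc j) = 1"
	proof -
		have e: "Suc (2 * j + 1) = 2 * Suc j + 0" by simp
		have l: "Suc (2 * j + 1) < S" using j S by linarith
		have c4': "h2 i (Suc j) = 1" using down[of 1 0 "Suc j" i] ij j S r rng[OF ij(1) j] by (auto simp: cell_forbidden_def h1_def h2_def)
		have c7: "c i j ~= Negative ==> x1 i j ~= 2" using right[of 1 1 i j] ij l r unfolding e
			by (cases "c i j") (auto simp: cell_forbidden_def h1_def x1_def)
		have c8: "c i j ~= Positive ==> x2 i j ~= 2" using right[of 2 1 i j] ij l c4' unfolding e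
			by (cases "c i j") (auto simp: cell_forbidden_def h2_def x2_def)
		show ?thesis
		proof (cases "x2 i j = 3")
			case True
			then have "x1 i j ~= 3" using c2 by simp
			then show ?thesis using c1 c5 c7 rng[OF ij] by auto
		next
			case False
			then show ?thesis using c3 c4 c6 c8 rng[OF ij] by auto
		qed
	qed
	with tb show ?thesis by blast
	qed
	have row: "EX j<C. c i j = Positive & b i j | c i j = Negative & v i j ~= 1" if i: "i < R" for i
	proof (rule ccontr)
	assume no: "~ ?thesis"
	have "2 * 0 + 1 < S" using S C by linarith
	have "h1 i j ~= 1" if "0 < j" "j < C" for j using that
	proof (induction j)
		case (Suc j)
		show ?case
		proof (cases "j = 0")
			case True
			have e: "Suc (2 * 0 + 1) = 2 * Suc 0 + (0::nat)" by simp
			have "Suc (2 * 0 + 1) < S" using Suc.prems S True by linarith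
			then have "(x1 i 0, h1 i (Suc 0)) \<notin> {1,2,3} \<times> {1}"
				using right[of 1 1 i 0] i src[OF i] unfolding e by (simp add: cell_forbidden_def x1_def h1_def)
			then show ?thesis using rng[OF i C] True by auto
		next
			case False
			then show ?thesis using Suc cell[OF i, of j] no by auto
		qed
	qed simp
	moreover have "h1 i (C - 1) = 1"
	proof -
		have "(h1 i (C - 1), x1 i (C - 1)) \<notin> {2, 3} \<times> {1, 2, 3}"
			using right[of 1 0 i "C - 1"] i C S snk[OF i] by (simp add: cell_forbidden_def x1_def h1_def)
		then show ?thesis using rng[OF i, of "C - 1"] C by auto
	qed
	moreover have "C - 1 ~= 0" using src[OF i] snk[OF i] by auto
	ultimately show False using C by auto
	qed
	have mono: "v i' j = 1" if "b i j" "i < i'" "i' < R" "j < C" for i i' j using that(2,3)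
	proof (induction i')
	case (Suc k)
	show ?case
	proof (cases "k = i")
		case True then show ?thesis using that(1) Suc by (simp add: b_def)
	next
		case False
		then have "v k j = 1" using Suc by simp
		then have "b k j" using cell[of k j] Suc that by simp
		then show ?thesis using Suc by (simp add: b_def)
	qed
	qed simp
	let ?\<sigma> = "%j. EX i<R. c i j = Positive & b i j"
	have "EX j<C. literal_holds ?\<sigma> c i j" if i: "i < R" for i
	proof -
	obtain j where j: "j < C" "c i j = Positive & b i j | c i j = Negative & v i j ~= 1" using row[OF i] by blast
	have "~ ?\<sigma> j" if n: "c i j = Negative" "v i j ~= 1"
	proof
		assume "?\<sigma> j"
		then obtain i' where i': "i' < R" "c i' j = Positive" "b i' j" by blast
		show False using mono[OF i'(3) ord[OF i'(1) i j(1) i'(2) n(1)] i j(1)] n(2) by blast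
	qed
	then show ?thesis using j i unfolding literal_holds_def by blast
	qed
	then show ?thesis by blast
qed

lemma satisfies_csp:
	assumes S: "S = 3 * R" "S = 2 * C" and C: "0 < C"
	and src: "\<And>i. i < R ==> c i 0 = Source" and snk: "\<And>i. i < R ==> c i (C - 1) = Sink"
	and only: "\<And>i j. i < R ==> j < C ==> (c i j = Source --> j = 0) & (c i j = Sink --> j = C - 1)"
	and sat: "\<And>i. i < R ==> EX j<C. literal_holds \<sigma> c i j"
	shows "EX h. csp_solution S (cell_grid c) h"
proof -
	define l where "l i j \<longleftrightarrow> (EX j'<j. literal_holds \<sigma> c i j')" for i j
	\<comment> \<open>Columns carry their value unchanged, and rows carry whether some literal further
	  left holds. Of the two crossing sites exactly one idles: the upper one if the variable is true,
	  the lower one if it is false.\<close>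
	define k where "k i j a b = (if b = 0 then (if l i j then 1 else 2)
		else if a = 0 then (if \<sigma> j then 1 else 2)
		else if a = 1 then (if \<sigma> j then 3 else if l i j then 1 else 2)
		else (if ~ \<sigma> j then 3 else if l i j then 1 else (2::nat)))" for i j a b :: nat
	define h where "h y x = k (y div 3) (x div 2) (y mod 3) (x mod 2)" for y x
	have l_Suc: "l i (Suc j) \<longleftrightarrow> l i j | literal_holds \<sigma> c i j" for i j unfolding l_def less_Suc_eq by blast
	have l0: "~ l i 0" for i by (simp add: l_def)
	have l_last: "l i (C - 1)" if i: "i < R" for i
	proof -
	obtain j where j: "j < C" "literal_holds \<sigma> c i j" using sat[OF i] by blast
	then have "j ~= C - 1" using snk[OF i] by (auto simp: literal_holds_def)
	then have "j < C - 1" using j(1) by linarith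
	then show ?thesis using j(2) unfolding l_def by blast
	qed
	have "csp_solution S (cell_grid c) h" unfolding csp_solution_def
	proof (intro conjI allI impI)
	fix y x show "h y x : {1, 2, 3}" by (simp add: h_def k_def)
	next
	fix y x assume yx: "y < S" "Suc x < S"
	define i a j b where d: "i = y div 3" "a = y mod 3" "j = x div 2" "b = x mod 2"
	have i: "i < R" "j < C" using yx S by (auto simp: d)
	have a: "a = 0 | a = 1 | a = 2" unfolding d by linarith
	have "b = 0 & Suc x div 2 = j & Suc x mod 2 = 1 | b = 1 & Suc x div 2 = Suc j & Suc x mod 2 = 0" unfolding d by presburger
	then show "(h y x, h y (Suc x)) \<notin> cell_grid c y x 0"
	proof (elim disjE conjE)
		assume 1: "b = 0" "Suc x div 2 = j" "Suc x mod 2 = 1"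
		have "(k i j a 0, k i j a 1) \<notin> cell_forbidden (c i j) a 0 0" using a l_last[OF i(1)] only[OF i] by (auto simp: k_def cell_forbidden_def)
		then show ?thesis using 1 by (simp add: cell_grid_def h_def d[symmetric])
	next
		assume 2: "b = 1" "Suc x div 2 = Suc j" "Suc x mod 2 = 0"
		have "(k i j a 1, k i (Suc j) a 0) \<notin> cell_forbidden (c i j) a 1 0" using a l0[of i] only[OF i] l_Suc[of i j]
			by (auto simp: k_def cell_forbidden_def literal_holds_def split: if_splits)
		then show ?thesis using 2 by (simp add: cell_grid_def h_def d[symmetric])
	qed
	next
	fix y x assume yx: "Suc y < S" "x < S"
	define i a j b where d: "i = y div 3" "a = y mod 3" "j = x div 2" "b = x mod 2"
	have b: "b = 0 | b = 1" unfolding d by linarith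
	have "a = 0 & Suc y div 3 = i & Suc y mod 3 = 1 | a = 1 & Suc y div 3 = i & Suc y mod 3 = 2
		| a = 2 & Suc y div 3 = Suc i & Suc y mod 3 = 0" unfolding d by presburger
	then show "(h y x, h (Suc y) x) \<notin> cell_grid c y x 1"
	proof (elim disjE conjE)
		assume 1: "a = 0" "Suc y div 3 = i" "Suc y mod 3 = 1"
		have "(k i j 0 b, k i j 1 b) \<notin> cell_forbidden (c i j) 0 b 1" using b by (auto simp: k_def cell_forbidden_def)
		then show ?thesis using 1 by (simp add: cell_grid_def h_def d[symmetric])
	next
		assume 2: "a = 1" "Suc y div 3 = i" "Suc y mod 3 = 2"
		have "(k i j 1 b, k i j 2 b) \<notin> cell_forbidden (c i j) 1 b 1" using b by (auto simp: k_def cell_forbidden_def)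
		then show ?thesis using 2 by (simp add: cell_grid_def h_def d[symmetric])
	next
		assume 3: "a = 2" "Suc y div 3 = Suc i" "Suc y mod 3 = 0"
		have "(k i j 2 b, k (Suc i) j 0 b) \<notin> cell_forbidden (c i j) 2 b 1" using b by (auto simp: k_def cell_forbidden_def)
		then show ?thesis using 3 by (simp add: cell_grid_def h_def d[symmetric])
	qed
	qed
	then show ?thesis by blast
qed

section \<open>Computations as clauses\<close>

text \<open>Variables live at positions \<open>(tt, p)\<close> of a square of side \<open>2 * N + 1\<close>; \<open>p\<close> stands for the cell
	\<open>p - N\<close>. The configuration at time \<open>s\<close> is described at \<open>tt = 1 + 2 * s\<close> by \<open>VS False i a\<close> (tape \<open>i\<close> has
	symbol \<open>a\<close> in the cell), \<open>VP False i z\<close> (the head of tape \<open>i\<close> is to the left of, at, or to the right of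
	the cell for \<open>z = 0, 1, 2\<close>) and \<open>VQ False q\<close> (the state, kept at \<open>p = 0\<close>), and once more at
	\<open>tt = 2 + 2 * s\<close> with \<open>True\<close> in place of \<open>False\<close>, where in addition \<open>VR i a\<close> holds for the symbol \<open>a\<close> read
	on tape \<open>i\<close>. At \<open>tt = 0\<close>, \<open>VE\<close> marks the cells behind the end of the certificate. All clauses but the
	one on the certificate are Horn clauses.\<close>

datatype var = VT | VE | VS bool nat nat | VP bool nat nat | VQ bool nat | VR nat nat

datatype loc = Here | Before | First

type_synonym clause = "(var \<times> loc) list \<times> (var \<times> nat \<times> loc) list"

fun locp :: "loc => nat => nat" where
	"locp Here p = p"
| "locp Before p = p - 1"
| "locp First p = 0"

definition clause_sat :: "(nat => nat => var => bool) => nat => nat => clause => bool" where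
	"clause_sat \<sigma> tt p c \<longleftrightarrow> (ALL (v, l) : set (fst c). \<sigma> tt (locp l p) v) -->
	 (EX (v, d, l) : set (snd c). \<sigma> (tt + d) (locp l p) v)"

definition filler :: clause where
	"filler = ([], [(VT, 0, Here)])"

text \<open>Where certificate symbols are allowed (\<open>qm = 1\<close>), the list begins with
  exactly three clauses on \<open>VE\<close>. The centre is the first such cell and has no
  predecessor; the filler there keeps the indices 0, 1, 2 of these clauses fixed, on which the
  ordering of the occurrences of \<open>VE\<close> relies.\<close>

definition init_clauses :: "nat => nat => nat => nat => clause list" where
	"init_clauses k b xs qm =
	 (if qm = 1 then
			[([], [(VE, 0, Here), (VS False 1 1, 1, Here), (VS False 1 2, 1, Here)]),
			 (if b = 1 then filler else ([(VE, Before)], [(VE, 0, Here)])),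
			 ([(VE, Here)], [(VS False 1 0, 1, Here)])]
		else [([], [(VS False 1 0, 1, Here)])]) @
	 [([], [(VQ False 0, 1, First)]), ([], [(VS False 0 xs, 1, Here)])] @
	 map (%i. ([], [(VS False i 0, 1, Here)])) [2..<k] @
	 map (%i. ([], [(VP False i (if b = 1 then 1 else if b = 3 | b = 5 then 0 else 2), 1, Here)])) [0..<k]"

text \<open>The symbol read on a tape is known only at the position of its head, while the action
  must be known everywhere. It is therefore first reported to position 0, and the second copy of the
  configuration bridges the half step that this takes.\<close>

definition copy_clauses :: "tm => clause list" where
	"copy_clauses M =
	 concat (map (%i.
		 concat (map (%a. [([(VS False i a, Here)], [(VS True i a, 1, Here)]),
												 ([(VP False i 1, Here), (VS False i a, Here)], [(VR i a, 1, First)])]) [0..<symbols M]) @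
		 map (%z. ([(VP False i z, Here)], [(VP True i z, 1, Here)])) [0, 1, 2]) [0..<tapes M]) @
	 map (%q. ([(VQ False q, First)], [(VQ True q, 1, First)])) [0..<Suc (states M)]"

text \<open>A neutral action for the halting state, so that the clauses for a step apply to it too
  and a halted configuration persists.\<close>

definition act_of :: "tm => nat => nat list => nat \<times> (nat \<times> move) list" where
	"act_of M q ss = (if q < states M then delta M q ss else (q, map (%s. (s, Stay)) ss))"

definition status :: "int => int => nat" where
	"status h z = (if h < z then 0 else if h = z then 1 else 2)"

text \<open>A head moves by at most one cell. So a head left of \<open>p - 1\<close> is afterwards
  still left of \<open>p\<close>, and a head right of \<open>p\<close> is still right of
  \<open>p - 1\<close>; only the head's own cell and its two neighbours need the direction of the
  move. Clauses that speak of the previous position are omitted at the first one, where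
  \<open>locp Before\<close> would be truncated to 0.\<close>

definition tape_clauses :: "nat => nat => nat => nat \<times> move => ((var \<times> loc) list \<times> (var \<times> nat \<times> loc)) list" where
	"tape_clauses G b i sd = (let (s, d) = sd in
	 [([(VP True i 1, Here)], (VS False i s, 1, Here)),
		([(VP True i 1, Here)], (VP False i (status (offset d) 0), 1, Here))] @
	 concat (map (%a. [([(VP True i 0, Here), (VS True i a, Here)], (VS False i a, 1, Here)),
											 ([(VP True i 2, Here), (VS True i a, Here)], (VS False i a, 1, Here))]) [0..<G]) @
	 (if b = 4 then []
		else [([(VP True i 0, Before)], (VP False i 0, 1, Here)),
					([(VP True i 2, Here)], (VP False i 2, 1, Before)),
					([(VP True i 1, Here)], (VP False i (status (offset d) (- 1)), 1, Before)),
					([(VP True i 1, Before)], (VP False i (status (offset d) 1), 1, Here))]))"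

definition act_premises :: "tm => nat => nat list => (var \<times> loc) list" where
	"act_premises M q ss = (VQ True q, First) # map (%i. (VR i (ss ! i), First)) [0..<tapes M]"

definition act_clauses :: "tm => nat => clause list" where
	"act_clauses M b =
	 concat (map (%q. concat (map (%ss.
		 map (%(ps, c). (act_premises M q ss @ ps, [c]))
			 (([], (VQ False (fst (act_of M q ss)), 1, First)) #
				concat (map (%i. tape_clauses (symbols M) b i (snd (act_of M q ss) ! i)) [0..<tapes M])))
		 (List.n_lists (tapes M) [0..<symbols M]))) [0..<Suc (states M)])"

text \<open>The numbers \<open>a\<close> and \<open>b\<close> tell whether \<open>tt\<close> and \<open>p\<close> are first (4), last (5), central (1), or
	before (2) or behind (3) the centre; \<open>xs\<close> is the input symbol in the cell.\<close>

definition clauses :: "tm => nat => nat => nat => nat => clause list" where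
	"clauses M a b xs qm =
	 (if a = 4 then init_clauses (tapes M) b xs qm else []) @
	 (if a = 5 then [] else copy_clauses M @ act_clauses M b) @
	 (if b = 1 then [([(VQ False (states M), First), (VS False 0 1, Here)], [])] else [])"

text \<open>The values inside the square are nonzero and hence not blank: a tape that bears the
  zones delimits a loop over the positions.\<close>

definition zone :: "nat => nat => nat" where
	"zone N k = (if k = 0 then 4 else if k < N then 2 else if k = N then 1 else if k < 2 * N then 3
	 else if k = 2 * N then 5 else 0)"

lemma in_concat_map: "y : set (concat (map f xs)) \<longleftrightarrow> (EX x : set xs. y : set (f x))" by simp

lemma in_map: "y : set (map f xs) \<longleftrightarrow> (EX x : set xs. y = f x)" by auto

locale computation =
	fixes M :: tm and x u :: "bool list" and N Q :: nat
	assumes wf: "wf_tm M" and two: "2 <= tapes M" and N: "1 < N" and Q: "Q <= N"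
begin

definition conf :: "nat => config" where
	"conf s = (step M ^^ s) (init_config M [x, u])"

definition state :: "nat => nat" where "state s = fst (conf s)"
definition cell :: "nat => nat => int => nat" where "cell s i = fst (snd (conf s) ! i)"
definition head :: "nat => nat => int" where "head s i = snd (snd (conf s) ! i)"
definition scanned :: "nat => nat list" where
	"scanned s = map (%i. cell s i (head s i)) [0..<tapes M]"
abbreviation act :: "nat => nat \<times> (nat \<times> move) list" where
	"act s \<equiv> act_of M (state s) (scanned s)"

lemma act_of_ok:
	assumes "q <= states M" "length ss = tapes M" "set ss \<subseteq> {..<symbols M}"
	shows "fst (act_of M q ss) <= states M" "length (snd (act_of M q ss)) = tapes M"
	"i < tapes M ==> fst (snd (act_of M q ss) ! i) < symbols M"
proof -
	have "fst (act_of M q ss) <= states M & length (snd (act_of M q ss)) = tapes M &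
		fst ` set (snd (act_of M q ss)) \<subseteq> {..<symbols M}"
	proof (cases "q < states M")
	case True
	note w = wf[unfolded wf_tm_def, THEN conjunct2, THEN conjunct2, rule_format, OF True conjI[OF assms(2,3)]]
	obtain q' acts where "delta M q ss = (q', acts)" by (metis surj_pair)
	then show ?thesis using w True by (simp add: act_of_def)
	next
	case False
	then show ?thesis using assms by (auto simp: act_of_def)
	qed
	then show "fst (act_of M q ss) <= states M" and l: "length (snd (act_of M q ss)) = tapes M"
	and "i < tapes M ==> fst (snd (act_of M q ss) ! i) < symbols M"
	using nth_mem[of i "snd (act_of M q ss)"] by (simp, simp, metis image_subset_iff lessThan_iff)
qed

lemma conf_Suc: "conf (Suc s) = step M (conf s)" by (simp add: conf_def)

lemma map2_stay: "map2 act_tape (map (%s. (s, Stay)) (map read_tape ts)) ts = ts" by (induction ts) auto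

lemma step_act: "length ts = tapes M ==> step M (q, ts) =
	(fst (act_of M q (map read_tape ts)), map2 act_tape (snd (act_of M q (map read_tape ts))) ts)"
	by (cases "q < states M") (simp_all add: act_of_def case_prod_beta map2_stay del: map_map)

lemma scanned_read:
	assumes "length (snd (conf s)) = tapes M"
	shows "scanned s = map read_tape (snd (conf s))"
proof (rule nth_equalityI)
	show "length (scanned s) = length (map read_tape (snd (conf s)))" using assms by (simp add: scanned_def)
	fix i assume "i < length (scanned s)"
	then have i: "i < tapes M" by (simp add: scanned_def)
	obtain t h where "snd (conf s) ! i = (t, h)" by (metis surj_pair)
	then show "scanned s ! i = map read_tape (snd (conf s)) ! i" using i assms by (simp add: scanned_def cell_def head_def)
qed

lemma conf_length: "length (snd (conf s)) = tapes M & state s <= states M &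
	(ALL i<tapes M. \<bar>head s i\<bar> <= int s & (ALL z. cell s i z < symbols M))"
proof (induction s)
	case 0
	have "3 <= symbols M" using wf by (simp add: wf_tm_def)
	then have "fst (word_tape w) z < symbols M" "snd (word_tape w) = 0" for w z by (auto simp: word_tape_def bit_symbol_def)
	then show ?case by (simp add: conf_def init_config_def state_def head_def cell_def)
next
	case (Suc s)
	obtain q ts where c: "conf s = (q, ts)" by (metis surj_pair)
	have len: "length ts = tapes M" "q <= states M" using Suc c by (auto simp: state_def)
	have sc: "map read_tape ts = scanned s" using scanned_read[of s] Suc c by simp
	have sym: "set (scanned s) \<subseteq> {..<symbols M}" using Suc by (auto simp: scanned_def)
	have l: "length (scanned s) = tapes M" by (simp add: scanned_def)
	note ok = act_of_ok[OF len(2) l sym]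
	have cS: "conf (Suc s) = (fst (act_of M q (scanned s)), map2 act_tape (snd (act_of M q (scanned s))) ts)"
	unfolding conf_Suc c step_act[OF len(1)] sc ..
	have "\<bar>head (Suc s) i\<bar> <= int (Suc s) & (ALL z. cell (Suc s) i z < symbols M)" if i: "i < tapes M" for i
	proof -
	obtain t h where th: "ts ! i = (t, h)" by (metis surj_pair)
	obtain a d where ad: "snd (act_of M q (scanned s)) ! i = (a, d)" by (metis surj_pair)
	have "snd (conf (Suc s)) ! i = (t(h := a), h + offset d)" using i len ok(2) th ad by (simp add: cS)
	moreover have "\<bar>h\<bar> <= int s" "ALL z. t z < symbols M" using Suc i c th by (auto simp: head_def cell_def)
	moreover have "a < symbols M" using ok(3)[OF i] ad by simp
	moreover have "\<bar>offset d\<bar> <= 1" by (cases d) auto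
	ultimately show ?thesis by (simp add: head_def cell_def)
	qed
	then show ?case using ok(1,2) len cS by (simp add: state_def)
qed

lemma cell_less: "i < tapes M ==> cell s i z < symbols M"
	and head_bound: "i < tapes M ==> \<bar>head s i\<bar> <= int s"
	and state_le: "state s <= states M" using conf_length[of s] by auto

lemma scanned_ok: "length (scanned s) = tapes M" "set (scanned s) \<subseteq> {..<symbols M}" using cell_less by (auto simp: scanned_def)

lemmas act_ok = act_of_ok[OF state_le scanned_ok]

lemma next_conf:
	shows "state (Suc s) = fst (act s)"
	and "i < tapes M ==> cell (Suc s) i z = (if z = head s i then fst (snd (act s) ! i) else cell s i z)"
	and "i < tapes M ==> head (Suc s) i = head s i + offset (snd (snd (act s) ! i))"
proof -
	obtain q ts where c: "conf s = (q, ts)" by (metis surj_pair)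
	have len: "length ts = tapes M" using conf_length[of s] c by auto
	have q: "state s = q" by (simp add: state_def c)
	have cS: "conf (Suc s) = (fst (act s), map2 act_tape (snd (act s)) ts)"
	unfolding conf_Suc c step_act[OF len] using scanned_read[of s] len c q by simp
	show "state (Suc s) = fst (act s)" by (simp add: state_def cS)
	assume i: "i < tapes M"
	obtain t h where th: "ts ! i = (t, h)" by (metis surj_pair)
	obtain a d where ad: "snd (act s) ! i = (a, d)" by (metis surj_pair)
	have "snd (conf (Suc s)) ! i = (t(h := a), h + offset d)" using i len act_ok(2) th ad by (simp add: cS)
	moreover have "cell s i = t" "head s i = h" using c th by (simp_all add: cell_def head_def)
	ultimately show "cell (Suc s) i z = (if z = head s i then fst (snd (act s) ! i) else cell s i z)"
	"head (Suc s) i = head s i + offset (snd (snd (act s) ! i))" using ad by (auto simp: cell_def[of "Suc s"] head_def[of "Suc s"])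
qed

lemma first_conf:
	"state 0 = 0" "i < tapes M ==> head 0 i = 0" "cell 0 0 = fst (word_tape x)" "cell 0 1 = fst (word_tape u)"
	"2 <= i ==> i < tapes M ==> cell 0 i z = 0" using two by (auto simp: conf_def init_config_def state_def head_def cell_def word_tape_def)

definition pos :: "nat => int" where "pos p = int p - int N"
definition xsym :: "nat => nat" where "xsym p = fst (word_tape x) (pos p)"
definition qmark :: "nat => nat" where "qmark p = (if N <= p & p < N + Q then 1 else 0)"

definition fact :: "nat => nat => var => bool" where
	"fact s p v = (case v of
		 VS b i a => i < tapes M & cell s i (pos p) = a
	 | VP b i z => i < tapes M & status (head s i) (pos p) = z
	 | VQ b q => p = 0 & state s = q
	 | VR i a => p = 0 & i < tapes M & cell s i (head s i) = a
	 | _ => False)"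

text \<open>\<open>VR\<close> belongs to the second half step. \<open>VT\<close> and
  \<open>VE\<close> have no facts of their own and are handled separately in
  \<open>actual\<close>.\<close>

fun primed :: "var => bool" where
	"primed (VS b i a) = b"
| "primed (VP b i z) = b"
| "primed (VQ b q) = b"
| "primed v = True"

section \<open>The assignment given by an accepting computation satisfies the clauses\<close>

definition actual :: "nat => nat => var => bool" where
	"actual tt p v \<longleftrightarrow> v = VT | v = VE & tt = 0 & qmark p = 1 & fst (word_tape u) (pos p) = 0 |
	 (EX s. tt = (if primed v then 2 + 2 * s else 1 + 2 * s) & fact s p v)"

lemma actual_simps:
	"actual tt p (VS False i a) \<longleftrightarrow> (EX s. tt = 1 + 2 * s & i < tapes M & cell s i (pos p) = a)"
	"actual tt p (VS True i a) \<longleftrightarrow> (EX s. tt = 2 + 2 * s & i < tapes M & cell s i (pos p) = a)"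
	"actual tt p (VP False i z) \<longleftrightarrow> (EX s. tt = 1 + 2 * s & i < tapes M & status (head s i) (pos p) = z)"
	"actual tt p (VP True i z) \<longleftrightarrow> (EX s. tt = 2 + 2 * s & i < tapes M & status (head s i) (pos p) = z)"
	"actual tt p (VQ False q) \<longleftrightarrow> (EX s. tt = 1 + 2 * s & p = 0 & state s = q)"
	"actual tt p (VQ True q) \<longleftrightarrow> (EX s. tt = 2 + 2 * s & p = 0 & state s = q)"
	"actual tt p (VR i a) \<longleftrightarrow> (EX s. tt = 2 + 2 * s & p = 0 & i < tapes M & cell s i (head s i) = a)"
	"actual tt p VE \<longleftrightarrow> tt = 0 & qmark p = 1 & fst (word_tape u) (pos p) = 0"
	"actual tt p VT" by (simp_all add: actual_def fact_def)

lemma actual_at: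
	"~ primed v ==> actual (1 + 2 * s) p v \<longleftrightarrow> fact s p v"
	"primed v ==> v ~= VT ==> v ~= VE ==> actual (2 + 2 * s) p v \<longleftrightarrow> fact s p v" by (auto simp: actual_def)

lemma zone_simps:
	assumes "p <= 2 * N"
	shows "zone N p = 4 \<longleftrightarrow> p = 0" "zone N p = 5 \<longleftrightarrow> p = 2 * N" "zone N p = 1 \<longleftrightarrow> p = N"
	"zone N p = 3 | zone N p = 5 \<longleftrightarrow> N < p" using assms N by (auto simp: zone_def)

lemma blank_iff: "fst (word_tape w) z = 0 \<longleftrightarrow> ~ (0 <= z & z < int (length w))" by (simp add: word_tape_def bit_symbol_def)

lemma word_tape_cases: "fst (word_tape w) z = 0 | fst (word_tape w) z = 1 | fst (word_tape w) z = 2" by (simp add: word_tape_def bit_symbol_def)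

lemma qmark_iff: "qmark p = 1 \<longleftrightarrow> 0 <= pos p & pos p < int Q" by (auto simp: qmark_def pos_def)

lemma actual_one: "~ primed v ==> actual (0 + 1) p v \<longleftrightarrow> fact 0 p v" using actual_at(1)[of v 0 p] by simp

lemma fact_cert: "fact 0 p (VS False 1 a) \<longleftrightarrow> fst (word_tape u) (pos p) = a" using two first_conf(4) by (simp add: fact_def)

lemma single_sat: "clause_sat \<sigma> tt p ([], [(v, 1, l)]) \<longleftrightarrow> \<sigma> (tt + 1) (locp l p) v" by (simp add: clause_sat_def)

lemma actual_VE: "actual 0 p VE \<longleftrightarrow> qmark p = 1 & ~ (0 <= pos p & pos p < int (length u))" by (simp add: actual_simps(8) blank_iff)

lemma cert_sat1:
	assumes "qmark p = 1"
	shows "clause_sat actual 0 p ([], [(VE, 0, Here), (VS False 1 1, 1, Here), (VS False 1 2, 1, Here)])"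
proof -
	have "actual 0 p VE | fact 0 p (VS False 1 1) | fact 0 p (VS False 1 2)"
	unfolding fact_cert actual_simps(8) using assms word_tape_cases[of u "pos p"] by blast
	then have "actual 0 p VE | actual (0 + 1) p (VS False 1 1) | actual (0 + 1) p (VS False 1 2)"
	using actual_one[of "VS False 1 1"] actual_one[of "VS False 1 2"] by simp
	then show ?thesis by (simp add: clause_sat_def)
qed

lemma cert_sat2: "clause_sat actual 0 p ([(VE, Here)], [(VS False 1 0, 1, Here)])"
proof -
	have "actual 0 p VE ==> fact 0 p (VS False 1 0)" unfolding fact_cert actual_simps(8) by blast
	then have "actual 0 p VE ==> actual (0 + 1) p (VS False 1 0)" using actual_one[of "VS False 1 0"] by simp
	then show ?thesis by (simp add: clause_sat_def)
qed

lemma cert_sat3: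
	assumes "qmark p ~= 1" "length u <= Q"
	shows "clause_sat actual 0 p ([], [(VS False 1 0, 1, Here)])"
proof -
	have "fact 0 p (VS False 1 0)" unfolding fact_cert blank_iff using assms unfolding qmark_iff by linarith
	then show ?thesis unfolding single_sat using actual_one[of "VS False 1 0"] by simp
qed

lemma cert_sat4:
	assumes "qmark p = 1" "p <= 2 * N"
	shows "clause_sat actual 0 p (if zone N p = 1 then filler else ([(VE, Before)], [(VE, 0, Here)]))"
proof (cases "zone N p = 1")
	case True
	then show ?thesis by (simp add: clause_sat_def filler_def actual_simps(9))
next
	case False
	then have "p ~= N" using zone_simps(3)[OF assms(2)] by blast
	moreover have "0 <= pos p" using assms(1) qmark_iff by blast
	ultimately have "pos (p - 1) = pos p - 1" "0 <= pos p - 1" by (simp_all add: pos_def of_nat_diff)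
	then have "actual 0 (p - 1) VE ==> actual 0 p VE" unfolding actual_VE using assms(1) by linarith
	then show ?thesis using False by (simp add: clause_sat_def)
qed

lemma first_sat:
	"clause_sat actual 0 p ([], [(VQ False 0, 1, First)])"
	"clause_sat actual 0 p ([], [(VS False 0 (xsym p), 1, Here)])"
	"2 <= i ==> i < tapes M ==> clause_sat actual 0 p ([], [(VS False i 0, 1, Here)])"
	"i < tapes M ==> clause_sat actual 0 p ([], [(VP False i (status 0 (pos p)), 1, Here)])"
proof -
	have f: "fact 0 0 (VQ False 0)" "fact 0 p (VS False 0 (xsym p))" using first_conf(1,3) two by (simp_all add: fact_def xsym_def)
	show "clause_sat actual 0 p ([], [(VQ False 0, 1, First)])" unfolding single_sat locp.simps using f(1) actual_one[of "VQ False 0"] by simp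
	show "clause_sat actual 0 p ([], [(VS False 0 (xsym p), 1, Here)])"
	unfolding single_sat locp.simps using f(2) actual_one[of "VS False 0 (xsym p)"] by simp
	show "clause_sat actual 0 p ([], [(VS False i 0, 1, Here)])" if "2 <= i" "i < tapes M"
	proof -
	have "fact 0 p (VS False i 0)" using first_conf(5) that by (simp add: fact_def)
	then show ?thesis unfolding single_sat locp.simps using actual_one[of "VS False i 0"] by simp
	qed
	show "clause_sat actual 0 p ([], [(VP False i (status 0 (pos p)), 1, Here)])" if "i < tapes M"
	proof -
	have "fact 0 p (VP False i (status 0 (pos p)))" using first_conf(2) that by (simp add: fact_def)
	then show ?thesis unfolding single_sat locp.simps using actual_one[of "VP False i (status 0 (pos p))"] by simp
	qed
qed

lemma status_zone:
	assumes "p <= 2 * N"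
	shows "(if zone N p = 1 then 1 else if zone N p = 3 | zone N p = 5 then 0 else 2) = status 0 (pos p)"
	unfolding zone_simps(3,4)[OF assms] by (simp add: status_def pos_def)

lemma init_sat:
	assumes "c : set (init_clauses (tapes M) (zone N p) (xsym p) (qmark p))" "p <= 2 * N" "length u <= Q"
	shows "clause_sat actual 0 p c"
proof -
	have "ALL c : set (init_clauses (tapes M) (zone N p) (xsym p) (qmark p)). clause_sat actual 0 p c"
	unfolding init_clauses_def set_append ball_Un status_zone[OF assms(2)]
	proof (intro conjI)
	show "ALL c : set (if qmark p = 1 then
			[([], [(VE, 0, Here), (VS False 1 1, 1, Here), (VS False 1 2, 1, Here)]),
			 (if zone N p = 1 then filler else ([(VE, Before)], [(VE, 0, Here)])),
			 ([(VE, Here)], [(VS False 1 0, 1, Here)])]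
		else [([], [(VS False 1 0, 1, Here)])]). clause_sat actual 0 p c"
	proof (cases "qmark p = 1")
		case True
		show ?thesis unfolding if_P[OF True] list.set using cert_sat1[OF True] cert_sat2[of p] cert_sat4[OF True assms(2)] by blast
	next
		case False
		show ?thesis unfolding if_not_P[OF False] list.set using cert_sat3[OF False assms(3)] by blast
	qed
	show "ALL c : set [([], [(VQ False 0, 1, First)]), ([], [(VS False 0 (xsym p), 1, Here)])]. clause_sat actual 0 p c"
		unfolding list.set using first_sat(1,2)[of p] by blast
	show "ALL c : set (map (%i. ([], [(VS False i 0, 1, Here)])) [2..<tapes M]). clause_sat actual 0 p c" using first_sat(3) by simp
	show "ALL c : set (map (%i. ([], [(VP False i (status 0 (pos p)), 1, Here)])) [0..<tapes M]). clause_sat actual 0 p c" using first_sat(4) by simp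
	qed
	then show ?thesis using assms(1) by blast
qed

lemma copy_sat:
	assumes "c : set (copy_clauses M)"
	shows "clause_sat actual tt p c"
proof -
	have "status h z = 1 \<longleftrightarrow> h = z" for h z by (auto simp: status_def)
	then show ?thesis using assms unfolding copy_clauses_def by (auto simp: clause_sat_def actual_simps)
qed

lemma status_shift: "status (h + d) z = status d (z - h)" by (auto simp: status_def)

definition conclusions :: "nat => nat => nat list => ((var \<times> loc) list \<times> (var \<times> nat \<times> loc)) set" where
	"conclusions b q ss = {(ps, a). (ps, a) = ([], (VQ False (fst (act_of M q ss)), 1, First)) |
		(EX i<tapes M. (ps, a) : set (tape_clauses (symbols M) b i (snd (act_of M q ss) ! i)))}"

lemma conclusions_set:
	"set (([], (VQ False (fst (act_of M q ss)), 1, First)) #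
	 concat (map (%i. tape_clauses (symbols M) b i (snd (act_of M q ss) ! i)) [0..<tapes M])) = conclusions b q ss" by (auto simp: conclusions_def)

lemma act_clausesE:
	assumes "c : set (act_clauses M b)"
	obtains q ss ps a where "length ss = tapes M" "c = (act_premises M q ss @ ps, [a])" "(ps, a) : conclusions b q ss"
proof -
	obtain q ss z where z: "ss : set (List.n_lists (tapes M) [0..<symbols M])" "z : conclusions b q ss"
	"c = (case z of (ps, c) => (act_premises M q ss @ ps, [c]))" using assms unfolding act_clauses_def in_concat_map in_map conclusions_set by blast
	obtain ps a where "z = (ps, a)" by (metis surj_pair)
	moreover have "length ss = tapes M" using z(1) by (rule length_n_lists_elem)
	ultimately show thesis using that z(2,3) by simp
qed

lemma act_clausesI:
	assumes "q <= states M" "length ss = tapes M" "set ss \<subseteq> {..<symbols M}" "(ps, a) : conclusions b q ss"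
	shows "(act_premises M q ss @ ps, [a]) : set (act_clauses M b)"
proof -
	have "ss : set (List.n_lists (tapes M) [0..<symbols M])" using assms(2,3) by (auto simp: set_n_lists)
	moreover have "q : set [0..<Suc (states M)]" using assms(1) by (simp only: set_upt) simp
	moreover have "(act_premises M q ss @ ps, [a]) = (case (ps, a) of (ps, c) => (act_premises M q ss @ ps, [c]))" by simp
	ultimately show ?thesis using assms(4) unfolding act_clauses_def in_concat_map in_map conclusions_set by blast
qed

lemma act_premises_actual:
	assumes "ALL (v, l) : set (act_premises M q ss). actual tt (locp l p) v" "length ss = tapes M"
	obtains s where "tt = 2 + 2 * s" "q = state s" "ss = scanned s"
proof -
	have "actual tt 0 (VQ True q)" using assms(1) by (simp add: act_premises_def)
	then obtain s where s: "tt = 2 + 2 * s" "q = state s" by (auto simp: actual_simps)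
	have "ss ! i = scanned s ! i" if "i < tapes M" for i
	proof -
	have "actual tt 0 (VR i (ss ! i))" using assms(1) that by (auto simp: act_premises_def)
	then show ?thesis using s(1) that by (auto simp: actual_simps scanned_def)
	qed
	then have "ss = scanned s" using assms(2) scanned_ok(1) by (intro nth_equalityI) auto
	with s show thesis using that by blast
qed

lemma tape_clauses_shape:
	assumes "(ps, (v, d, l)) : set (tape_clauses G b i sd)"
	shows "d = 1" "~ primed v" "ALL (v', l') : set ps. primed v' & v' ~= VT & v' ~= VE"
	using assms by (auto simp: tape_clauses_def Let_def split: if_splits prod.splits)

lemma tape_sat:
	assumes "(ps, (v, d, l)) : set (tape_clauses (symbols M) (zone N p) i (snd (act s) ! i))" "i < tapes M"
	"p <= 2 * N" "ALL (v, l) : set ps. actual (2 + 2 * s) (locp l p) v"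
	shows "actual (2 + 2 * s + d) (locp l p) v"
proof -
	obtain a m where am: "snd (act s) ! i = (a, m)" by (metis surj_pair)
	note shape = tape_clauses_shape[OF assms(1)]
	have pr: "ALL (v, l) : set ps. fact s (locp l p) v" using assms(4) shape(3) actual_at(2) by fast
	have m: "\<bar>offset m\<bar> <= 1" by (cases m) auto
	have b: "zone N p = 4 \<longleftrightarrow> p = 0" using zone_simps[OF assms(3)] by simp
	have pos: "pos (p - Suc 0) = pos p - 1" if "p ~= 0" using that by (simp add: pos_def of_nat_diff)
	have s1: "status h z = 0 \<longleftrightarrow> h < z" "status h z = Suc 0 \<longleftrightarrow> h = z" "status h z = 2 \<longleftrightarrow> z < h" for h z
	by (auto simp: status_def)
	have nc: "cell (Suc s) i z = (if z = head s i then a else cell s i z)" "head (Suc s) i = head s i + offset m" for z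
	using next_conf(2,3)[OF assms(2), of s] am by simp_all
	have "fact (Suc s) (locp l p) v" using assms(1) pr unfolding am tape_clauses_def Let_def prod.case b using assms(2) m
	by (auto simp: fact_def nc s1 pos status_shift split: if_splits)
	then have "actual (1 + 2 * Suc s) (locp l p) v" using actual_at(1)[OF shape(2)] by blast
	moreover have "1 + 2 * Suc s = 2 + 2 * s + d" using shape(1) by simp
	ultimately show ?thesis by metis
qed

lemma act_sat:
	assumes "c : set (act_clauses M (zone N p))" "p <= 2 * N"
	shows "clause_sat actual tt p c" unfolding clause_sat_def
proof
	assume pr: "ALL (v, l) : set (fst c). actual tt (locp l p) v"
	obtain q ss ps a where c: "length ss = tapes M" "c = (act_premises M q ss @ ps, [a])"
	"(ps, a) : conclusions (zone N p) q ss" by (rule act_clausesE[OF assms(1)])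
	have 1: "ALL (v, l) : set (act_premises M q ss). actual tt (locp l p) v"
	and 2: "ALL (v, l) : set ps. actual tt (locp l p) v" using pr c(2) by auto
	obtain s where s: "tt = 2 + 2 * s" "q = state s" "ss = scanned s" by (rule act_premises_actual[OF 1 c(1)])
	obtain v d l where a: "a = (v, d, l)" by (metis prod_cases3)
	have "actual (2 + 2 * s + d) (locp l p) v" using c(3) unfolding s(2,3) conclusions_def mem_Collect_eq prod.case
	proof
	assume "(ps, a) = ([], (VQ False (fst (act s)), 1, First))"
	moreover have "fact (Suc s) 0 (VQ False (fst (act s)))" using next_conf(1)[of s] by (simp add: fact_def)
	then have "actual (1 + 2 * Suc s) 0 (VQ False (fst (act s)))" using actual_at(1)[of "VQ False (fst (act s))" "Suc s" 0] by simp
	ultimately show ?thesis using a by simp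
	next
	assume "EX i<tapes M. (ps, a) : set (tape_clauses (symbols M) (zone N p) i (snd (act s) ! i))"
	then obtain i where "i < tapes M" "(ps, (v, d, l)) : set (tape_clauses (symbols M) (zone N p) i (snd (act s) ! i))" using a by blast
	then show ?thesis using tape_sat assms(2) 2 s(1) by blast
	qed
	then show "EX (v, d, l) : set (snd c). actual (tt + d) (locp l p) v" using c(2) a s(1) by simp
qed

lemma halted_conf:
	assumes "state s = states M" "s <= t"
	shows "conf t = conf s" using assms(2)
proof (induction t rule: dec_induct)
	case (step n)
	then have "fst (conf n) = states M" using assms(1) by (simp add: state_def)
	then obtain ts where "conf n = (states M, ts)" by (metis prod.collapse)
	then have "conf (Suc n) = conf n" by (simp add: conf_Suc)
	with step.IH show ?case by simp
qed simp

lemma output_cell: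
	assumes "computes_within M [x, u] T [r]" "state s = states M"
	shows "cell s 0 0 = bit_symbol r"
proof -
	have T: "state T = states M" "tape_output (snd (conf T) ! 0) [r]"
	using assms(1) by (auto simp: computes_within_def conf_def state_def split: prod.splits)
	have "conf s = conf T" using halted_conf[OF assms(2), of T] halted_conf[OF T(1), of s] by (cases "s <= T") auto
	then show ?thesis using T(2) by (simp add: tape_output_def cell_def)
qed

lemma actual_satisfies:
	assumes "computes_within M [x, u] T [True]" "length u <= Q" "p <= 2 * N"
	"c : set (clauses M (zone N tt) (zone N p) (xsym p) (qmark p))" "tt <= 2 * N"
	shows "clause_sat actual tt p c"
proof -
	have z: "zone N tt = 4 \<longleftrightarrow> tt = 0" "zone N p = 1 \<longleftrightarrow> p = N" using zone_simps assms by auto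
	consider "tt = 0" "c : set (init_clauses (tapes M) (zone N p) (xsym p) (qmark p))"
	| "c : set (copy_clauses M)" | "c : set (act_clauses M (zone N p))"
	| "p = N" "c = ([(VQ False (states M), First), (VS False 0 1, Here)], [])" using assms(4) unfolding clauses_def z by (auto split: if_splits)
	then show ?thesis
	proof cases
	case 4
	have "~ (EX s s'. tt = 1 + 2 * s & state s = states M & tt = 1 + 2 * s' & cell s' 0 0 = 1)"
		using output_cell[OF assms(1)] by (auto simp: bit_symbol_def)
	then show ?thesis using 4 by (auto simp: clause_sat_def actual_simps pos_def)
	qed (use init_sat copy_sat act_sat assms in auto)
qed

section \<open>Every satisfying assignment contains the facts of the computation\<close>

context
	fixes \<sigma> :: "nat => nat => var => bool"
	assumes sat: "\<And>tt p c. tt <= 2 * N ==> p <= 2 * N ==>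
		c : set (clauses M (zone N tt) (zone N p) (xsym p) (qmark p)) ==> clause_sat \<sigma> tt p c"
begin

lemma status_cases: "status h z = 0 | status h z = 1 | status h z = 2" by (simp add: status_def)

lemma copy_derive:
	assumes "fact s p v" "~ primed v" "\<And>p v. p <= 2 * N ==> ~ primed v ==> fact s p v ==> \<sigma> tt p v" "p <= 2 * N" "tt < 2 * N"
	shows "case v of VS b i a => \<sigma> (Suc tt) p (VS True i a) | VP b i z => \<sigma> (Suc tt) p (VP True i z)
	| VQ b q => \<sigma> (Suc tt) p (VQ True q) | _ => True"
proof -
	have z: "zone N tt ~= 5" using zone_simps(2)[of tt] assms(5) by auto
	have cl: "clause_sat \<sigma> tt p c" if "c : set (copy_clauses M)" for c using sat[of tt p c] that z assms(4,5) by (simp add: clauses_def)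
	have v: "\<sigma> tt p v" using assms by blast
	show ?thesis
	proof (cases v)
	case (VS b i a)
	then have "i < tapes M" "a < symbols M" "~ b" using assms(1,2) cell_less by (auto simp: fact_def)
	then have "([(VS False i a, Here)], [(VS True i a, 1, Here)]) : set (copy_clauses M)" unfolding copy_clauses_def by auto
	from cl[OF this] show ?thesis using v VS \<open>~ b\<close> by (simp add: clause_sat_def)
	next
	case (VP b i z)
	then have "i < tapes M" "z = 0 | z = 1 | z = 2" "~ b" using assms(1,2) status_cases[of "head s i" "pos p"] by (auto simp: fact_def)
	then have "([(VP False i z, Here)], [(VP True i z, 1, Here)]) : set (copy_clauses M)" unfolding copy_clauses_def by auto
	from cl[OF this] show ?thesis using v VP \<open>~ b\<close> by (simp add: clause_sat_def)
	next
	case (VQ b q)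
	then have "p = 0" "q <= states M" "~ b" using assms(1,2) state_le by (auto simp: fact_def)
	then have "([(VQ False q, First)], [(VQ True q, 1, First)]) : set (copy_clauses M)" unfolding copy_clauses_def by auto
	from cl[OF this] show ?thesis using v VQ \<open>~ b\<close> \<open>p = 0\<close> by (simp add: clause_sat_def)
	qed auto
qed

lemma read_derive:
	assumes "\<And>p v. p <= 2 * N ==> ~ primed v ==> fact s p v ==> \<sigma> tt p v" "tt < 2 * N" "i < tapes M" "s < N"
	shows "\<sigma> (Suc tt) 0 (VR i (cell s i (head s i)))"
proof -
	\<comment> \<open>The position of the head; it lies in the square because after
	  \<open>s < N\<close> steps no head is further than \<open>s\<close> from cell 0.\<close>
	let ?a = "cell s i (head s i)" and ?p = "nat (head s i + int N)"
	have h: "\<bar>head s i\<bar> <= int s" by (rule head_bound[OF assms(3)])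
	have p: "?p <= 2 * N" "pos ?p = head s i" using h assms(4) by (auto simp: pos_def)
	have z: "zone N tt ~= 5" using zone_simps(2)[of tt] assms(2) by auto
	have "?a < symbols M" using cell_less assms(3) by simp
	then have "([(VP False i 1, Here), (VS False i ?a, Here)], [(VR i ?a, 1, First)]) : set (copy_clauses M)"
	using assms(3) unfolding copy_clauses_def by fastforce
	then have "clause_sat \<sigma> tt ?p ([(VP False i 1, Here), (VS False i ?a, Here)], [(VR i ?a, 1, First)])"
	using sat[of tt ?p] z p(1) assms(2) by (simp add: clauses_def)
	moreover have "\<sigma> tt ?p (VP False i 1)" "\<sigma> tt ?p (VS False i ?a)"
	using assms(1)[OF p(1)] assms(3) p(2) by (auto simp: fact_def status_def)
	ultimately show ?thesis by (simp add: clause_sat_def)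
qed

lemma step_derive:
	assumes prev: "\<And>p v. p <= 2 * N ==> ~ primed v ==> fact s p v ==> \<sigma> (1 + 2 * s) p v"
	and s: "Suc s < N" and p: "p <= 2 * N" and v: "~ primed v" "fact (Suc s) p v"
	shows "\<sigma> (1 + 2 * Suc s) p v"
proof -
	let ?t = "Suc (1 + 2 * s)"
	have t: "1 + 2 * s < 2 * N" "?t < 2 * N" using s by auto
	have cp: "fact s p v ==> ~ primed v ==> p <= 2 * N ==> case v of VS b i a => \<sigma> ?t p (VS True i a) | VP b i z => \<sigma> ?t p (VP True i z)
	| VQ b q => \<sigma> ?t p (VQ True q) | _ => True" for p v using copy_derive[OF _ _ prev _ t(1)] by blast
	have S: "\<sigma> ?t p (VS True i (cell s i (pos p)))" if "i < tapes M" "p <= 2 * N" for i p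
	using cp[of p "VS False i (cell s i (pos p))"] that by (simp add: fact_def)
	have P: "\<sigma> ?t p (VP True i (status (head s i) (pos p)))" if "i < tapes M" "p <= 2 * N" for i p
	using cp[of p "VP False i (status (head s i) (pos p))"] that by (simp add: fact_def)
	have prem: "\<sigma> ?t (locp l p') v" if "(v, l) : set (act_premises M (state s) (scanned s))" for v l p'
	proof -
	have "\<sigma> ?t 0 (VQ True (state s))" using cp[of 0 "VQ False (state s)"] by (simp add: fact_def)
	moreover have "\<sigma> ?t 0 (VR i (scanned s ! i))" if "i < tapes M" for i using read_derive[OF prev t(1) that] s that by (simp add: scanned_def)
	ultimately show ?thesis using that by (auto simp: act_premises_def)
	qed
	have z: "zone N ?t ~= 5" using zone_simps(2)[of ?t] t(2) by auto
	have cl: "\<sigma> (Suc ?t) (locp l p') v"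
	if "p' <= 2 * N" "(ps, a) = ([], (VQ False (fst (act s)), 1, First)) |
		(EX i<tapes M. (ps, a) : set (tape_clauses (symbols M) (zone N p') i (snd (act s) ! i)))"
		"\<And>v l. (v, l) : set ps ==> \<sigma> ?t (locp l p') v" "a = (v, 1, l)" for p' ps a v l
	proof -
	have "(act_premises M (state s) (scanned s) @ ps, [a]) : set (act_clauses M (zone N p'))"
		using act_clausesI[OF state_le scanned_ok] that(2) unfolding conclusions_def by blast
	then have "clause_sat \<sigma> ?t p' (act_premises M (state s) (scanned s) @ ps, [a])"
		using sat[of ?t p'] z that(1) t(2) by (simp add: clauses_def)
	then show ?thesis using prem that(3,4) by (auto simp: clause_sat_def)
	qed
	have zp: "zone N p' = 4 \<longleftrightarrow> p' = 0" if "p' <= 2 * N" for p' using zone_simps that by simp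
	have t3: "1 + 2 * Suc s = Suc ?t" by simp
	show ?thesis unfolding t3
	proof (cases v)
	case (VS b i a)
	then have i: "i < tapes M" "~ b" "a = cell (Suc s) i (pos p)" using v by (auto simp: fact_def)
	obtain a' m where am: "snd (act s) ! i = (a', m)" by (metis surj_pair)
	show "\<sigma> (Suc ?t) p v"
	proof (cases "pos p = head s i")
		case True
		have "([(VP True i 1, Here)], (VS False i a', 1, Here)) : set (tape_clauses (symbols M) (zone N p) i (snd (act s) ! i))"
			by (simp add: am tape_clauses_def)
		moreover have "a = a'" using i True am next_conf(2) by simp
		moreover have "\<sigma> ?t p (VP True i 1)" using P[OF i(1) p] True by (simp add: status_def)
		ultimately show ?thesis using cl[OF p, of "[(VP True i 1, Here)]" "(VS False i a', 1, Here)" "VS False i a" Here] VS i(1,2) by auto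
	next
		case False
		then have a: "a = cell s i (pos p)" using i next_conf(2) by simp
		have st: "status (head s i) (pos p) = 0 | status (head s i) (pos p) = 2" using False by (auto simp: status_def)
		have "a < symbols M" using a cell_less i by simp
		then have "([(VP True i (status (head s i) (pos p)), Here), (VS True i a, Here)], (VS False i a, 1, Here))
				: set (tape_clauses (symbols M) (zone N p) i (snd (act s) ! i))" using st by (auto simp: am tape_clauses_def)
		note m = this
		have pr: "\<sigma> ?t (locp l p) v'"
			if "(v', l) : set [(VP True i (status (head s i) (pos p)), Here), (VS True i a, Here)]" for v' l
			using that P[OF i(1) p] S[OF i(1) p, folded a] by auto
		have "\<sigma> (Suc ?t) (locp Here p) (VS False i a)" by (rule cl[OF p _ pr refl]) (use m i(1) in blast)
		then show ?thesis using VS i(2) by simp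
	qed
	next
	case (VQ b q)
	then have "~ b" "p = 0" "q = fst (act s)" using v next_conf(1) by (auto simp: fact_def)
	then show "\<sigma> (Suc ?t) p v" using cl[OF p, of "[]" "(VQ False (fst (act s)), 1, First)" "VQ False (fst (act s))" First] VQ by auto
	next
	case (VP b i z)
	obtain a' m where am: "snd (act s) ! i = (a', m)" by (metis surj_pair)
	then have i: "i < tapes M" "~ b" "z = status (offset m) (pos p - head s i)" using VP v next_conf(3)[of i s] by (auto simp: fact_def status_shift)
	have m: "\<bar>offset m\<bar> <= 1" by (cases m) auto
	have h: "\<bar>head s i\<bar> <= int s" by (rule head_bound[OF i(1)])
	let ?tc = "%p. set (tape_clauses (symbols M) (zone N p) i (snd (act s) ! i))"
	have one: "\<sigma> (Suc ?t) (locp l p') (VP False i z)"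
		if "p' <= 2 * N" "([(VP True i y, l')], (VP False i z, 1, l)) : ?tc p'" "\<sigma> ?t (locp l' p') (VP True i y)" for p' y l l'
		using cl[OF that(1), of "[(VP True i y, l')]" "(VP False i z, 1, l)" "VP False i z" l] that i(1) by auto
	have tgt: "v = VP False i z" using VP i by simp
	\<comment> \<open>Left of the head, the status at \<open>p\<close> is concluded by the clauses of
	  position \<open>Suc p\<close> through \<open>Before\<close>; this position is still in the square
	  because \<open>Suc s < N\<close>. At the head and right of it the clauses of \<open>p\<close>
	  itself serve.\<close>
	consider "pos p = head s i" | "pos p = head s i - 1" | "pos p = head s i + 1" | "pos p < head s i - 1" | "head s i + 1 < pos p" by linarith
	then show "\<sigma> (Suc ?t) p v"
	proof cases
		case 1
		have "([(VP True i 1, Here)], (VP False i z, 1, Here)) : ?tc p" using i(3) 1 by (simp add: am tape_clauses_def)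
		from one[OF p this] show ?thesis using P[OF i(1) p] 1 tgt by (simp add: status_def)
	next
		case 2
		have q: "Suc p <= 2 * N" "pos (Suc p) = head s i" using 2 h s by (auto simp: pos_def)
		have "([(VP True i 1, Here)], (VP False i z, 1, Before)) : ?tc (Suc p)" using i(3) 2 zp[OF q(1)] by (simp add: am tape_clauses_def)
		from one[OF q(1) this] show ?thesis using P[OF i(1) q(1)] q(2) tgt by (simp add: status_def)
	next
		case 3
		have q: "p ~= 0" "pos (p - 1) = head s i" "p - 1 <= 2 * N" using 3 h s p by (auto simp: pos_def of_nat_diff)
		have "([(VP True i 1, Before)], (VP False i z, 1, Here)) : ?tc p" using i(3) 3 zp[OF p] q(1) by (simp add: am tape_clauses_def)
		from one[OF p this] show ?thesis using P[OF i(1) q(3)] q(2) tgt by (simp add: status_def)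
	next
		case 4
		have q: "Suc p <= 2 * N" "pos (Suc p) < head s i" using 4 h s by (auto simp: pos_def)
		have "z = 2" using i(3) 4 m by (auto simp: status_def)
		have "([(VP True i 2, Here)], (VP False i z, 1, Before)) : ?tc (Suc p)"
			using \<open>z = 2\<close> zp[OF q(1)] by (simp add: am tape_clauses_def)
		from one[OF q(1) this] show ?thesis using P[OF i(1) q(1)] q(2) tgt by (simp add: status_def)
	next
		case 5
		have q: "p ~= 0" "head s i < pos (p - 1)" "p - 1 <= 2 * N" using 5 h s p by (auto simp: pos_def of_nat_diff)
		have "z = 0" using i(3) 5 m by (auto simp: status_def)
		have "([(VP True i 0, Before)], (VP False i z, 1, Here)) : ?tc p" using \<open>z = 0\<close> zp[OF p] q(1) by (simp add: am tape_clauses_def)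
		from one[OF p this] show ?thesis using P[OF i(1) q(3)] q(2) tgt by (simp add: status_def)
	qed
	qed (use v in auto)
qed

lemma facts_derive:
	assumes init: "\<And>p v. p <= 2 * N ==> ~ primed v ==> fact 0 p v ==> \<sigma> 1 p v"
	and "s < N" "p <= 2 * N" "~ primed v" "fact s p v"
	shows "\<sigma> (1 + 2 * s) p v" using assms(2-)
proof (induction s arbitrary: p v)
	case 0
	then show ?case using init by simp
next
	case (Suc s)
	show ?case by (rule step_derive) (use Suc in auto)
qed

lemma init_derive:
	assumes cert: "\<And>p. p <= 2 * N ==> \<sigma> 1 p (VS False 1 (fst (word_tape u) (pos p)))"
	and p: "p <= 2 * N" and v: "~ primed v" "fact 0 p v"
	shows "\<sigma> 1 p v"
proof -
	have z: "zone N 0 = 4" by (simp add: zone_def)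
	have cl: "clause_sat \<sigma> 0 p c" if "c : set (init_clauses (tapes M) (zone N p) (xsym p) (qmark p))" for c
	using sat[of 0 p c] that z p by (simp add: clauses_def)
	have st: "status 0 (pos p) = (if zone N p = 1 then 1 else if zone N p = 3 | zone N p = 5 then 0 else 2)"
	unfolding zone_simps(3,4)[OF p] by (auto simp: status_def pos_def)
	show ?thesis
	proof (cases v)
	case (VS b i a)
	then have i: "i < tapes M" "~ b" "a = cell 0 i (pos p)" using v by (auto simp: fact_def)
	consider "i = 0" | "i = 1" | "2 <= i" by linarith
	then show ?thesis
	proof cases
		case 1
		have "([], [(VS False 0 (xsym p), 1, Here)]) : set (init_clauses (tapes M) (zone N p) (xsym p) (qmark p))" by (simp add: init_clauses_def)
		from cl[OF this] show ?thesis using 1 i VS by (simp add: clause_sat_def first_conf xsym_def)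
	next
		case 2
		then show ?thesis using cert[OF p] i VS first_conf(4) by simp
	next
		case 3
		have "([], [(VS False i 0, 1, Here)]) : set (init_clauses (tapes M) (zone N p) (xsym p) (qmark p))" using i 3 by (simp add: init_clauses_def)
		from cl[OF this] show ?thesis using 3 i VS by (simp add: clause_sat_def first_conf)
	qed
	next
	case (VQ b q)
	have "([], [(VQ False 0, 1, First)]) : set (init_clauses (tapes M) (zone N p) (xsym p) (qmark p))" by (simp add: init_clauses_def)
	from cl[OF this] show ?thesis using VQ v by (simp add: clause_sat_def fact_def first_conf)
	next
	case (VP b i z)
	then have i: "i < tapes M" "~ b" "z = status 0 (pos p)" using v by (auto simp: fact_def first_conf)
	then have "([], [(VP False i z, 1, Here)]) : set (init_clauses (tapes M) (zone N p) (xsym p) (qmark p))" unfolding init_clauses_def st by auto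
	from cl[OF this] show ?thesis using VP i by (simp add: clause_sat_def)
	qed (use v in auto)
qed

lemma accepts_derive:
	assumes cert: "\<And>p. p <= 2 * N ==> \<sigma> 1 p (VS False 1 (fst (word_tape u) (pos p)))"
	and T: "computes_within M [x, u] T [r]" "T < N"
	shows r
proof -
	have halt: "state T = states M" using T(1) by (auto simp: computes_within_def conf_def state_def split: prod.splits)
	have f: "\<sigma> (1 + 2 * T) p v" if "p <= 2 * N" "~ primed v" "fact T p v" for p v
	by (rule facts_derive[OF init_derive[OF cert]]) (use that T in auto)
	have "zone N N = 1" using N by (simp add: zone_def)
	\<comment> \<open>Symbol 1 in cell 0 of tape 0 is the answer False. The clause at the centre
	  excludes it in the halting state, and it is applied at the time when \<open>M\<close> has
	  halted.\<close>
	then have "clause_sat \<sigma> (1 + 2 * T) N ([(VQ False (states M), First), (VS False 0 1, Here)], [])"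
	using sat[of "1 + 2 * T" N] T(2) by (simp add: clauses_def)
	moreover have "\<sigma> (1 + 2 * T) 0 (VQ False (states M))" using f[of 0] halt by (simp add: fact_def)
	ultimately have "~ \<sigma> (1 + 2 * T) N (VS False 0 1)" by (simp add: clause_sat_def)
	then have "cell T 0 0 ~= 1" using f[of N "VS False 0 1"] two by (auto simp: fact_def pos_def)
	then show r using output_cell[OF T(1) halt] by (auto simp: bit_symbol_def split: if_splits)
qed

end

end

theorem clauses_satisfiable_iff:
	assumes wf: "wf_tm M" and two: "2 <= tapes M" and N: "1 < N" "Q <= N"
	and R: "\<And>u. length u <= Q ==> computes_within M [x, u] (T u) [R u] & T u < N"
	shows "(EX \<sigma>. ALL tt<=2 * N. ALL p<=2 * N. ALL c : set (clauses M (zone N tt) (zone N p)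
					 (fst (word_tape x) (int p - int N)) (if N <= p & p < N + Q then 1 else 0)). clause_sat \<sigma> tt p c) \<longleftrightarrow>
			 (EX u. length u <= Q & R u)"
proof
	assume "EX \<sigma>. ALL tt<=2 * N. ALL p<=2 * N. ALL c : set (clauses M (zone N tt) (zone N p)
					 (fst (word_tape x) (int p - int N)) (if N <= p & p < N + Q then 1 else 0)). clause_sat \<sigma> tt p c"
	then obtain \<sigma> where sat0: "\<And>tt p c. tt <= 2 * N ==> p <= 2 * N ==> c : set (clauses M (zone N tt) (zone N p)
					 (fst (word_tape x) (int p - int N)) (if N <= p & p < N + Q then 1 else 0)) ==> clause_sat \<sigma> tt p c" by blast
	\<comment> \<open>The certificate ends at the first mark \<open>VE\<close>, or at \<open>Q\<close>
	  if there is none. The marks beyond it follow from the clause that passes \<open>VE\<close> on to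
	  the next cell.\<close>
	define L where "L = (LEAST z. z = Q | \<sigma> 0 (N + z) VE)"
	have L1: "L = Q | \<sigma> 0 (N + L) VE" unfolding L_def by (rule LeastI[of _ Q]) simp
	have L2: "L <= Q" unfolding L_def by (rule Least_le) simp
	have L3: "~ \<sigma> 0 (N + z) VE" if "z < L" for z using not_less_Least[of z] that unfolding L_def by blast
	\<comment> \<open>An assignment may claim both bits for a cell. Preferring the bit for symbol 2 is
	  safe: if it is not claimed, symbol 1 is.\<close>
	define u where "u = map (%z. \<sigma> 1 (N + z) (VS False 1 2)) [0..<L]"
	have u: "length u = L" by (simp add: u_def)
	interpret computation M x u N Q by unfold_locales (use assms in auto)
	have sat: "clause_sat \<sigma> tt p c"
	if "tt <= 2 * N" "p <= 2 * N" "c : set (clauses M (zone N tt) (zone N p) (xsym p) (qmark p))" for tt p c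
	using sat0 that unfolding xsym_def qmark_def pos_def by blast
	have cl: "clause_sat \<sigma> 0 p c" if "p <= 2 * N" "c : set (init_clauses (tapes M) (zone N p) (xsym p) (qmark p))" for c p
	using sat[of 0 p c] that by (simp add: clauses_def zone_def)
	have q: "qmark (N + z) = 1" if "z < Q" for z using that by (simp add: qmark_def)
	have "\<sigma> 1 p (VS False 1 (fst (word_tape u) (pos p)))" if p: "p <= 2 * N" for p
	proof (cases "qmark p = 1")
	case False
	then have "([], [(VS False 1 0, 1, Here)]) : set (init_clauses (tapes M) (zone N p) (xsym p) (qmark p))" by (simp add: init_clauses_def)
	from cl[OF p this] have "\<sigma> 1 p (VS False 1 0)" by (simp add: clause_sat_def)
	moreover have "fst (word_tape u) (pos p) = 0" using False u L2 by (auto simp: qmark_def pos_def word_tape_def split: if_splits)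
	ultimately show ?thesis by simp
	next
	case True
	then obtain z where z: "p = N + z" "z < Q" by (auto simp: qmark_def split: if_splits dest: le_Suc_ex)
	show ?thesis
	proof (cases "z < L")
		case True
		have "([], [(VE, 0, Here), (VS False 1 1, 1, Here), (VS False 1 2, 1, Here)])
				: set (init_clauses (tapes M) (zone N p) (xsym p) (qmark p))" using q z by (simp add: init_clauses_def)
		from cl[OF p this] have "\<sigma> 1 p (VS False 1 1) | \<sigma> 1 p (VS False 1 2)" using L3[OF True] z by (simp add: clause_sat_def)
		moreover have "fst (word_tape u) (pos p) = bit_symbol (\<sigma> 1 p (VS False 1 2))" using True z u by (simp add: word_tape_def pos_def u_def)
		ultimately show ?thesis by (auto simp: bit_symbol_def)
	next
		case False
		have "\<sigma> 0 (N + y) VE" if "L <= y" "y < Q" for y using that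
		proof (induction y rule: dec_induct)
			case base
			then show ?case using L1 by simp
		next
			case (step y)
			have y: "N + Suc y <= 2 * N" using step Q by simp
			have "zone N (N + Suc y) ~= 1" using zone_simps(3)[OF y] by simp
			then have "([(VE, Before)], [(VE, 0, Here)])
					: set (init_clauses (tapes M) (zone N (N + Suc y)) (xsym (N + Suc y)) (qmark (N + Suc y)))"
				using q[of "Suc y"] step by (simp add: init_clauses_def)
			from cl[OF y this] show ?case using step by (simp add: clause_sat_def)
		qed
		then have E: "\<sigma> 0 p VE" using False z by simp
		have "([(VE, Here)], [(VS False 1 0, 1, Here)]) : set (init_clauses (tapes M) (zone N p) (xsym p) (qmark p))"
			using q z by (simp add: init_clauses_def)
		from cl[OF p this] have "\<sigma> 1 p (VS False 1 0)" using E by (simp add: clause_sat_def)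
		moreover have "fst (word_tape u) (pos p) = 0" using False z u by (simp add: word_tape_def pos_def)
		ultimately show ?thesis by simp
	qed
	qed
	from accepts_derive[OF sat this] have "R u" using R[of u] u L2 by blast
	then show "EX u. length u <= Q & R u" using u L2 by blast
next
	assume "EX u. length u <= Q & R u"
	then obtain u where u: "length u <= Q" "R u" by blast
	interpret computation M x u N Q by unfold_locales (use assms in auto)
	have "computes_within M [x, u] (T u) [True]" using R[OF u(1)] u(2) by simp
	from actual_satisfies[OF this u(1)]
	show "EX \<sigma>. ALL tt<=2 * N. ALL p<=2 * N. ALL c : set (clauses M (zone N tt) (zone N p)
					 (fst (word_tape x) (int p - int N)) (if N <= p & p < N + Q then 1 else 0)). clause_sat \<sigma> tt p c"
	unfolding xsym_def qmark_def pos_def by (intro exI[of _ actual]) blast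
qed

section \<open>Programs that move heads and append to the output\<close>

lemma runs_mono: "runs p T t T' ==> t <= t' ==> runs p T t' T'" unfolding runs_def using le_trans by blast

lemma runs_Op: "runs (Op i g) T 1 (T(i := act_tape (g (view T)) (T i)))" unfolding runs_def using exec.Op by blast

lemma runs_Seq:
	assumes "runs a T s T'" "runs b T' t T''"
	shows "runs (a ;; b) T (s + t) T''"
proof -
	obtain s' t' where "s' <= s" "exec a T s' T'" "t' <= t" "exec b T' t' T''" using assms unfolding runs_def by blast
	then show ?thesis unfolding runs_def by (intro exI[of _ "s' + t'"] conjI exec.Seq[of a T s' T']) auto
qed

lemma runs_Cond:
	assumes "c (view T) ==> runs a T t T'" "~ c (view T) ==> runs b T t T'"
	shows "runs (Cond c a b) T (Suc t) T'"
proof (cases "c (view T)")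
	case True
	then obtain s where "s <= t" "exec a T s T'" using assms(1) unfolding runs_def by blast
	then show ?thesis using exec.CondT[of c T a s T' b] True unfolding runs_def by auto
next
	case False
	then obtain s where "s <= t" "exec b T s T'" using assms(2) unfolding runs_def by blast
	then show ?thesis using exec.CondF[of c T b s T' a] False unfolding runs_def by auto
qed

lemma runs_While:
	assumes "\<And>k. k < n ==> c (view (T k)) & runs a (T k) t (T (Suc k))" "~ c (view (T n))"
	shows "runs (While c a) (T 0) (n * Suc t + 1) (T n)" using assms
proof (induction n arbitrary: T)
	case 0
	then have "exec (While c a) (T 0) 1 (T 0)" by (intro exec.WhileF) simp
	then show ?case unfolding runs_def by auto
next
	case (Suc n)
	have "runs (While c a) (T (Suc 0)) (n * Suc t + 1) (T (Suc n))" using Suc.IH[of "%k. T (Suc k)"] Suc.prems by auto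
	then obtain s2 where s2: "s2 <= n * Suc t + 1" "exec (While c a) (T (Suc 0)) s2 (T (Suc n))" unfolding runs_def by blast
	obtain s1 where s1: "s1 <= t" "exec a (T 0) s1 (T (Suc 0))" using Suc.prems(1)[of 0] unfolding runs_def by auto
	have "exec (While c a) (T 0) (Suc (s1 + s2)) (T (Suc n))" using Suc.prems(1)[of 0] by (intro exec.WhileT[OF _ s1(2) s2(2)]) simp
	moreover have "Suc (s1 + s2) <= Suc n * Suc t + 1" using s1(1) s2(1) by simp
	ultimately show ?case unfolding runs_def by blast
qed

type_synonym contents = "nat => int => nat"
type_synonym heads = "nat => int"

text \<open>Contents and heads are kept apart because most programs below only move heads; their
  effect is then a change of \<open>h\<close> alone.\<close>

definition st :: "contents => heads => mem" where
	"st w h = (%i. (w i, h i))"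

definition look :: "contents => heads => view" where
	"look w h = (%i. if i < ntapes then w i (h i) else 0)"

lemma view_st: "view (st w h) = look w h" by (auto simp: view_def st_def look_def)

definition Mv :: "nat => move => prog" where
	"Mv i d = Op i (%v. (v i, d))"

lemma wf_Mv [simp]: "wf_prog (Mv i d) \<longleftrightarrow> i < ntapes" by (auto simp: Mv_def)

lemma runs_Mv:
	assumes "i < ntapes"
	shows "runs (Mv i d) (st w h) 1 (st w (h(i := h i + offset d)))"
proof -
	have "runs (Mv i d) (st w h) 1 ((st w h)(i := act_tape (look w h i, d) (st w h i)))"
	using runs_Op[of i "%v. (v i, d)" "st w h"] unfolding Mv_def[symmetric] view_st .
	moreover have "(st w h)(i := act_tape (look w h i, d) (st w h i)) = st w (h(i := h i + offset d))"
	using assms by (auto simp: st_def look_def fun_eq_iff)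
	ultimately show ?thesis by simp
qed

definition Skip :: prog where "Skip = Mv 0 Stay"

lemma wf_Skip [simp]: "wf_prog Skip" by (simp add: Skip_def ntapes_def)

lemma runs_Skip: "runs Skip T 1 T"
proof -
	have "act_tape (view T 0, Stay) (T 0) = T 0" by (cases "T 0") (simp add: view_def ntapes_def)
	then show ?thesis using runs_Op[of 0 "%v. (v 0, Stay)" T] by (simp add: Skip_def Mv_def)
qed

fun mvs :: "(nat \<times> move) list => prog" where
	"mvs [] = Skip"
| "mvs ((i, d) # ms) = Mv i d ;; mvs ms"

fun off :: "(nat \<times> move) list => nat => int" where
	"off [] j = 0"
| "off ((i, d) # ms) j = (if i = j then offset d else 0) + off ms j"

lemma wf_mvs [simp]: "wf_prog (mvs ms) \<longleftrightarrow> fst ` set ms \<subseteq> {..<ntapes}" by (induction ms rule: mvs.induct) auto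

lemma runs_mvs:
	assumes "fst ` set ms \<subseteq> {..<ntapes}"
	shows "runs (mvs ms) (st w h) (Suc (length ms)) (st w (%j. h j + off ms j))" using assms
proof (induction ms arbitrary: h rule: mvs.induct)
	case 1
	show ?case using runs_Skip by simp
next
	case (2 i d ms)
	have "runs (mvs ((i, d) # ms)) (st w h) (1 + Suc (length ms)) (st w (%j. (h(i := h i + offset d)) j + off ms j))"
	unfolding mvs.simps using 2 by (intro runs_Seq[OF runs_Mv] 2) auto
	moreover have "(%j. (h(i := h i + offset d)) j + off ms j) = (%j. h j + off ((i, d) # ms) j)" by (auto simp: fun_eq_iff)
	ultimately show ?case by simp
qed

lemma off_notin: "j \<notin> fst ` set ms ==> off ms j = 0" by (induction ms rule: mvs.induct) auto

fun opposite :: "move => move" where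
	"opposite Lt = Rt"
| "opposite Stay = Stay"
| "opposite Rt = Lt"

definition rewind :: "(nat \<times> move) list => (nat \<times> move) list" where
	"rewind ms = map (%(i, d). (i, opposite d)) ms"

lemma off_back [simp]: "off (rewind ms) j = - off ms j"
proof (induction ms rule: mvs.induct)
	case (2 i d ms) then show ?case by (cases d) (auto simp: rewind_def)
qed (simp add: rewind_def)

lemma back_simps [simp]: "fst ` set (rewind ms) = fst ` set ms" "length (rewind ms) = length ms" by (force simp: rewind_def image_image)+

text \<open>Tape 0 holds the output written so far, its head standing behind it.\<close>

definition ost :: "contents => bool list => heads => mem" where
	"ost w xs h = st (w(0 := fst (word_tape xs))) (h(0 := int (length xs)))"

definition scan :: "contents => heads => view" where
	"scan w h = (%i. if 0 < i & i < ntapes then w i (h i) else 0)"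

lemma view_ost: "view (ost w xs h) = scan w h" by (auto simp: ost_def view_st look_def scan_def fun_eq_iff word_tape_def)

text \<open>The specification for printing: previous output is arbitrary and all other heads return
  to where they were. Composing programs then just concatenates their outputs.\<close>

definition emits :: "prog => contents => heads => bool list => nat => bool" where
	"emits p w h s t \<longleftrightarrow> (ALL xs. runs p (ost w xs h) t (ost w (xs @ s) h))"

lemma emits_mono: "emits p w h s t ==> t <= t' ==> emits p w h s t'" unfolding emits_def using runs_mono by blast

lemma emits_Skip: "emits Skip w h [] 1" unfolding emits_def using runs_Skip by simp

lemma emits_Seq: "emits a w h s t ==> emits b w h s' t' ==> emits (a ;; b) w h (s @ s') (t + t')"
	unfolding emits_def append_assoc[symmetric] using runs_Seq by blast

text \<open>One instruction per bit, up to a fixed bound on the length. The word \<open>g v\<close>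
  is evaluated afresh each time, which is harmless: only tape 0 changes, and its head always sees a
  blank.\<close>

fun Emit :: "(view => bool list) => nat => prog" where
	"Emit g 0 = Skip"
| "Emit g (Suc k) = Emit g k ;;
	 Op 0 (%v. if k < length (g v) then (bit_symbol (g v ! k), Rt) else (0, Stay))"

lemma wf_Emit [simp]: "wf_prog (Emit g k)" by (induction k) (auto simp: ntapes_def nsyms_def bit_symbol_def)

lemma word_tape_snoc:
	"(fst (word_tape xs))(int (length xs) := bit_symbol b) = fst (word_tape (xs @ [b]))"
	by (auto simp: word_tape_def fun_eq_iff nth_append nat_less_iff)

lemma emits_Emit:
	assumes "length (g (scan w h)) <= K"
	shows "emits (Emit g K) w h (g (scan w h)) (Suc K)"
proof -
	let ?s = "g (scan w h)"
	have "emits (Emit g k) w h (take k ?s) (Suc k)" for k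
	proof (induction k)
	case 0
	then show ?case using emits_Skip by simp
	next
	case (Suc k)
	let ?op = "Op 0 (%v. if k < length (g v) then (bit_symbol (g v ! k), Rt) else (0, Stay))"
	have op: "emits ?op w h (if k < length ?s then [?s ! k] else []) 1" unfolding emits_def
	proof
		fix xs
		let ?a = "if k < length ?s then (bit_symbol (?s ! k), Rt) else (0, Stay)"
		have r: "runs ?op (ost w xs h) 1 ((ost w xs h)(0 := act_tape ?a (ost w xs h 0)))"
			using runs_Op[of 0 "%v. if k < length (g v) then (bit_symbol (g v ! k), Rt) else (0, Stay)" "ost w xs h"] unfolding view_ost .
		have z: "(fst (word_tape xs))(int (length xs) := 0) = fst (word_tape xs)" by (auto simp: word_tape_def fun_eq_iff)
		have "(ost w xs h)(0 := act_tape ?a (ost w xs h 0)) = ost w (xs @ (if k < length ?s then [?s ! k] else [])) h"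
			by (auto simp: ost_def st_def fun_eq_iff word_tape_snoc[symmetric] z)
		with r show "runs ?op (ost w xs h) 1 (ost w (xs @ (if k < length ?s then [?s ! k] else [])) h)" by metis
	qed
	have "take k ?s @ (if k < length ?s then [?s ! k] else []) = take (Suc k) ?s" by (simp add: take_Suc_conv_app_nth)
	with emits_Seq[OF Suc op] show ?case by simp
	qed
	from this[of K] assms show ?thesis by simp
qed

fun unroll :: "nat => (nat => prog) => prog" where
	"unroll 0 b = Skip"
| "unroll (Suc k) b = unroll k b ;; b k"

lemma wf_unroll [simp]: "wf_prog (unroll k b) \<longleftrightarrow> (ALL j<k. wf_prog (b j))" by (induction k) (auto simp: less_Suc_eq)

lemma emits_unroll:
	assumes "\<And>k. k < K ==> emits (b k) w h (s k) t"
	shows "emits (unroll K b) w h (concat (map s [0..<K])) (K * t + 1)" using assms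
proof (induction K)
	case 0
	then show ?case using emits_Skip by simp
next
	case (Suc K)
	have "emits (unroll (Suc K) b) w h (concat (map s [0..<K]) @ s K) (K * t + 1 + t)"
	unfolding unroll.simps by (rule emits_Seq[OF Suc.IH]) (use Suc.prems in auto)
	then show ?case by (simp add: algebra_simps)
qed

text \<open>The loop runs over a block of nonblank cells on tape \<open>i\<close>. It ends on the
  blank behind the block, so one step back precedes the return run, which ends on the blank before
  the block and needs one step forward.\<close>

definition loop :: "nat => (nat \<times> move) list => prog => prog" where
	"loop i ms body = While (%v. v i ~= 0) (body ;; mvs ms) ;; mvs (rewind ms) ;;
	 While (%v. v i ~= 0) (mvs (rewind ms)) ;; mvs ms"

lemma wf_loop [simp]: "wf_prog (loop i ms body) \<longleftrightarrow> wf_prog body & fst ` set ms \<subseteq> {..<ntapes}" by (auto simp: loop_def)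

definition shifted :: "(nat \<times> move) list => nat => heads => heads" where
	"shifted ms k h = (%j. h j + int k * off ms j)"

lemma runs_mvs_ost:
	assumes "fst ` set ms \<subseteq> {0<..<ntapes}"
	shows "runs (mvs ms) (ost w xs h) (Suc (length ms)) (ost w xs (%j. h j + off ms j))"
proof -
	have "0 \<notin> fst ` set ms" using assms by auto
	then have "(%j. (h(0 := int (length xs))) j + off ms j) = (%j. h j + off ms j)(0 := int (length xs))" by (auto simp: off_notin)
	moreover have "fst ` set ms \<subseteq> {..<ntapes}" using assms by auto
	ultimately show ?thesis unfolding ost_def using runs_mvs by metis
qed

lemma emits_loop:
	assumes ms: "fst ` set ms \<subseteq> {0<..<ntapes}" and i: "0 < i" "i < ntapes" "off ms i = 1"
	and w: "\<And>k. k < W ==> w i (h i + int k) ~= 0" "w i (h i + int W) = 0" "w i (h i - 1) = 0"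
	and b: "\<And>k. k < W ==> emits body w (shifted ms k h) (s k) t"
	shows "emits (loop i ms body) w h (concat (map s [0..<W])) (W * (t + 2 * length ms + 4) + 2 * length ms + 4)" unfolding emits_def
proof
	fix xs
	let ?l = "length ms" and ?s = "concat (map s [0..<W])"
	let ?T = "%k. ost w (xs @ concat (map s [0..<k])) (shifted ms k h)"
	have sc: "scan w (shifted ms k h) i = w i (h i + int k)" for k using i by (simp add: scan_def shifted_def)
	have "runs (While (%v. v i ~= 0) (body ;; mvs ms)) (?T 0) (W * Suc (t + Suc ?l) + 1) (?T W)"
	proof (rule runs_While)
	fix k assume k: "k < W"
	have "runs body (?T k) t (ost w ((xs @ concat (map s [0..<k])) @ s k) (shifted ms k h))" using b[OF k] unfolding emits_def by blast
	then have "runs body (?T k) t (ost w (xs @ concat (map s [0..<Suc k])) (shifted ms k h))" by simp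
	moreover have "runs (mvs ms) (ost w (xs @ concat (map s [0..<Suc k])) (shifted ms k h)) (Suc ?l) (?T (Suc k))"
	proof -
		have "(%j. shifted ms k h j + off ms j) = shifted ms (Suc k) h" by (auto simp: shifted_def fun_eq_iff algebra_simps)
		then show ?thesis using runs_mvs_ost[OF ms] by metis
	qed
	ultimately have "runs (body ;; mvs ms) (?T k) (t + Suc ?l) (?T (Suc k))" by (rule runs_Seq)
	then show "view (?T k) i ~= 0 & runs (body ;; mvs ms) (?T k) (t + Suc ?l) (?T (Suc k))" using w(1)[OF k] by (simp add: view_ost sc)
	next
	show "~ view (?T W) i ~= 0" using w(2) by (simp add: view_ost sc)
	qed
	moreover have "?T 0 = ost w xs h" by (simp add: shifted_def)
	ultimately have 1: "runs (While (%v. v i ~= 0) (body ;; mvs ms)) (ost w xs h) (W * Suc (t + Suc ?l) + 1) (?T W)" by simp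
	let ?B = "%k. ost w (xs @ ?s) (%j. h j + (int W - 1 - int k) * off ms j)"
	have ms': "fst ` set (rewind ms) \<subseteq> {0<..<ntapes}" using ms by simp
	have "(%j. shifted ms W h j + off (rewind ms) j) = (%j. h j + (int W - 1 - int 0) * off ms j)" by (auto simp: shifted_def fun_eq_iff algebra_simps)
	then have 2: "runs (mvs (rewind ms)) (?T W) (Suc ?l) (?B 0)" using runs_mvs_ost[OF ms', of w "xs @ ?s" "shifted ms W h"] by simp
	have 3: "runs (While (%v. v i ~= 0) (mvs (rewind ms))) (?B 0) (W * Suc (Suc ?l) + 1) (?B W)"
	proof (rule runs_While)
	fix k assume k: "k < W"
	have "(%j. h j + (int W - 1 - int k) * off ms j + off (rewind ms) j) = (%j. h j + (int W - 1 - int (Suc k)) * off ms j)"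
		by (auto simp: fun_eq_iff algebra_simps)
	then have r: "runs (mvs (rewind ms)) (?B k) (Suc ?l) (?B (Suc k))"
		using runs_mvs_ost[OF ms', of w "xs @ ?s" "%j. h j + (int W - 1 - int k) * off ms j"] by simp
	have e: "h i + (int W - 1 - int k) = h i + int (W - 1 - k)" using k by simp
	have "w i (h i + (int W - 1 - int k)) ~= 0" unfolding e by (rule w(1)) (use k in linarith)
	moreover have "view (?B k) i = w i (h i + (int W - 1 - int k))" using i by (simp add: view_ost scan_def)
	ultimately show "view (?B k) i ~= 0 & runs (mvs (rewind ms)) (?B k) (Suc ?l) (?B (Suc k))" using r by metis
	next
	show "~ view (?B W) i ~= 0" using w(3) i by (simp add: view_ost scan_def)
	qed
	have 4: "runs (mvs ms) (?B W) (Suc ?l) (ost w (xs @ ?s) h)"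
	using runs_mvs_ost[OF ms, of w "xs @ ?s" "%j. h j + (int W - 1 - int W) * off ms j"] by simp
	have "runs (loop i ms body) (ost w xs h)
		(W * Suc (t + Suc ?l) + 1 + (Suc ?l + (W * Suc (Suc ?l) + 1 + Suc ?l))) (ost w (xs @ ?s) h)"
	unfolding loop_def by (intro runs_Seq[OF 1] runs_Seq[OF 2] runs_Seq[OF 3] 4)
	then show "runs (loop i ms body) (ost w xs h) (W * (t + 2 * ?l + 4) + 2 * ?l + 4) (ost w (xs @ ?s) h)" by (rule runs_mono) (simp add: algebra_simps)
qed

section \<open>Copying words and evaluating polynomials\<close>

fun writes :: "nat list => (view => nat \<times> move) => prog" where
	"writes [] g = Skip"
| "writes (i # is) g = Op i g ;; writes is g"

lemma wf_writes [simp]: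
	"wf_prog (writes is g) \<longleftrightarrow> set is \<subseteq> {..<ntapes} & (is ~= [] --> (ALL v. (ALL j. v j < nsyms) --> fst (g v) < nsyms))"
	by (induction "is") auto

text \<open>The action must not depend on the tapes that are being written.\<close>

lemma runs_writes:
	assumes "distinct is" "\<And>T'. (\<And>j. j \<notin> set is ==> T' j = T j) ==> g (view T') = a"
	shows "runs (writes is g) T (Suc (length is)) (%j. if j : set is then act_tape a (T j) else T j)" using assms
proof (induction "is" arbitrary: T)
	case Nil
	then show ?case using runs_Skip by simp
next
	case (Cons i "is")
	let ?T = "T(i := act_tape a (T i))"
	have "g (view T) = a" by (rule Cons.prems(2)) simp
	then have 1: "runs (Op i g) T 1 ?T" using runs_Op[of i g T] by simp
	have "runs (writes is g) ?T (Suc (length is)) (%j. if j : set is then act_tape a (?T j) else ?T j)"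
	proof (rule Cons.IH)
	show "distinct is" using Cons.prems by simp
	fix T' :: mem assume "\<And>j. j \<notin> set is ==> T' j = ?T j"
	then show "g (view T') = a" by (intro Cons.prems(2)) auto
	qed
	from runs_Seq[OF 1 this]
	have "runs (writes (i # is) g) T (1 + Suc (length is)) (%j. if j : set is then act_tape a (?T j) else ?T j)" by simp
	moreover have "(%j. if j : set is then act_tape a (?T j) else ?T j) =
		(%j. if j : set (i # is) then act_tape a (T j) else T j)" using Cons.prems(1) by (auto simp: fun_eq_iff)
	ultimately show ?case by simp
qed

text \<open>The source is erased while being read, since tape 0 must be blank to receive the output.
  The way back is therefore measured on a copy.\<close>

definition transfer :: "nat => nat list => prog" where
	"transfer i is = While (%v. v i ~= 0) (writes is (%v. (v i, Rt)) ;; Op i (%v. (0, Rt))) ;;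
	 mvs (map (%j. (j, Lt)) (i # is)) ;;
	 While (%v. v (hd is) ~= 0) (mvs (map (%j. (j, Lt)) (i # is))) ;;
	 mvs (map (%j. (j, Rt)) (i # is))"

lemma wf_transfer: "i < ntapes ==> set is \<subseteq> {..<ntapes} ==> wf_prog (transfer i is)" by (auto simp: transfer_def nsyms_def)

lemma off_map:
	"distinct js ==> off (map (%j. (j, d)) js) k = (if k : set js then offset d else 0)" by (induction js) auto

lemma word_tape_nonblank: "fst (word_tape x) p ~= 0 \<longleftrightarrow> 0 <= p & p < int (length x)" by (auto simp: word_tape_def bit_symbol_def)

lemma runs_transfer:
	assumes d: "distinct (i # is)" "is ~= []" "set (i # is) \<subseteq> {..<ntapes}"
	and T: "T i = word_tape x" "\<And>j. j : set is ==> T j = word_tape []"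
	shows "runs (transfer i is) T ((length x + 1) * (2 * length is + 9) + 2 * length is + 9)
	(%j. if j = i then word_tape [] else if j : set is then word_tape x else T j)"
proof -
	let ?n = "length x" and ?l = "length is"
	define wx where "wx = fst (word_tape x)"
	have wx: "wx p ~= 0 \<longleftrightarrow> 0 <= p & p < int ?n" for p unfolding wx_def by (rule word_tape_nonblank)
	have wt: "word_tape x = (wx, 0)" "word_tape [] = (%p. 0, 0)" by (auto simp: wx_def word_tape_def fun_eq_iff)
	let ?A = "%k j. if j = i then (%p. if int k <= p then wx p else 0, int k)
	 else if j : set is then (%p. if p < int k then wx p else 0, int k) else T j"
	have i: "i < ntapes" using d by simp
	have vi: "view (?A k) i = wx (int k)" for k using i by (simp add: view_def)
	have neg: "wx p = 0" if "p < 0" for p using wx[of p] that by linarith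
	have ge: "wx p = 0" if "int ?n <= p" for p using wx[of p] that by linarith
	have z0: "(%p. if int 0 <= p then wx p else 0) = wx" "(%p. if p < int 0 then wx p else 0) = (%p. 0)" using neg by (simp_all add: fun_eq_iff not_le)
	have A0: "?A 0 = T"
	proof
	fix j show "?A 0 j = T j" unfolding z0 using T[unfolded wt] by (cases "j = i"; cases "j : set is") simp_all
	qed
	have 1: "runs (While (%v. v i ~= 0) (writes is (%v. (v i, Rt)) ;; Op i (%v. (0, Rt))))
		(?A 0) (?n * Suc (Suc ?l + 1) + 1) (?A ?n)"
	proof (rule runs_While)
	fix k assume k: "k < ?n"
	let ?a = "(wx (int k), Rt)"
	let ?M = "%j. if j : set is then act_tape ?a (?A k j) else ?A k j"
	have "runs (writes is (%v. (v i, Rt))) (?A k) (Suc ?l) ?M"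
	proof (rule runs_writes)
		fix T' :: mem assume "\<And>j. j \<notin> set is ==> T' j = ?A k j"
		then have "T' i = ?A k i" using d by simp
		then have "view T' i = view (?A k) i" by (simp only: view_def)
		then show "(view T' i, Rt) = ?a" by (simp only: vi)
	qed (use d in simp)
	moreover have "runs (Op i (%v. (0, Rt))) ?M 1 (?A (Suc k))"
	proof -
		have c: "(%p. if int k <= p then wx p else 0)(int k := 0) = (%p. if int (Suc k) <= p then wx p else 0)"
			"(%p. if p < int k then wx p else 0)(int k := wx (int k)) = (%p. if p < int (Suc k) then wx p else 0)" by (auto simp: fun_eq_iff)
		have "(?M(i := act_tape (0, Rt) (?M i))) j = ?A (Suc k) j" for j
		proof (cases "j = i")
			case True
			then show ?thesis using d c(1) by simp
		next
			case False
			then show ?thesis using c(2) by simp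
		qed
		then have "?M(i := act_tape (0, Rt) (?M i)) = ?A (Suc k)" by (rule ext)
		then show ?thesis using runs_Op[of i "%v. (0, Rt)" ?M] by metis
	qed
	ultimately have "runs (writes is (%v. (v i, Rt)) ;; Op i (%v. (0, Rt))) (?A k) (Suc ?l + 1) (?A (Suc k))" by (rule runs_Seq)
	moreover have "view (?A k) i ~= 0" unfolding vi wx using k by simp
	ultimately show "view (?A k) i ~= 0 & runs (writes is (%v. (v i, Rt)) ;; Op i (%v. (0, Rt))) (?A k) (Suc ?l + 1) (?A (Suc k))"
		by blast
	next
	show "~ view (?A ?n) i ~= 0" unfolding vi wx by simp
	qed
	let ?w = "%j. if j = i then (%p. 0) else if j : set is then wx else fst (T j)"
	let ?h = "%p j. if j = i | j : set is then p else snd (T j)"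
	have An: "?A ?n = st ?w (?h (int ?n))"
	proof
	fix j
	have "(%p. if int ?n <= p then wx p else 0) = (%p. 0)"
		"(%p. if p < int ?n then wx p else 0) = wx" using ge by (simp_all add: fun_eq_iff not_less)
	then show "?A ?n j = st ?w (?h (int ?n)) j" by (cases "j = i"; cases "j : set is") (simp_all add: st_def)
	qed
	have mv: "runs (mvs (map (%j. (j, m)) (i # is))) (st ?w (?h p)) (?l + 2) (st ?w (?h (p + offset m)))" for p m
	proof -
	have "fst ` set (map (%j. (j, m)) (i # is)) \<subseteq> {..<ntapes}" using d(3) by auto
	from runs_mvs[OF this, of ?w "?h p"]
	have "runs (mvs (map (%j. (j, m)) (i # is))) (st ?w (?h p)) (?l + 2)
		 (st ?w (%j. ?h p j + off (map (%j. (j, m)) (i # is)) j))" by simp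
	moreover have "(%j. ?h p j + off (map (%j. (j, m)) (i # is)) j) = ?h (p + offset m)" unfolding off_map[OF d(1)] by (auto simp: fun_eq_iff)
	ultimately show ?thesis by simp
	qed
	have hd: "hd is : set is" "hd is ~= i" "hd is < ntapes" using d by (cases "is"; auto)+
	have vh: "view (st ?w (?h p)) (hd is) = wx p" for p using hd by (simp add: view_st look_def)
	have 2: "runs (mvs (map (%j. (j, Lt)) (i # is))) (?A ?n) (?l + 2) (st ?w (?h (int ?n - 1 - int 0)))"
	proof -
	have e: "int ?n + offset Lt = int ?n - 1 - int 0" by simp
	show ?thesis unfolding An using mv[of Lt "int ?n"] unfolding e .
	qed
	have 3: "runs (While (%v. v (hd is) ~= 0) (mvs (map (%j. (j, Lt)) (i # is))))
		(st ?w (?h (int ?n - 1 - int 0))) (?n * Suc (?l + 2) + 1) (st ?w (?h (int ?n - 1 - int ?n)))"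
	proof (rule runs_While[where T = "%k. st ?w (?h (int ?n - 1 - int k))"])
	fix k assume "k < ?n"
	then have "view (st ?w (?h (int ?n - 1 - int k))) (hd is) ~= 0" unfolding vh wx by linarith
	moreover have "int ?n - 1 - int k + offset Lt = int ?n - 1 - int (Suc k)" by simp
	ultimately show "view (st ?w (?h (int ?n - 1 - int k))) (hd is) ~= 0 &
		runs (mvs (map (%j. (j, Lt)) (i # is))) (st ?w (?h (int ?n - 1 - int k))) (?l + 2)
			 (st ?w (?h (int ?n - 1 - int (Suc k))))" using mv[of Lt "int ?n - 1 - int k"] by metis
	next
	show "~ view (st ?w (?h (int ?n - 1 - int ?n))) (hd is) ~= 0" unfolding vh wx by linarith
	qed
	have 4: "runs (mvs (map (%j. (j, Rt)) (i # is))) (st ?w (?h (int ?n - 1 - int ?n))) (?l + 2) (st ?w (?h 0))"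
	proof -
	have e: "int ?n - 1 - int ?n + offset Rt = 0" by simp
	show ?thesis using mv[of Rt "int ?n - 1 - int ?n"] unfolding e .
	qed
	have E: "st ?w (?h 0) = (%j. if j = i then word_tape [] else if j : set is then word_tape x else T j)" unfolding wt by (rule ext) (simp add: st_def)
	have "runs (transfer i is) T (?n * Suc (Suc ?l + 1) + 1 + (?l + 2 + (?n * Suc (?l + 2) + 1 + (?l + 2)))) (st ?w (?h 0))"
	unfolding transfer_def by (intro runs_Seq[OF 1[unfolded A0]] runs_Seq[OF 2] runs_Seq[OF 3] 4)
	then show ?thesis unfolding E by (rule runs_mono) (simp add: algebra_simps)
qed

text \<open>A tape that is blank up to a mark 1 at cell 0 serves as a counter, its value being the position of
	the head. Tapes 4 and 5 are counters, and tape 2 holds a word.\<close>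

definition counter :: "int => nat" where
	"counter p = (if p = 0 then 1 else 0)"

text \<open>A Horner step. Tape 4 is counted down, and each unit adds the length of the word on tape
  2 to tape 5; after adding \<open>c\<close>, tape 5 is poured back into tape 4.\<close>

definition mul_add :: "nat => prog" where
	"mul_add c =
	 While (%v. v 4 ~= 1) (Mv 4 Lt ;; While (%v. v 2 ~= 0) (mvs [(2, Rt), (5, Rt)]) ;;
		 Mv 2 Lt ;; While (%v. v 2 ~= 0) (Mv 2 Lt) ;; Mv 2 Rt) ;;
	 mvs (replicate c (5, Rt)) ;;
	 While (%v. v 5 ~= 1) (mvs [(5, Lt), (4, Rt)])"

lemma wf_mul_add [simp]: "wf_prog (mul_add c)" by (auto simp: mul_add_def ntapes_def)

lemma off_replicate: "off (replicate c (i, d)) j = (if i = j then int c * offset d else 0)" by (induction c) (auto simp: algebra_simps)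

lemma runs_mul_add:
	assumes w: "w 2 = fst (word_tape x)" "w 4 = counter" "w 5 = counter"
	and h: "h 2 = 0" "h 4 = int a" "h 5 = 0" and n: "n = length x"
	shows "runs (mul_add c) (st w h) (a * (12 * n + 12) + 6 * c + 12) (st w (h(4 := int (a * n + c))))"
proof -
	let ?n = "length x"
	let ?H = "%p q r. h(2 := p, 4 := q, 5 := r)"
	have look: "look w (?H p q r) 2 = fst (word_tape x) p" "look w (?H p q r) 4 = counter q" "look w (?H p q r) 5 = counter r" for p q r
	using w by (simp_all add: look_def ntapes_def)
	have mv: "runs (Mv 2 d) (st w (?H p q r)) 1 (st w (?H (p + offset d) q r))"
	"runs (Mv 4 d) (st w (?H p q r)) 1 (st w (?H p (q + offset d) r))" for d p q r
	using runs_Mv[of 2 d w "?H p q r"] runs_Mv[of 4 d w "?H p q r"] by (simp_all add: ntapes_def fun_upd_twist)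
	have ms: "runs (mvs [(2, Rt), (5, Rt)]) (st w (?H p q r)) 3 (st w (?H (p + 1) q (r + 1)))"
	"runs (mvs [(5, Lt), (4, Rt)]) (st w (?H p q r)) 3 (st w (?H p (q + 1) (r - 1)))"
	"runs (mvs (replicate c (5, Rt))) (st w (?H p q r)) (Suc c) (st w (?H p q (r + int c)))" for p q r
	proof -
	have "(%j. ?H p q r j + off [(2, Rt), (5, Rt)] j) = ?H (p + 1) q (r + 1)"
		"(%j. ?H p q r j + off [(5, Lt), (4, Rt)] j) = ?H p (q + 1) (r - 1)"
		"(%j. ?H p q r j + off (replicate c (5, Rt)) j) = ?H p q (r + int c)" by (auto simp: fun_eq_iff off_replicate)
	moreover have "fst ` set [(2::nat, Rt), (5, Rt)] \<subseteq> {..<ntapes}"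
		"fst ` set [(5::nat, Lt), (4, Rt)] \<subseteq> {..<ntapes}"
		"fst ` set (replicate c (5::nat, Rt)) \<subseteq> {..<ntapes}" by (auto simp: ntapes_def)
	ultimately show "runs (mvs [(2, Rt), (5, Rt)]) (st w (?H p q r)) 3 (st w (?H (p + 1) q (r + 1)))"
		"runs (mvs [(5, Lt), (4, Rt)]) (st w (?H p q r)) 3 (st w (?H p (q + 1) (r - 1)))"
		"runs (mvs (replicate c (5, Rt))) (st w (?H p q r)) (Suc c) (st w (?H p q (r + int c)))"
		using runs_mvs[of "[(2, Rt), (5, Rt)]" w "?H p q r"]
			runs_mvs[of "[(5, Lt), (4, Rt)]" w "?H p q r"]
			runs_mvs[of "replicate c (5, Rt)" w "?H p q r"]
		by (simp_all only: list.size length_replicate numeral_3_eq_3 add_0_right add_Suc_right)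
	qed
	let ?body = "Mv 4 Lt ;; While (%v. v 2 ~= 0) (mvs [(2, Rt), (5, Rt)]) ;;
		 Mv 2 Lt ;; While (%v. v 2 ~= 0) (Mv 2 Lt) ;; Mv 2 Rt"
	have body: "runs ?body (st w (?H 0 q r)) (1 + (n * 4 + 1 + (1 + (n * 2 + 1 + 1)))) (st w (?H 0 (q - 1) (r + int n)))" for q r
	proof -
	have 1: "runs (Mv 4 Lt) (st w (?H 0 q r)) 1 (st w (?H (int 0) (q - 1) (r + int 0)))" using mv(2)[of Lt 0 q r] by simp
	have 2: "runs (While (%v. v 2 ~= 0) (mvs [(2, Rt), (5, Rt)])) (st w (?H (int 0) (q - 1) (r + int 0)))
		(?n * Suc 3 + 1) (st w (?H (int ?n) (q - 1) (r + int ?n)))"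
	proof (rule runs_While[where T = "%k. st w (?H (int k) (q - 1) (r + int k))"])
		fix k assume "k < ?n"
		then have "look w (?H (int k) (q - 1) (r + int k)) 2 ~= 0" unfolding look word_tape_nonblank by simp
		moreover have "int k + 1 = int (Suc k)" "r + int k + 1 = r + int (Suc k)" by simp_all
		ultimately show "view (st w (?H (int k) (q - 1) (r + int k))) 2 ~= 0 &
			runs (mvs [(2, Rt), (5, Rt)]) (st w (?H (int k) (q - 1) (r + int k))) 3 (st w (?H (int (Suc k)) (q - 1) (r + int (Suc k))))"
			using ms(1)[of "int k" "q - 1" "r + int k"] unfolding view_st by metis
	next
		show "~ view (st w (?H (int ?n) (q - 1) (r + int ?n))) 2 ~= 0" unfolding view_st look word_tape_nonblank by simp
	qed
	have 3: "runs (Mv 2 Lt) (st w (?H (int ?n) (q - 1) (r + int ?n))) 1 (st w (?H (int ?n - 1 - int 0) (q - 1) (r + int ?n)))"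
		using mv(1)[of Lt "int ?n"] by simp
	have 4: "runs (While (%v. v 2 ~= 0) (Mv 2 Lt)) (st w (?H (int ?n - 1 - int 0) (q - 1) (r + int ?n)))
		(?n * Suc 1 + 1) (st w (?H (int ?n - 1 - int ?n) (q - 1) (r + int ?n)))"
	proof (rule runs_While[where T = "%k. st w (?H (int ?n - 1 - int k) (q - 1) (r + int ?n))"])
		fix k assume "k < ?n"
		then have "look w (?H (int ?n - 1 - int k) (q - 1) (r + int ?n)) 2 ~= 0" unfolding look word_tape_nonblank by linarith
		moreover have "int ?n - 1 - int k + offset Lt = int ?n - 1 - int (Suc k)" by simp
		ultimately show "view (st w (?H (int ?n - 1 - int k) (q - 1) (r + int ?n))) 2 ~= 0 &
			runs (Mv 2 Lt) (st w (?H (int ?n - 1 - int k) (q - 1) (r + int ?n))) 1 (st w (?H (int ?n - 1 - int (Suc k)) (q - 1) (r + int ?n)))"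
			using mv(1)[of Lt "int ?n - 1 - int k"] unfolding view_st by metis
	next
		show "~ view (st w (?H (int ?n - 1 - int ?n) (q - 1) (r + int ?n))) 2 ~= 0" unfolding view_st look word_tape_nonblank by linarith
	qed
	have 5: "runs (Mv 2 Rt) (st w (?H (int ?n - 1 - int ?n) (q - 1) (r + int ?n))) 1 (st w (?H 0 (q - 1) (r + int ?n)))"
		using mv(1)[of Rt "-1"] by simp
	have "runs ?body (st w (?H 0 q r)) (1 + (?n * Suc 3 + 1 + (1 + (?n * Suc 1 + 1 + 1)))) (st w (?H 0 (q - 1) (r + int ?n)))"
		by (intro runs_Seq[OF 1] runs_Seq[OF 2] runs_Seq[OF 3] runs_Seq[OF 4] 5)
	then show ?thesis unfolding n by (rule runs_mono) simp
	qed
	let ?t = "1 + (n * 4 + 1 + (1 + (n * 2 + 1 + 1)))"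
	have 1: "runs (While (%v. v 4 ~= 1) ?body) (st w (?H 0 (int a - int 0) (int (0 * n)))) (a * Suc ?t + 1)
		(st w (?H 0 (int a - int a) (int (a * n))))"
	proof (rule runs_While[where T = "%k. st w (?H 0 (int a - int k) (int (k * n)))"])
	fix k assume "k < a"
	then have "look w (?H 0 (int a - int k) (int (k * n))) 4 ~= 1" unfolding look counter_def by simp
	moreover have "int a - int k - 1 = int a - int (Suc k)" "int (k * n) + int n = int (Suc k * n)" by simp_all
	ultimately show "view (st w (?H 0 (int a - int k) (int (k * n)))) 4 ~= 1 &
		runs ?body (st w (?H 0 (int a - int k) (int (k * n)))) ?t (st w (?H 0 (int a - int (Suc k)) (int (Suc k * n))))"
		using body[of "int a - int k" "int (k * n)"] unfolding view_st by metis
	next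
	show "~ view (st w (?H 0 (int a - int a) (int (a * n)))) 4 ~= 1" unfolding view_st look counter_def by simp
	qed
	have 2: "runs (mvs (replicate c (5, Rt))) (st w (?H 0 (int a - int a) (int (a * n)))) (Suc c)
	 (st w (?H 0 (int 0) (int (a * n + c) - int 0)))" using ms(3)[of 0 0 "int (a * n)"] by simp
	have 3: "runs (While (%v. v 5 ~= 1) (mvs [(5, Lt), (4, Rt)])) (st w (?H 0 (int 0) (int (a * n + c) - int 0)))
	 ((a * n + c) * Suc 3 + 1) (st w (?H 0 (int (a * n + c)) (int (a * n + c) - int (a * n + c))))"
	proof (rule runs_While[where T = "%k. st w (?H 0 (int k) (int (a * n + c) - int k))"])
	fix k assume "k < a * n + c"
	then have "look w (?H 0 (int k) (int (a * n + c) - int k)) 5 ~= 1" unfolding look counter_def by (simp del: of_nat_add of_nat_mult)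
	moreover have "int k + 1 = int (Suc k)" "int (a * n + c) - int k - 1 = int (a * n + c) - int (Suc k)" by simp_all
	ultimately show "view (st w (?H 0 (int k) (int (a * n + c) - int k))) 5 ~= 1 &
		runs (mvs [(5, Lt), (4, Rt)]) (st w (?H 0 (int k) (int (a * n + c) - int k))) 3
			(st w (?H 0 (int (Suc k)) (int (a * n + c) - int (Suc k))))" using ms(2)[of 0 "int k" "int (a * n + c) - int k"] unfolding view_st by metis
	next
	show "~ view (st w (?H 0 (int (a * n + c)) (int (a * n + c) - int (a * n + c)))) 5 ~= 1" unfolding view_st look counter_def by simp
	qed
	have H0: "?H 0 (int a - int 0) (int (0 * n)) = h" using h by (auto simp: fun_eq_iff)
	have H1: "?H 0 (int (a * n + c)) (int (a * n + c) - int (a * n + c)) = h(4 := int (a * n + c))" using h by (auto simp: fun_eq_iff)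
	have "runs (mul_add c) (st w h) (a * Suc ?t + 1 + (Suc c + ((a * n + c) * Suc 3 + 1)))
		(st w (h(4 := int (a * n + c))))" using runs_Seq[OF 1 runs_Seq[OF 2 3]] unfolding H0 H1 mul_add_def .
	then show ?thesis by (rule runs_mono) (simp add: algebra_simps)
qed

text \<open>Horner's scheme: the value of \<open>pCons c p\<close> arises from that of
  \<open>p\<close> by one \<open>mul_add c\<close>, and the bound on its time is again a polynomial
  in the length.\<close>

lemma poly_program:
	fixes p :: "nat poly"
	obtains prog and tp :: "nat poly" where "wf_prog prog"
	"\<And>w h x. w 2 = fst (word_tape x) ==> w 4 = counter ==> w 5 = counter ==> h 2 = 0 ==> h 4 = 0 ==> h 5 = 0 ==>
		 runs prog (st w h) (poly tp (length x)) (st w (h(4 := int (poly p (length x)))))"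
proof -
	have "EX prog (tp :: nat poly). wf_prog prog &
	(ALL w h x. w 2 = fst (word_tape x) --> w 4 = counter --> w 5 = counter --> h 2 = 0 --> h 4 = 0 --> h 5 = 0 -->
		 runs prog (st w h) (poly tp (length x)) (st w (h(4 := int (poly p (length x))))))"
	proof (induction p)
	case 0
	have "runs Skip (st w h) (poly 1 (length x)) (st w (h(4 := int (poly 0 (length x)))))" if "h 4 = 0" for w h x
	proof -
		have "h(4 := 0) = h" using that by auto
		then show ?thesis using runs_Skip by simp
	qed
	then show ?case using wf_Skip by blast
	next
	case (pCons c p)
	then obtain prog tp where pr: "wf_prog prog"
		"\<And>w h x. w 2 = fst (word_tape x) ==> w 4 = counter ==> w 5 = counter ==> h 2 = 0 ==> h 4 = 0 ==> h 5 = 0 ==>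
			 runs prog (st w h) (poly tp (length x)) (st w (h(4 := int (poly p (length x)))))" by metis
	let ?tp = "tp + (p * [:12, 12:] + [:6 * c + 12:])"
	have "runs (prog ;; mul_add c) (st w h) (poly ?tp (length x)) (st w (h(4 := int (poly (pCons c p) (length x)))))"
		if w: "w 2 = fst (word_tape x)" "w 4 = counter" "w 5 = counter" and h: "h 2 = 0" "h 4 = 0" "h 5 = 0" for w h and x
	proof -
		let ?a = "poly p (length x)"
		let ?h = "h(4 := int ?a)"
		have "runs (mul_add c) (st w ?h) (?a * (12 * length x + 12) + 6 * c + 12) (st w (?h(4 := int (?a * length x + c))))"
			by (rule runs_mul_add[OF w]) (use h in simp_all)
		from runs_Seq[OF pr(2)[OF w h] this]
		have "runs (prog ;; mul_add c) (st w h) (poly tp (length x) + (?a * (12 * length x + 12) + 6 * c + 12))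
			(st w (?h(4 := int (?a * length x + c))))" .
		moreover have "?a * length x + c = poly (pCons c p) (length x)" by (simp add: algebra_simps)
		moreover have "poly ?tp (length x) = poly tp (length x) + (?a * (12 * length x + 12) + 6 * c + 12)" by (simp add: algebra_simps)
		ultimately show ?thesis by (simp only: fun_upd_upd)
	qed
	moreover have "wf_prog (prog ;; mul_add c)" using pr(1) by simp
	ultimately show ?case by blast
	qed
	then show thesis using that by blast
qed

section \<open>Setting up the tapes of the reduction\<close>

text \<open>Tape 2 holds the input, tape 3 a block of marks as long as certificates may be, tapes 4 and 5 are
	counters; tapes 6 to 13 bear the zones of a line of positions and drive loops, and tapes 14 to 17
	are read at the difference of two positions.\<close>

definition zone_tape :: "nat => int => nat" where
	"zone_tape N p = (if - int N <= p & p <= int N then zone N (nat (p + int N)) else 0)"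

definition diff_tape :: "int => nat" where
	"diff_tape p = (if p = - 1 then 1 else if p = 0 then 2 else if p = 1 then 3 else 0)"

definition marks :: "nat => int => nat" where
	"marks q p = (if 0 <= p & p < int q then 1 else 0)"

definition work_tapes :: "bool list => nat => nat => contents" where
	"work_tapes x q N i = (if i = 2 then fst (word_tape x) else if i = 3 then marks q
	 else if i = 4 | i = 5 then counter else if 6 <= i & i <= 13 then zone_tape N
	 else if 14 <= i & i <= 17 then diff_tape else (%p. 0))"

definition work_heads :: "nat => heads" where
	"work_heads N i = (if i = 2 | i = 3 | 6 <= i & i <= 13 then - int N else 0)"

definition drivers :: "nat list" where "drivers = [6, 7, 8, 9, 10, 11, 12, 13]"

definition differences :: "nat list" where "differences = [14, 15, 16, 17]"

lemma drivers: "distinct drivers" "set drivers \<subseteq> {..<ntapes}" "i : set drivers \<longleftrightarrow> 6 <= i & i <= 13" "length drivers = 8"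
	and differences: "distinct differences" "set differences \<subseteq> {..<ntapes}" "i : set differences \<longleftrightarrow> 14 <= i & i <= 17" "length differences = 4"
	by (auto simp: drivers_def differences_def ntapes_def)

lemma runs_writes_st:
	assumes "distinct is"
	shows "runs (writes is (%v. (s, d))) (st w h) (Suc (length is))
	(st (%i. if i : set is then (w i)(h i := s) else w i) (%i. if i : set is then h i + offset d else h i))"
proof -
	have "runs (writes is (%v. (s, d))) (st w h) (Suc (length is))
		(%j. if j : set is then act_tape (s, d) (st w h j) else st w h j)" by (rule runs_writes) (use assms in auto)
	moreover have "(%j. if j : set is then act_tape (s, d) (st w h j) else st w h j) =
		st (%i. if i : set is then (w i)(h i := s) else w i) (%i. if i : set is then h i + offset d else h i)" by (auto simp: st_def fun_eq_iff)
	ultimately show ?thesis by simp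
qed

lemma runs_Op_st:
	"runs (Op i (%v. (s, d))) (st w h) 1 (st (w(i := (w i)(h i := s))) (h(i := h i + offset d)))"
proof -
	have "(st w h)(i := act_tape (s, d) (st w h i)) = st (w(i := (w i)(h i := s))) (h(i := h i + offset d))" by (auto simp: st_def fun_eq_iff)
	then show ?thesis using runs_Op[of i "%v. (s, d)" "st w h"] by metis
qed

lemma runs_mvs_to:
	assumes "fst ` set ms \<subseteq> {..<ntapes}" "h' = (%j. h j + off ms j)" "t = Suc (length ms)"
	shows "runs (mvs ms) (st w h) t (st w h')" using runs_mvs[OF assms(1)] assms(2,3) by simp

definition marking :: prog where
	"marking = While (%v. v 4 ~= 1) (Mv 4 Lt ;; Op 3 (%v. (1, Rt))) ;; Mv 3 Lt ;;
	 While (%v. v 3 ~= 0) (Mv 3 Lt) ;; Mv 3 Rt"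

lemma runs_marking:
	assumes w: "w 3 = (%p. 0)" "w 4 = counter" and h: "h 3 = 0" "h 4 = int q"
	shows "runs marking (st w h) (6 * q + 6) (st (w(3 := marks q)) (h(4 := 0)))"
proof -
	have r1: "runs (While (%v. v 4 ~= 1) (Mv 4 Lt ;; Op 3 (%v. (1, Rt))))
	 (st (w(3 := marks 0)) (h(3 := int 0, 4 := int q - int 0))) (q * Suc (1 + 1) + 1)
	 (st (w(3 := marks q)) (h(3 := int q, 4 := int q - int q)))"
	proof (rule runs_While[where T = "%k. st (w(3 := marks k)) (h(3 := int k, 4 := int q - int k))"])
	fix k assume k: "k < q"
	let ?h = "h(3 := int k, 4 := int q - int k)"
	have "runs (Mv 4 Lt) (st (w(3 := marks k)) ?h) 1 (st (w(3 := marks k)) (?h(4 := ?h 4 + offset Lt)))"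
		by (rule runs_Mv) (simp add: ntapes_def)
	moreover have "runs (Op 3 (%v. (1, Rt))) (st (w(3 := marks k)) (?h(4 := ?h 4 + offset Lt))) 1
			(st (w(3 := marks (Suc k))) (h(3 := int (Suc k), 4 := int q - int (Suc k))))"
	proof -
		let ?w = "w(3 := marks k)" and ?g = "?h(4 := ?h 4 + offset Lt)"
		have "?w(3 := (?w 3)(?g 3 := 1)) = w(3 := marks (Suc k))" by (auto simp: fun_eq_iff marks_def)
		moreover have "?g(3 := ?g 3 + offset Rt) = h(3 := int (Suc k), 4 := int q - int (Suc k))" by (auto simp: fun_eq_iff)
		ultimately show ?thesis using runs_Op_st[of 3 1 Rt ?w ?g] by metis
	qed
	ultimately have "runs (Mv 4 Lt ;; Op 3 (%v. (1, Rt))) (st (w(3 := marks k)) ?h) (1 + 1)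
			(st (w(3 := marks (Suc k))) (h(3 := int (Suc k), 4 := int q - int (Suc k))))" by (rule runs_Seq)
	then show "view (st (w(3 := marks k)) ?h) 4 ~= 1 & runs (Mv 4 Lt ;; Op 3 (%v. (1, Rt))) (st (w(3 := marks k)) ?h) (1 + 1)
			(st (w(3 := marks (Suc k))) (h(3 := int (Suc k), 4 := int q - int (Suc k))))" using k w by (simp add: view_st look_def ntapes_def counter_def)
	next
	show "~ view (st (w(3 := marks q)) (h(3 := int q, 4 := int q - int q))) 4 ~= 1" using w by (simp add: view_st look_def ntapes_def counter_def)
	qed
	let ?w = "w(3 := marks q)" and ?H = "%p. h(3 := p, 4 := 0)"
	have mv: "runs (Mv 3 d) (st ?w (?H p)) 1 (st ?w (?H (p + offset d)))" for d p
	proof -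
	have "(?H p)(3 := ?H p 3 + offset d) = ?H (p + offset d)" by (auto simp: fun_eq_iff)
	moreover have "3 < ntapes" by (simp add: ntapes_def)
	ultimately show ?thesis using runs_Mv[where i = 3 and w = ?w and h = "?H p" and d = d] by simp
	qed
	have v3: "view (st ?w (?H p)) 3 = marks q p" for p by (simp add: view_st look_def ntapes_def)
	have r2: "runs (Mv 3 Lt) (st ?w (?H (int q))) 1 (st ?w (?H (int q - 1 - int 0)))" using mv[of Lt "int q"] by simp
	have r3: "runs (While (%v. v 3 ~= 0) (Mv 3 Lt)) (st ?w (?H (int q - 1 - int 0))) (q * Suc 1 + 1) (st ?w (?H (int q - 1 - int q)))"
	proof (rule runs_While[where T = "%k. st ?w (?H (int q - 1 - int k))"])
	fix k assume "k < q"
	moreover have "int q - 1 - int k + offset Lt = int q - 1 - int (Suc k)" by simp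
	ultimately show "view (st ?w (?H (int q - 1 - int k))) 3 ~= 0 &
			runs (Mv 3 Lt) (st ?w (?H (int q - 1 - int k))) 1 (st ?w (?H (int q - 1 - int (Suc k))))"
		unfolding v3 using mv[of Lt "int q - 1 - int k"] by (simp add: marks_def)
	next
	show "~ view (st ?w (?H (int q - 1 - int q))) 3 ~= 0" unfolding v3 by (simp add: marks_def)
	qed
	have r4: "runs (Mv 3 Rt) (st ?w (?H (int q - 1 - int q))) 1 (st ?w (?H 0))" using mv[of Rt "-1"] by simp
	have e: "w(3 := marks 0) = w" "h(3 := int 0, 4 := int q - int 0) = h" "h(3 := int q, 4 := int q - int q) = ?H (int q)"
		"?H 0 = h(4 := 0)" using w h by (auto simp: fun_eq_iff marks_def)
	have "runs marking (st w h) (q * Suc (1 + 1) + 1 + (1 + (q * Suc 1 + 1 + 1))) (st ?w (?H 0))"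
	unfolding marking_def by (intro runs_Seq[OF r1[unfolded e]] runs_Seq[OF r2] runs_Seq[OF r3] r4)
	then show ?thesis unfolding e by (rule runs_mono) simp
qed

text \<open>The number \<open>N\<close> is used three times by pouring it between tapes 4 and 5: for
  \<open>N\<close> cells to the right of the centre, for the way back, and for \<open>N\<close>
  cells to the left. The outermost cells are overwritten by 5 and 4. On the last pass tapes 2 and 3
  are moved along, so that all these heads start at position 0 of the line.\<close>

definition ruling :: prog where
	"ruling = writes drivers (%v. (1, Rt)) ;;
	 While (%v. v 4 ~= 1) (mvs [(4, Lt), (5, Rt)] ;; writes drivers (%v. (3, Rt))) ;;
	 mvs (map (%j. (j, Lt)) drivers) ;; writes drivers (%v. (5, Lt)) ;;
	 While (%v. v 5 ~= 1) (mvs ([(5, Lt), (4, Rt)] @ map (%j. (j, Lt)) drivers)) ;;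
	 While (%v. v 4 ~= 1) (mvs [(4, Lt), (2, Lt), (3, Lt)] ;; writes drivers (%v. (2, Lt))) ;;
	 mvs (map (%j. (j, Rt)) drivers) ;; writes drivers (%v. (4, Stay))"

lemma off_append: "off (ms @ ms') j = off ms j + off ms' j" by (induction ms rule: mvs.induct) auto

lemma runs_ruling:
	fixes w h
	defines "A \<equiv> %c p a b r. st (%i. if 6 <= i & i <= 13 then c else w i)
	 (%i. if 6 <= i & i <= 13 then p else if i = 4 then a else if i = 5 then b else if i = 2 | i = 3 then r else h i)"
	assumes w: "w 4 = counter" "w 5 = counter" and N: "1 < N"
	shows "runs ruling (A (%p. 0) 0 (int N) 0 0) (50 * N + 50) (A (zone_tape N) (- int N) 0 0 (- int N))"
proof -
	have wr: "runs (writes drivers (%v. (s, d))) (A c p a b r) 9 (A (c(p := s)) (p + offset d) a b r)" for s d c p a b r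
	proof -
	let ?w = "%i. if 6 <= i & i <= 13 then c else w i"
	let ?h = "%i. if 6 <= i & i <= 13 then p else if i = 4 then a else if i = 5 then b else if i = 2 | i = 3 then r else h i"
	have "(%i. if i : set drivers then (?w i)(?h i := s) else ?w i) = (%i. if 6 <= i & i <= 13 then c(p := s) else w i)"
		"(%i. if i : set drivers then ?h i + offset d else ?h i) =
			(%i. if 6 <= i & i <= 13 then p + offset d else if i = 4 then a else if i = 5 then b else if i = 2 | i = 3 then r else h i)"
		unfolding drivers(3) by (auto simp: fun_eq_iff)
	moreover have "Suc (length drivers) = 9" using drivers(4) by simp
	ultimately show ?thesis unfolding A_def using runs_writes_st[OF drivers(1), of s d ?w ?h] by metis
	qed
	have mv: "runs (mvs ms) (A c p a b r) (Suc (length ms)) (A c p' a' b' r')"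
	if "fst ` set ms \<subseteq> {..<ntapes}" "\<And>i. off ms i = (if 6 <= i & i <= 13 then p' - p else if i = 4 then a' - a
		 else if i = 5 then b' - b else if i = 2 | i = 3 then r' - r else 0)" for ms c p a b r p' a' b' r'
	unfolding A_def by (rule runs_mvs_to[OF that(1) _ refl]) (auto simp: fun_eq_iff that(2))
	have lf: "off (map (%j. (j, d)) drivers) i = (if 6 <= i & i <= 13 then offset d else 0)" for d i unfolding off_map[OF drivers(1)] drivers(3) ..
	have fs: "fst ` set (map (%j. (j, d)) drivers) \<subseteq> {..<ntapes}" for d using drivers(2) by auto
	have v: "view (A c p a b r) 4 = counter a" "view (A c p a b r) 5 = counter b" for c p a b r
	using w by (simp_all add: A_def view_st look_def ntapes_def)
	let ?c1 = "%k p. if p = 0 then 1 else if 0 < p & p <= int k then 3 else 0 :: nat"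
	let ?c2 = "%k p. if p = 0 then 1 else if p = int N then 5 else if 0 < p & p < int N then 3
	 else if - int k <= p & p < 0 then 2 else 0 :: nat"
	have r1: "runs (writes drivers (%v. (1, Rt))) (A (%p. 0) 0 (int N) 0 0) 9 (A (?c1 0) (1 + int 0) (int N - int 0) (int 0) 0)"
	proof -
	have "(%p. 0 :: nat)(0 := 1) = ?c1 0" by (auto simp: fun_eq_iff)
	then show ?thesis using wr[of 1 Rt "%p. 0" 0 "int N" 0 0] by simp
	qed
	have r2: "runs (While (%v. v 4 ~= 1) (mvs [(4, Lt), (5, Rt)] ;; writes drivers (%v. (3, Rt))))
		(A (?c1 0) (1 + int 0) (int N - int 0) (int 0) 0) (N * Suc (3 + 9) + 1) (A (?c1 N) (1 + int N) (int N - int N) (int N) 0)"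
	proof (rule runs_While[where T = "%k. A (?c1 k) (1 + int k) (int N - int k) (int k) 0"])
	fix k assume k: "k < N"
	have "runs (mvs [(4, Lt), (5, Rt)]) (A (?c1 k) (1 + int k) (int N - int k) (int k) 0) (Suc (length [(4::nat, Lt), (5, Rt)]))
			(A (?c1 k) (1 + int k) (int N - int (Suc k)) (int (Suc k)) 0)" by (rule mv) (auto simp: ntapes_def)
	moreover have "runs (writes drivers (%v. (3, Rt))) (A (?c1 k) (1 + int k) (int N - int (Suc k)) (int (Suc k)) 0) 9
			(A (?c1 (Suc k)) (1 + int (Suc k)) (int N - int (Suc k)) (int (Suc k)) 0)"
	proof -
		have "(?c1 k)(1 + int k := 3) = ?c1 (Suc k)" by (auto simp: fun_eq_iff)
		moreover have "1 + int k + offset Rt = 1 + int (Suc k)" by simp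
		ultimately show ?thesis using wr[of 3 Rt "?c1 k" "1 + int k" "int N - int (Suc k)" "int (Suc k)" 0] by metis
	qed
	ultimately have "runs (mvs [(4, Lt), (5, Rt)] ;; writes drivers (%v. (3, Rt))) (A (?c1 k) (1 + int k) (int N - int k) (int k) 0)
			(Suc (length [(4::nat, Lt), (5, Rt)]) + 9) (A (?c1 (Suc k)) (1 + int (Suc k)) (int N - int (Suc k)) (int (Suc k)) 0)"
		by (rule runs_Seq)
	then show "view (A (?c1 k) (1 + int k) (int N - int k) (int k) 0) 4 ~= 1 &
		runs (mvs [(4, Lt), (5, Rt)] ;; writes drivers (%v. (3, Rt))) (A (?c1 k) (1 + int k) (int N - int k) (int k) 0)
			(3 + 9) (A (?c1 (Suc k)) (1 + int (Suc k)) (int N - int (Suc k)) (int (Suc k)) 0)"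
		using k unfolding v by (simp add: counter_def numeral_3_eq_3)
	next
	show "~ view (A (?c1 N) (1 + int N) (int N - int N) (int N) 0) 4 ~= 1" unfolding v by (simp add: counter_def)
	qed
	have r3: "runs (mvs (map (%j. (j, Lt)) drivers)) (A (?c1 N) (1 + int N) (int N - int N) (int N) 0) (Suc (length (map (%j. (j, Lt)) drivers)))
		(A (?c1 N) (int N) 0 (int N) 0)" by (rule mv[OF fs]) (simp add: lf)
	have r4: "runs (writes drivers (%v. (5, Lt))) (A (?c1 N) (int N) 0 (int N) 0) 9 (A (?c2 0) (int N - 1 - int 0) (int 0) (int N - int 0) 0)"
	proof -
	have "(?c1 N)(int N := 5) = ?c2 0" using N by (auto simp: fun_eq_iff)
	moreover have "int N + offset Lt = int N - 1 - int 0" "int N = int N - int 0" "(0::int) = int 0" by simp_all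
	ultimately show ?thesis using wr[of 5 Lt "?c1 N" "int N" 0 "int N" 0] by metis
	qed
	have r5: "runs (While (%v. v 5 ~= 1) (mvs ([(5, Lt), (4, Rt)] @ map (%j. (j, Lt)) drivers)))
		(A (?c2 0) (int N - 1 - int 0) (int 0) (int N - int 0) 0) (N * Suc 11 + 1) (A (?c2 0) (int N - 1 - int N) (int N) (int N - int N) 0)"
	proof (rule runs_While[where T = "%k. A (?c2 0) (int N - 1 - int k) (int k) (int N - int k) 0"])
	fix k assume k: "k < N"
	let ?ms = "[(5, Lt), (4, Rt)] @ map (%j. (j, Lt)) drivers"
	have "runs (mvs ?ms) (A (?c2 0) (int N - 1 - int k) (int k) (int N - int k) 0) (Suc (length ?ms))
			(A (?c2 0) (int N - 1 - int (Suc k)) (int (Suc k)) (int N - int (Suc k)) 0)"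
	proof (rule mv)
		show "fst ` set ?ms \<subseteq> {..<ntapes}" using fs[of Lt] by (auto simp: ntapes_def)
		show "off ?ms i = (if 6 <= i & i <= 13 then int N - 1 - int (Suc k) - (int N - 1 - int k) else if i = 4 then int (Suc k) - int k
			 else if i = 5 then int N - int (Suc k) - (int N - int k) else if i = 2 | i = 3 then 0 - 0 else 0)" for i unfolding off_append lf by auto
	qed
	moreover have "Suc (length ?ms) = 11" using drivers(4) by simp
	ultimately show "view (A (?c2 0) (int N - 1 - int k) (int k) (int N - int k) 0) 5 ~= 1 &
		runs (mvs ?ms) (A (?c2 0) (int N - 1 - int k) (int k) (int N - int k) 0) 11
			(A (?c2 0) (int N - 1 - int (Suc k)) (int (Suc k)) (int N - int (Suc k)) 0)"
		using k unfolding v by (metis counter_def diff_gt_0_iff_gt of_nat_less_iff order_less_irrefl zero_neq_one)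
	next
	show "~ view (A (?c2 0) (int N - 1 - int N) (int N) (int N - int N) 0) 5 ~= 1" unfolding v by (simp add: counter_def)
	qed
	have r6: "runs (While (%v. v 4 ~= 1) (mvs [(4, Lt), (2, Lt), (3, Lt)] ;; writes drivers (%v. (2, Lt))))
		(A (?c2 0) (- 1 - int 0) (int N - int 0) 0 (- int 0)) (N * Suc (4 + 9) + 1) (A (?c2 N) (- 1 - int N) (int N - int N) 0 (- int N))"
	proof (rule runs_While[where T = "%k. A (?c2 k) (- 1 - int k) (int N - int k) 0 (- int k)"])
	fix k assume k: "k < N"
	let ?ms = "[(4::nat, Lt), (2, Lt), (3, Lt)]"
	have "runs (mvs ?ms) (A (?c2 k) (- 1 - int k) (int N - int k) 0 (- int k)) (Suc (length ?ms))
			(A (?c2 k) (- 1 - int k) (int N - int (Suc k)) 0 (- int (Suc k)))" by (rule mv) (auto simp: ntapes_def)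
	moreover have "runs (writes drivers (%v. (2, Lt))) (A (?c2 k) (- 1 - int k) (int N - int (Suc k)) 0 (- int (Suc k))) 9
			(A (?c2 (Suc k)) (- 1 - int (Suc k)) (int N - int (Suc k)) 0 (- int (Suc k)))"
	proof -
		have "(?c2 k)(- 1 - int k := 2) = ?c2 (Suc k)" by (auto simp: fun_eq_iff)
		moreover have "- 1 - int k + offset Lt = - 1 - int (Suc k)" by simp
		ultimately show ?thesis using wr[of 2 Lt "?c2 k" "- 1 - int k" "int N - int (Suc k)" 0 "- int (Suc k)"] by metis
	qed
	ultimately have "runs (mvs ?ms ;; writes drivers (%v. (2, Lt))) (A (?c2 k) (- 1 - int k) (int N - int k) 0 (- int k))
			(Suc (length ?ms) + 9) (A (?c2 (Suc k)) (- 1 - int (Suc k)) (int N - int (Suc k)) 0 (- int (Suc k)))" by (rule runs_Seq)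
	moreover have "Suc (length ?ms) = 4" by simp
	moreover have "view (A (?c2 k) (- 1 - int k) (int N - int k) 0 (- int k)) 4 ~= 1" using k unfolding v by (simp add: counter_def)
	ultimately show "view (A (?c2 k) (- 1 - int k) (int N - int k) 0 (- int k)) 4 ~= 1 &
		runs (mvs ?ms ;; writes drivers (%v. (2, Lt))) (A (?c2 k) (- 1 - int k) (int N - int k) 0 (- int k))
			(4 + 9) (A (?c2 (Suc k)) (- 1 - int (Suc k)) (int N - int (Suc k)) 0 (- int (Suc k)))" by metis
	next
	show "~ view (A (?c2 N) (- 1 - int N) (int N - int N) 0 (- int N)) 4 ~= 1" unfolding v by (simp add: counter_def)
	qed
	have r7: "runs (mvs (map (%j. (j, Rt)) drivers)) (A (?c2 N) (- 1 - int N) (int N - int N) 0 (- int N))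
		(Suc (length (map (%j. (j, Rt)) drivers))) (A (?c2 N) (- int N) 0 0 (- int N))" by (rule mv[OF fs]) (simp add: lf)
	have r8: "runs (writes drivers (%v. (4, Stay))) (A (?c2 N) (- int N) 0 0 (- int N)) 9 (A (zone_tape N) (- int N) 0 0 (- int N))"
	proof -
	have "((?c2 N)(- int N := 4)) p = zone_tape N p" for p
	proof (cases "- int N <= p")
		case True
		then have "nat (p + int N) = 0 \<longleftrightarrow> p = - int N" "nat (p + int N) < N \<longleftrightarrow> p < 0" "nat (p + int N) = N \<longleftrightarrow> p = 0"
			"nat (p + int N) < 2 * N \<longleftrightarrow> p < int N" "nat (p + int N) = 2 * N \<longleftrightarrow> p = int N" using N by linarith+
		then show ?thesis using N True unfolding zone_tape_def zone_def by auto
	next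
		case False
		then show ?thesis using N by (auto simp: zone_tape_def)
	qed
	then have "(?c2 N)(- int N := 4) = zone_tape N" by (rule ext)
	moreover have "- int N + offset Stay = - int N" by simp
	ultimately show ?thesis using wr[of 4 Stay "?c2 N" "- int N" 0 0 "- int N"] by metis
	qed
	have e: "A (?c2 0) (int N - 1 - int N) (int N) (int N - int N) 0 = A (?c2 0) (- 1 - int 0) (int N - int 0) 0 (- int 0)" by simp
	have len: "length (map (%j. (j, d)) drivers) = 8" for d :: move using drivers(4) by simp
	have "runs ruling (A (%p. 0) 0 (int N) 0 0)
	 (9 + (N * Suc (3 + 9) + 1 + (Suc 8 + (9 + (N * Suc 11 + 1 + (N * Suc (4 + 9) + 1 + (Suc 8 + 9))))))) (A (zone_tape N) (- int N) 0 0 (- int N))"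
	unfolding ruling_def
	by (intro runs_Seq[OF r1] runs_Seq[OF r2] runs_Seq[OF r3[unfolded len]] runs_Seq[OF r4] runs_Seq[OF r5[unfolded e]] runs_Seq[OF r6]
				runs_Seq[OF r7[unfolded len]] r8)
	then show ?thesis by (rule runs_mono) simp
qed

definition differencing :: prog where
	"differencing = writes differences (%v. (2, Lt)) ;; writes differences (%v. (1, Rt)) ;;
	 mvs (map (%j. (j, Rt)) differences) ;; writes differences (%v. (3, Lt)) ;;
	 Op 4 (%v. (1, Stay)) ;; Op 5 (%v. (1, Stay))"

lemma runs_differencing:
	assumes w: "\<And>i. 4 <= i ==> w i = (%p. 0)"
	shows "runs differencing (st w (%i. 0)) 22
	(st (%i. if i = 4 | i = 5 then counter else if 14 <= i & i <= 17 then diff_tape else w i) (%i. 0))"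
proof -
	define A where "A c p = st (%i. if 14 <= i & i <= 17 then c else w i) (%i. if 14 <= i & i <= 17 then p else 0)" for c and p :: int
	have wr: "runs (writes differences (%v. (s, d))) (A c p) 5 (A (c(p := s)) (p + offset d))" for s d c p
	proof -
	let ?w = "%i. if 14 <= i & i <= 17 then c else w i" and ?h = "%i. if 14 <= i & i <= 17 then p else 0"
	have "(%i. if i : set differences then (?w i)(?h i := s) else ?w i) = (%i. if 14 <= i & i <= 17 then c(p := s) else w i)"
		"(%i. if i : set differences then ?h i + offset d else ?h i) = (%i. if 14 <= i & i <= 17 then p + offset d else 0)"
		unfolding differences(3) by (auto simp: fun_eq_iff)
	moreover have "Suc (length differences) = 5" using differences(4) by simp
	ultimately show ?thesis unfolding A_def using runs_writes_st[OF differences(1), of s d ?w ?h] by metis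
	qed
	have mv: "runs (mvs (map (%j. (j, Rt)) differences)) (A c 0) 5 (A c 1)" for c unfolding A_def
	proof (rule runs_mvs_to)
	show "fst ` set (map (%j. (j, Rt)) differences) \<subseteq> {..<ntapes}" using differences(2) by auto
	show "(%i. if 14 <= i & i <= 17 then 1 else 0) =
			(%j. (if 14 <= j & j <= 17 then 0 else 0) + off (map (%j. (j, Rt)) differences) j)"
		unfolding off_map[OF differences(1)] differences(3) by (auto simp: fun_eq_iff)
	qed (simp add: differences(4))
	let ?z = "%p::int. 0::nat"
	have r1: "runs (writes differences (%v. (2, Lt))) (A ?z 0) 5 (A (?z(0 := 2)) (- 1))" using wr[of 2 Lt ?z 0] by simp
	have r2: "runs (writes differences (%v. (1, Rt))) (A (?z(0 := 2)) (- 1)) 5 (A (?z(0 := 2, - 1 := 1)) 0)"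
	using wr[of 1 Rt "?z(0 := 2)" "- 1"] by simp
	have r4: "runs (writes differences (%v. (3, Lt))) (A (?z(0 := 2, - 1 := 1)) 1) 5 (A (?z(0 := 2, - 1 := 1, 1 := 3)) 0)"
	using wr[of 3 Lt "?z(0 := 2, - 1 := 1)" 1] by simp
	have d: "?z(0 := 2, - 1 := 1, 1 := 3) = diff_tape" by (auto simp: fun_eq_iff diff_tape_def)
	let ?w = "%i. if 14 <= i & i <= 17 then diff_tape else w i"
	have A1: "A diff_tape 0 = st ?w (%i. 0)" by (auto simp: A_def st_def fun_eq_iff)
	have A0: "A ?z 0 = st w (%i. 0)" using w by (auto simp: A_def st_def fun_eq_iff)
	have c: "?z(0 := 1) = counter" by (auto simp: fun_eq_iff counter_def)
	have r5: "runs (Op 4 (%v. (1, Stay))) (st ?w (%i. 0)) 1 (st (?w(4 := counter)) (%i. 0))"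
	using runs_Op_st[of 4 1 Stay ?w "%i. 0"] w c by (simp add: fun_upd_idem)
	have r6: "runs (Op 5 (%v. (1, Stay))) (st (?w(4 := counter)) (%i. 0)) 1 (st (?w(4 := counter, 5 := counter)) (%i. 0))"
	using runs_Op_st[of 5 1 Stay "?w(4 := counter)" "%i. 0"] w c by (simp add: fun_upd_idem)
	have "runs differencing (A ?z 0) (5 + (5 + (5 + (5 + (1 + 1))))) (st (?w(4 := counter, 5 := counter)) (%i. 0))" unfolding differencing_def
	by (intro runs_Seq[OF r1] runs_Seq[OF r2] runs_Seq[OF mv] runs_Seq[OF r4[unfolded d, unfolded A1]] runs_Seq[OF r5] r6)
	moreover have "?w(4 := counter, 5 := counter) = (%i. if i = 4 | i = 5 then counter else if 14 <= i & i <= 17 then diff_tape else w i)"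
	by (auto simp: fun_eq_iff)
	ultimately show ?thesis unfolding A0 by simp
qed

lemma wf_setup: "wf_prog marking" "wf_prog ruling" "wf_prog differencing" using drivers(2) differences(2)
	by (auto simp: marking_def ruling_def differencing_def ntapes_def nsyms_def)

lemma setup_program:
	fixes q pN :: "nat poly"
	assumes pN: "\<And>n. 1 < poly pN n"
	obtains prog and tp :: "nat poly" where "wf_prog prog"
	"\<And>x. runs prog (init_mem [x]) (poly tp (length x))
		 (ost (work_tapes x (poly q (length x)) (poly pN (length x))) [] (work_heads (poly pN (length x))))"
proof -
	obtain pq tq where pq: "wf_prog pq"
	"\<And>w h x. w 2 = fst (word_tape x) ==> w 4 = counter ==> w 5 = counter ==> h 2 = 0 ==> h 4 = 0 ==> h 5 = 0 ==>
		 runs pq (st w h) (poly tq (length x)) (st w (h(4 := int (poly q (length x)))))" using poly_program by blast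
	obtain pn tn where pn: "wf_prog pn"
	"\<And>w h x. w 2 = fst (word_tape x) ==> w 4 = counter ==> w 5 = counter ==> h 2 = 0 ==> h 4 = 0 ==> h 5 = 0 ==>
		 runs pn (st w h) (poly tn (length x)) (st w (h(4 := int (poly pN (length x)))))" using poly_program by blast
	let ?p = "transfer 0 [2] ;; differencing ;; pq ;; marking ;; pn ;; ruling"
	let ?tp = "[:22, 11:] + [:22:] + tq + (smult 6 q + [:6:]) + tn + (smult 50 pN + [:50:])"
	have "runs ?p (init_mem [x]) (poly ?tp (length x))
		 (ost (work_tapes x (poly q (length x)) (poly pN (length x))) [] (work_heads (poly pN (length x))))" for x
	proof -
	let ?n = "length x"
	let ?q = "poly q ?n" and ?N = "poly pN ?n"
	let ?w1 = "%i. if i = 2 then fst (word_tape x) else (%p. 0)"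
	let ?w2 = "%i. if i = 4 | i = 5 then counter else if 14 <= i & i <= 17 then diff_tape else ?w1 i"
	let ?w3 = "?w2(3 := marks ?q)"
	have wt: "word_tape x = (fst (word_tape x), 0)" "word_tape [] = (%p. 0, 0)" by (auto simp: word_tape_def fun_eq_iff)
	have "runs (transfer 0 [2]) (init_mem [x]) ((length x + 1) * (2 * length [2::nat] + 9) + 2 * length [2::nat] + 9)
			(%j. if j = 0 then word_tape [] else if j : set [2] then word_tape x else init_mem [x] j)"
		by (rule runs_transfer) (auto simp: ntapes_def init_mem_def)
	moreover have "(%j. if j = 0 then word_tape [] else if j : set [2] then word_tape x else init_mem [x] j) = st ?w1 (%i. 0)"
	proof
		fix j show "(if j = 0 then word_tape [] else if j : set [2] then word_tape x else init_mem [x] j) = st ?w1 (%i. 0) j"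
			using wt by (simp add: st_def init_mem_def)
	qed
	ultimately have r1: "runs (transfer 0 [2]) (init_mem [x]) ((length x + 1) * 11 + 11) (st ?w1 (%i. 0))" by (simp add: numeral_eq_Suc)
	have r2: "runs differencing (st ?w1 (%i. 0)) 22 (st ?w2 (%i. 0))" by (rule runs_differencing) simp
	have r3: "runs pq (st ?w2 (%i. 0)) (poly tq ?n) (st ?w2 ((%i. 0)(4 := int ?q)))" by (rule pq(2)) simp_all
	have r4: "runs marking (st ?w2 ((%i. 0)(4 := int ?q))) (6 * ?q + 6) (st ?w3 ((%i. 0)(4 := int ?q, 4 := 0)))" by (rule runs_marking) simp_all
	have z: "((%i. 0)(4 := int ?q, 4 := 0)) = (%i. 0 :: int)" by (auto simp: fun_eq_iff)
	have r5: "runs pn (st ?w3 (%i. 0)) (poly tn ?n) (st ?w3 ((%i. 0)(4 := int ?N)))" by (rule pn(2)) simp_all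
	let ?A = "%c p a b r. st (%i. if 6 <= i & i <= 13 then c else ?w3 i)
	 (%i. if 6 <= i & i <= 13 then p else if i = 4 then a else if i = 5 then b else if i = 2 | i = 3 then r else 0)"
	have e1: "st ?w3 ((%i. 0)(4 := int ?N)) = ?A (%p. 0) 0 (int ?N) 0 0" by (auto simp: st_def fun_eq_iff)
	have e2: "?A (zone_tape ?N) (- int ?N) 0 0 (- int ?N) = ost (work_tapes x ?q ?N) [] (work_heads ?N)"
		unfolding ost_def wt(2) by (auto simp: st_def fun_eq_iff work_tapes_def work_heads_def)
	have r6: "runs ruling (?A (%p. 0) 0 (int ?N) 0 0) (50 * ?N + 50) (?A (zone_tape ?N) (- int ?N) 0 0 (- int ?N))"
		by (rule runs_ruling[where w = ?w3 and h = "%i. 0"]) (use pN in simp_all)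
	have "runs ?p (init_mem [x]) ((length x + 1) * 11 + 11 + (22 + (poly tq ?n + (6 * ?q + 6 + (poly tn ?n + (50 * ?N + 50))))))
		 (ost (work_tapes x ?q ?N) [] (work_heads ?N))"
		by (intro runs_Seq[OF r1] runs_Seq[OF r2] runs_Seq[OF r3] runs_Seq[OF r4[unfolded z]] runs_Seq[OF r5[unfolded e1]] r6[unfolded e2])
	then show ?thesis by (rule runs_mono) (simp add: algebra_simps)
	qed
	moreover have "wf_prog ?p" using pq(1) pn(1) wf_setup by (simp add: wf_transfer ntapes_def)
	ultimately show thesis using that by blast
qed

section \<open>The clauses on the lattice\<close>

text \<open>Padding gives every position the same number of clause slots, whatever its
  zones.\<close>

definition clause_at :: "tm => nat => nat => nat => nat => nat => clause" where
	"clause_at M a b xs qm k = (let cs = clauses M a b xs qm in if k < length cs then cs ! k else filler)"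

definition clause_pool :: "tm => clause list" where
	"clause_pool M = filler # concat (map (%a. concat (map (%b. concat (map (%xs. concat (map (%qm.
	 clauses M a b xs qm) [0, 1])) [0, 1, 2])) [1, 2, 3, 4, 5])) [1, 2, 3, 4, 5])"

definition pool_vars :: "tm => var list" where
	"pool_vars M = remdups (concat (map (%c. map fst (fst c) @ map fst (snd c)) (clause_pool M)))"

text \<open>A position gets \<open>2 * width M\<close> rows and \<open>3 * width M\<close> columns
  of cells. A cell has 3 rows and 2 columns of sites, so both sides come to
  \<open>6 * width M\<close> sites per position and the lattice is square.\<close>

definition width :: "tm => nat" where
	"width M = Suc (length (clause_pool M) + length (pool_vars M))"

text \<open>Slot 0 and the last slot of a position carry no variable, which leaves room for the
  source and the sink.\<close>

definition var_at :: "tm => nat => var option" where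
	"var_at M s = (if 0 < s & s <= length (pool_vars M) then Some (pool_vars M ! (s - 1)) else None)"

text \<open>A position \<open>(tt', p')\<close> is seen from \<open>(tt, p)\<close> through the differences \<open>tt' - tt\<close> and \<open>p' - p\<close>, of
	which only the values -1, 0, 1 are distinguished, as symbols 1, 2, 3.\<close>

definition dsym :: "nat => nat => nat" where
	"dsym a b = (if b + 1 = a then 1 else if b = a then 2 else if b = a + 1 then 3 else 0)"

fun at_loc :: "loc => nat => nat => bool" where
	"at_loc Here b dp \<longleftrightarrow> dp = 2"
| "at_loc Before b dp \<longleftrightarrow> dp = 1"
| "at_loc First b dp \<longleftrightarrow> b = 4"

definition occurs_pos :: "clause => var => nat => nat => nat => bool" where
	"occurs_pos c v b dt dp \<longleftrightarrow> (EX d l. (v, d, l) : set (snd c) & dt = 2 + d & at_loc l b dp)"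

definition occurs_neg :: "clause => var => nat => nat => nat => bool" where
	"occurs_neg c v b dt dp \<longleftrightarrow> (EX l. (v, l) : set (fst c) & dt = 2 & at_loc l b dp)"

text \<open>For a fixed \<open>M\<close>, all arguments have a bounded range, so this is a finite
  table that one instruction of the printing program can consult.\<close>

definition cell_code :: "tm => nat => nat => nat => nat => nat => nat => nat => nat => nat => nat => cell" where
	"cell_code M a b xs qm a' b' dt dp k s =
	 (if a' = 4 & b' = 4 & s = 0 then Source
		else if a' = 5 & b' = 5 & s = 3 * width M - 1 then Sink
		else case var_at M s of None => Blank | Some v =>
			if occurs_pos (clause_at M a b xs qm k) v b' dt dp then Positive
			else if occurs_neg (clause_at M a b xs qm k) v b' dt dp then Negative else Blank)"

lemma length_concat_map_le: "x : set xs ==> length (f x) <= length (concat (map f xs))" by (induction xs) auto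

lemma subset_concat_map: "x : set xs ==> set (f x) \<subseteq> set (concat (map f xs))" by auto

lemma clauses_pool:
	assumes "a : {1,2,3,4,5}" "b : {1,2,3,4,5}" "xs : {0,1,2}" "qm : {0,1}"
	shows "set (clauses M a b xs qm) \<subseteq> set (clause_pool M)" "length (clauses M a b xs qm) <= 2 * width M"
proof -
	let ?f1 = "%a b xs. concat (map (%qm. clauses M a b xs qm) [0, 1])"
	let ?f2 = "%a b. concat (map (%xs. ?f1 a b xs) [0, 1, 2])"
	let ?f3 = "%a. concat (map (%b. ?f2 a b) [1, 2, 3, 4, 5])"
	let ?f4 = "concat (map (%a. ?f3 a) [1, 2, 3, 4, 5])"
	have p: "clause_pool M = filler # ?f4" by (simp only: clause_pool_def)
	have i: "a : set [1,2,3,4,5]" "b : set [1,2,3,4,5]" "xs : set [0,1,2]" "qm : set [0,1]" using assms by simp_all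
	have "length (clauses M a b xs qm) <= length (?f1 a b xs)" by (rule length_concat_map_le[OF i(4), of "%qm. clauses M a b xs qm"])
	also have "\<dots> <= length (?f2 a b)" by (rule length_concat_map_le[OF i(3), of "%xs. ?f1 a b xs"])
	also have "\<dots> <= length (?f3 a)" by (rule length_concat_map_le[OF i(2), of "%b. ?f2 a b"])
	also have "\<dots> <= length ?f4" by (rule length_concat_map_le[OF i(1), of "%a. ?f3 a"])
	finally have le: "length (clauses M a b xs qm) <= length ?f4" .
	have gen: "l <= 2 * Suc (L + Suc 0 + v)" if "l <= L" for l L v :: nat using that by simp
	show "length (clauses M a b xs qm) <= 2 * width M" unfolding width_def p list.size by (rule gen[OF le])
	have "set (clauses M a b xs qm) \<subseteq> set (?f1 a b xs)" by (rule subset_concat_map[OF i(4), of "%qm. clauses M a b xs qm"])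
	also have "\<dots> \<subseteq> set (?f2 a b)" by (rule subset_concat_map[OF i(3), of "%xs. ?f1 a b xs"])
	also have "\<dots> \<subseteq> set (?f3 a)" by (rule subset_concat_map[OF i(2), of "%b. ?f2 a b"])
	also have "\<dots> \<subseteq> set ?f4" by (rule subset_concat_map[OF i(1), of "%a. ?f3 a"])
	finally show "set (clauses M a b xs qm) \<subseteq> set (clause_pool M)" unfolding p list.set by (rule subset_insertI2)
qed

lemma clause_at_cases: "clause_at M a b xs qm k : set (clauses M a b xs qm) | clause_at M a b xs qm k = filler" by (simp add: clause_at_def Let_def)

lemma clause_atE:
	assumes "c : set (clauses M a b xs qm)" "length (clauses M a b xs qm) <= K"
	obtains k where "k < K" "clause_at M a b xs qm k = c"
proof -
	obtain k where "k < length (clauses M a b xs qm)" "clauses M a b xs qm ! k = c" using assms(1) by (metis in_set_conv_nth)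
	then show thesis using that[of k] assms(2) by (simp add: clause_at_def Let_def)
qed

text \<open>Clauses that cannot disturb the order of occurrences: they conclude for the next time
  only, and their premises avoid the variables that are ever concluded for the same time.\<close>

definition later :: "clause => bool" where
	"later c \<longleftrightarrow> (ALL (v, l) : set (fst c). v ~= VE & v ~= VT) & (ALL (v, d, l) : set (snd c). d = 1)"

lemma later_act: "c : set (act_clauses M b) ==> later c"
proof -
	assume "c : set (act_clauses M b)"
	then obtain q ss z where z: "z : set (([], (VQ False (fst (act_of M q ss)), 1, First)) #
	 concat (map (%i. tape_clauses (symbols M) b i (snd (act_of M q ss) ! i)) [0..<tapes M]))"
	"c = (case z of (ps, c) => (act_premises M q ss @ ps, [c]))" unfolding act_clauses_def in_concat_map in_map by blast
	obtain ps v d l where zz: "z = (ps, (v, d, l))" by (metis prod_cases4)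
	have "d = 1 & (ALL (v', l') : set ps. v' ~= VT & v' ~= VE)"
	using z(1) unfolding zz by (auto simp: tape_clauses_def Let_def split: if_splits prod.splits)
	then show ?thesis unfolding z(2) zz by (auto simp: later_def act_premises_def)
qed

lemma later_copy: "c : set (copy_clauses M) ==> later c" unfolding copy_clauses_def by (auto simp: later_def)

lemma later_init:
	assumes "qm ~= 1 | k >= 3" "k < length (init_clauses t b xs qm)"
	shows "later (init_clauses t b xs qm ! k)"
proof -
	define r :: "clause list" where "r = [([], [(VQ False 0, 1, First)]), ([], [(VS False 0 xs, 1, Here)])] @
	 map (%i. ([], [(VS False i 0, 1, Here)])) [2..<t] @
	 map (%i. ([], [(VP False i (if b = 1 then 1 else if b = 3 | b = 5 then 0 else 2), 1, Here)])) [0..<t]"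
	have rl: "later c" if "c : set r" for c using that by (auto simp: later_def r_def)
	show ?thesis
	proof (cases "qm = 1")
	case True
	then have l: "init_clauses t b xs qm = [([], [(VE, 0, Here), (VS False 1 1, 1, Here), (VS False 1 2, 1, Here)]),
			 (if b = 1 then filler else ([(VE, Before)], [(VE, 0, Here)])), ([(VE, Here)], [(VS False 1 0, 1, Here)])] @ r"
		by (simp only: init_clauses_def if_True simp_thms r_def)
	have k: "3 <= k" using assms(1) True by simp
	have "init_clauses t b xs qm ! k = r ! (k - 3)" unfolding l using k by (subst nth_append) (simp add: numeral_3_eq_3)
	moreover have "k - 3 < length r"
	proof -
		have gen: "k - 3 < L" if "k < Suc (Suc (Suc 0)) + L" for L using that k by linarith
		have "length (init_clauses t b xs qm) = Suc (Suc (Suc 0)) + length r" unfolding l by simp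
		then show ?thesis using gen[of "length r"] assms(2) by simp
	qed
	ultimately show ?thesis using rl nth_mem by metis
	next
	case False
	then have "init_clauses t b xs qm = ([], [(VS False 1 0, 1, Here)]) # r" by (simp add: init_clauses_def r_def)
	moreover have "later ([], [(VS False 1 0, 1, Here)])" by (simp add: later_def)
	ultimately have "ALL c : set (init_clauses t b xs qm). later c" using rl by simp
	then show ?thesis using assms(2) nth_mem by blast
	qed
qed

text \<open>This isolates the clauses in which \<open>VE\<close> occurs, together with their slots.
  All others are fillers, have only conclusions for the next time, or have no conclusion.\<close>

lemma clause_at_shape:
	fixes M a b xs qm k
	defines "c \<equiv> clause_at M a b xs qm k"
	obtains "c = filler" | "later c" | "fst c = [(VQ False (states M), First), (VS False 0 1, Here)]" "snd c = []"
	| "a = 4" "qm = 1" "k = 0" "c = ([], [(VE, 0, Here), (VS False 1 1, 1, Here), (VS False 1 2, 1, Here)])"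
	| "a = 4" "qm = 1" "k = 1" "b ~= 1" "c = ([(VE, Before)], [(VE, 0, Here)])"
	| "a = 4" "qm = 1" "k = 2" "c = ([(VE, Here)], [(VS False 1 0, 1, Here)])"
proof -
	let ?I = "if a = 4 then init_clauses (tapes M) b xs qm else []"
	let ?A = "if a = 5 then [] else copy_clauses M @ act_clauses M b"
	let ?F = "if b = 1 then [([(VQ False (states M), First), (VS False 0 1, Here)], [])] else []"
	have cs: "clauses M a b xs qm = ?I @ ?A @ ?F" by (simp only: clauses_def)
	show thesis
	proof (cases "k < length (clauses M a b xs qm)")
	case False
	then show thesis using that(1) by (simp add: c_def clause_at_def Let_def)
	next
	case True
	then have c: "c = (?I @ ?A @ ?F) ! k" by (simp only: c_def clause_at_def Let_def cs if_True)
	show thesis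
	proof (cases "k < length ?I")
		case True
		then have a: "a = 4" by (auto split: if_splits)
		have c: "c = init_clauses (tapes M) b xs qm ! k" "k < length (init_clauses (tapes M) b xs qm)"
			using True a unfolding c by (simp_all add: nth_append)
		show thesis
		proof (cases "qm ~= 1 | k >= 3")
			case True
			then show thesis using that(2) later_init c by metis
		next
			case False
			then have "qm = 1" "k = 0 | k = 1 | k = 2" by auto
			then show thesis using a c(1) that(1,4-6) by (cases "b = 1") (auto simp: init_clauses_def)
		qed
	next
		case False
		then have "c : set (?A @ ?F)" using True[unfolded cs] unfolding c by (subst nth_append) (simp only: if_False, rule nth_mem, simp)
		then consider "c : set (copy_clauses M)" | "c : set (act_clauses M b)"
			| "c = ([(VQ False (states M), First), (VS False 0 1, Here)], [])" by (auto split: if_splits)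
		then show thesis using that(2,3) later_copy later_act by cases auto
	qed
	qed
qed

lemma concs_now:
	assumes "(v, d, l) : set (snd (clause_at M a b xs qm k))"
	shows "d = 1 | d = 0 & v = VT | d = 0 & v = VE & l = Here & k <= 1"
	by (rule clause_at_shape[of M a b xs qm k]) (use assms in \<open>auto simp: filler_def later_def\<close>)

lemma prems_now:
	assumes "(v, l) : set (fst (clause_at M a b xs qm k))"
	shows "v ~= VT" "v = VE ==> k = 2 & l = Here | k = 1 & l = Before"
	by (rule clause_at_shape[of M a b xs qm k]; use assms in \<open>auto simp: filler_def later_def\<close>)+

lemma concs_last:
	assumes "(v, d, l) : set (snd (clause_at M 5 b xs qm k))"
	shows "d = 0"
proof -
	have "clause_at M 5 b xs qm k = filler | snd (clause_at M 5 b xs qm k) = []"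
	using clause_at_cases[of M 5 b xs qm k] by (auto simp: clauses_def split: if_splits)
	then show ?thesis using assms by (auto simp: filler_def)
qed

text \<open>At the first position, \<open>Before\<close> would be confused with the position itself
  because of truncated subtraction. Only a certificate clause could use it there, and this needs
  \<open>qm = 1\<close>, which fails at position 0.\<close>

lemma before_not_first:
	assumes "(v, Before) : set (fst (clause_at M a 4 xs qm k)) | (v, d, Before) : set (snd (clause_at M a 4 xs qm k))"
	shows "qm = 1"
proof -
	have "ALL c : set (clauses M a 4 xs qm). qm = 1 | (ALL v. (v, Before) \<notin> set (fst c)) & (ALL v d. (v, d, Before) \<notin> set (snd c))"
	proof
	fix c assume "c : set (clauses M a 4 xs qm)"
	then consider "c : set (init_clauses (tapes M) 4 xs qm)" | "c : set (copy_clauses M)" | "c : set (act_clauses M 4)"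
		by (auto simp: clauses_def split: if_splits)
	then show "qm = 1 | (ALL v. (v, Before) \<notin> set (fst c)) & (ALL v d. (v, d, Before) \<notin> set (snd c))"
	proof cases
		case 1
		then show ?thesis by (auto simp: init_clauses_def split: if_splits)
	next
		case 2
		then show ?thesis unfolding copy_clauses_def by auto
	next
		case 3
		then obtain q ss z where z: "z : set (([], (VQ False (fst (act_of M q ss)), 1, First)) #
			 concat (map (%i. tape_clauses (symbols M) 4 i (snd (act_of M q ss) ! i)) [0..<tapes M]))"
			"c = (case z of (ps, c) => (act_premises M q ss @ ps, [c]))" unfolding act_clauses_def in_concat_map in_map by blast
		obtain ps v d l where zz: "z = (ps, (v, d, l))" by (metis prod_cases4)
		have "l ~= Before & (ALL (v', l') : set ps. l' ~= Before)"
			using z(1) unfolding zz by (auto simp: tape_clauses_def Let_def split: if_splits prod.splits)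
		then show ?thesis unfolding z(2) zz by (auto simp: act_premises_def)
	qed
	qed
	then show ?thesis using clause_at_cases[of M a 4 xs qm k] assms by (auto simp: filler_def)
qed

lemma triple_decode:
	fixes tt p W K k :: nat
	assumes "p < W" "k < K"
	shows "((tt * W + p) * K + k) div K div W = tt" "((tt * W + p) * K + k) div K mod W = p"
	"((tt * W + p) * K + k) mod K = k" using assms by (simp_all add: div_mult2_eq[symmetric])

lemma triple_less:
	fixes tt p W K k :: nat
	assumes "tt < W" "p < W" "k < K"
	shows "(tt * W + p) * K + k < W * W * K"
proof -
	have "tt * W + p < W * W" using assms mult_le_mono1[of "Suc tt" W W] by simp
	then show ?thesis using assms(3) mult_le_mono1[of "Suc (tt * W + p)" "W * W" K] by simp
qed

lemma triple_bounds:
	fixes W K j :: nat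
	assumes "j < W * W * K"
	shows "j div K div W < W" "j div K mod W < W" "j mod K < K" "(j div K div W * W + j div K mod W) * K + j mod K = j"
proof -
	have "0 < W" "0 < K" using assms by (auto intro: gr0I)
	moreover have "j div K < W * W" using assms by (rule less_mult_imp_div_less)
	then have "j div K div W < W" by (rule less_mult_imp_div_less)
	ultimately show "j div K div W < W" "j div K mod W < W" "j mod K < K"
	"(j div K div W * W + j div K mod W) * K + j mod K = j" by simp_all
qed

lemma lex_less:
	fixes tt p W K k :: nat
	assumes "p < W" "k < K" "tt < tt' | tt = tt' & (p < p' | p = p' & k < k')"
	shows "(tt * W + p) * K + k < (tt' * W + p') * K + k'"
proof -
	have "tt * W + p < tt' * W + p' | tt * W + p = tt' * W + p' & k < k'" using assms(1,3) mult_le_mono1[of "Suc tt" tt' W] by auto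
	then show ?thesis using assms(2) mult_le_mono1[of "Suc (tt * W + p)" "tt' * W + p'" K] by auto
qed

locale clause_grid =
	fixes M :: tm and x :: "bool list" and N Q :: nat
	assumes N: "1 < N" "Q <= N"
begin

definition W :: nat where "W = 2 * N + 1"
definition R :: nat where "R = W * W * (2 * width M)"
definition C :: nat where "C = W * W * (3 * width M)"

definition row_clause :: "nat => nat => nat => clause" where
	"row_clause tt p k = clause_at M (zone N tt) (zone N p) (fst (word_tape x) (int p - int N))
	 (if N <= p & p < N + Q then 1 else 0) k"

definition site_cell :: "nat => nat => nat => nat => nat => nat => cell" where
	"site_cell tt p k tt' p' s = cell_code M (zone N tt) (zone N p) (fst (word_tape x) (int p - int N))
	 (if N <= p & p < N + Q then 1 else 0) (zone N tt') (zone N p') (dsym tt tt') (dsym p p') k s"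

definition cells :: "nat => nat => cell" where
	"cells i j = site_cell (i div (2 * width M) div W) (i div (2 * width M) mod W) (i mod (2 * width M))
	 (j div (3 * width M) div W) (j div (3 * width M) mod W) (j mod (3 * width M))"

definition clauses_at :: "nat => nat => clause list" where
	"clauses_at tt p = clauses M (zone N tt) (zone N p) (fst (word_tape x) (int p - int N))
	 (if N <= p & p < N + Q then 1 else 0)"

lemma row_clause_cases: "row_clause tt p k : set (clauses_at tt p) | row_clause tt p k = filler"
	unfolding row_clause_def clauses_at_def by (rule clause_at_cases)

lemma width_pos: "0 < width M" by (simp add: width_def)

lemma W_pos: "0 < W" by (simp add: W_def)

lemma zone_W:
	assumes "p < W"
	shows "zone N p = 4 \<longleftrightarrow> p = 0" "zone N p = 5 \<longleftrightarrow> p = 2 * N" "zone N p : {1,2,3,4,5}"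
	using assms N by (auto simp: zone_def W_def)

lemma occurrence_iff:
	assumes "tt < W" "p < W" "tt' < W" "p' < W"
	shows "occurs_pos (row_clause tt p k) v (zone N p') (dsym tt tt') (dsym p p') \<longleftrightarrow>
		(EX d l. (v, d, l) : set (snd (row_clause tt p k)) & tt' = tt + d & p' = locp l p)"
	"occurs_neg (row_clause tt p k) v (zone N p') (dsym tt tt') (dsym p p') \<longleftrightarrow>
		(EX l. (v, l) : set (fst (row_clause tt p k)) & tt' = tt & p' = locp l p)"
proof -
	have bf: "p ~= 0" if "(v, Before) : set (fst (row_clause tt p k)) | (v, d, Before) : set (snd (row_clause tt p k))" for v d
	proof
	assume "p = 0"
	then have "(if N <= p & p < N + Q then 1 else 0 :: nat) = 1"
		using before_not_first[of v M "zone N tt" "fst (word_tape x) (int p - int N)" _ k d] that unfolding row_clause_def by (simp add: zone_def)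
	then show False using N \<open>p = 0\<close> by (simp split: if_splits)
	qed
	have loc: "at_loc l (zone N p') (dsym p p') \<longleftrightarrow> p' = locp l p" if "l = Before ==> p ~= 0" for l
	using that zone_W(1)[OF assms(4)] by (cases l) (auto simp: dsym_def)
	have dt: "dsym tt tt' = 2 + d \<longleftrightarrow> tt' = tt + d" if "d <= 1" for d using that by (auto simp: dsym_def)
	have d1: "d <= 1" if "(v, d, l) : set (snd (row_clause tt p k))" for d l v using concs_now[OF that[unfolded row_clause_def]] by auto
	show "occurs_pos (row_clause tt p k) v (zone N p') (dsym tt tt') (dsym p p') \<longleftrightarrow>
		(EX d l. (v, d, l) : set (snd (row_clause tt p k)) & tt' = tt + d & p' = locp l p)" unfolding occurs_pos_def using loc dt d1 bf by metis
	have dt0: "dsym tt tt' = 2 \<longleftrightarrow> tt' = tt" by (auto simp: dsym_def)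
	show "occurs_neg (row_clause tt p k) v (zone N p') (dsym tt tt') (dsym p p') \<longleftrightarrow>
		(EX l. (v, l) : set (fst (row_clause tt p k)) & tt' = tt & p' = locp l p)" unfolding occurs_neg_def dt0 using loc bf by metis
qed

text \<open>If the conclusion is for the next time, time decides. Otherwise the variable is
  \<open>VE\<close>: it is concluded at its own position in slot 0 or 1, and is a premise either in
  slot 1 of the next position or in slot 2 of the same one.\<close>

lemma occurrence_order:
	assumes "(v, d, l) : set (snd (row_clause tt p k))" "(v, l') : set (fst (row_clause tt2 p2 k2))"
	"tt2 = tt + d" "locp l p = locp l' p2" "l' = Before ==> p2 ~= 0"
	shows "tt < tt2 | tt = tt2 & (p < p2 | p = p2 & k < k2)"
	using concs_now[OF assms(1)[unfolded row_clause_def]] prems_now[OF assms(2)[unfolded row_clause_def]] assms(3-5) by auto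

lemma site_cell_iff:
	assumes "tt < W" "p < W" "tt' < W" "p' < W" "s < 3 * width M"
	shows "site_cell tt p k tt' p' s = Positive \<longleftrightarrow> (EX v. var_at M s = Some v &
		occurs_pos (row_clause tt p k) v (zone N p') (dsym tt tt') (dsym p p'))"
	and "site_cell tt p k tt' p' s = Negative \<longleftrightarrow> (EX v. var_at M s = Some v &
		~ occurs_pos (row_clause tt p k) v (zone N p') (dsym tt tt') (dsym p p') &
		occurs_neg (row_clause tt p k) v (zone N p') (dsym tt tt') (dsym p p'))"
proof -
	have "var_at M 0 = None" "var_at M (3 * width M - 1) = None" by (simp_all add: var_at_def width_def)
	then show "site_cell tt p k tt' p' s = Positive \<longleftrightarrow> (EX v. var_at M s = Some v &
		occurs_pos (row_clause tt p k) v (zone N p') (dsym tt tt') (dsym p p'))"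
	"site_cell tt p k tt' p' s = Negative \<longleftrightarrow> (EX v. var_at M s = Some v &
		~ occurs_pos (row_clause tt p k) v (zone N p') (dsym tt tt') (dsym p p') &
		occurs_neg (row_clause tt p k) v (zone N p') (dsym tt tt') (dsym p p'))"
	unfolding site_cell_def cell_code_def row_clause_def by (auto split: option.splits)
qed

lemma site_Positive:
	assumes "tt < W" "p < W" "tt' < W" "p' < W" "s < 3 * width M"
	shows "site_cell tt p k tt' p' s = Positive \<longleftrightarrow> (EX v d l. var_at M s = Some v &
		(v, d, l) : set (snd (row_clause tt p k)) & tt' = tt + d & p' = locp l p)"
	unfolding site_cell_iff(1)[OF assms] occurrence_iff(1)[OF assms(1-4)] by blast

lemma site_NegativeD:
	assumes "tt < W" "p < W" "tt' < W" "p' < W" "s < 3 * width M" "site_cell tt p k tt' p' s = Negative"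
	shows "EX v l. var_at M s = Some v & (v, l) : set (fst (row_clause tt p k)) & tt' = tt & p' = locp l p"
	using assms(6) unfolding site_cell_iff(2)[OF assms(1-5)] occurrence_iff[OF assms(1-4)] by blast

lemma site_NegativeI:
	assumes "tt < W" "p < W" "p' < W" "s < 3 * width M" "var_at M s = Some v" "(v, l) : set (fst (row_clause tt p k))" "p' = locp l p"
	"~ (EX d l'. (v, d, l') : set (snd (row_clause tt p k)) & tt = tt + d & p' = locp l' p)"
	shows "site_cell tt p k tt p' s = Negative"
	unfolding site_cell_iff(2)[OF assms(1,2,1,3,4)] occurrence_iff[OF assms(1,2,1,3)] using assms(5-8) by blast

lemma site_cell_Source: "site_cell tt p k tt' p' s = Source \<longleftrightarrow> zone N tt' = 4 & zone N p' = 4 & s = 0"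
	by (auto simp: site_cell_def cell_code_def split: option.splits)

lemma site_cell_Sink: "site_cell tt p k tt' p' s = Sink \<longleftrightarrow> zone N tt' = 5 & zone N p' = 5 & s = 3 * width M - 1"
	by (auto simp: site_cell_def cell_code_def split: option.splits)

lemma var_at_pool:
	assumes "(v, d, l) : set (snd (row_clause tt p k)) | (v, l) : set (fst (row_clause tt p k))" "tt < W" "p < W"
	obtains s where "s < 3 * width M" "var_at M s = Some v"
proof -
	have "row_clause tt p k : set (clause_pool M)"
	proof -
	have sub: "set (clauses_at tt p) \<subseteq> set (clause_pool M)" unfolding clauses_at_def
		by (rule clauses_pool) (use zone_W(3) assms(2,3) in \<open>auto simp: word_tape_def bit_symbol_def\<close>)
	have "filler : set (clause_pool M)" by (simp add: clause_pool_def)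
	then show ?thesis using row_clause_cases[of tt p k] sub by (metis subsetD)
	qed
	then have "v : set (pool_vars M)" using assms(1) by (force simp: pool_vars_def)
	then obtain k where "k < length (pool_vars M)" "pool_vars M ! k = v" by (metis in_set_conv_nth)
	then show thesis using that[of "Suc k"] by (simp add: var_at_def width_def)
qed

lemma var_at_inj: "var_at M s = Some v ==> var_at M s' = Some v ==> s = s'"
proof -
	assume a: "var_at M s = Some v" "var_at M s' = Some v"
	have "distinct (pool_vars M)" by (simp add: pool_vars_def)
	moreover have s: "0 < s" "s <= length (pool_vars M)" "0 < s'" "s' <= length (pool_vars M)"
	"pool_vars M ! (s - 1) = pool_vars M ! (s' - 1)" using a by (auto simp: var_at_def split: if_splits)
	ultimately have "s - 1 = s' - 1" by (subst (asm) nth_eq_iff_index_eq) auto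
	then show ?thesis using s by simp
qed

lemma clauses_at_length: "tt < W ==> p < W ==> length (clauses_at tt p) <= 2 * width M" unfolding clauses_at_def
	by (rule clauses_pool) (use zone_W(3) in \<open>auto simp: word_tape_def bit_symbol_def\<close>)

lemma cells_at:
	assumes "p < W" "k < 2 * width M" "p' < W" "s < 3 * width M"
	shows "cells ((tt * W + p) * (2 * width M) + k) ((tt' * W + p') * (3 * width M) + s) = site_cell tt p k tt' p' s"
	unfolding cells_def triple_decode[OF assms(1,2)] triple_decode[OF assms(3,4)] ..

lemma before_pos:
	assumes "(v, Before) : set (fst (row_clause tt p k))"
	shows "p ~= 0"
proof
	assume p: "p = 0"
	have z: "zone N 0 = 4" by (simp add: zone_def)
	have "(if N <= 0 & 0 < N + Q then 1 else 0 :: nat) = 1"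
	by (rule before_not_first, rule disjI1) (use assms[unfolded row_clause_def p z] in assumption)
	then show False using N by (simp split: if_splits)
qed

lemma cells_PositiveD:
	assumes "i < R" "j < C" "cells i j = Positive"
	shows "EX v d l. var_at M (j mod (3 * width M)) = Some v &
		(v, d, l) : set (snd (row_clause (i div (2 * width M) div W) (i div (2 * width M) mod W) (i mod (2 * width M)))) &
		j div (3 * width M) div W = i div (2 * width M) div W + d & j div (3 * width M) mod W = locp l (i div (2 * width M) mod W)"
proof -
	note b = triple_bounds[OF assms(1)[unfolded R_def]] and c = triple_bounds[OF assms(2)[unfolded C_def]]
	have "site_cell (i div (2 * width M) div W) (i div (2 * width M) mod W) (i mod (2 * width M))
	 (j div (3 * width M) div W) (j div (3 * width M) mod W) (j mod (3 * width M)) = Positive" using assms(3) by (simp only: cells_def)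
	from this[unfolded site_Positive[OF b(1,2) c(1-3)]] show ?thesis .
qed

lemma cells_NegativeD:
	assumes "i < R" "j < C" "cells i j = Negative"
	shows "EX v l. var_at M (j mod (3 * width M)) = Some v &
		(v, l) : set (fst (row_clause (i div (2 * width M) div W) (i div (2 * width M) mod W) (i mod (2 * width M)))) &
		j div (3 * width M) div W = i div (2 * width M) div W & j div (3 * width M) mod W = locp l (i div (2 * width M) mod W)"
proof -
	note b = triple_bounds[OF assms(1)[unfolded R_def]] and c = triple_bounds[OF assms(2)[unfolded C_def]]
	have "site_cell (i div (2 * width M) div W) (i div (2 * width M) mod W) (i mod (2 * width M))
	 (j div (3 * width M) div W) (j div (3 * width M) mod W) (j mod (3 * width M)) = Negative" using assms(3) by (simp only: cells_def)
	from site_NegativeD[OF b(1,2) c(1-3) this] show ?thesis .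
qed

theorem grid_solvable_iff:
	"(EX h. csp_solution (6 * width M * (W * W)) (cell_grid cells) h) \<longleftrightarrow>
	 (EX \<sigma>. ALL tt<=2 * N. ALL p<=2 * N. ALL c : set (clauses_at tt p). clause_sat \<sigma> tt p c)"
proof
	have S: "6 * width M * (W * W) = 3 * R" "6 * width M * (W * W) = 2 * C" by (simp_all add: R_def C_def)
	have C0: "0 < C" using W_pos width_pos by (simp add: C_def)
	have last: "C - 1 = (2 * N * W + 2 * N) * (3 * width M) + (3 * width M - 1)"
	proof -
	have "C = (2 * N * W + 2 * N) * (3 * width M) + 3 * width M" by (simp add: C_def W_def algebra_simps)
	then show ?thesis using width_pos by simp
	qed
	have src: "cells i 0 = Source" if "i < R" for i
	proof -
	have "zone N 0 = 4" by (simp add: zone_def)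
	then show ?thesis by (simp add: cells_def site_cell_Source)
	qed
	have snk: "cells i (C - 1) = Sink" if "i < R" for i
	proof -
	have l: "2 * N < W" "3 * width M - 1 < 3 * width M" using width_pos by (simp_all add: W_def)
	show ?thesis unfolding cells_def last triple_decode[OF l] using zone_W(2)[OF l(1)] by (simp add: site_cell_Sink)
	qed
	have dec: "i div (2 * width M) div W < W" "i div (2 * width M) mod W < W" "i mod (2 * width M) < 2 * width M"
	"(i div (2 * width M) div W * W + i div (2 * width M) mod W) * (2 * width M) + i mod (2 * width M) = i" if "i < R" for i
	by (rule triple_bounds[OF that[unfolded R_def]])+
	have decC: "j div (3 * width M) div W < W" "j div (3 * width M) mod W < W" "j mod (3 * width M) < 3 * width M"
	"(j div (3 * width M) div W * W + j div (3 * width M) mod W) * (3 * width M) + j mod (3 * width M) = j" if "j < C" for j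
	by (rule triple_bounds[OF that[unfolded C_def]])+
	note pos = cells_PositiveD and neg = cells_NegativeD and bf = before_pos
	have ord: "i < i'" if i: "i < R" "i' < R" "j < C" and c: "cells i j = Positive" "cells i' j = Negative" for i i' j
	proof -
	obtain v d l where 1: "var_at M (j mod (3 * width M)) = Some v"
		"(v, d, l) : set (snd (row_clause (i div (2 * width M) div W) (i div (2 * width M) mod W) (i mod (2 * width M))))"
		"j div (3 * width M) div W = i div (2 * width M) div W + d" "j div (3 * width M) mod W = locp l (i div (2 * width M) mod W)"
		using pos[OF i(1,3) c(1)] by blast
	obtain v' l' where 2: "var_at M (j mod (3 * width M)) = Some v'"
		"(v', l') : set (fst (row_clause (i' div (2 * width M) div W) (i' div (2 * width M) mod W) (i' mod (2 * width M))))"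
		"j div (3 * width M) div W = i' div (2 * width M) div W" "j div (3 * width M) mod W = locp l' (i' div (2 * width M) mod W)"
		using neg[OF i(2,3) c(2)] by blast
	have v: "v' = v" using 1(1) 2(1) by simp
	have bf': "l' = Before ==> i' div (2 * width M) mod W ~= 0" using bf[of v'] 2(2) by blast
	have "(i div (2 * width M) div W * W + i div (2 * width M) mod W) * (2 * width M) + i mod (2 * width M)
		 < (i' div (2 * width M) div W * W + i' div (2 * width M) mod W) * (2 * width M) + i' mod (2 * width M)"
		by (rule lex_less[OF dec(2,3)[OF i(1)]], rule occurrence_order[OF 1(2) 2(2)[unfolded v]])
			(use 1(3,4) 2(3,4) bf' in simp_all)
	then show ?thesis unfolding dec(4)[OF i(1)] dec(4)[OF i(2)] .
	qed
	{
	assume "EX h. csp_solution (6 * width M * (W * W)) (cell_grid cells) h"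
	then obtain h where h: "csp_solution (6 * width M * (W * W)) (cell_grid cells) h" by blast
	have "EX \<rho>. ALL i<R. EX j<C. literal_holds \<rho> cells i j" by (rule csp_satisfies[where c = cells and h = h, OF S C0 ord src snk h])
	then obtain \<rho> where rho: "\<And>i. i < R ==> EX j<C. literal_holds \<rho> cells i j" by blast
	define \<sigma> where "\<sigma> tt p v = \<rho> ((tt * W + p) * (3 * width M) + (SOME s. s < 3 * width M & var_at M s = Some v))" for tt p v
	have sig: "\<sigma> (j div (3 * width M) div W) (j div (3 * width M) mod W) v = \<rho> j"
		if "j < C" "var_at M (j mod (3 * width M)) = Some v" for j v
	proof -
		have "(SOME s. s < 3 * width M & var_at M s = Some v) = j mod (3 * width M)"
			by (rule some_equality) (use that decC(3)[OF that(1)] var_at_inj in blast)+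
		then show ?thesis unfolding \<sigma>_def using decC(4)[OF that(1)] by simp
	qed
	have "clause_sat \<sigma> tt p c" if tt: "tt <= 2 * N" "p <= 2 * N" and c: "c : set (clauses_at tt p)" for tt p c
	proof -
		have W: "tt < W" "p < W" using tt by (simp_all add: W_def)
		obtain k where k: "k < 2 * width M" "row_clause tt p k = c" unfolding row_clause_def
			by (rule clause_atE[OF c[unfolded clauses_at_def] clauses_at_length[OF W, unfolded clauses_at_def]])
		define i where "i = (tt * W + p) * (2 * width M) + k"
		have i: "i < R" unfolding i_def R_def by (rule triple_less[OF W k(1)])
		have di: "i div (2 * width M) div W = tt" "i div (2 * width M) mod W = p" "i mod (2 * width M) = k"
			unfolding i_def by (rule triple_decode[OF W(2) k(1)])+
		obtain j where j: "j < C" "literal_holds \<rho> cells i j" using rho[OF i] by blast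
		from j(2) consider "cells i j = Positive" "\<rho> j" | "cells i j = Negative" "~ \<rho> j" unfolding literal_holds_def by blast
		then show ?thesis
		proof cases
			case 1
			then show ?thesis using pos[OF i j(1) 1(1)] sig[OF j(1)] unfolding di k(2) clause_sat_def by fastforce
		next
			case 2
			then show ?thesis using neg[OF i j(1) 2(1)] sig[OF j(1)] unfolding di k(2) clause_sat_def by fastforce
		qed
	qed
	then show "EX \<sigma>. ALL tt<=2 * N. ALL p<=2 * N. ALL c : set (clauses_at tt p). clause_sat \<sigma> tt p c" by blast
	next
	assume "EX \<sigma>. ALL tt<=2 * N. ALL p<=2 * N. ALL c : set (clauses_at tt p). clause_sat \<sigma> tt p c"
	then obtain \<sigma>0 where s0: "\<And>tt p c. tt <= 2 * N ==> p <= 2 * N ==> c : set (clauses_at tt p) ==> clause_sat \<sigma>0 tt p c" by blast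
	\<comment> \<open>Making \<open>VT\<close> true everywhere satisfies the fillers, and it destroys
	  no other clause because \<open>VT\<close> is never a premise.\<close>
	define \<sigma> where "\<sigma> tt p v \<longleftrightarrow> v = VT | \<sigma>0 tt p v" for tt p v
	define \<rho> where "\<rho> j \<longleftrightarrow> (EX v. var_at M (j mod (3 * width M)) = Some v &
			\<sigma> (j div (3 * width M) div W) (j div (3 * width M) mod W) v)" for j
	have holds: "EX j<C. literal_holds \<rho> cells i j" if i: "i < R" for i
	proof -
		define tt p k where d: "tt = i div (2 * width M) div W" "p = i div (2 * width M) mod W" "k = i mod (2 * width M)"
		have W: "tt < W" "p < W" "k < 2 * width M" unfolding d using dec[OF i] by blast+
		have W': "tt <= 2 * N" "p <= 2 * N" using W by (simp_all add: W_def)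
		have "clause_sat \<sigma> tt p (row_clause tt p k)"
		proof (cases "row_clause tt p k = filler")
			case True
			then show ?thesis by (simp add: clause_sat_def filler_def \<sigma>_def)
		next
			case False
			then have "row_clause tt p k : set (clauses_at tt p)" using row_clause_cases by blast
			from s0[OF W' this] have s: "clause_sat \<sigma>0 tt p (row_clause tt p k)" .
			have nv: "v ~= VT" if "(v, l) : set (fst (row_clause tt p k))" for v l using prems_now(1)[OF that[unfolded row_clause_def]] .
			show ?thesis using s nv unfolding clause_sat_def \<sigma>_def by fast
		qed
		then consider v l where "(v, l) : set (fst (row_clause tt p k))" "~ \<sigma> tt (locp l p) v"
			| v d l where "(v, d, l) : set (snd (row_clause tt p k))" "\<sigma> (tt + d) (locp l p) v" unfolding clause_sat_def by fast
		then show ?thesis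
		proof cases
			case 1
			obtain s where s: "s < 3 * width M" "var_at M s = Some v" by (rule var_at_pool[OF disjI2[OF 1(1)] W(1,2)])
			have lp: "locp l p < W" using W(2) by (cases l) auto
			define j where "j = (tt * W + locp l p) * (3 * width M) + s"
			have j: "j < C" unfolding j_def C_def by (rule triple_less[OF W(1) lp s(1)])
			note dj = triple_decode[OF lp s(1), of tt, folded j_def]
			have no: "~ (EX d l'. (v, d, l') : set (snd (row_clause tt p k)) & tt = tt + d & locp l p = locp l' p)"
			proof
				assume "EX d l'. (v, d, l') : set (snd (row_clause tt p k)) & tt = tt + d & locp l p = locp l' p"
				then obtain d l' where o: "(v, d, l') : set (snd (row_clause tt p k))" "tt = tt + d" "locp l' p = locp l p" by auto
				have "l = Before ==> p ~= 0" using bf 1(1) by blast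
				from occurrence_order[OF o(1) 1(1) o(2,3) this] show False by simp
			qed
			have "cells i j = Negative" unfolding cells_def dj d[symmetric] by (rule site_NegativeI[OF W(1,2) lp s 1(1) refl no])
			moreover have "~ \<rho> j" unfolding \<rho>_def dj using s(2) 1(2) by auto
			ultimately show ?thesis using j unfolding literal_holds_def by blast
		next
			case 2
			\<comment> \<open>At the last time all conclusions refer to that time itself, so the column of
			  the literal exists.\<close>
			have td: "tt + d < W"
			proof (cases "tt = 2 * N")
				case True
				then have "zone N tt = 5" using zone_W(2)[OF W(1)] by blast
				then show ?thesis using concs_last 2(1)[unfolded row_clause_def] W(1) by fastforce
			next
				case False
				then show ?thesis using concs_now[OF 2(1)[unfolded row_clause_def]] W' by (auto simp: W_def)
			qed
			obtain s where s: "s < 3 * width M" "var_at M s = Some v" by (rule var_at_pool[OF disjI1[OF 2(1)] W(1,2)])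
			have lp: "locp l p < W" using W(2) by (cases l) auto
			define j where "j = ((tt + d) * W + locp l p) * (3 * width M) + s"
			have j: "j < C" unfolding j_def C_def by (rule triple_less[OF td lp s(1)])
			note dj = triple_decode[OF lp s(1), of "tt + d", folded j_def]
			have "cells i j = Positive" unfolding cells_def dj d[symmetric] site_Positive[OF W(1,2) td lp s(1)] using s(2) 2(1) by blast
			moreover have "\<rho> j" unfolding \<rho>_def dj using s(2) 2(2) by auto
			ultimately show ?thesis using j unfolding literal_holds_def by blast
		qed
	qed
	have only: "(cells i j = Source --> j = 0) & (cells i j = Sink --> j = C - 1)" if "i < R" "j < C" for i j
	proof -
		have j0: "j = 0" if "j div (3 * width M) div W = 0" "j div (3 * width M) mod W = 0" "j mod (3 * width M) = 0"
			using decC(4)[OF \<open>j < C\<close>] that by simp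
		have jl: "j = C - 1" if "j div (3 * width M) div W = 2 * N" "j div (3 * width M) mod W = 2 * N" "j mod (3 * width M) = 3 * width M - 1"
			using decC(4)[OF \<open>j < C\<close>] unfolding that last by simp
		show ?thesis
			unfolding cells_def site_cell_Source site_cell_Sink zone_W(1,2)[OF decC(1)[OF \<open>j < C\<close>]] zone_W(1,2)[OF decC(2)[OF \<open>j < C\<close>]]
			by (intro conjI impI; elim conjE; (rule j0; assumption | rule jl; assumption))
	qed
	show "EX h. csp_solution (6 * width M * (W * W)) (cell_grid cells) h"
		by (rule satisfies_csp[where c = cells and \<sigma> = \<rho>, OF S C0 src snk only holds])
	}
qed

end

section \<open>Adjacency in the lattice\<close>

definition site_size :: nat where "site_size = 1009"

definition flip :: "nat => nat" where
	"flip s = (if s = 1 then 3 else if s = 3 then 1 else s)"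

text \<open>Whether a gadget edge leads from offset \<open>k\<close> of one block to offset
  \<open>k'\<close> of another depends on the two sites only through their differences. The first
  component of a gadget edge is always inner and thus determines the copy.\<close>

definition arrow :: "nat => nat => nat => nat => bool" where
	"arrow dy dx k k' \<longleftrightarrow> (EX e<18. EX (i, j) : set gadget_edges. k = Suc (e * 56 + i) &
	 (j < 56 & dy = 2 & dx = 2 & k' = Suc (e * 56 + j) | j = 56 & dy = 2 & dx = 2 & k' = 0 |
		j = 57 & k' = 0 & (if e < 9 then dy = 2 & dx = 3 else dy = 3 & dx = 2)))"

definition adjacency :: "nat => nat => nat => nat => bool" where
	"adjacency dy dx k k' \<longleftrightarrow> arrow dy dx k k' | arrow (flip dy) (flip dx) k' k"

lemma diff_symbol_flip: "dsym b a = flip (dsym a b)" by (auto simp: dsym_def flip_def)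

lemma diff_symbol_iff: "dsym a b = 2 \<longleftrightarrow> b = a" "dsym a b = 3 \<longleftrightarrow> b = Suc a"
	by (auto simp: dsym_def)

lemma block_eq_iff:
	fixes a b r s K :: nat
	assumes "r < K" "s < K"
	shows "a * K + r = b * K + s \<longleftrightarrow> a = b & r = s"
proof
	assume e: "a * K + r = b * K + s"
	have "(a * K + r) div K = a" "(b * K + s) div K = b" using assms by simp_all
	then have "a = b" using e by simp
	then show "a = b & r = s" using e by simp
qed simp

lemma vertex_eq_iff:
	fixes y x k y' x' k' S :: nat
	assumes "x < S" "x' < S" "k < 1009" "k' < 1009"
	shows "(y * S + x) * 1009 + k = (y' * S + x') * 1009 + k' \<longleftrightarrow> y = y' & x = x' & k = k'"
	unfolding block_eq_iff[OF assms(3,4)] block_eq_iff[OF assms(1,2)] by blast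

definition half_edge :: "nat => nat => nat => bool" where
	"half_edge S v v' \<longleftrightarrow> (EX g i j. (i, j) : set gadget_edges & node_ok S g i & node_ok S g j & v = vtx S g i & v' = vtx S g j)"

lemma half_edge_lattice: "half_edge S v v' ==> {v, v'} : lattice_edges S"
proof -
	assume "half_edge S v v'"
	then obtain g i j where g: "(i, j) : set gadget_edges" "node_ok S g i" "node_ok S g j" "v = vtx S g i" "v' = vtx S g j"
	unfolding half_edge_def by blast
	have "{v, v'} = {vtx S g i, vtx S g j}" by (simp only: g(4,5))
	then show ?thesis unfolding lattice_edges_def using g(1-3) by blast
qed

lemma lattice_edge_half: "{v, v'} : lattice_edges S \<longleftrightarrow> half_edge S v v' | half_edge S v' v"
proof
	assume "{v, v'} : lattice_edges S"
	then obtain g k l where g: "{v, v'} = {vtx S g k, vtx S g l}" "(k, l) : set gadget_edges" "node_ok S g k" "node_ok S g l"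
	unfolding lattice_edges_def by blast
	have "half_edge S (vtx S g k) (vtx S g l)" unfolding half_edge_def using g(2-4) by blast
	moreover have "v = vtx S g k & v' = vtx S g l | v = vtx S g l & v' = vtx S g k" using g(1) by (simp add: doubleton_eq_iff)
	ultimately show "half_edge S v v' | half_edge S v' v" by metis
next
	assume "half_edge S v v' | half_edge S v' v"
	then show "{v, v'} : lattice_edges S" using half_edge_lattice[of S v v'] half_edge_lattice[of S v' v] by (auto simp: insert_commute)
qed

lemma half_edge_iff:
	assumes "y < S" "x < S" "y' < S" "x' < S" "k < 1009" "k' < 1009"
	shows "half_edge S ((y * S + x) * 1009 + k) ((y' * S + x') * 1009 + k') \<longleftrightarrow>
	 arrow (dsym y y') (dsym x x') k k'"
proof
	assume "half_edge S ((y * S + x) * 1009 + k) ((y' * S + x') * 1009 + k')"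
	then obtain g i j where g: "(i, j) : set gadget_edges" "node_ok S g i" "node_ok S g j"
	"(y * S + x) * 1009 + k = vtx S g i" "(y' * S + x') * 1009 + k' = vtx S g j" unfolding half_edge_def by blast
	obtain a b e where ge: "g = (a, b, e)" by (metis prod_cases3)
	have ok: "a < S" "b < S" "e < 18" using g(2) by (auto simp: ge node_ok_def gadgets_def)
	have ij: "i < 56" "j < 58" using gadget_edge_bounds[OF g(1)] by auto
	have "Suc (e * 56 + i) < 1009" using ok(3) ij(1) by linarith
	moreover have "vtx S g i = (a * S + b) * 1009 + Suc (e * 56 + i)" using ij(1) by (simp only: ge vtx.simps if_True)
	ultimately have 1: "y = a" "x = b" "k = Suc (e * 56 + i)" using g(4) vertex_eq_iff[OF assms(2) ok(2) assms(5)] by metis+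
	consider "j < 56" | "j = 56" | "j = 57" using ij(2) by linarith
	then have "j < 56 & dsym y y' = 2 & dsym x x' = 2 & k' = Suc (e * 56 + j) |
	 j = 56 & dsym y y' = 2 & dsym x x' = 2 & k' = 0 |
	 j = 57 & k' = 0 & (if e < 9 then dsym y y' = 2 & dsym x x' = 3 else dsym y y' = 3 & dsym x x' = 2)"
	proof cases
	case 1
	have "Suc (e * 56 + j) < 1009" using ok(3) 1 by linarith
	moreover have "vtx S g j = (a * S + b) * 1009 + Suc (e * 56 + j)" using 1 by (simp only: ge vtx.simps if_True)
	ultimately have "y' = a" "x' = b" "k' = Suc (e * 56 + j)" using g(5) vertex_eq_iff[OF assms(4) ok(2) assms(6)] by metis+
	then show ?thesis using 1 \<open>y = a\<close> \<open>x = b\<close> by (simp add: diff_symbol_iff)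
	next
	case 2
	have "vtx S g j = (a * S + b) * 1009 + 0" using 2 by (simp add: ge vtx_56 hub_def)
	then have "y' = a" "x' = b" "k' = 0" using g(5) vertex_eq_iff[OF assms(4) ok(2) assms(6), of 0] by simp_all
	then show ?thesis using 2 \<open>y = a\<close> \<open>x = b\<close> by (simp add: diff_symbol_iff)
	next
	case 3
	obtain c d where t: "target g = (c, d)" by (metis surj_pair)
	have cd: "c < S" "d < S" using g(3) 3 t by (auto simp: node_ok_def sites_def)
	have "vtx S g j = (c * S + d) * 1009 + 0" using 3 by (simp add: vtx_57 t hub_def)
	then have "y' = c" "x' = d" "k' = 0" using g(5) vertex_eq_iff[OF assms(4) cd(2) assms(6), of 0] by simp_all
	then show ?thesis using 3 t \<open>y = a\<close> \<open>x = b\<close> by (auto simp: ge diff_symbol_iff split: if_splits)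
	qed
	then show "arrow (dsym y y') (dsym x x') k k'"
	unfolding arrow_def using ok(3) g(1) 1(3) by (intro exI[of _ e] conjI bexI[of _ "(i, j)"]) auto
next
	assume "arrow (dsym y y') (dsym x x') k k'"
	then obtain e i j where a: "e < 18" "(i, j) : set gadget_edges" "k = Suc (e * 56 + i)"
	"j < 56 & dsym y y' = 2 & dsym x x' = 2 & k' = Suc (e * 56 + j) |
	 j = 56 & dsym y y' = 2 & dsym x x' = 2 & k' = 0 |
	 j = 57 & k' = 0 & (if e < 9 then dsym y y' = 2 & dsym x x' = 3 else dsym y y' = 3 & dsym x x' = 2)"
	unfolding arrow_def by auto
	have ij: "i < 56" "j < 58" using gadget_edge_bounds[OF a(2)] by auto
	let ?g = "(y, x, e)"
	have gg: "?g : gadgets S" using assms a(1) by (simp add: gadgets_def)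
	have ni: "node_ok S ?g i" using gg ij by (simp add: node_ok_def)
	have vi: "(y * S + x) * 1009 + k = vtx S ?g i" using ij(1) a(3) by (simp only: vtx.simps if_True)
	have "node_ok S ?g j & (y' * S + x') * 1009 + k' = vtx S ?g j" using a(4)
	proof (elim disjE conjE)
	assume j: "j < 56" "dsym y y' = 2" "dsym x x' = 2" "k' = Suc (e * 56 + j)"
	have "vtx S ?g j = (y * S + x) * 1009 + Suc (e * 56 + j)" using j(1) by (simp only: vtx.simps if_True)
	then show ?thesis using gg j by (simp add: diff_symbol_iff node_ok_def del: vtx.simps)
	next
	assume "j = 56" "dsym y y' = 2" "dsym x x' = 2" "k' = 0"
	then show ?thesis using gg by (simp add: diff_symbol_iff node_ok_def vtx_56 hub_def del: vtx.simps)
	next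
	assume j: "j = 57" "k' = 0" "if e < 9 then dsym y y' = 2 & dsym x x' = 3 else dsym y y' = 3 & dsym x x' = 2"
	then have "target ?g = (y', x')" by (auto simp: diff_symbol_iff split: if_splits)
	then show ?thesis using gg j assms by (simp add: node_ok_def vtx_57 hub_def sites_def del: vtx.simps target.simps)
	qed
	then show "half_edge S ((y * S + x) * 1009 + k) ((y' * S + x') * 1009 + k')" unfolding half_edge_def using a(2) ni vi by blast
qed

lemma lattice_edge_iff:
	assumes "y < S" "x < S" "y' < S" "x' < S" "k < 1009" "k' < 1009"
	shows "{(y * S + x) * 1009 + k, (y' * S + x') * 1009 + k'} : lattice_edges S \<longleftrightarrow>
	 adjacency (dsym y y') (dsym x x') k k'"
	unfolding lattice_edge_half half_edge_iff[OF assms] half_edge_iff[OF assms(3,4,1,2,6,5)] adjacency_def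
	diff_symbol_flip[of y' y] diff_symbol_flip[of x' x] ..

text \<open>The difference of two numbers with two digits, as far as it is -1, 0 or 1. If the
  leading digits agree, the last digits decide; if they differ by one, only a carry from the largest
  to the smallest last digit matters.\<close>

definition digit_diff :: "nat => nat => bool => bool => bool => bool => nat" where
	"digit_diff sa sr l f' f l' = (if sa = 2 then sr else if sa = 3 & l & f' then 3 else if sa = 1 & f & l' then 1 else 0)"

lemma digit_diff:
	fixes a a' r r' K :: nat
	assumes "r < K" "r' < K"
	shows "dsym (a * K + r) (a' * K + r') =
	digit_diff (dsym a a') (dsym r r') (r = K - 1) (r' = 0) (r = 0) (r' = K - 1)"
proof -
	consider "a' = a" | "a' = Suc a" | "a = Suc a'" | "a + 2 <= a'" | "a' + 2 <= a" by linarith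
	then show ?thesis
	proof cases
	case 4
	then have "a * K + 2 * K <= a' * K" using mult_le_mono1[of "a + 2" a' K] by (simp add: algebra_simps)
	then show ?thesis using 4 assms by (simp add: digit_diff_def dsym_def)
	next
	case 5
	then have "a' * K + 2 * K <= a * K" using mult_le_mono1[of "a' + 2" a K] by (simp add: algebra_simps)
	then show ?thesis using 5 assms by (simp add: digit_diff_def dsym_def)
	qed (use assms in \<open>auto simp: digit_diff_def dsym_def\<close>)
qed

text \<open>A coordinate of a site has three digits: time, position, and place within the position.
  The zones 4 and 5 tell the machine whether the middle digit is smallest or largest.\<close>

definition line_diff :: "nat => nat => nat => nat => nat => nat => nat => nat" where
	"line_diff z dt dp b b' r r' = digit_diff (digit_diff dt dp (b = 5) (b' = 4) (b = 4) (b' = 5))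
	 (dsym r r') (r = z - 1) (r' = 0) (r = 0) (r' = z - 1)"

lemma line_diff:
	assumes "p < 2 * N + 1" "p' < 2 * N + 1" "r < z" "r' < z" "1 < N"
	shows "dsym ((tt * (2 * N + 1) + p) * z + r) ((tt' * (2 * N + 1) + p') * z + r') =
	line_diff z (dsym tt tt') (dsym p p') (zone N p) (zone N p') r r'"
proof -
	have "zone N p = 4 \<longleftrightarrow> p = 0" "zone N p = 5 \<longleftrightarrow> p = 2 * N + 1 - 1" if "p < 2 * N + 1" for p
	using that assms(5) by (auto simp: zone_def)
	then show ?thesis unfolding line_diff_def digit_diff[OF assms(3,4)] digit_diff[OF assms(1,2)] using assms(1,2) by simp
qed

section \<open>The reduction is computable in polynomial time\<close>

lemma map_block:
	fixes a b :: nat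
	shows "map f [0..<a * b] = concat (map (%i. map (%j. f (i * b + j)) [0..<b]) [0..<a])"
proof (induction a)
	case (Suc a)
	have "[0..<Suc a * b] = [0..<a * b] @ map (%j. a * b + j) [0..<b]"
	using upt_add_eq_append[of 0 "a * b" b] map_add_upt[of "a * b" b] by (simp add: add.commute)
	then show ?case using Suc by simp
qed simp

lemma concat_map_concat: "concat (concat xss) = concat (map concat xss)" by (induction xss) auto

lemma concat_block:
	fixes a b :: nat
	shows "concat (map f [0..<a * b]) = concat (map (%i. concat (map (%j. f (i * b + j)) [0..<b])) [0..<a])"
	unfolding map_block concat_map_concat by (simp add: comp_def)

text \<open>The three digits of a site coordinate as nested loops. Two of them will run on tapes
  that bear zones; the innermost has a constant bound and is unrolled in the program.\<close>

definition nest :: "nat => nat => (nat => nat => nat => 'a list) => 'a list" where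
	"nest W z F = concat (map (%tt. concat (map (%p. concat (map (%r. F tt p r) [0..<z])) [0..<W])) [0..<W])"

lemma concat_nest: "concat (map f [0..<W * W * z]) = nest W z (%tt p r. f ((tt * W + p) * z + r))"
	unfolding nest_def concat_block[of f "W * W" z] concat_block[of _ W W] ..

lemma nest_cong:
	assumes "\<And>tt p r. tt < W ==> p < W ==> r < z ==> F tt p r = G tt p r"
	shows "nest W z F = nest W z G" unfolding nest_def using assms by (intro arg_cong[where f = concat] map_cong refl) simp

definition sweep :: "nat => nat => (nat \<times> move) list => (nat \<times> move) list => nat => (nat => prog) => prog" where
	"sweep a b ma mb z body = loop a ma (loop b mb (unroll z body))"

text \<open>The 5 bounds the number of heads that a loop moves along.\<close>

definition sweep_time :: "nat => nat => nat => nat" where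
	"sweep_time z W t = W * ((W * (z * t + 1 + 2 * 5 + 4) + 2 * 5 + 4) + 2 * 5 + 4) + 2 * 5 + 4"

lemma wf_sweep [simp]: "wf_prog (sweep a b ma mb z body) \<longleftrightarrow> (ALL r<z. wf_prog (body r)) &
	fst ` set ma \<subseteq> {..<ntapes} & fst ` set mb \<subseteq> {..<ntapes}" by (auto simp: sweep_def)

lemma zone_tape_at:
	assumes "1 < N"
	shows "k < 2 * N + 1 ==> zone_tape N (- int N + int k) = zone N k"
	"k < 2 * N + 1 ==> zone_tape N (- int N + int k) ~= 0"
	"zone_tape N (- int N + int (2 * N + 1)) = 0" "zone_tape N (- int N - 1) = 0" using assms by (auto simp: zone_tape_def zone_def)

lemma emits_sweep:
	assumes N: "1 < N" and W: "W = 2 * N + 1"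
	and ma: "fst ` set ma \<subseteq> {0<..<ntapes}" "length ma <= 5" "off ma a = 1" "off ma b = 0"
	and mb: "fst ` set mb \<subseteq> {0<..<ntapes}" "length mb <= 5" "off mb b = 1"
	and ab: "0 < a" "a < ntapes" "0 < b" "b < ntapes"
	and w: "w a = zone_tape N" "w b = zone_tape N" "h a = - int N" "h b = - int N"
	and body: "\<And>tt p r. tt < W ==> p < W ==> r < z ==> emits (body r) w (shifted mb p (shifted ma tt h)) (F tt p r) t"
	shows "emits (sweep a b ma mb z body) w h (nest W z F) (sweep_time z W t)"
proof -
	let ?tb = "W * (z * t + 1 + 2 * length mb + 4) + 2 * length mb + 4"
	have inner: "emits (loop b mb (unroll z body)) w (shifted ma tt h)
		(concat (map (%p. concat (map (%r. F tt p r) [0..<z])) [0..<W])) ?tb" if tt: "tt < W" for tt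
	proof (rule emits_loop[OF mb(1) ab(3,4) mb(3)])
	have hb: "shifted ma tt h b = - int N" using ma(4) w(4) by (simp add: shifted_def)
	show "w b (shifted ma tt h b + int k) ~= 0" if "k < W" for k unfolding hb w(2) using zone_tape_at(2)[OF N, of k] that W by simp
	show "w b (shifted ma tt h b + int W) = 0" unfolding hb w(2) W by (rule zone_tape_at(3)[OF N])
	show "w b (shifted ma tt h b - 1) = 0" unfolding hb w(2) by (rule zone_tape_at(4)[OF N])
	show "emits (unroll z body) w (shifted mb p (shifted ma tt h)) (concat (map (%r. F tt p r) [0..<z])) (z * t + 1)"
		if "p < W" for p by (rule emits_unroll) (rule body[OF tt that])
	qed
	have "emits (loop a ma (loop b mb (unroll z body))) w h
		(concat (map (%tt. concat (map (%p. concat (map (%r. F tt p r) [0..<z])) [0..<W])) [0..<W]))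
		(W * (?tb + 2 * length ma + 4) + 2 * length ma + 4)"
	proof (rule emits_loop[OF ma(1) ab(1,2) ma(3)])
	show "w a (h a + int k) ~= 0" if "k < W" for k unfolding w using zone_tape_at(2)[OF N, of k] that W by simp
	show "w a (h a + int W) = 0" unfolding w W by (rule zone_tape_at(3)[OF N])
	show "w a (h a - 1) = 0" unfolding w by (rule zone_tape_at(4)[OF N])
	qed (rule inner)
	then show ?thesis unfolding sweep_def nest_def
	proof (rule emits_mono)
	have "?tb <= W * (z * t + 1 + 2 * 5 + 4) + 2 * 5 + 4" using mb(2) by (intro add_mono mult_le_mono) auto
	then show "W * (?tb + 2 * length ma + 4) + 2 * length ma + 4 <= sweep_time z W t"
		unfolding sweep_time_def using ma(2) mb(2) by (intro add_mono mult_le_mono) auto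
	qed
qed

definition site_string :: "cell => nat => nat => bool list" where
	"site_string c a b = concat (map (%r. encode_nat_set (set (block_list (cell_forbidden c a b 0) (cell_forbidden c a b 1) r))) [0..<site_size])"

definition site_bound :: nat where
	"site_bound = Max ((%(c, a, b). length (site_string c a b)) ` ({Blank, Positive, Negative, Source, Sink} \<times> {..<3} \<times> {..<2}))"

lemma site_bound: "a < 3 ==> b < 2 ==> length (site_string c a b) <= site_bound" unfolding site_bound_def
	by (rule Max_ge) (auto intro!: image_eqI[of _ _ "(c, a, b)"], cases c, auto)

definition count_program :: "nat => prog" where
	"count_program z = sweep 6 7 [(6, Rt)] [(7, Rt)] z (%r.
	 sweep 8 9 [(8, Rt)] [(9, Rt)] z (%r'. Emit (%v. replicate site_size True) site_size))"

definition adjacency_row :: "nat => nat => nat => nat => nat => nat => view => bool list" where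
	"adjacency_row z r r' k s s' v = map (adjacency (line_diff z (v 14) (v 15) (v 7) (v 11) r s)
	 (line_diff z (v 16) (v 17) (v 9) (v 13) r' s') k) [0..<site_size]"

text \<open>The loops over the first vertex move the heads of tapes 14 to 17 to the left, those over
  the second vertex to the right. These tapes therefore show the differences of the digits.\<close>

definition adjacency_program :: "nat => prog" where
	"adjacency_program z =
	 sweep 6 7 [(6, Rt), (14, Lt)] [(7, Rt), (15, Lt)] z (%r.
	 sweep 8 9 [(8, Rt), (16, Lt)] [(9, Rt), (17, Lt)] z (%r'.
	 unroll site_size (%k.
	 sweep 10 11 [(10, Rt), (14, Rt)] [(11, Rt), (15, Rt)] z (%s.
	 sweep 12 13 [(12, Rt), (16, Rt)] [(13, Rt), (17, Rt)] z (%s'.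
	 Emit (adjacency_row z r r' k s s') site_size)))))"

definition view_cell :: "tm => nat => nat => view => cell" where
	"view_cell M k s v = cell_code M (v 6) (v 7) (v 2) (v 3) (v 8) (v 9) (v 14) (v 15) k s"

text \<open>The outer sweep runs through rows, that is clauses, and the inner one through columns,
  that is variables. Tapes 2 and 3 follow the position of the clause and show its input symbol and
  whether certificate symbols are allowed there.\<close>

definition list_program :: "tm => nat => prog" where
	"list_program M z =
	 sweep 6 7 [(6, Rt), (14, Lt)] [(7, Rt), (15, Lt), (2, Rt), (3, Rt)] z (%r.
	 sweep 8 9 [(8, Rt), (14, Rt)] [(9, Rt), (15, Rt)] z (%r'.
	 Emit (%v. site_string (view_cell M (r div 3) (r' div 2) v) (r mod 3) (r' mod 2)) site_bound))"

lemma wf_programs: "wf_prog (count_program z)" "wf_prog (adjacency_program z)" "wf_prog (list_program M z)"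
	by (auto simp: count_program_def adjacency_program_def list_program_def ntapes_def)

lemma diff_tape: "diff_tape (int b - int a) = dsym a b" by (auto simp: diff_tape_def dsym_def)

context
	fixes x :: "bool list" and q N W z :: nat
	assumes N: "1 < N" and W: "W = 2 * N + 1"
begin

abbreviation "w0 \<equiv> work_tapes x q N"
abbreviation "h0 \<equiv> work_heads N"

lemma w0_simps:
	"w0 6 = zone_tape N" "w0 7 = zone_tape N" "w0 8 = zone_tape N" "w0 9 = zone_tape N"
	"w0 10 = zone_tape N" "w0 11 = zone_tape N" "w0 12 = zone_tape N" "w0 13 = zone_tape N"
	"w0 14 = diff_tape" "w0 15 = diff_tape" "w0 16 = diff_tape" "w0 17 = diff_tape"
	"w0 2 = fst (word_tape x)" "w0 3 = marks q" by (simp_all add: work_tapes_def)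

lemma h0_simps:
	"h0 6 = - int N" "h0 7 = - int N" "h0 8 = - int N" "h0 9 = - int N"
	"h0 10 = - int N" "h0 11 = - int N" "h0 12 = - int N" "h0 13 = - int N"
	"h0 14 = 0" "h0 15 = 0" "h0 16 = 0" "h0 17 = 0" "h0 2 = - int N" "h0 3 = - int N" by (simp_all add: work_heads_def)

lemma emits_count:
	"emits (count_program z) w0 h0 (nest W z (%tt p r. nest W z (%tt' p' r'. replicate site_size True)))
	 (sweep_time z W (sweep_time z W (Suc site_size)))" unfolding count_program_def
proof (rule emits_sweep[OF N W])
	fix tt p r
	show "emits (sweep 8 9 [(8, Rt)] [(9, Rt)] z (%r'. Emit (%v. replicate site_size True) site_size)) w0
	(shifted [(7, Rt)] p (shifted [(6, Rt)] tt h0)) (nest W z (%tt' p' r'. replicate site_size True))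
	(sweep_time z W (Suc site_size))"
	proof (rule emits_sweep[OF N W])
	fix tt' p' r'
	let ?h = "shifted [(9, Rt)] p' (shifted [(8, Rt)] tt' (shifted [(7, Rt)] p (shifted [(6, Rt)] tt h0)))"
	show "emits (Emit (%v. replicate site_size True) site_size) w0 ?h (replicate site_size True) (Suc site_size)"
		using emits_Emit[of "%v. replicate site_size True" w0 ?h site_size] by simp
	qed (simp_all add: ntapes_def w0_simps h0_simps shifted_def)
qed (simp_all add: ntapes_def w0_simps h0_simps)

lemma emits_adjacency:
	"emits (adjacency_program z) w0 h0
	 (nest W z (%tt p r. nest W z (%tt' p' r'. concat (map (%k.
		nest W z (%ups \<rho> s. nest W z (%ups' \<rho>' s'.
			map (adjacency (line_diff z (dsym tt ups) (dsym p \<rho>) (zone N p) (zone N \<rho>) r s)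
					 (line_diff z (dsym tt' ups') (dsym p' \<rho>') (zone N p') (zone N \<rho>') r' s') k) [0..<site_size]))) [0..<site_size]))))
	 (sweep_time z W (sweep_time z W (site_size * sweep_time z W (sweep_time z W (Suc site_size)) + 1)))" unfolding adjacency_program_def
proof (rule emits_sweep[OF N W])
	fix tt p r assume a1: "tt < W" "p < W" "r < z"
	let ?h1 = "shifted [(7, Rt), (15, Lt)] p (shifted [(6, Rt), (14, Lt)] tt h0)"
	show "emits (sweep 8 9 [(8, Rt), (16, Lt)] [(9, Rt), (17, Lt)] z (%r'.
	 unroll site_size (%k.
	 sweep 10 11 [(10, Rt), (14, Rt)] [(11, Rt), (15, Rt)] z (%s.
	 sweep 12 13 [(12, Rt), (16, Rt)] [(13, Rt), (17, Rt)] z (%s'.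
	 Emit (adjacency_row z r r' k s s') site_size)))) ) w0 ?h1
	 (nest W z (%tt' p' r'. concat (map (%k.
		nest W z (%ups \<rho> s. nest W z (%ups' \<rho>' s'.
			map (adjacency (line_diff z (dsym tt ups) (dsym p \<rho>) (zone N p) (zone N \<rho>) r s)
					 (line_diff z (dsym tt' ups') (dsym p' \<rho>') (zone N p') (zone N \<rho>') r' s') k) [0..<site_size]))) [0..<site_size])))
	 (sweep_time z W (site_size * sweep_time z W (sweep_time z W (Suc site_size)) + 1))"
	proof (rule emits_sweep[OF N W])
	fix tt' p' r' assume a2: "tt' < W" "p' < W" "r' < z"
	let ?h2 = "shifted [(9, Rt), (17, Lt)] p' (shifted [(8, Rt), (16, Lt)] tt' ?h1)"
	show "emits (unroll site_size (%k.
		 sweep 10 11 [(10, Rt), (14, Rt)] [(11, Rt), (15, Rt)] z (%s.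
		 sweep 12 13 [(12, Rt), (16, Rt)] [(13, Rt), (17, Rt)] z (%s'.
		 Emit (adjacency_row z r r' k s s') site_size)))) w0 ?h2
		 (concat (map (%k. nest W z (%ups \<rho> s. nest W z (%ups' \<rho>' s'.
				map (adjacency (line_diff z (dsym tt ups) (dsym p \<rho>) (zone N p) (zone N \<rho>) r s)
					 (line_diff z (dsym tt' ups') (dsym p' \<rho>') (zone N p') (zone N \<rho>') r' s') k) [0..<site_size]))) [0..<site_size]))
		 (site_size * sweep_time z W (sweep_time z W (Suc site_size)) + 1)"
	proof (rule emits_unroll, rule emits_sweep[OF N W])
		fix k ups \<rho> s assume a3: "ups < W" "\<rho> < W" "s < z"
		let ?h3 = "shifted [(11, Rt), (15, Rt)] \<rho> (shifted [(10, Rt), (14, Rt)] ups ?h2)"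
		show "emits (sweep 12 13 [(12, Rt), (16, Rt)] [(13, Rt), (17, Rt)] z (%s'.
			 Emit (adjacency_row z r r' k s s') site_size)) w0 ?h3
			 (nest W z (%ups' \<rho>' s'.
				map (adjacency (line_diff z (dsym tt ups) (dsym p \<rho>) (zone N p) (zone N \<rho>) r s)
					 (line_diff z (dsym tt' ups') (dsym p' \<rho>') (zone N p') (zone N \<rho>') r' s') k) [0..<site_size]))
			 (sweep_time z W (Suc site_size))"
		proof (rule emits_sweep[OF N W])
			fix ups' \<rho>' s' assume a4: "ups' < W" "\<rho>' < W" "s' < z"
			let ?h4 = "shifted [(13, Rt), (17, Rt)] \<rho>' (shifted [(12, Rt), (16, Rt)] ups' ?h3)"
			have h: "?h4 14 = int ups - int tt" "?h4 15 = int \<rho> - int p" "?h4 16 = int ups' - int tt'" "?h4 17 = int \<rho>' - int p'"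
				"?h4 7 = - int N + int p" "?h4 11 = - int N + int \<rho>" "?h4 9 = - int N + int p'" "?h4 13 = - int N + int \<rho>'"
				by (simp_all add: shifted_def h0_simps)
			have sc: "scan w0 ?h4 i = w0 i (?h4 i)" if "i : {14, 15, 16, 17, 7, 11, 9, 13}" for i using that by (auto simp: scan_def ntapes_def)
			have v: "scan w0 ?h4 14 = dsym tt ups" "scan w0 ?h4 15 = dsym p \<rho>" "scan w0 ?h4 16 = dsym tt' ups'"
				"scan w0 ?h4 17 = dsym p' \<rho>'" by (simp_all only: sc insert_iff simp_thms h w0_simps diff_tape)
			have v': "scan w0 ?h4 7 = zone N p" "scan w0 ?h4 11 = zone N \<rho>" "scan w0 ?h4 9 = zone N p'" "scan w0 ?h4 13 = zone N \<rho>'"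
				using zone_tape_at(1)[OF N] a1(2) a2(2) a3(2) a4(2) W by (simp_all only: sc insert_iff simp_thms h w0_simps)
			have "adjacency_row z r r' k s s' (scan w0 ?h4) =
				map (adjacency (line_diff z (dsym tt ups) (dsym p \<rho>) (zone N p) (zone N \<rho>) r s)
					 (line_diff z (dsym tt' ups') (dsym p' \<rho>') (zone N p') (zone N \<rho>') r' s') k) [0..<site_size]"
				unfolding adjacency_row_def v v' ..
			moreover have "length (adjacency_row z r r' k s s' (scan w0 ?h4)) <= site_size" by (simp add: adjacency_row_def)
			ultimately show "emits (Emit (adjacency_row z r r' k s s') site_size) w0 ?h4
				(map (adjacency (line_diff z (dsym tt ups) (dsym p \<rho>) (zone N p) (zone N \<rho>) r s)
					 (line_diff z (dsym tt' ups') (dsym p' \<rho>') (zone N p') (zone N \<rho>') r' s') k) [0..<site_size]) (Suc site_size)"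
				using emits_Emit[of "adjacency_row z r r' k s s'" w0 ?h4 site_size] by metis
		qed (simp_all add: ntapes_def w0_simps h0_simps shifted_def)
	qed (simp_all add: ntapes_def w0_simps h0_simps shifted_def)
	qed (simp_all add: ntapes_def w0_simps h0_simps shifted_def)
qed (simp_all add: ntapes_def w0_simps h0_simps)

lemma emits_lists:
	"emits (list_program M z) w0 h0
	 (nest W z (%tt p r. nest W z (%tt' p' r'.
			site_string (cell_code M (zone N tt) (zone N p) (fst (word_tape x) (int p - int N)) (if N <= p & p < N + q then 1 else 0)
				 (zone N tt') (zone N p') (dsym tt tt') (dsym p p') (r div 3) (r' div 2)) (r mod 3) (r' mod 2))))
	 (sweep_time z W (sweep_time z W (Suc site_bound)))" unfolding list_program_def
proof (rule emits_sweep[OF N W])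
	fix tt p r assume a1: "tt < W" "p < W" "r < z"
	let ?h1 = "shifted [(7, Rt), (15, Lt), (2, Rt), (3, Rt)] p (shifted [(6, Rt), (14, Lt)] tt h0)"
	show "emits (sweep 8 9 [(8, Rt), (14, Rt)] [(9, Rt), (15, Rt)] z (%r'.
	 Emit (%v. site_string (view_cell M (r div 3) (r' div 2) v) (r mod 3) (r' mod 2)) site_bound)) w0 ?h1
	 (nest W z (%tt' p' r'.
			site_string (cell_code M (zone N tt) (zone N p) (fst (word_tape x) (int p - int N)) (if N <= p & p < N + q then 1 else 0)
				 (zone N tt') (zone N p') (dsym tt tt') (dsym p p') (r div 3) (r' div 2)) (r mod 3) (r' mod 2)))
	 (sweep_time z W (Suc site_bound))"
	proof (rule emits_sweep[OF N W])
	fix tt' p' r' assume a2: "tt' < W" "p' < W" "r' < z"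
	let ?h4 = "shifted [(9, Rt), (15, Rt)] p' (shifted [(8, Rt), (14, Rt)] tt' ?h1)"
	have h: "?h4 14 = int tt' - int tt" "?h4 15 = int p' - int p" "?h4 6 = - int N + int tt" "?h4 7 = - int N + int p"
		"?h4 8 = - int N + int tt'" "?h4 9 = - int N + int p'" "?h4 2 = int p - int N" "?h4 3 = int p - int N" by (simp_all add: shifted_def h0_simps)
	have sc: "scan w0 ?h4 i = w0 i (?h4 i)" if "i : {14, 15, 6, 7, 8, 9, 2, 3}" for i using that by (auto simp: scan_def ntapes_def)
	have v: "scan w0 ?h4 14 = dsym tt tt'" "scan w0 ?h4 15 = dsym p p'" "scan w0 ?h4 2 = fst (word_tape x) (int p - int N)"
		by (simp_all only: sc insert_iff simp_thms h w0_simps diff_tape)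
	have v': "scan w0 ?h4 6 = zone N tt" "scan w0 ?h4 7 = zone N p" "scan w0 ?h4 8 = zone N tt'" "scan w0 ?h4 9 = zone N p'"
		using zone_tape_at(1)[OF N] a1(1,2) a2(1,2) W by (simp_all only: sc insert_iff simp_thms h w0_simps)
	have "marks q (int p - int N) = (if N <= p & p < N + q then 1 else 0)" by (auto simp: marks_def)
	then have v'': "scan w0 ?h4 3 = (if N <= p & p < N + q then 1 else 0)" by (simp only: sc insert_iff simp_thms h w0_simps)
	let ?g = "%v. site_string (view_cell M (r div 3) (r' div 2) v) (r mod 3) (r' mod 2)"
	have "?g (scan w0 ?h4) = site_string (cell_code M (zone N tt) (zone N p) (fst (word_tape x) (int p - int N)) (if N <= p & p < N + q then 1 else 0)
				 (zone N tt') (zone N p') (dsym tt tt') (dsym p p') (r div 3) (r' div 2)) (r mod 3) (r' mod 2)"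
		unfolding view_cell_def v v' v'' ..
	moreover have "length (?g (scan w0 ?h4)) <= site_bound" by (rule site_bound) simp_all
	ultimately show "emits (Emit ?g site_bound) w0 ?h4
			(site_string (cell_code M (zone N tt) (zone N p) (fst (word_tape x) (int p - int N)) (if N <= p & p < N + q then 1 else 0)
				 (zone N tt') (zone N p') (dsym tt tt') (dsym p p') (r div 3) (r' div 2)) (r mod 3) (r' mod 2)) (Suc site_bound)"
		using emits_Emit[of ?g w0 ?h4 site_bound] by metis
	qed (simp_all add: ntapes_def w0_simps h0_simps shifted_def)
qed (simp_all add: ntapes_def w0_simps h0_simps)

end

definition poly_bounded :: "(nat => nat) => bool" where
	"poly_bounded f \<longleftrightarrow> (EX p :: nat poly. ALL n. f n <= poly p n)"

lemma poly_bounded_const: "poly_bounded (%n. c)" unfolding poly_bounded_def by (rule exI[of _ "[:c:]"]) simp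

lemma poly_bounded_poly: "poly_bounded (poly p)" unfolding poly_bounded_def by blast

lemma poly_bounded_add: "poly_bounded f ==> poly_bounded g ==> poly_bounded (%n. f n + g n)" unfolding poly_bounded_def by (metis add_mono poly_add)

lemma poly_bounded_mult: "poly_bounded f ==> poly_bounded g ==> poly_bounded (%n. f n * g n)"
	unfolding poly_bounded_def by (metis mult_le_mono poly_mult)

lemma poly_bounded_sweep: "poly_bounded W ==> poly_bounded t ==> poly_bounded (%n. sweep_time z (W n) (t n))"
	unfolding sweep_time_def by (intro poly_bounded_add poly_bounded_mult poly_bounded_const)

definition lattice_instance :: "tm => nat poly => nat poly => bool list => list_colouring_input" where
	"lattice_instance M q pN x = (let N = poly pN (length x); S = 6 * width M * ((2 * N + 1) * (2 * N + 1)) in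
	 (S * S * 1009, lattice_edges S, lattice_lists S (cell_grid (clause_grid.cells M x N (poly q (length x))))))"

lemma encode_lattice_instance:
	fixes M x N Q
	assumes N: "1 < N" "Q <= N"
	defines "W \<equiv> 2 * N + 1" and "z \<equiv> 6 * width M"
	defines "S \<equiv> 6 * width M * ((2 * N + 1) * (2 * N + 1))"
	shows "encode_input (S * S * 1009, lattice_edges S, lattice_lists S (cell_grid (clause_grid.cells M x N Q))) =
	 nest W z (%tt p r. nest W z (%tt' p' r'. replicate site_size True)) @ [False] @
	 nest W z (%tt p r. nest W z (%tt' p' r'. concat (map (%k.
		nest W z (%ups \<rho> s. nest W z (%ups' \<rho>' s'.
			map (adjacency (line_diff z (dsym tt ups) (dsym p \<rho>) (zone N p) (zone N \<rho>) r s)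
					 (line_diff z (dsym tt' ups') (dsym p' \<rho>') (zone N p') (zone N \<rho>') r' s') k) [0..<site_size]))) [0..<site_size]))) @
	 nest W z (%tt p r. nest W z (%tt' p' r'.
			site_string (cell_code M (zone N tt) (zone N p) (fst (word_tape x) (int p - int N)) (if N <= p & p < N + Q then 1 else 0)
				 (zone N tt') (zone N p') (dsym tt tt') (dsym p p') (r div 3) (r' div 2)) (r mod 3) (r' mod 2)))"
proof -
	interpret cg: clause_grid M x N Q by unfold_locales (rule N)+
	have W': "W = 2 * N + 1" by (simp add: W_def)
	have Wl: "cg.W = W" by (simp add: cg.W_def W')
	have S: "S = W * W * z" by (simp add: S_def W_def z_def)
	let ?y = "%tt p r. (tt * W + p) * z + r"
	have less: "?y tt p r < S" if "tt < W" "p < W" "r < z" for tt p r unfolding S by (rule triple_less[OF that])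
	\<comment> \<open>Each of the three parts of the code is a concatenation over the vertices. A
	  vertex consists of two site coordinates of three digits each and an offset in the block.\<close>
	have all: "concat (map f [0..<S * S * 1009]) =
		nest W z (%tt p r. nest W z (%tt' p' r'. concat (map (%k. f ((?y tt p r * S + ?y tt' p' r') * 1009 + k)) [0..<site_size])))"
	for f :: "nat => bool list"
	proof -
	have "concat (map f [0..<S * S * 1009]) =
			concat (map (%y. concat (map (%x. concat (map (%k. f ((y * S + x) * 1009 + k)) [0..<site_size])) [0..<S])) [0..<S])"
		unfolding concat_block[of f "S * S" 1009] concat_block[of _ S S] site_size_def ..
	also have "\<dots> = nest W z (%tt p r. concat (map (%x. concat (map (%k. f ((?y tt p r * S + x) * 1009 + k)) [0..<site_size])) [0..<S]))"
		by (subst (2) S) (rule concat_nest)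
	also have "\<dots> = nest W z (%tt p r. nest W z (%tt' p' r'. concat (map (%k. f ((?y tt p r * S + ?y tt' p' r') * 1009 + k)) [0..<site_size])))"
	proof (rule nest_cong)
		fix tt p r
		have "concat (map g [0..<S]) = nest W z (%tt' p' r'. g (?y tt' p' r'))" for g :: "nat => bool list" unfolding S by (rule concat_nest)
		then show "concat (map (%x. concat (map (%k. f ((?y tt p r * S + x) * 1009 + k)) [0..<site_size])) [0..<S]) =
			nest W z (%tt' p' r'. concat (map (%k. f ((?y tt p r * S + ?y tt' p' r') * 1009 + k)) [0..<site_size]))" .
	qed
	finally show ?thesis .
	qed
	have single: "map f [0..<n] = concat (map (%i. [f i]) [0..<n])" for f :: "nat => bool" and n by (induction n) auto
	have repl: "concat (map (%k. [True]) [0..<n]) = replicate n True" for n by (induction n) (auto simp: replicate_append_same)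
	have 1: "replicate (S * S * 1009) True = nest W z (%tt p r. nest W z (%tt' p' r'. replicate site_size True))"
	using all[of "%k. [True]"] unfolding repl .
	have sz: "k < 1009" if "k < site_size" for k using that by (simp add: site_size_def)
	have row: "map (%j. {(?y tt p r * S + ?y tt' p' r') * 1009 + k, j} : lattice_edges S) [0..<S * S * 1009] =
		nest W z (%ups \<rho> s. nest W z (%ups' \<rho>' s'.
			map (adjacency (line_diff z (dsym tt ups) (dsym p \<rho>) (zone N p) (zone N \<rho>) r s)
					 (line_diff z (dsym tt' ups') (dsym p' \<rho>') (zone N p') (zone N \<rho>') r' s') k) [0..<site_size]))"
	if a: "tt < W" "p < W" "r < z" "tt' < W" "p' < W" "r' < z" "k < site_size" for tt p r tt' p' r' k unfolding single all
	proof (intro nest_cong)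
	fix ups \<rho> s ups' \<rho>' s' assume b: "ups < W" "\<rho> < W" "s < z" "ups' < W" "\<rho>' < W" "s' < z"
	have dl: "dsym (?y tt p r) (?y ups \<rho> s) = line_diff z (dsym tt ups) (dsym p \<rho>) (zone N p) (zone N \<rho>) r s"
		"dsym (?y tt' p' r') (?y ups' \<rho>' s') = line_diff z (dsym tt' ups') (dsym p' \<rho>') (zone N p') (zone N \<rho>') r' s'"
		unfolding W' by (rule line_diff; use a b N W' in simp)+
	show "concat (map (%l. [{(?y tt p r * S + ?y tt' p' r') * 1009 + k, (?y ups \<rho> s * S + ?y ups' \<rho>' s') * 1009 + l} : lattice_edges S]) [0..<site_size]) =
		concat (map (%i. [adjacency (line_diff z (dsym tt ups) (dsym p \<rho>) (zone N p) (zone N \<rho>) r s)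
					 (line_diff z (dsym tt' ups') (dsym p' \<rho>') (zone N p') (zone N \<rho>') r' s') k i]) [0..<site_size])"
	proof (intro arg_cong[where f = concat] map_cong refl)
		fix l assume "l : set [0..<site_size]"
		then have l: "l < 1009" using sz by simp
		show "[{(?y tt p r * S + ?y tt' p' r') * 1009 + k, (?y ups \<rho> s * S + ?y ups' \<rho>' s') * 1009 + l} : lattice_edges S] =
			[adjacency (line_diff z (dsym tt ups) (dsym p \<rho>) (zone N p) (zone N \<rho>) r s)
					 (line_diff z (dsym tt' ups') (dsym p' \<rho>') (zone N p') (zone N \<rho>') r' s') k l]"
			unfolding lattice_edge_iff[OF less[OF a(1-3)] less[OF a(4-6)] less[OF b(1-3)] less[OF b(4-6)] sz[OF a(7)] l] dl ..
	qed
	qed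
	have 2: "concat (map (%i. map (%j. {i, j} : lattice_edges S) [0..<S * S * 1009]) [0..<S * S * 1009]) =
	 nest W z (%tt p r. nest W z (%tt' p' r'. concat (map (%k.
		nest W z (%ups \<rho> s. nest W z (%ups' \<rho>' s'.
			map (adjacency (line_diff z (dsym tt ups) (dsym p \<rho>) (zone N p) (zone N \<rho>) r s)
					 (line_diff z (dsym tt' ups') (dsym p' \<rho>') (zone N p') (zone N \<rho>') r' s') k) [0..<site_size]))) [0..<site_size])))"
	unfolding all
	proof (intro nest_cong arg_cong[where f = concat] map_cong refl)
	fix tt p r tt' p' r' k assume "tt < W" "p < W" "r < z" "tt' < W" "p' < W" "r' < z" "k : set [0..<site_size]"
	then show "map (%j. {(?y tt p r * S + ?y tt' p' r') * 1009 + k, j} : lattice_edges S) [0..<S * S * 1009] =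
		nest W z (%ups \<rho> s. nest W z (%ups' \<rho>' s'.
			map (adjacency (line_diff z (dsym tt ups) (dsym p \<rho>) (zone N p) (zone N \<rho>) r s)
					 (line_diff z (dsym tt' ups') (dsym p' \<rho>') (zone N p') (zone N \<rho>') r' s') k) [0..<site_size]))"
		by (intro row) simp_all
	qed
	have 3: "concat (map (%v. encode_nat_set (lattice_lists S (cell_grid cg.cells) v)) [0..<S * S * 1009]) =
	 nest W z (%tt p r. nest W z (%tt' p' r'.
			site_string (cell_code M (zone N tt) (zone N p) (fst (word_tape x) (int p - int N)) (if N <= p & p < N + Q then 1 else 0)
				 (zone N tt') (zone N p') (dsym tt tt') (dsym p p') (r div 3) (r' div 2)) (r mod 3) (r' mod 2)))" unfolding all
	proof (intro nest_cong)
	fix tt p r tt' p' r' assume a: "tt < W" "p < W" "r < z" "tt' < W" "p' < W" "r' < z"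
	let ?c = "cell_code M (zone N tt) (zone N p) (fst (word_tape x) (int p - int N)) (if N <= p & p < N + Q then 1 else 0)
				 (zone N tt') (zone N p') (dsym tt tt') (dsym p p') (r div 3) (r' div 2)"
	have r3: "r div 3 < 2 * width M" "r' div 2 < 3 * width M" using a(3,6) by (auto simp: z_def)
	\<comment> \<open>Splits a coordinate of a site into that of its cell and the place in the cell,
	  using \<open>6 * width M\<close> once as three times and once as two times the number of
	  cells.\<close>
	have e: "?y tt p r = 3 * ((tt * W + p) * (2 * width M) + r div 3) + r mod 3"
		"?y tt' p' r' = 2 * ((tt' * W + p') * (3 * width M) + r' div 2) + r' mod 2" by (simp_all add: z_def algebra_simps)
	have "cell_grid cg.cells (?y tt p r) (?y tt' p' r') d =
			cell_forbidden (cg.cells ((tt * W + p) * (2 * width M) + r div 3) ((tt' * W + p') * (3 * width M) + r' div 2)) (r mod 3) (r' mod 2) d" for d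
		unfolding e by (rule cell_grid_at) simp_all
	also have "\<dots> d = cell_forbidden ?c (r mod 3) (r' mod 2) d" for d
		using cg.cells_at[of p "r div 3" p' "r' div 2" tt tt'] a r3 unfolding Wl cg.site_cell_def by simp
	finally have g: "cell_grid cg.cells (?y tt p r) (?y tt' p' r') d = cell_forbidden ?c (r mod 3) (r' mod 2) d" for d .
	have L: "lattice_lists S (cell_grid cg.cells) ((?y tt p r * S + ?y tt' p' r') * 1009 + k) =
			set (block_list (cell_forbidden ?c (r mod 3) (r' mod 2) 0) (cell_forbidden ?c (r mod 3) (r' mod 2) 1) k)"
		if "k < site_size" for k
	proof -
		have gen: "(a * 1009 + k) div 1009 = a" "(a * 1009 + k) mod 1009 = k" for a :: nat using sz[OF that] by simp_all
		have k: "((?y tt p r * S + ?y tt' p' r') * 1009 + k) div 1009 = ?y tt p r * S + ?y tt' p' r'"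
			"((?y tt p r * S + ?y tt' p' r') * 1009 + k) mod 1009 = k" by (rule gen)+
		show ?thesis unfolding lattice_lists_def Let_def k site_decode[OF less[OF a(4-6)]] g ..
	qed
	show "concat (map (%k. encode_nat_set (lattice_lists S (cell_grid cg.cells) ((?y tt p r * S + ?y tt' p' r') * 1009 + k))) [0..<site_size]) =
		 site_string ?c (r mod 3) (r' mod 2)" unfolding site_string_def
		by (intro arg_cong[where f = concat] map_cong refl, rule arg_cong[where f = encode_nat_set], rule L, simp)
	qed
	show ?thesis unfolding encode_input.simps 1 2 3 ..
qed

lemma lattice_instance_computable:
	assumes pN: "\<And>n. 1 < poly pN n" "\<And>n. poly q n <= poly pN n"
	shows "polytime_computable (%x. encode_input (lattice_instance M q pN x))"
proof -
	obtain prep tp where s: "wf_prog prep"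
	"\<And>x. runs prep (init_mem [x]) (poly tp (length x))
		 (ost (work_tapes x (poly q (length x)) (poly pN (length x))) [] (work_heads (poly pN (length x))))" using setup_program[OF pN(1)] by blast
	let ?z = "6 * width M"
	let ?main = "count_program ?z ;; Emit (%v. [False]) 1 ;; adjacency_program ?z ;; list_program M ?z"
	let ?W = "%n. 2 * poly pN n + 1"
	let ?t1 = "%n. sweep_time ?z (?W n) (sweep_time ?z (?W n) (Suc site_size))"
	let ?t3 = "%n. sweep_time ?z (?W n) (sweep_time ?z (?W n) (site_size * sweep_time ?z (?W n) (sweep_time ?z (?W n) (Suc site_size)) + 1))"
	let ?t4 = "%n. sweep_time ?z (?W n) (sweep_time ?z (?W n) (Suc site_bound))"
	let ?t = "%n. poly tp n + (?t1 n + (2 + (?t3 n + ?t4 n)))"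
	have "poly_bounded ?t" by (intro poly_bounded_add poly_bounded_sweep poly_bounded_mult poly_bounded_const poly_bounded_poly)
	then obtain P where P: "\<And>n. ?t n <= poly P n" unfolding poly_bounded_def by blast
	have wf: "wf_prog (prep ;; ?main)" by (simp only: wf_prog.simps s(1) wf_programs wf_Emit simp_thms)
	have "computes_within (machine (prep ;; ?main)) [x] (poly P (length x)) (encode_input (lattice_instance M q pN x))" for x
	proof -
	let ?n = "length x"
	let ?N = "poly pN ?n" and ?Q = "poly q ?n"
	let ?w = "work_tapes x ?Q ?N" and ?h = "work_heads ?N"
	have e2: "emits (Emit (%v. [False]) 1) ?w ?h [False] 2" using emits_Emit[of "%v. [False]" ?w ?h 1] by (simp add: numeral_2_eq_2)
	have "emits ?main ?w ?h (encode_input (lattice_instance M q pN x)) (?t1 ?n + (2 + (?t3 ?n + ?t4 ?n)))"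
		unfolding lattice_instance_def Let_def encode_lattice_instance[OF pN]
		by (intro emits_Seq emits_count[OF pN(1) refl] e2 emits_adjacency[OF pN(1) refl] emits_lists[OF pN(1) refl])
	then have "runs ?main (ost ?w [] ?h) (?t1 ?n + (2 + (?t3 ?n + ?t4 ?n))) (ost ?w (encode_input (lattice_instance M q pN x)) ?h)"
		unfolding emits_def by (metis append_Nil)
	from runs_mono[OF runs_Seq[OF s(2) this] P]
	have "runs (prep ;; ?main) (init_mem [x]) (poly P ?n) (ost ?w (encode_input (lattice_instance M q pN x)) ?h)" .
	then show ?thesis by (rule runs_computes[OF _ wf]) (simp add: ost_def st_def tape_output_def word_tape_def)
	qed
	then show ?thesis unfolding polytime_computable_def using wf_machine[OF wf] by blast
qed

section \<open>Programs with a clock\<close>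

text \<open>Such programs write nothing new, so a state is just the list of heads. Tests do not see
  tape 4; a clock there can stop loops but not influence anything else. The output head stays in
  place.\<close>

fun moving :: "prog => bool" where
	"moving (Op i g) \<longleftrightarrow> i ~= 4 & i < ntapes & (EX d. g = (%v. (v i, d)) & (i = 0 --> d = Stay))"
| "moving (a ;; b) \<longleftrightarrow> moving a & moving b"
| "moving (Cond c a b) \<longleftrightarrow> (ALL v s. c (v(4 := s)) = c v) & moving a & moving b"
| "moving (While c a) \<longleftrightarrow> (ALL v s. c (v(4 := s)) = c v) & moving a"

text \<open>Every pass through a loop is paid for with the counter on tape 4, so that the program stops on all
	inputs.\<close>

fun clocked :: "prog => prog" where
	"clocked (Op i g) = Op i g"
| "clocked (a ;; b) = clocked a ;; clocked b"
| "clocked (Cond c a b) = Cond c (clocked a) (clocked b)"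
| "clocked (While c a) = While (%v. c v & v 4 ~= 1) (Mv 4 Lt ;; clocked a)"

fun ccost :: "prog => nat" where
	"ccost (Op i g) = 1"
| "ccost (a ;; b) = ccost a + ccost b"
| "ccost (Cond c a b) = ccost a + ccost b + 1"
| "ccost (While c a) = ccost a + 3"

lemma wf_clocked: "moving p ==> wf_prog (clocked p)" by (induction p) (auto simp: ntapes_def)

lemma exec_Mv: "i < ntapes ==> exec (Mv i d) (st w h) 1 (st w (h(i := h i + offset d)))"
proof -
	assume i: "i < ntapes"
	have "exec (Mv i d) (st w h) 1 ((st w h)(i := act_tape (look w h i, d) (st w h i)))"
	using exec.Op[of i "%v. (v i, d)" "st w h"] unfolding Mv_def[symmetric] view_st .
	moreover have "(st w h)(i := act_tape (look w h i, d) (st w h i)) = st w (h(i := h i + offset d))"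
	using i by (auto simp: st_def look_def fun_eq_iff)
	ultimately show ?thesis by simp
qed

text \<open>The clock serves as a potential: every tick pays for \<open>ccost p\<close> steps, and
  one further share pays for the steps after the last tick.\<close>

lemma clocked_halts:
	assumes "moving p" "w 4 = counter" "h 4 = int k"
	shows "EX t h' k'. exec (clocked p) (st w h) t (st w h') & h' 4 = int k' & k' <= k & h' 0 = h 0 &
	 t + ccost p * k' <= ccost p * (k + 1)" using assms
proof (induction p arbitrary: h k)
	case (Op i g)
	then obtain d where i: "i ~= 4" "i < ntapes" "i = 0 --> d = Stay" and g: "g = (%v. (v i, d))" by auto
	have e: "exec (clocked (Op i g)) (st w h) 1 (st w (h(i := h i + offset d)))" using exec_Mv[OF i(2), of d w h] by (simp add: g Mv_def)
	have z: "(h(i := h i + offset d)) 4 = int k" "(h(i := h i + offset d)) 0 = h 0" using Op.prems(3) i by auto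
	have "1 + ccost (Op i g) * k <= ccost (Op i g) * (k + 1)" by simp
	with e z show ?case by blast
next
	case (Seq a b)
	obtain t1 h1 k1 where 1: "exec (clocked a) (st w h) t1 (st w h1)" "h1 4 = int k1" "k1 <= k" "h1 0 = h 0"
	"t1 + ccost a * k1 <= ccost a * (k + 1)" using Seq.IH(1)[of h k] Seq.prems by auto
	obtain t2 h2 k2 where 2: "exec (clocked b) (st w h1) t2 (st w h2)" "h2 4 = int k2" "k2 <= k1" "h2 0 = h1 0"
	"t2 + ccost b * k2 <= ccost b * (k1 + 1)" using Seq.IH(2)[of h1 k1] Seq.prems 1(2) by auto
	have "exec (clocked (a ;; b)) (st w h) (t1 + t2) (st w h2)" unfolding clocked.simps by (rule exec.Seq[OF 1(1) 2(1)])
	moreover have "t1 + t2 + ccost (a ;; b) * k2 <= ccost (a ;; b) * (k + 1)"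
	proof -
	have "ccost a * k2 <= ccost a * k1" "ccost b * k1 <= ccost b * k" using mult_le_mono2[OF 2(3)] mult_le_mono2[OF 1(3)] by this+
	then show ?thesis using 1(5) 2(5) unfolding ccost.simps add_mult_distrib add_mult_distrib2 by linarith
	qed
	moreover have "h2 0 = h 0" "k2 <= k" using 1 2 by simp_all
	ultimately show ?case using 2(2) by blast
next
	case (Cond c a b)
	show ?case
	proof (cases "c (view (st w h))")
	case True
	obtain t1 h1 k1 where 1: "exec (clocked a) (st w h) t1 (st w h1)" "h1 4 = int k1" "k1 <= k" "h1 0 = h 0"
		"t1 + ccost a * k1 <= ccost a * (k + 1)" using Cond.IH(1)[of h k] Cond.prems by auto
	have "exec (clocked (Cond c a b)) (st w h) (Suc t1) (st w h1)" unfolding clocked.simps by (rule exec.CondT[where c = c, OF True 1(1)])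
	moreover have "Suc t1 + ccost (Cond c a b) * k1 <= ccost (Cond c a b) * (k + 1)" using 1(3,5) mult_le_mono2[OF 1(3), of "ccost b"]
		unfolding ccost.simps add_mult_distrib add_mult_distrib2 by linarith
	ultimately show ?thesis using 1(2-4) by blast
	next
	case False
	obtain t1 h1 k1 where 1: "exec (clocked b) (st w h) t1 (st w h1)" "h1 4 = int k1" "k1 <= k" "h1 0 = h 0"
		"t1 + ccost b * k1 <= ccost b * (k + 1)" using Cond.IH(2)[of h k] Cond.prems by auto
	have "exec (clocked (Cond c a b)) (st w h) (Suc t1) (st w h1)" unfolding clocked.simps by (rule exec.CondF[where c = c, OF False 1(1)])
	moreover have "Suc t1 + ccost (Cond c a b) * k1 <= ccost (Cond c a b) * (k + 1)" using 1(3,5) mult_le_mono2[OF 1(3), of "ccost a"]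
		unfolding ccost.simps add_mult_distrib add_mult_distrib2 by linarith
	ultimately show ?thesis using 1(2-4) by blast
	qed
next
	case (While c a)
	\<comment> \<open>A second induction, on the clock, since each pass through the loop uses at least
	  one tick.\<close>
	show ?case using While.prems(3)
	proof (induction k arbitrary: h rule: less_induct)
	case (less k)
	let ?c = "%v. c v & v 4 ~= 1" and ?b = "Mv 4 Lt ;; clocked a"
	show ?case
	proof (cases "?c (view (st w h))")
		case False
		have "exec (clocked (While c a)) (st w h) 1 (st w h)" unfolding clocked.simps by (rule exec.WhileF[where c = ?c, OF False])
		then show ?thesis using less.prems by (rule_tac x = 1 in exI, rule_tac x = h in exI, rule_tac x = k in exI) simp
	next
		case True
		have four: "4 < ntapes" by (simp add: ntapes_def)
		have "view (st w h) 4 = counter (int k)" using While.prems(2) less.prems four by (simp add: view_st look_def)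
		then have k: "0 < k" using True by (cases "k = 0") (auto simp: counter_def)
		let ?h = "h(4 := h 4 + offset Lt)"
		have ma: "moving a" using While.prems(1) by simp
		have h4: "?h 4 = int (k - 1)" using less.prems k by (simp add: of_nat_diff)
		obtain t1 h1 k1 where 1: "exec (clocked a) (st w ?h) t1 (st w h1)" "h1 4 = int k1" "k1 <= k - 1" "h1 0 = ?h 0"
			"t1 + ccost a * k1 <= ccost a * (k - 1 + 1)" using While.IH[of ?h "k - 1", OF ma While.prems(2) h4] by blast
		have "k1 < k" using 1(3) k by linarith
		from less.IH[OF this, of h1, OF 1(2)] obtain t2 h2 k2 where 2: "exec (clocked (While c a)) (st w h1) t2 (st w h2)" "h2 4 = int k2"
			"k2 <= k1" "h2 0 = h1 0" "t2 + ccost (While c a) * k2 <= ccost (While c a) * (k1 + 1)" by blast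
		have "exec ?b (st w h) (1 + t1) (st w h1)" by (rule exec.Seq[OF exec_Mv[OF four] 1(1)])
		from exec.WhileT[where c = ?c, OF True this 2(1)[unfolded clocked.simps]]
		have "exec (clocked (While c a)) (st w h) (Suc (1 + t1 + t2)) (st w h2)" unfolding clocked.simps .
		moreover have "Suc (1 + t1 + t2) + ccost (While c a) * k2 <= ccost (While c a) * (k + 1)"
		proof -
			have "k - 1 + 1 = k" using k by simp
			then have a: "t1 + ccost a * k1 <= ccost a * k" using 1(5) by simp
			have b: "t2 + ccost (While c a) * k2 <= ccost a * k1 + 3 * k1 + ccost a + 3" using 2(5) by (simp add: algebra_simps)
			have "ccost (While c a) * (k + 1) = ccost a * k + 3 * k + ccost a + 3" by (simp add: algebra_simps)
			then show ?thesis using a b \<open>k1 < k\<close> by linarith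
		qed
		moreover have "h2 0 = h 0" "k2 <= k" using 1 2 by simp_all
		ultimately show ?thesis using 2(2) by blast
	qed
	qed
qed

lemma look_clock: "4 < ntapes ==> look w (h(4 := s)) = (look w h)(4 := w 4 s)" by (auto simp: look_def fun_eq_iff)

text \<open>A run of \<open>t\<close> steps makes at most \<open>t\<close> passes through loops, so
  a clock of at least \<open>t\<close> never runs out. Each pass costs one more step for the tick,
  whence the factor 2.\<close>

lemma clocked_sim:
	assumes "exec p T t T'" "moving p" "T = st w h" "w 4 = counter"
	shows "EX h'. T' = st w h' & (ALL k>=t. EX t' k'. t' <= 2 * t & k - t <= k' & k' <= k &
	 exec (clocked p) (st w (h(4 := int k))) t' (st w (h'(4 := int k'))))" using assms
proof (induction arbitrary: h rule: exec.induct)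
	case (Op i g T)
	then obtain d where i: "i ~= 4" "i < ntapes" and g: "g = (%v. (v i, d))" by auto
	have "T(i := act_tape (g (view T)) (T i)) = st w (h(i := h i + offset d))"
	unfolding Op.prems(2) view_st g using i by (auto simp: st_def look_def fun_eq_iff)
	moreover have "exec (clocked (Op i g)) (st w (h(4 := int k))) 1 (st w ((h(i := h i + offset d))(4 := int k)))" for k
	proof -
	have "(h(4 := int k))(i := (h(4 := int k)) i + offset d) = (h(i := h i + offset d))(4 := int k)" using i by (auto simp: fun_eq_iff)
	then show ?thesis using exec_Mv[OF i(2), of d w "h(4 := int k)"] by (simp add: g Mv_def)
	qed
	then have "ALL k>=1. EX t' k'. t' <= 2 * 1 & k - 1 <= k' & k' <= k &
	 exec (clocked (Op i g)) (st w (h(4 := int k))) t' (st w ((h(i := h i + offset d))(4 := int k')))"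
	by (intro allI impI, rule_tac x = 1 in exI, rule_tac x = k in exI) simp
	ultimately show ?case by blast
next
	case (Seq a T s T' b t T'')
	have m: "moving a" "moving b" using Seq.prems(1) by simp_all
	obtain h1 where 1: "T' = st w h1" "ALL k>=s. EX t' k'. t' <= 2 * s & k - s <= k' & k' <= k &
	 exec (clocked a) (st w (h(4 := int k))) t' (st w (h1(4 := int k')))" using Seq.IH(1)[OF m(1) Seq.prems(2,3)] by blast
	obtain h2 where 2: "T'' = st w h2" "ALL k>=t. EX t' k'. t' <= 2 * t & k - t <= k' & k' <= k &
	 exec (clocked b) (st w (h1(4 := int k))) t' (st w (h2(4 := int k')))" using Seq.IH(2)[OF m(2) 1(1) Seq.prems(3)] by blast
	have "EX t' k'. t' <= 2 * (s + t) & k - (s + t) <= k' & k' <= k &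
	 exec (clocked (a ;; b)) (st w (h(4 := int k))) t' (st w (h2(4 := int k')))" if k: "s + t <= k" for k
	proof -
	have "s <= k" using k by simp
	then obtain t1 k1 where a: "t1 <= 2 * s" "k - s <= k1" "k1 <= k" "exec (clocked a) (st w (h(4 := int k))) t1 (st w (h1(4 := int k1)))"
		using 1(2) by blast
	have "t <= k1" using a(2) k by linarith
	then obtain t2 k2 where b: "t2 <= 2 * t" "k1 - t <= k2" "k2 <= k1" "exec (clocked b) (st w (h1(4 := int k1))) t2 (st w (h2(4 := int k2)))"
		using 2(2) by blast
	have "exec (clocked (a ;; b)) (st w (h(4 := int k))) (t1 + t2) (st w (h2(4 := int k2)))" unfolding clocked.simps by (rule exec.Seq[OF a(4) b(4)])
	moreover have "t1 + t2 <= 2 * (s + t)" using a(1) b(1) by simp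
	moreover have "k - (s + t) <= k2" using diff_le_mono[OF a(2), of t] b(2) by simp
	moreover have "k2 <= k" using a(3) b(3) by simp
	ultimately show ?thesis by blast
	qed
	with 2(1) show ?case by blast
next
	case (CondT c T a t T' b)
	have m: "moving a" using CondT.prems(1) by simp
	obtain h1 where 1: "T' = st w h1" "ALL k>=t. EX t' k'. t' <= 2 * t & k - t <= k' & k' <= k &
	 exec (clocked a) (st w (h(4 := int k))) t' (st w (h1(4 := int k')))" using CondT.IH[OF m CondT.prems(2,3)] by blast
	have c: "c (view (st w (h(4 := int k))))" for k using CondT.hyps(1) CondT.prems unfolding view_st by (simp add: look_clock ntapes_def view_st)
	have "EX t' k'. t' <= 2 * Suc t & k - Suc t <= k' & k' <= k &
	 exec (clocked (Cond c a b)) (st w (h(4 := int k))) t' (st w (h1(4 := int k')))" if k: "Suc t <= k" for k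
	proof -
	have "t <= k" using k by simp
	then obtain t1 k1 where a: "t1 <= 2 * t" "k - t <= k1" "k1 <= k" "exec (clocked a) (st w (h(4 := int k))) t1 (st w (h1(4 := int k1)))"
		using 1(2) by blast
	have "exec (clocked (Cond c a b)) (st w (h(4 := int k))) (Suc t1) (st w (h1(4 := int k1)))"
		unfolding clocked.simps by (rule exec.CondT[where c = c, OF c a(4)])
	moreover have "Suc t1 <= 2 * Suc t" using a(1) by simp
	moreover have "k - Suc t <= k1" using a(2) by arith
	ultimately show ?thesis using a(3) by blast
	qed
	with 1(1) show ?case by blast
next
	case (CondF c T b t T' a)
	have m: "moving b" using CondF.prems(1) by simp
	obtain h1 where 1: "T' = st w h1" "ALL k>=t. EX t' k'. t' <= 2 * t & k - t <= k' & k' <= k &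
	 exec (clocked b) (st w (h(4 := int k))) t' (st w (h1(4 := int k')))" using CondF.IH[OF m CondF.prems(2,3)] by blast
	have c: "~ c (view (st w (h(4 := int k))))" for k using CondF.hyps(1) CondF.prems unfolding view_st by (simp add: look_clock ntapes_def view_st)
	have "EX t' k'. t' <= 2 * Suc t & k - Suc t <= k' & k' <= k &
	 exec (clocked (Cond c a b)) (st w (h(4 := int k))) t' (st w (h1(4 := int k')))" if k: "Suc t <= k" for k
	proof -
	have "t <= k" using k by simp
	then obtain t1 k1 where a: "t1 <= 2 * t" "k - t <= k1" "k1 <= k" "exec (clocked b) (st w (h(4 := int k))) t1 (st w (h1(4 := int k1)))"
		using 1(2) by blast
	have "exec (clocked (Cond c a b)) (st w (h(4 := int k))) (Suc t1) (st w (h1(4 := int k1)))"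
		unfolding clocked.simps by (rule exec.CondF[where c = c, OF c a(4)])
	moreover have "Suc t1 <= 2 * Suc t" using a(1) by simp
	moreover have "k - Suc t <= k1" using a(2) by arith
	ultimately show ?thesis using a(3) by blast
	qed
	with 1(1) show ?case by blast
next
	case (WhileF c T a)
	let ?c = "%v. c v & v 4 ~= 1"
	have c: "~ ?c (view (st w (h(4 := int k))))" for k using WhileF.hyps(1) WhileF.prems unfolding view_st by (simp add: look_clock ntapes_def view_st)
	have "exec (clocked (While c a)) (st w (h(4 := int k))) 1 (st w (h(4 := int k)))" for k
	unfolding clocked.simps by (rule exec.WhileF[where c = ?c, OF c])
	then have "ALL k>=1. EX t' k'. t' <= 2 * 1 & k - 1 <= k' & k' <= k &
	 exec (clocked (While c a)) (st w (h(4 := int k))) t' (st w (h(4 := int k')))"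
	by (intro allI impI, rule_tac x = 1 in exI, rule_tac x = k in exI) simp
	then show ?case using WhileF.prems(2) by blast
next
	case (WhileT c T a s T' t T'')
	let ?c = "%v. c v & v 4 ~= 1" and ?b = "Mv 4 Lt ;; clocked a"
	have four: "4 < ntapes" by (simp add: ntapes_def)
	have mo: "moving a" using WhileT.prems(1) by simp
	obtain h1 where 1: "T' = st w h1" "ALL k>=s. EX t' k'. t' <= 2 * s & k - s <= k' & k' <= k &
	 exec (clocked a) (st w (h(4 := int k))) t' (st w (h1(4 := int k')))" using WhileT.IH(1)[OF mo WhileT.prems(2,3)] by blast
	obtain h2 where 2: "T'' = st w h2" "ALL k>=t. EX t' k'. t' <= 2 * t & k - t <= k' & k' <= k &
	 exec (clocked (While c a)) (st w (h1(4 := int k))) t' (st w (h2(4 := int k')))"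
	using WhileT.IH(2)[OF WhileT.prems(1) 1(1) WhileT.prems(3)] by blast
	have "EX t' k'. t' <= 2 * Suc (s + t) & k - Suc (s + t) <= k' & k' <= k &
	 exec (clocked (While c a)) (st w (h(4 := int k))) t' (st w (h2(4 := int k')))" if k: "Suc (s + t) <= k" for k
	proof -
	have c: "?c (view (st w (h(4 := int k))))"
		using WhileT.hyps(1) WhileT.prems k unfolding view_st by (simp add: look_clock ntapes_def view_st counter_def)
	have "s <= k - 1" using k by linarith
	then obtain t1 k1 where a: "t1 <= 2 * s" "k - 1 - s <= k1" "k1 <= k - 1"
		"exec (clocked a) (st w (h(4 := int (k - 1)))) t1 (st w (h1(4 := int k1)))" using 1(2) by blast
	have "t <= k1" using a(2) k by linarith
	then obtain t2 k2 where b: "t2 <= 2 * t" "k1 - t <= k2" "k2 <= k1"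
		"exec (clocked (While c a)) (st w (h1(4 := int k1))) t2 (st w (h2(4 := int k2)))" using 2(2) by blast
	have "(h(4 := int k))(4 := (h(4 := int k)) 4 + offset Lt) = h(4 := int (k - 1))" using k by (auto simp: fun_eq_iff)
	then have m: "exec (Mv 4 Lt) (st w (h(4 := int k))) 1 (st w (h(4 := int (k - 1))))"
		using exec_Mv[OF four, of Lt w "h(4 := int k)"] by metis
	have "exec (clocked (While c a)) (st w (h(4 := int k))) (Suc (1 + t1 + t2)) (st w (h2(4 := int k2)))" unfolding clocked.simps
		by (rule exec.WhileT[where c = ?c, OF c exec.Seq[OF m a(4)] b(4)[unfolded clocked.simps]])
	moreover have "Suc (1 + t1 + t2) <= 2 * Suc (s + t)" using a(1) b(1) by simp
	moreover have "k - Suc (s + t) <= k2" using diff_le_mono[OF a(2), of t] b(2) by simp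
	moreover have "k2 <= k" using a(3) b(3) by simp
	ultimately show ?thesis by blast
	qed
	with 2(1) show ?case by blast
qed

section \<open>Reading codes\<close>

definition spells :: "(int => nat) => int => bool list => bool" where
	"spells f p s \<longleftrightarrow> (ALL k<length s. f (p + int k) = bit_symbol (s ! k))"

lemma spells_nth: "spells f p s ==> k < length s ==> f (p + int k) = bit_symbol (s ! k)" by (simp add: spells_def)

lemma spells_appendD1: "spells f p (s @ s') ==> spells f p s" unfolding spells_def by (metis length_append nth_append trans_less_add1)

lemma spells_appendD2: "spells f p (s @ s') ==> spells f (p + int (length s)) s'" unfolding spells_def
proof (intro allI impI)
	fix k assume a: "ALL k<length (s @ s'). f (p + int k) = bit_symbol ((s @ s') ! k)" and k: "k < length s'"
	have "f (p + int (length s + k)) = bit_symbol ((s @ s') ! (length s + k))" by (rule a[rule_format]) (use k in simp)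
	then show "f (p + int (length s) + int k) = bit_symbol (s' ! k)" by (simp add: add.assoc)
qed

lemma spells_word: "spells (fst (word_tape x)) 0 x" by (simp add: spells_def word_tape_def)

text \<open>Separates the framing of a number from its binary digits: machines compare digit lists,
  and \<open>nat_bits_inj\<close> turns equal digits into equal numbers.\<close>

fun code :: "bool list => bool list" where
	"code [] = [False]"
| "code (d # ds) = True # d # code ds"

fun nat_bits :: "nat => bool list" where
	"nat_bits n = (if n = 0 then [] else odd n # nat_bits (n div 2))"

declare nat_bits.simps [simp del]

lemma encode_code: "encode_nat n = code (nat_bits n)" by (induction n rule: nat_bits.induct) (subst nat_bits.simps, subst encode_nat.simps, auto)

lemma nat_bits_inj: "nat_bits m = nat_bits n ==> m = n"
proof (induction m arbitrary: n rule: nat_bits.induct)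
	case (1 m)
	show ?case
	proof (cases "m = 0 | n = 0")
	case True
	then show ?thesis using "1.prems" nat_bits.simps[of m] nat_bits.simps[of n] by (auto split: if_splits)
	next
	case False
	then have "odd m = odd n" "nat_bits (m div 2) = nat_bits (n div 2)" using "1.prems" nat_bits.simps[of m] nat_bits.simps[of n] by auto
	moreover from this(2) have "m div 2 = n div 2" using "1.IH" False by blast
	ultimately show ?thesis by (metis bit_eq_rec div_mult_mod_eq odd_iff_mod_2_eq_one even_iff_mod_2_eq_zero)
	qed
qed

lemma code_length: "length (code ds) = 2 * length ds + 1" by (induction ds) auto

lemma code_nth:
	"k < length ds ==> code ds ! (2 * k) = True" "k < length ds ==> code ds ! (2 * k + 1) = ds ! k"
	"code ds ! (2 * length ds) = False"
proof (induction ds arbitrary: k)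
	case (Cons d ds)
	{ case 1 then show ?case using Cons(1)[of "k - 1"] by (cases k) auto }
	{ case 2 then show ?case using Cons(2)[of "k - 1"] by (cases k) auto }
	{ case 3 then show ?case using Cons(3) by simp }
qed auto

lemma spells_code:
	assumes "spells f p (code ds)"
	shows "k < length ds ==> f (p + 2 * int k) = 2" "k < length ds ==> f (p + 2 * int k + 1) = bit_symbol (ds ! k)"
	"f (p + 2 * int (length ds)) = 1"
proof -
	have *: "f (p + int j) = bit_symbol (code ds ! j)" if "j < 2 * length ds + 1" for j using spells_nth[OF assms] that by (simp add: code_length)
	show "f (p + 2 * int k) = 2" if "k < length ds" using *[of "2 * k"] code_nth(1)[OF that] that by (simp add: bit_symbol_def)
	show "f (p + 2 * int k + 1) = bit_symbol (ds ! k)" if "k < length ds" using *[of "2 * k + 1"] code_nth(2)[OF that] that by (simp add: algebra_simps)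
	show "f (p + 2 * int (length ds)) = 1" using *[of "2 * length ds"] code_nth(3)[of ds] by (simp add: bit_symbol_def)
qed

lemma runs_mvs_le:
	assumes "fst ` set ms \<subseteq> {..<ntapes}" "\<And>j. h' j = h j + off ms j" "Suc (length ms) <= t"
	shows "runs (mvs ms) (st w h) t (st w h')"
proof -
	have "h' = (%j. h j + off ms j)" using assms(2) by (rule ext)
	then show ?thesis using runs_mono[OF runs_mvs[OF assms(1), of w h] assms(3)] by simp
qed

text \<open>A code can be passed without knowing the number: symbol 2 announces a digit, symbol 1 is
  the end. The tapes in \<open>ms\<close> count the length along.\<close>

definition skip :: "nat => (nat \<times> move) list => prog" where
	"skip t ms = While (%v. v t = 2) (mvs ms ;; mvs ms) ;; mvs ms"

lemma runs_skip:
	assumes ms: "fst ` set ms \<subseteq> {..<ntapes}" "length ms <= 2" "off ms t = 1" "t < ntapes"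
	and c: "spells (w t) (h t) (encode_nat m)" and l: "length (encode_nat m) <= L"
	shows "runs (skip t ms) (st w h) (4 * L + 4) (st w (%j. h j + int (length (encode_nat m)) * off ms j))"
proof -
	let ?ds = "nat_bits m"
	have c': "spells (w t) (h t) (code ?ds)" using c by (simp add: encode_code)
	let ?T = "%k. st w (%j. h j + 2 * int k * off ms j)"
	have v: "view (?T k) t = w t (h t + 2 * int k)" for k using ms(3,4) by (simp add: view_st look_def)
	have 1: "runs (While (%v. v t = 2) (mvs ms ;; mvs ms)) (?T 0) (length ?ds * Suc (3 + 3) + 1) (?T (length ?ds))"
	proof (rule runs_While[where T = ?T])
	fix k assume k: "k < length ?ds"
	have "runs (mvs ms) (?T k) 3 (st w (%j. h j + (2 * int k + 1) * off ms j))"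
		by (rule runs_mvs_le[OF ms(1)]) (use ms(2) in \<open>simp_all add: algebra_simps\<close>)
	moreover have "runs (mvs ms) (st w (%j. h j + (2 * int k + 1) * off ms j)) 3 (?T (Suc k))"
		by (rule runs_mvs_le[OF ms(1)]) (use ms(2) in \<open>simp_all add: algebra_simps\<close>)
	ultimately have "runs (mvs ms ;; mvs ms) (?T k) (3 + 3) (?T (Suc k))" by (rule runs_Seq)
	then show "view (?T k) t = 2 & runs (mvs ms ;; mvs ms) (?T k) (3 + 3) (?T (Suc k))" unfolding v using spells_code(1)[OF c' k] by simp
	next
	show "~ view (?T (length ?ds)) t = 2" unfolding v using spells_code(3)[OF c'] by simp
	qed
	have "int (length (encode_nat m)) = 2 * int (length ?ds) + 1" by (simp add: encode_code code_length)
	then have 2: "runs (mvs ms) (?T (length ?ds)) 3 (st w (%j. h j + int (length (encode_nat m)) * off ms j))"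
	by (intro runs_mvs_le[OF ms(1)]) (use ms(2) in \<open>simp_all add: algebra_simps\<close>)
	have "?T 0 = st w h" by simp
	from runs_Seq[OF 1[unfolded this] 2]
	have "runs (skip t ms) (st w h) (length ?ds * Suc (3 + 3) + 1 + 3) (st w (%j. h j + int (length (encode_nat m)) * off ms j))" unfolding skip_def .
	moreover have "length ?ds * Suc (3 + 3) + 1 + 3 <= 4 * L + 4" using l by (simp add: encode_code code_length)
	ultimately show ?thesis by (rule runs_mono)
qed

definition unwind :: "nat => nat => prog" where
	"unwind c t = While (%v. v c ~= 1) (mvs [(c, Lt), (t, Lt)])"

lemma runs_unwind:
	assumes "c < ntapes" "t < ntapes" "c ~= t" "w c = counter" "h c = int k" "k <= L"
	shows "runs (unwind c t) (st w h) (4 * L + 1) (st w (h(c := 0, t := h t - int k)))"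
proof -
	let ?T = "%j. st w (h(c := int k - int j, t := h t - int j))"
	have v: "view (?T j) c = counter (int k - int j)" for j using assms by (simp add: view_st look_def)
	have "runs (unwind c t) (?T 0) (k * Suc 3 + 1) (?T k)" unfolding unwind_def
	proof (rule runs_While[where T = ?T])
	fix j assume j: "j < k"
	have "runs (mvs [(c, Lt), (t, Lt)]) (?T j) 3 (?T (Suc j))" by (rule runs_mvs_le) (use assms(1-3) in auto)
	then show "view (?T j) c ~= 1 & runs (mvs [(c, Lt), (t, Lt)]) (?T j) 3 (?T (Suc j))" using j unfolding v by (simp add: counter_def)
	next
	show "~ view (?T k) c ~= 1" unfolding v by (simp add: counter_def)
	qed
	moreover have "?T 0 = st w h" using assms(5) by (simp add: fun_upd_idem)
	moreover have "?T k = st w (h(c := 0, t := h t - int k))" by simp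
	ultimately have "runs (unwind c t) (st w h) (k * Suc 3 + 1) (st w (h(c := 0, t := h t - int k)))" by metis
	then show ?thesis by (rule runs_mono) (use assms(6) in simp)
qed

text \<open>Two codes are read in parallel. Tape 16 is a flag, raised by leaving its mark when two
  digits differ; tapes 13 and 14 record the moves, so that both reading heads can be
  returned.\<close>

definition compare :: prog where
	"compare = While (%v. v 9 = 2 & v 10 = 2 & v 16 = 1)
	 (mvs [(9, Rt), (13, Rt), (10, Rt), (14, Rt)] ;;
		Cond (%v. v 9 = v 10) Skip (mvs [(16, Rt)]) ;;
		mvs [(9, Rt), (13, Rt), (10, Rt), (14, Rt)]) ;;
	 Cond (%v. v 16 = 1 & v 9 = v 10) (mvs [(15, Rt)]) Skip ;;
	 While (%v. v 16 ~= 1) (mvs [(16, Lt)])"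

lemma runs_compare:
	assumes w: "w 16 = counter" and h: "h 16 = 0"
	and a: "spells (w 9) (h 9) (encode_nat m)" "spells (w 10) (h 10) (encode_nat m')"
	and L: "length (encode_nat m) <= L"
	obtains k where "k <= L + 1" "runs compare (st w h) (20 * L + 40)
	(st w (h(9 := h 9 + int k, 13 := h 13 + int k, 10 := h 10 + int k, 14 := h 14 + int k,
		15 := h 15 + (if m = m' then 1 else 0))))"
proof -
	let ?ds = "nat_bits m" and ?es = "nat_bits m'"
	have a': "spells (w 9) (h 9) (code ?ds)" "spells (w 10) (h 10) (code ?es)" using a by (simp_all add: encode_code)
	\<comment> \<open>The first index at which the digits differ or one of the lists ends. In the
	  former case the pass for this index is still completed, hence the extra one in \<open>n\<close>
	  below.\<close>
	define d where "d = (LEAST k. ~ (k < length ?ds & k < length ?es & ?ds ! k = ?es ! k))"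
	have d1: "~ (d < length ?ds & d < length ?es & ?ds ! d = ?es ! d)" unfolding d_def by (rule LeastI[of _ "length ?ds"]) simp
	have d2: "k < length ?ds & k < length ?es & ?ds ! k = ?es ! k" if "k < d" for k
	using not_less_Least[of k "%k. ~ (k < length ?ds & k < length ?es & ?ds ! k = ?es ! k)"] that unfolding d_def by blast
	define mis where "mis \<longleftrightarrow> d < length ?ds & d < length ?es"
	have dle: "d <= length ?ds" "d <= length ?es"
	proof -
	show "d <= length ?ds" unfolding d_def by (rule Least_le) simp
	show "d <= length ?es" unfolding d_def by (rule Least_le) simp
	qed
	define n where "n = (if mis then Suc d else d)"
	let ?H = "%k f r. h(9 := h 9 + k, 13 := h 13 + k, 10 := h 10 + k, 14 := h 14 + k, 16 := f, 15 := h 15 + r)"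
	let ?ms = "[(9::nat, Rt), (13, Rt), (10, Rt), (14, Rt)]"
	let ?T = "%k. st w (?H (2 * int k) (if k = Suc d then 1 else 0) 0)"
	have nt: "9 < ntapes" "10 < ntapes" "16 < ntapes" by (simp_all add: ntapes_def)
	have v: "view (st w (?H k f r)) 9 = w 9 (h 9 + k)" "view (st w (?H k f r)) 10 = w 10 (h 10 + k)"
	"view (st w (?H k f r)) 16 = counter f" for k f r using nt w by (simp_all add: view_st look_def)
	have mv: "runs (mvs ?ms) (st w (?H k f r)) 5 (st w (?H (k + 1) f r))" for k f r by (rule runs_mvs_le) (auto simp: ntapes_def)
	have mf: "runs (mvs [(16, Rt)]) (st w (?H k f r)) 2 (st w (?H k (f + 1) r))"
	"runs (mvs [(16, Lt)]) (st w (?H k f r)) 2 (st w (?H k (f - 1) r))"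
	"runs (mvs [(15, Rt)]) (st w (?H k f r)) 2 (st w (?H k f (r + 1)))" for k f r by (rule runs_mvs_le; auto simp: ntapes_def)+
	have 1: "runs (While (%v. v 9 = 2 & v 10 = 2 & v 16 = 1) (mvs ?ms ;; Cond (%v. v 9 = v 10) Skip (mvs [(16, Rt)]) ;; mvs ?ms))
		(?T 0) (n * Suc (5 + (3 + 5)) + 1) (?T n)"
	proof (rule runs_While[where T = ?T])
	fix k assume k: "k < n"
	have kd: "k <= d" "k < length ?ds" "k < length ?es" using k d2[of k] dle by (auto simp: n_def mis_def less_Suc_eq split: if_splits)
	have sy: "w 9 (h 9 + 2 * int k) = 2" "w 10 (h 10 + 2 * int k) = 2"
		"w 9 (h 9 + 2 * int k + 1) = bit_symbol (?ds ! k)" "w 10 (h 10 + 2 * int k + 1) = bit_symbol (?es ! k)"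
		using spells_code(1,2)[OF a'(1) kd(2)] spells_code(1,2)[OF a'(2) kd(3)] by simp_all
	have eq: "?ds ! k = ?es ! k \<longleftrightarrow> k ~= d" using d1 d2[of k] kd k by (cases "k = d") (auto simp: n_def mis_def)
	have T: "?T k = st w (?H (2 * int k) 0 0)" using kd(1) by simp
	have r2: "runs (Cond (%v. v 9 = v 10) Skip (mvs [(16, Rt)])) (st w (?H (2 * int k + 1) 0 0)) (Suc 2)
			(st w (?H (2 * int k + 1) (if Suc k = Suc d then 1 else 0) 0))"
	proof (rule runs_Cond)
		assume "view (st w (?H (2 * int k + 1) 0 0)) 9 = view (st w (?H (2 * int k + 1) 0 0)) 10"
		then have "bit_symbol (?ds ! k) = bit_symbol (?es ! k)" unfolding v using sy(3,4) by (simp add: add.assoc)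
		then have "k ~= d" using eq by (auto simp: bit_symbol_def split: if_splits)
		then show "runs Skip (st w (?H (2 * int k + 1) 0 0)) 2 (st w (?H (2 * int k + 1) (if Suc k = Suc d then 1 else 0) 0))"
			using runs_mono[OF runs_Skip, of 2] by simp
	next
		assume "view (st w (?H (2 * int k + 1) 0 0)) 9 ~= view (st w (?H (2 * int k + 1) 0 0)) 10"
		then have "bit_symbol (?ds ! k) ~= bit_symbol (?es ! k)" unfolding v using sy(3,4) by (simp add: add.assoc)
		then have "k = d" using eq by auto
		then show "runs (mvs [(16, Rt)]) (st w (?H (2 * int k + 1) 0 0)) 2 (st w (?H (2 * int k + 1) (if Suc k = Suc d then 1 else 0) 0))"
			using mf(1)[of "2 * int k + 1" 0 0] by simp
	qed
	have e: "2 * int k + 1 + 1 = 2 * int (Suc k)" "(Suc 2) = 3" by simp_all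
	have "runs (mvs ?ms ;; Cond (%v. v 9 = v 10) Skip (mvs [(16, Rt)]) ;; mvs ?ms) (st w (?H (2 * int k) 0 0)) (5 + (Suc 2 + 5))
			(st w (?H (2 * int k + 1 + 1) (if Suc k = Suc d then 1 else 0) 0))" by (rule runs_Seq[OF mv runs_Seq[OF r2 mv]])
	then have r: "runs (mvs ?ms ;; Cond (%v. v 9 = v 10) Skip (mvs [(16, Rt)]) ;; mvs ?ms) (?T k) (5 + (3 + 5)) (?T (Suc k))" unfolding e T .
	have "view (?T k) 9 = 2" "view (?T k) 10 = 2" "view (?T k) 16 = 1" unfolding T v using sy(1,2) by (simp_all add: counter_def)
	with r show "(view (?T k) 9 = 2 & view (?T k) 10 = 2 & view (?T k) 16 = 1) &
			runs (mvs ?ms ;; Cond (%v. v 9 = v 10) Skip (mvs [(16, Rt)]) ;; mvs ?ms) (?T k) (5 + (3 + 5)) (?T (Suc k))" by blast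
	next
	show "~ (view (?T n) 9 = 2 & view (?T n) 10 = 2 & view (?T n) 16 = 1)"
	proof (cases mis)
		case True
		then show ?thesis unfolding v by (simp add: n_def counter_def)
	next
		case False
		then have "d = length ?ds | d = length ?es" using dle by (auto simp: mis_def)
		then have "w 9 (h 9 + 2 * int d) = 1 | w 10 (h 10 + 2 * int d) = 1" using spells_code(3)[OF a'(1)] spells_code(3)[OF a'(2)] by auto
		then show ?thesis unfolding v using False by (auto simp: n_def)
	qed
	qed
	let ?f = "if mis then 1 else 0 :: int" and ?k = "2 * int n"
	have Tn: "?T n = st w (?H ?k ?f 0)" by (simp add: n_def)
	have same: "?f = 0 & w 9 (h 9 + ?k) = w 10 (h 10 + ?k) \<longleftrightarrow> m = m'"
	proof (cases mis)
	case True
	then have "?ds ~= ?es" using d1 by (auto simp: mis_def)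
	then show ?thesis using True by auto
	next
	case False
	then have n: "n = d" by (simp add: n_def)
	have s9: "w 9 (h 9 + 2 * int d) = (if d = length ?ds then 1 else 2)" using spells_code(1,3)[OF a'(1)] dle(1) by (cases "d = length ?ds") auto
	have s10: "w 10 (h 10 + 2 * int d) = (if d = length ?es then 1 else 2)" using spells_code(1,3)[OF a'(2)] dle(2) by (cases "d = length ?es") auto
	have one: "d = length ?ds | d = length ?es" using False dle by (auto simp: mis_def)
	have both: "?ds = ?es" if "d = length ?ds" "d = length ?es" using d2 by (intro nth_equalityI) (simp_all add: that[symmetric])
	have "w 9 (h 9 + 2 * int d) = w 10 (h 10 + 2 * int d) \<longleftrightarrow> (d = length ?ds \<longleftrightarrow> d = length ?es)"
		unfolding s9 s10 by simp
	also have "\<dots> \<longleftrightarrow> m = m'"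
	proof
		assume "d = length ?ds \<longleftrightarrow> d = length ?es"
		then show "m = m'" using one both nat_bits_inj[of m m'] by blast
	qed simp
	finally show ?thesis using False n by simp
	qed
	let ?r = "if m = m' then 1 else 0 :: int"
	have 2: "runs (Cond (%v. v 16 = 1 & v 9 = v 10) (mvs [(15, Rt)]) Skip) (st w (?H ?k ?f 0)) (Suc 2) (st w (?H ?k ?f ?r))"
	proof -
	have c: "view (st w (?H ?k ?f 0)) 16 = 1 & view (st w (?H ?k ?f 0)) 9 = view (st w (?H ?k ?f 0)) 10 \<longleftrightarrow> m = m'"
		unfolding v same[symmetric] by (simp add: counter_def)
	show ?thesis
	proof (rule runs_Cond)
		assume "view (st w (?H ?k ?f 0)) 16 = 1 & view (st w (?H ?k ?f 0)) 9 = view (st w (?H ?k ?f 0)) 10"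
		then have e: "?r = 0 + 1" using c by simp
		show "runs (mvs [(15, Rt)]) (st w (?H ?k ?f 0)) 2 (st w (?H ?k ?f ?r))" unfolding e by (rule mf(3))
	next
		assume "~ (view (st w (?H ?k ?f 0)) 16 = 1 & view (st w (?H ?k ?f 0)) 9 = view (st w (?H ?k ?f 0)) 10)"
		then have "m ~= m'" unfolding c .
		then have "?r = 0" by simp
		then show "runs Skip (st w (?H ?k ?f 0)) 2 (st w (?H ?k ?f ?r))" using runs_mono[OF runs_Skip, of 2 "st w (?H ?k ?f 0)"] by simp
	qed
	qed
	have 3: "runs (While (%v. v 16 ~= 1) (mvs [(16, Lt)])) (st w (?H ?k ?f ?r)) (1 * Suc 2 + 1) (st w (?H ?k 0 ?r))"
	proof (cases mis)
	case True
	have "runs (While (%v. v 16 ~= 1) (mvs [(16, Lt)])) (st w (?H ?k (1 - int 0) ?r)) (1 * Suc 2 + 1) (st w (?H ?k (1 - int 1) ?r))"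
	proof (rule runs_While[where T = "%j. st w (?H ?k (1 - int j) ?r)"])
		fix j :: nat assume "j < 1"
		then have "j = 0" by simp
		then show "view (st w (?H ?k (1 - int j) ?r)) 16 ~= 1 & runs (mvs [(16, Lt)]) (st w (?H ?k (1 - int j) ?r)) 2 (st w (?H ?k (1 - int (Suc j)) ?r))"
			unfolding v using mf(2)[of ?k 1 ?r] by (simp add: counter_def)
	next
		show "~ view (st w (?H ?k (1 - int 1) ?r)) 16 ~= 1" unfolding v by (simp add: counter_def)
	qed
	then show ?thesis using True by simp
	next
	case False
	have "runs (While (%v. v 16 ~= 1) (mvs [(16, Lt)])) (st w (?H ?k 0 ?r)) (0 * Suc 2 + 1) (st w (?H ?k 0 ?r))"
		by (rule runs_While[where T = "%j. st w (?H ?k 0 ?r)"]) (simp_all add: v counter_def)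
	then have "runs (While (%v. v 16 ~= 1) (mvs [(16, Lt)])) (st w (?H ?k 0 ?r)) (1 * Suc 2 + 1) (st w (?H ?k 0 ?r))" by (rule runs_mono) simp
	then show ?thesis using False by simp
	qed
	have T0: "?T 0 = st w h" using h by (simp add: fun_upd_idem)
	have E: "?H ?k 0 ?r = h(9 := h 9 + int (2 * n), 13 := h 13 + int (2 * n), 10 := h 10 + int (2 * n), 14 := h 14 + int (2 * n),
		15 := h 15 + (if m = m' then 1 else 0))" using h by (auto simp: fun_eq_iff)
	have "runs compare (st w h) (n * Suc (5 + (3 + 5)) + 1 + (Suc 2 + (1 * Suc 2 + 1))) (st w (?H ?k 0 ?r))"
	unfolding compare_def by (rule runs_Seq[OF 1[unfolded T0 Tn] runs_Seq[OF 2 3]])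
	moreover have nl: "2 * n <= L + 1" using dle(1) L by (auto simp: n_def mis_def encode_code code_length)
	moreover have "n * Suc (5 + (3 + 5)) + 1 + (Suc 2 + (1 * Suc 2 + 1)) <= 20 * L + 40" using nl by simp
	ultimately show thesis using that[OF nl] runs_mono unfolding E by blast
qed

section \<open>Verifying a colouring\<close>

text \<open>A certificate consists of two bits for each vertex, which choose a colour from its list. The input
	is kept on the tapes 6 to 10: tapes 6 and 7 run through pairs of vertices, tape 8 through the
	adjacency matrix, and tapes 9 and 10 through the lists. Tapes 11 and 12 run through the certificate,
	tapes 13, 14, 17 and 18 count moves that have to be undone, and tape 15 counts conflicts.\<close>

definition step_code :: "nat => nat => prog" where
	"step_code t c = skip t [(t, Rt), (c, Rt)]"

text \<open>The first \<open>step_code\<close> passes the size of the list. Any symbol other than 2,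
  blanks included, means to go on to the next colour, so every word, however short, selects some
  colour from each list.\<close>

definition choose_code :: "nat => nat => nat => prog" where
	"choose_code t c r = step_code t c ;; Cond (%v. v r = 2) Skip
	 (step_code t c ;; mvs [(r, Rt)] ;; Cond (%v. v r = 2) Skip (step_code t c) ;; mvs [(r, Lt)])"

definition check :: prog where
	"check = choose_code 9 13 11 ;; choose_code 10 14 12 ;; compare ;; unwind 13 9 ;; unwind 14 10"

definition step_block :: "nat => nat => prog" where
	"step_block t c = step_code t c ;; step_code t c ;; step_code t c ;; step_code t c"

definition home :: "nat => (nat \<times> move) list => prog" where
	"home t ms = mvs [(t, Lt)] ;; While (%v. v t ~= 0) (mvs ms) ;; mvs [(t, Rt)]"

definition visit :: prog where
	"visit = Cond (%v. v 8 = 2) check Skip ;; step_block 10 17 ;;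
	 mvs [(12, Rt), (12, Rt), (8, Rt), (7, Rt)]"

definition visit_row :: prog where
	"visit_row = While (%v. v 7 = 2) visit ;; home 7 [(7, Lt), (12, Lt), (12, Lt)] ;;
	 unwind 17 10 ;; step_block 9 18 ;; mvs [(11, Rt), (11, Rt), (6, Rt)]"

text \<open>The lists start behind \<open>n + 1 + n * n\<close> symbols. The unary number at the
  beginning, read on three tapes, measures both the first \<open>n\<close> cells and the
  \<open>n * n\<close> cells of the matrix.\<close>

definition locate :: prog where
	"locate = While (%v. v 8 = 2) (mvs [(8, Rt), (9, Rt), (10, Rt)]) ;;
	 mvs [(8, Rt), (9, Rt), (10, Rt)] ;;
	 While (%v. v 6 = 2) (While (%v. v 7 = 2) (mvs [(7, Rt), (9, Rt), (10, Rt)]) ;;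
		 home 7 [(7, Lt)] ;; mvs [(6, Rt)]) ;; home 6 [(6, Lt)]"

definition verify :: prog where
	"verify = locate ;; While (%v. v 6 = 2) visit_row"

lemma moving_Mv: "i ~= 0 ==> i ~= 4 ==> i < ntapes ==> moving (Mv i d)" by (auto simp: Mv_def)

lemma moving_Skip: "moving Skip" by (auto simp: Skip_def Mv_def ntapes_def)

lemma moving_mvs: "ALL (i, d) : set ms. i ~= 0 & i ~= 4 & i < ntapes ==> moving (mvs ms)"
	by (induction ms rule: mvs.induct) (auto simp: moving_Skip intro: moving_Mv)

lemma moving_verify: "moving verify" by (simp add: verify_def locate_def visit_row_def visit_def home_def step_block_def check_def choose_code_def
		step_code_def skip_def unwind_def compare_def moving_mvs moving_Skip ntapes_def del: mvs.simps)

definition vtapes :: "bool list => bool list => contents" where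
	"vtapes x u i = (if i : {2, 6, 7, 8, 9, 10} then fst (word_tape x) else if i : {11, 12} then fst (word_tape u)
	 else if i : {4, 5, 13, 14, 15, 16, 17} then counter else (%p. 0))"

lemma vtapes:
	"vtapes x u 2 = fst (word_tape x)" "vtapes x u 6 = fst (word_tape x)" "vtapes x u 7 = fst (word_tape x)"
	"vtapes x u 8 = fst (word_tape x)" "vtapes x u 9 = fst (word_tape x)" "vtapes x u 10 = fst (word_tape x)"
	"vtapes x u 11 = fst (word_tape u)" "vtapes x u 12 = fst (word_tape u)"
	"vtapes x u 4 = counter" "vtapes x u 5 = counter" "vtapes x u 13 = counter" "vtapes x u 14 = counter"
	"vtapes x u 15 = counter" "vtapes x u 16 = counter" "vtapes x u 17 = counter" by (simp_all add: vtapes_def)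

lemma home_runs:
	assumes t: "t < ntapes" and ms: "fst ` set ms \<subseteq> {..<ntapes}" "off ms t = - 1" "length ms <= 3"
	and w: "\<And>k. k < n ==> w t (int k) ~= 0" "w t (- 1) = 0" and h: "h t = int n" and L: "n <= L"
	shows "runs (home t ms) (st w h) (5 * L + 5) (st w (%j. h j + int n * off ms j))"
proof -
	let ?T = "%k. st w (%j. (h(t := h t - 1)) j + int k * off ms j)"
	have v: "view (?T k) t = w t (int n - 1 - int k)" for k using t ms(2) h by (simp add: view_st look_def)
	have 1: "runs (mvs [(t, Lt)]) (st w h) 2 (?T 0)" by (rule runs_mvs_le) (use t in auto)
	have 2: "runs (While (%v. v t ~= 0) (mvs ms)) (?T 0) (n * Suc 4 + 1) (?T n)"
	proof (rule runs_While[where T = ?T])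
	fix k assume k: "k < n"
	have e: "int n - 1 - int k = int (n - 1 - k)" using k by simp
	have "w t (int n - 1 - int k) ~= 0" unfolding e by (rule w(1)) (use k in simp)
	moreover have "runs (mvs ms) (?T k) 4 (?T (Suc k))" by (rule runs_mvs_le[OF ms(1)]) (use ms(3) in \<open>simp_all add: algebra_simps\<close>)
	ultimately show "view (?T k) t ~= 0 & runs (mvs ms) (?T k) 4 (?T (Suc k))" unfolding v by blast
	next
	show "~ view (?T n) t ~= 0" unfolding v using w(2) by simp
	qed
	have 3: "runs (mvs [(t, Rt)]) (?T n) 2 (st w (%j. h j + int n * off ms j))" by (rule runs_mvs_le) (use t in auto)
	have "runs (home t ms) (st w h) (2 + (n * Suc 4 + 1 + 2)) (st w (%j. h j + int n * off ms j))"
	unfolding home_def by (rule runs_Seq[OF 1 runs_Seq[OF 2 3]])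
	then show ?thesis by (rule runs_mono) (use L in simp)
qed

locale verification =
	fixes n :: nat and E :: "nat set set" and L :: "nat => nat set" and u :: "bool list"
	assumes simple: "simple_graph {..<n} E" and three: "regular_assignment 3 {..<n} L"
begin

definition x :: "bool list" where "x = encode_input (n, E, L)"
abbreviation "wx \<equiv> fst (word_tape x)"
abbreviation "wu \<equiv> fst (word_tape u)"
abbreviation "w \<equiv> vtapes x u"
abbreviation "K \<equiv> length x + 1"

definition codes :: "nat => nat list" where "codes i = card (L i) # sorted_list_of_set (L i)"
definition block :: "nat => bool list" where "block i = concat (map encode_nat (codes i))"
definition start :: "nat => nat" where "start i = n + 1 + n * n + length (concat (map block [0..<i]))"
definition part :: "nat => nat => nat" where "part i m = length (concat (map encode_nat (take m (codes i))))"
definition choice :: "nat => nat" where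
	"choice i = (if wu (2 * int i) = 2 then 0 else if wu (2 * int i + 1) = 2 then 1 else 2)"
definition colour :: "nat => nat" where "colour i = codes i ! Suc (choice i)"

lemma codes_length: "i < n ==> length (codes i) = 4" using three by (simp add: codes_def regular_assignment_def)

lemma x_eq: "x = replicate n True @ ([False] @ (map (%k. {k div n, k mod n} : E) [0..<n * n] @ concat (map block [0..<n])))"
proof -
	have "map (%k. {k div n, k mod n} : E) [0..<n * n] = concat (map (%i. map (%j. {i, j} : E) [0..<n]) [0..<n])"
	unfolding map_block by (intro arg_cong[where f = concat] map_cong refl) simp
	moreover have "encode_nat_set (L i) = block i" for i by (simp add: encode_nat_set_def block_def codes_def)
	ultimately show ?thesis by (simp add: x_def)
qed

lemma n_less: "n < K" "n + 1 + n * n <= length x" unfolding x_eq by simp_all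

lemma unary: "k < n ==> wx (int k) = 2" "wx (int n) = 1" "wx (- 1) = 0"
proof -
	have x: "x ! k = (k ~= n)" if "k <= n" for k using that by (auto simp: x_eq nth_append)
	show "wx (int k) = 2" if "k < n" using that x[of k] n_less by (simp add: word_tape_def bit_symbol_def)
	show "wx (int n) = 1" using x[of n] n_less by (simp add: word_tape_def bit_symbol_def)
	show "wx (- 1) = 0" by (simp add: word_tape_def)
qed

lemma spells_tail: "spells wx (int n + 1) (map (%k. {k div n, k mod n} : E) [0..<n * n] @ concat (map block [0..<n]))"
proof -
	have "spells wx 0 (replicate n True @ ([False] @ (map (%k. {k div n, k mod n} : E) [0..<n * n] @ concat (map block [0..<n]))))"
	using spells_word[of x] unfolding x_eq[symmetric] .
	from spells_appendD2[OF spells_appendD2[OF this]] show ?thesis by simp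
qed

lemma adjacency_symbol:
	assumes "i < n" "j < n"
	shows "wx (int n + 1 + int (i * n + j)) = bit_symbol ({i, j} : E)"
proof -
	have l: "i * n + j < n * n" using assms mult_le_mono1[of "Suc i" n n] by simp
	have d: "(i * n + j) div n = i" "(i * n + j) mod n = j" using assms by simp_all
	show ?thesis using spells_nth[OF spells_appendD1[OF spells_tail], of "i * n + j"] l by (simp add: d assms)
qed

lemma upt_split: "i < n ==> [0..<n] = [0..<i] @ i # [Suc i..<n]" using upt_add_eq_append[of 0 i "n - i"] upt_conv_Cons[of i n] by simp

lemma spells_block:
	assumes "i < n"
	shows "spells wx (int (start i)) (block i)" "start i + length (block i) <= length x"
proof -
	have e: "concat (map block [0..<n]) = concat (map block [0..<i]) @ (block i @ concat (map block [Suc i..<n]))" unfolding upt_split[OF assms] by simp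
	have "spells wx (int n + 1 + int (n * n)) (concat (map block [0..<i]) @ (block i @ concat (map block [Suc i..<n])))"
	using spells_appendD2[OF spells_tail] unfolding e by simp
	from spells_appendD1[OF spells_appendD2[OF this]] show "spells wx (int (start i)) (block i)" by (simp add: start_def algebra_simps)
	have "length (concat (map block [0..<i])) + length (block i) <= length (concat (map block [0..<n]))" unfolding e length_append by linarith
	moreover have "length x = n + 1 + n * n + length (concat (map block [0..<n]))" unfolding x_eq length_append by (simp del: length_concat)
	ultimately show "start i + length (block i) <= length x" unfolding start_def by linarith
qed

lemma start_Suc: "start (Suc i) = start i + length (block i)" by (simp add: start_def)

lemma part_simps: "part i 0 = 0" "i < n ==> part i 4 = length (block i)" using codes_length[of i] by (simp_all add: part_def block_def)

lemma part_Suc: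
	assumes "i < n" "m < 4"
	shows "part i (Suc m) = part i m + length (encode_nat (codes i ! m))"
	"spells wx (int (start i) + int (part i m)) (encode_nat (codes i ! m))"
	"part i (Suc m) <= length (block i)"
proof -
	have m: "m < length (codes i)" using assms codes_length by simp
	show 1: "part i (Suc m) = part i m + length (encode_nat (codes i ! m))" by (simp add: part_def take_Suc_conv_app_nth[OF m])
	have e: "block i = concat (map encode_nat (take m (codes i))) @ (encode_nat (codes i ! m) @ concat (map encode_nat (drop (Suc m) (codes i))))"
	unfolding block_def by (subst id_take_nth_drop[OF m]) simp
	show "spells wx (int (start i) + int (part i m)) (encode_nat (codes i ! m))"
	using spells_appendD1[OF spells_appendD2[OF spells_block(1)[OF assms(1), unfolded e]]] by (simp add: part_def)
	show "part i (Suc m) <= length (block i)" unfolding 1 by (subst e) (simp add: part_def)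
qed

lemma code_le: "i < n ==> m < 4 ==> part i (Suc m) <= length x" "i < n ==> m < 4 ==> length (encode_nat (codes i ! m)) <= length x"
	using part_Suc(1,3)[of i m] spells_block(2)[of i] by linarith+

lemma step_code_runs:
	assumes "i < n" "m < 4" "t < ntapes" "c < ntapes" "t ~= c" "w t = wx" "h t = int (start i + part i m)"
	shows "runs (step_code t c) (st w h) (4 * K) (st w (h(t := int (start i + part i (Suc m)), c := h c + int (part i (Suc m)) - int (part i m))))"
proof -
	let ?ms = "[(t, Rt), (c, Rt)]"
	have 1: "runs (step_code t c) (st w h) (4 * length x + 4) (st w (%j. h j + int (length (encode_nat (codes i ! m))) * off ?ms j))"
	unfolding step_code_def by (rule runs_skip) (use assms part_Suc(2)[OF assms(1,2)] code_le(2)[OF assms(1,2)] in auto)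
	have 2: "(%j. h j + int (length (encode_nat (codes i ! m))) * off ?ms j) =
		h(t := int (start i + part i (Suc m)), c := h c + int (part i (Suc m)) - int (part i m))"
	using assms(5,7) part_Suc(1)[OF assms(1,2)] by (auto simp: fun_eq_iff)
	show ?thesis by (rule runs_mono[OF 1[unfolded 2]]) simp
qed

lemma step_block_runs:
	assumes "i < n" "t < ntapes" "c < ntapes" "t ~= c" "w t = wx" "h t = int (start i)"
	shows "runs (step_block t c) (st w h) (16 * K) (st w (h(t := int (start (Suc i)), c := h c + int (start (Suc i)) - int (start i))))"
proof -
	let ?H = "%m. h(t := int (start i + part i m), c := h c + int (part i m))"
	have s: "runs (step_code t c) (st w (?H m)) (4 * K) (st w (?H (Suc m)))" if "m < 4" for m
	proof -
	have "(?H m)(t := int (start i + part i (Suc m)), c := (?H m) c + int (part i (Suc m)) - int (part i m)) = ?H (Suc m)"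
		using assms(4) by (auto simp: fun_eq_iff)
	then show ?thesis using step_code_runs[OF assms(1) that assms(2-5), of "?H m"] assms(4) by simp
	qed
	have "runs (step_block t c) (st w (?H 0)) (4 * K + (4 * K + (4 * K + 4 * K))) (st w (?H (Suc (Suc (Suc (Suc 0))))))"
	unfolding step_block_def by (intro runs_Seq[OF s runs_Seq[OF s runs_Seq[OF s s]]]) simp_all
	moreover have "?H 0 = h" using assms(6) by (auto simp: fun_eq_iff part_simps(1))
	moreover have "part i (Suc (Suc (Suc (Suc 0)))) = length (block i)" using part_simps(2)[OF assms(1)] by (simp add: numeral_eq_Suc)
	then have "?H (Suc (Suc (Suc (Suc 0)))) = h(t := int (start (Suc i)), c := h c + int (start (Suc i)) - int (start i))" by (simp add: start_Suc)
	ultimately show ?thesis by (simp add: algebra_simps)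
qed

lemma choice_less: "choice i < 3" by (simp add: choice_def)

lemma choose_code_runs:
	assumes i: "i < n" and t: "t < ntapes" "c < ntapes" "r < ntapes" "t ~= c" "r ~= t" "r ~= c" and w: "w t = wx" "w r = wu"
	and h: "h t = int (start i)" "h r = 2 * int i"
	shows "runs (choose_code t c r) (st w h) (20 * K) (st w (h(t := int (start i + part i (Suc (choice i))), c := h c + int (part i (Suc (choice i))))))"
proof -
	let ?H = "%m. h(t := int (start i + part i m), c := h c + int (part i m))"
	have s: "runs (step_code t c) (st w (g(t := int (start i + part i m), c := y + int (part i m)))) (4 * K)
		(st w (g(t := int (start i + part i (Suc m)), c := y + int (part i (Suc m)))))" if "m < 4" for m g y
	proof -
	let ?G = "%m. g(t := int (start i + part i m), c := y + int (part i m))"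
	have "(?G m)(t := int (start i + part i (Suc m)), c := (?G m) c + int (part i (Suc m)) - int (part i m)) = ?G (Suc m)"
		using t(4) by (auto simp: fun_eq_iff)
	then show ?thesis using step_code_runs[OF i that t(1,2,4) w(1), of "?G m"] t(4) by simp
	qed
	have v: "view (st w (?H m)) r = wu (2 * int i)" "view (st w ((?H m)(r := 2 * int i + 1))) r = wu (2 * int i + 1)" for m
	using t w(2) h(2) by (simp_all add: view_st look_def)
	have mr: "runs (mvs [(r, Rt)]) (st w (?H m)) 2 (st w ((?H m)(r := 2 * int i + 1)))"
	"runs (mvs [(r, Lt)]) (st w ((?H m)(r := 2 * int i + 1))) 2 (st w (?H m))" for m by (rule runs_mvs_le; use t h(2) in auto)+
	have sw: "(?H m)(r := 2 * int i + 1) = (h(r := 2 * int i + 1))(t := int (start i + part i m), c := h c + int (part i m))" for m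
	using t by (auto simp: fun_eq_iff)
	have s2: "runs (step_code t c) (st w ((?H 2)(r := 2 * int i + 1))) (4 * K) (st w ((?H (Suc 2))(r := 2 * int i + 1)))" unfolding sw by (rule s) simp
	have 1: "runs (step_code t c) (st w (?H 0)) (4 * K) (st w (?H (Suc 0)))" by (rule s) simp
	have inner: "runs (step_code t c ;; mvs [(r, Rt)] ;; Cond (%v. v r = 2) Skip (step_code t c) ;; mvs [(r, Lt)])
		(st w (?H (Suc 0))) (4 * K + (2 + (Suc (4 * K) + 2))) (st w (?H (if wu (2 * int i + 1) = 2 then 2 else 3)))"
	proof -
	have a: "runs (step_code t c) (st w (?H (Suc 0))) (4 * K) (st w (?H 2))" using s[of "Suc 0" h "h c"] by (simp add: numeral_2_eq_2)
	have b: "runs (Cond (%v. v r = 2) Skip (step_code t c)) (st w ((?H 2)(r := 2 * int i + 1))) (Suc (4 * K))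
			(st w ((?H (if wu (2 * int i + 1) = 2 then 2 else 3))(r := 2 * int i + 1)))"
	proof (rule runs_Cond)
		assume "view (st w ((?H 2)(r := 2 * int i + 1))) r = 2"
		then have e: "(if wu (2 * int i + 1) = 2 then 2 else 3 :: nat) = 2" unfolding v by simp
		show "runs Skip (st w ((?H 2)(r := 2 * int i + 1))) (4 * K) (st w ((?H (if wu (2 * int i + 1) = 2 then 2 else 3))(r := 2 * int i + 1)))"
			unfolding e by (rule runs_mono[OF runs_Skip]) simp
	next
		assume "view (st w ((?H 2)(r := 2 * int i + 1))) r ~= 2"
		then have e: "(if wu (2 * int i + 1) = 2 then 2 else 3 :: nat) = Suc 2" unfolding v by simp
		show "runs (step_code t c) (st w ((?H 2)(r := 2 * int i + 1))) (4 * K) (st w ((?H (if wu (2 * int i + 1) = 2 then 2 else 3))(r := 2 * int i + 1)))"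
			unfolding e by (rule s2)
	qed
	show ?thesis by (rule runs_Seq[OF a runs_Seq[OF mr(1) runs_Seq[OF b mr(2)]]])
	qed
	let ?m = "Suc (choice i)"
	have 2: "runs (Cond (%v. v r = 2) Skip (step_code t c ;; mvs [(r, Rt)] ;; Cond (%v. v r = 2) Skip (step_code t c) ;; mvs [(r, Lt)]))
		(st w (?H (Suc 0))) (Suc (4 * K + (2 + (Suc (4 * K) + 2)))) (st w (?H ?m))"
	proof (rule runs_Cond)
	assume "view (st w (?H (Suc 0))) r = 2"
	then have e: "?m = Suc 0" unfolding v by (simp add: choice_def)
	show "runs Skip (st w (?H (Suc 0))) (4 * K + (2 + (Suc (4 * K) + 2))) (st w (?H ?m))" unfolding e by (rule runs_mono[OF runs_Skip]) simp
	next
	assume "view (st w (?H (Suc 0))) r ~= 2"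
	then have e: "?m = (if wu (2 * int i + 1) = 2 then 2 else 3)" unfolding v by (simp add: choice_def)
	show "runs (step_code t c ;; mvs [(r, Rt)] ;; Cond (%v. v r = 2) Skip (step_code t c) ;; mvs [(r, Lt)])
		(st w (?H (Suc 0))) (4 * K + (2 + (Suc (4 * K) + 2))) (st w (?H ?m))" unfolding e by (rule inner)
	qed
	have H0: "?H 0 = h" using h(1) by (auto simp: fun_eq_iff part_simps(1))
	have "runs (choose_code t c r) (st w h) (4 * K + Suc (4 * K + (2 + (Suc (4 * K) + 2)))) (st w (?H ?m))"
	unfolding choose_code_def using runs_Seq[OF 1 2] unfolding H0 .
	then show ?thesis by (rule runs_mono) simp
qed

definition conflict :: "nat => nat => nat" where
	"conflict i j = (if {i, j} : E & colour i = colour j then 1 else 0)"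

lemma check_runs:
	assumes ij: "i < n" "j < n" and h: "h 9 = int (start i)" "h 10 = int (start j)" "h 11 = 2 * int i" "h 12 = 2 * int j"
	"h 13 = 0" "h 14 = 0" "h 16 = 0"
	shows "runs check (st w h) (140 * K) (st w (h(15 := h 15 + (if colour i = colour j then 1 else 0))))"
proof -
	let ?a = "part i (Suc (choice i))" and ?b = "part j (Suc (choice j))"
	let ?h1 = "h(9 := int (start i + ?a), 13 := h 13 + int ?a)"
	let ?h2 = "?h1(10 := int (start j + ?b), 14 := ?h1 14 + int ?b)"
	have r1: "runs (choose_code 9 13 11) (st w h) (20 * K) (st w ?h1)" by (rule choose_code_runs[OF ij(1)]) (simp_all add: ntapes_def vtapes h)
	have r2: "runs (choose_code 10 14 12) (st w ?h1) (20 * K) (st w ?h2)"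
	by (rule choose_code_runs[OF ij(2)]) (simp_all add: ntapes_def vtapes h)
	have m: "Suc (choice i) < 4" "Suc (choice j) < 4" using choice_less[of i] choice_less[of j] by simp_all
	have ab: "?a <= length x" "?b <= length x"
	using code_le(1)[OF ij(1), of "choice i"] code_le(1)[OF ij(2), of "choice j"] choice_less[of i] choice_less[of j] by simp_all
	have sp: "spells (w 9) (?h2 9) (encode_nat (colour i))" "spells (w 10) (?h2 10) (encode_nat (colour j))"
	using part_Suc(2)[OF ij(1) m(1)] part_Suc(2)[OF ij(2) m(2)] by (simp_all add: vtapes colour_def)
	have h16: "?h2 16 = 0" "w 16 = counter" using h by (simp_all add: vtapes)
	have len: "length (encode_nat (colour i)) <= length x" unfolding colour_def by (rule code_le(2)[OF ij(1) m(1)])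
	obtain k where k: "k <= length x + 1" "runs compare (st w ?h2) (20 * length x + 40)
	(st w (?h2(9 := ?h2 9 + int k, 13 := ?h2 13 + int k, 10 := ?h2 10 + int k, 14 := ?h2 14 + int k,
		15 := ?h2 15 + (if colour i = colour j then 1 else 0))))" by (rule runs_compare[OF h16(2,1) sp len])
	let ?h3 = "?h2(9 := ?h2 9 + int k, 13 := ?h2 13 + int k, 10 := ?h2 10 + int k, 14 := ?h2 14 + int k,
		15 := ?h2 15 + (if colour i = colour j then 1 else 0))"
	have r4: "runs (unwind 13 9) (st w ?h3) (4 * (2 * K) + 1) (st w (?h3(13 := 0, 9 := ?h3 9 - int (?a + k))))"
	by (rule runs_unwind) (use ab k(1) in \<open>simp_all add: ntapes_def vtapes h\<close>)
	let ?h4 = "?h3(13 := 0, 9 := ?h3 9 - int (?a + k))"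
	have r5: "runs (unwind 14 10) (st w ?h4) (4 * (2 * K) + 1) (st w (?h4(14 := 0, 10 := ?h4 10 - int (?b + k))))"
	by (rule runs_unwind) (use ab k(1) in \<open>simp_all add: ntapes_def vtapes h\<close>)
	have e: "?h4(14 := 0, 10 := ?h4 10 - int (?b + k)) = h(15 := h 15 + (if colour i = colour j then 1 else 0))" using h by (auto simp: fun_eq_iff)
	have "runs check (st w h) (20 * K + (20 * K + (20 * length x + 40 + (4 * (2 * K) + 1 + (4 * (2 * K) + 1)))))
	 (st w (?h4(14 := 0, 10 := ?h4 10 - int (?b + k))))"
	unfolding check_def by (rule runs_Seq[OF r1 runs_Seq[OF r2 runs_Seq[OF k(2) runs_Seq[OF r4 r5]]]])
	then show ?thesis unfolding e by (rule runs_mono) simp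
qed

text \<open>The common invariant of the two loops: the heads when the pair \<open>(i, j)\<close> is
  about to be visited and \<open>f\<close> conflicts have been found.\<close>

definition place_heads :: "heads => nat => nat => nat => heads" where
	"place_heads h i j f = h(6 := int i, 7 := int j, 8 := int (n + 1 + i * n + j), 9 := int (start i), 10 := int (start j),
	 11 := 2 * int i, 12 := 2 * int j, 15 := int f, 17 := int (start j) - int (start 0), 18 := int (start i) - int (start 0))"

context
	fixes h :: heads
	assumes h: "h 13 = 0" "h 14 = 0" "h 16 = 0"
begin

lemma visit_runs:
	assumes ij: "i < n" "j < n"
	shows "runs visit (st w (place_heads h i j f)) (170 * K) (st w (place_heads h i (Suc j) (f + conflict i j)))"
proof -
	let ?h = "place_heads h i j f"
	let ?h1 = "?h(15 := ?h 15 + int (conflict i j))"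
	have v: "view (st w ?h) 8 = bit_symbol ({i, j} : E)"
	proof -
	have "?h 8 = int n + 1 + int (i * n + j)" by (simp add: place_heads_def)
	then show ?thesis using adjacency_symbol[OF ij] by (simp add: view_st look_def ntapes_def vtapes)
	qed
	have r1: "runs (Cond (%v. v 8 = 2) check Skip) (st w ?h) (Suc (140 * K)) (st w ?h1)"
	proof (rule runs_Cond)
	assume "view (st w ?h) 8 = 2"
	then have "{i, j} : E" unfolding v by (auto simp: bit_symbol_def split: if_splits)
	then have e: "int (conflict i j) = (if colour i = colour j then 1 else 0)" by (simp add: conflict_def)
	show "runs check (st w ?h) (140 * K) (st w ?h1)" unfolding e by (rule check_runs[OF ij]) (simp_all add: place_heads_def h)
	next
	assume "view (st w ?h) 8 ~= 2"
	then have "{i, j} \<notin> E" unfolding v by (auto simp: bit_symbol_def)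
	then have "?h1 = ?h" by (auto simp: conflict_def)
	then show "runs Skip (st w ?h) (140 * K) (st w ?h1)" using runs_mono[OF runs_Skip, of "140 * K" "st w ?h"] by simp
	qed
	let ?h2 = "?h1(10 := int (start (Suc j)), 17 := ?h1 17 + int (start (Suc j)) - int (start j))"
	have r2: "runs (step_block 10 17) (st w ?h1) (16 * K) (st w ?h2)"
	by (rule step_block_runs[OF ij(2)]) (simp_all add: ntapes_def vtapes place_heads_def)
	have r3: "runs (mvs [(12, Rt), (12, Rt), (8, Rt), (7, Rt)]) (st w ?h2) 5 (st w (place_heads h i (Suc j) (f + conflict i j)))"
	by (rule runs_mvs_le) (auto simp: ntapes_def place_heads_def)
	have "runs visit (st w ?h) (Suc (140 * K) + (16 * K + 5)) (st w (place_heads h i (Suc j) (f + conflict i j)))"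
	unfolding visit_def by (rule runs_Seq[OF r1 runs_Seq[OF r2 r3]])
	then show ?thesis by (rule runs_mono) simp
qed

lemma visit_row_runs:
	assumes i: "i < n"
	shows "runs visit_row (st w (place_heads h i 0 f)) (220 * (K * K)) (st w (place_heads h (Suc i) 0 (f + (\<Sum>j<n. conflict i j))))"
proof -
	let ?T = "%j. st w (place_heads h i j (f + (\<Sum>k<j. conflict i k)))"
	have v: "view (?T j) 7 = wx (int j)" for j by (simp add: view_st look_def ntapes_def vtapes place_heads_def)
	have r1: "runs (While (%v. v 7 = 2) visit) (?T 0) (n * Suc (170 * K) + 1) (?T n)"
	proof (rule runs_While[where T = ?T])
	fix j assume j: "j < n"
	show "view (?T j) 7 = 2 & runs visit (?T j) (170 * K) (?T (Suc j))"
		using visit_runs[OF i j, of "f + (\<Sum>k<j. conflict i k)"] unary(1)[OF j] unfolding v by (simp add: add.assoc)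
	next
	show "~ view (?T n) 7 = 2" unfolding v using unary(2) by simp
	qed
	let ?f = "f + (\<Sum>j<n. conflict i j)"
	let ?h1 = "place_heads h i n ?f"
	let ?ms = "[(7::nat, Lt), (12, Lt), (12, Lt)]"
	have r2: "runs (home 7 ?ms) (st w ?h1) (5 * K + 5) (st w (%j. ?h1 j + int n * off ?ms j))"
	by (rule home_runs) (use unary n_less in \<open>auto simp: ntapes_def vtapes place_heads_def\<close>)
	have e2: "(%j. ?h1 j + int n * off ?ms j) = ?h1(7 := 0, 12 := 0)" by (auto simp: fun_eq_iff place_heads_def)
	have sn: "start 0 <= start n" "start n <= length x"
	proof -
	show "start 0 <= start n" by (simp add: start_def)
	have "length x = n + 1 + n * n + length (concat (map block [0..<n]))" unfolding x_eq length_append by (simp del: length_concat)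
	then show "start n <= length x" by (simp add: start_def)
	qed
	let ?h2 = "?h1(7 := 0, 12 := 0)"
	have r3: "runs (unwind 17 10) (st w ?h2) (4 * K + 1) (st w (?h2(17 := 0, 10 := ?h2 10 - int (start n - start 0))))"
	by (rule runs_unwind) (use sn in \<open>simp_all add: ntapes_def vtapes place_heads_def of_nat_diff\<close>)
	let ?h3 = "?h2(17 := 0, 10 := ?h2 10 - int (start n - start 0))"
	let ?h4 = "?h3(9 := int (start (Suc i)), 18 := ?h3 18 + int (start (Suc i)) - int (start i))"
	have r4: "runs (step_block 9 18) (st w ?h3) (16 * K) (st w ?h4)"
	by (rule step_block_runs[OF i]) (simp_all add: ntapes_def vtapes place_heads_def)
	have r5: "runs (mvs [(11, Rt), (11, Rt), (6, Rt)]) (st w ?h4) 4 (st w (place_heads h (Suc i) 0 ?f))"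
	by (rule runs_mvs_le) (use sn in \<open>auto simp: ntapes_def place_heads_def of_nat_diff\<close>)
	have "runs visit_row (?T 0) (n * Suc (170 * K) + 1 + (5 * K + 5 + (4 * K + 1 + (16 * K + 4)))) (st w (place_heads h (Suc i) 0 ?f))"
	unfolding visit_row_def by (rule runs_Seq[OF r1 runs_Seq[OF r2[unfolded e2] runs_Seq[OF r3 runs_Seq[OF r4 r5]]]])
	moreover have "n * Suc (170 * K) + 1 + (5 * K + 5 + (4 * K + 1 + (16 * K + 4))) <= 220 * (K * K)"
	proof -
	have bound: "a + 1 + (5 * k + 5 + (4 * k + 1 + (16 * k + 4))) <= 220 * c"
		if "a <= k + 170 * c" "k <= c" "1 <= k" for a c k :: nat using that by linarith
	have "n * Suc (170 * K) <= K * Suc (170 * K)" using n_less(1) by (intro mult_le_mono1) simp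
	also have "\<dots> = K + 170 * (K * K)" by (simp add: algebra_simps)
	finally show ?thesis by (rule bound) simp_all
	qed
	ultimately show ?thesis using runs_mono by simp
qed

lemma locate_runs:
	assumes z: "h 6 = 0" "h 7 = 0" "h 8 = 0" "h 9 = 0" "h 10 = 0" "h 11 = 0" "h 12 = 0" "h 15 = 0" "h 17 = 0" "h 18 = 0"
	shows "runs locate (st w h) (40 * (K * K)) (st w (place_heads h 0 0 0))"
proof -
	let ?A = "%k. h(8 := int k, 9 := int k, 10 := int k)"
	let ?ms = "[(8::nat, Rt), (9, Rt), (10, Rt)]"
	have va: "view (st w (?A k)) 8 = wx (int k)" for k by (simp add: view_st look_def ntapes_def vtapes)
	have ma: "runs (mvs ?ms) (st w (?A k)) 4 (st w (?A (Suc k)))" for k by (rule runs_mvs_le) (auto simp: ntapes_def)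
	have r1: "runs (While (%v. v 8 = 2) (mvs ?ms)) (st w (?A 0)) (n * Suc 4 + 1) (st w (?A n))"
	proof (rule runs_While[where T = "%k. st w (?A k)"])
	fix k assume "k < n"
	then show "view (st w (?A k)) 8 = 2 & runs (mvs ?ms) (st w (?A k)) 4 (st w (?A (Suc k)))" unfolding va using ma unary(1) by simp
	next
	show "~ view (st w (?A n)) 8 = 2" unfolding va using unary(2) by simp
	qed
	let ?B = "%i j. h(8 := int (Suc n), 6 := int i, 7 := int j, 9 := int (Suc n + i * n + j), 10 := int (Suc n + i * n + j))"
	let ?mb = "[(7::nat, Rt), (9, Rt), (10, Rt)]"
	have AB: "?A (Suc n) = ?B 0 0" using z by (auto simp: fun_eq_iff)
	have vb: "view (st w (?B i j)) 7 = wx (int j)" "view (st w (?B i j)) 6 = wx (int i)" for i j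
	by (simp_all add: view_st look_def ntapes_def vtapes)
	have row: "runs (While (%v. v 7 = 2) (mvs ?mb) ;; home 7 [(7, Lt)] ;; mvs [(6, Rt)]) (st w (?B i 0))
		(n * Suc 4 + 1 + (5 * K + 5 + 2)) (st w (?B (Suc i) 0))" for i
	proof -
	have 1: "runs (While (%v. v 7 = 2) (mvs ?mb)) (st w (?B i 0)) (n * Suc 4 + 1) (st w (?B i n))"
	proof (rule runs_While[where T = "%j. st w (?B i j)"])
		fix j assume j: "j < n"
		have "runs (mvs ?mb) (st w (?B i j)) 4 (st w (?B i (Suc j)))" by (rule runs_mvs_le) (auto simp: ntapes_def)
		then show "view (st w (?B i j)) 7 = 2 & runs (mvs ?mb) (st w (?B i j)) 4 (st w (?B i (Suc j)))" unfolding vb using unary(1)[OF j] by simp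
	next
		show "~ view (st w (?B i n)) 7 = 2" unfolding vb using unary(2) by simp
	qed
	have 2: "runs (home 7 [(7, Lt)]) (st w (?B i n)) (5 * K + 5) (st w (%j. ?B i n j + int n * off [(7, Lt)] j))"
		by (rule home_runs) (use unary n_less in \<open>auto simp: ntapes_def vtapes\<close>)
	have 3: "runs (mvs [(6, Rt)]) (st w (%j. ?B i n j + int n * off [(7, Lt)] j)) 2 (st w (?B (Suc i) 0))"
		by (rule runs_mvs_le) (auto simp: ntapes_def algebra_simps)
	show ?thesis by (rule runs_Seq[OF 1 runs_Seq[OF 2 3]])
	qed
	have r3: "runs (While (%v. v 6 = 2) (While (%v. v 7 = 2) (mvs ?mb) ;; home 7 [(7, Lt)] ;; mvs [(6, Rt)]))
		(st w (?B 0 0)) (n * Suc (n * Suc 4 + 1 + (5 * K + 5 + 2)) + 1) (st w (?B n 0))"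
	proof (rule runs_While[where T = "%i. st w (?B i 0)"])
	fix i assume "i < n"
	then show "view (st w (?B i 0)) 6 = 2 & runs (While (%v. v 7 = 2) (mvs ?mb) ;; home 7 [(7, Lt)] ;; mvs [(6, Rt)]) (st w (?B i 0))
		(n * Suc 4 + 1 + (5 * K + 5 + 2)) (st w (?B (Suc i) 0))" unfolding vb using row unary(1) by blast
	next
	show "~ view (st w (?B n 0)) 6 = 2" unfolding vb using unary(2) by simp
	qed
	have r4: "runs (home 6 [(6, Lt)]) (st w (?B n 0)) (5 * K + 5) (st w (%j. ?B n 0 j + int n * off [(6, Lt)] j))"
	by (rule home_runs) (use unary n_less in \<open>auto simp: ntapes_def vtapes\<close>)
	have e: "(%j. ?B n 0 j + int n * off [(6, Lt)] j) = place_heads h 0 0 0" using z by (auto simp: fun_eq_iff place_heads_def start_def)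
	have A0: "?A 0 = h" using z by (auto simp: fun_eq_iff)
	have "runs locate (st w (?A 0)) (n * Suc 4 + 1 + (4 + (n * Suc (n * Suc 4 + 1 + (5 * K + 5 + 2)) + 1 + (5 * K + 5)))) (st w (place_heads h 0 0 0))"
	unfolding locate_def by (rule runs_Seq[OF r1 runs_Seq[OF ma[of n, unfolded AB] runs_Seq[OF r3 r4[unfolded e]]]])
	moreover have "n * Suc 4 + 1 + (4 + (n * Suc (n * Suc 4 + 1 + (5 * K + 5 + 2)) + 1 + (5 * K + 5))) <= 40 * (K * K)"
	proof -
	have bound: "m * Suc 4 + 1 + (4 + (a + 1 + (5 * k + 5))) <= 40 * c"
		if "a <= 10 * c + 9 * k" "k <= c" "1 <= k" "m <= k" for a c k m :: nat using that by simp
	have "n * Suc (n * Suc 4 + 1 + (5 * K + 5 + 2)) <= K * (10 * K + 9)" using n_less(1) by (intro mult_le_mono) simp_all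
	also have "\<dots> = 10 * (K * K) + 9 * K" by (simp add: algebra_simps)
	finally show ?thesis by (rule bound) (use n_less(1) in simp_all)
	qed
	ultimately show ?thesis unfolding A0 using runs_mono by blast
qed

lemma verify_runs:
	assumes z: "h 6 = 0" "h 7 = 0" "h 8 = 0" "h 9 = 0" "h 10 = 0" "h 11 = 0" "h 12 = 0" "h 15 = 0" "h 17 = 0" "h 18 = 0"
	shows "runs verify (st w h) (300 * K ^ 3) (st w (place_heads h n 0 (\<Sum>i<n. \<Sum>j<n. conflict i j)))"
proof -
	let ?T = "%i. st w (place_heads h i 0 (\<Sum>k<i. \<Sum>j<n. conflict k j))"
	have v: "view (?T i) 6 = wx (int i)" for i by (simp add: view_st look_def ntapes_def vtapes place_heads_def)
	have r: "runs (While (%v. v 6 = 2) visit_row) (?T 0) (n * Suc (220 * (K * K)) + 1) (?T n)"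
	proof (rule runs_While[where T = ?T])
	fix i assume i: "i < n"
	show "view (?T i) 6 = 2 & runs visit_row (?T i) (220 * (K * K)) (?T (Suc i))"
		using visit_row_runs[OF i, of "\<Sum>k<i. \<Sum>j<n. conflict k j"] unary(1)[OF i] unfolding v by simp
	next
	show "~ view (?T n) 6 = 2" unfolding v using unary(2) by simp
	qed
	have T0: "?T 0 = st w (place_heads h 0 0 0)" by simp
	have "runs verify (st w h) (40 * (K * K) + (n * Suc (220 * (K * K)) + 1)) (?T n)"
	unfolding verify_def by (rule runs_Seq[OF locate_runs[OF z] r[unfolded T0]])
	moreover have "40 * (K * K) + (n * Suc (220 * (K * K)) + 1) <= 300 * K ^ 3"
	proof -
	have "n * Suc (220 * (K * K)) <= K * Suc (220 * (K * K))" using n_less(1) by (intro mult_le_mono1) simp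
	moreover have "K * Suc (220 * (K * K)) = 220 * (K * (K * K)) + K" by (simp add: algebra_simps)
	moreover have "K * K <= K * (K * K)" "K <= K * K" "1 <= K" by simp_all
	ultimately have "40 * (K * K) + (n * Suc (220 * (K * K)) + 1) <= 300 * (K * (K * K))" by linarith
	then show ?thesis by (simp only: power3_eq_cube mult.assoc)
	qed
	ultimately show ?thesis using runs_mono by blast
qed

end

end

section \<open>A planar drawing of the lattice\<close>

text \<open>The gadget is drawn with straight segments inside the lens \<open>\<bar>Y\<bar> <= X * (1 - X)\<close>, with its
	ends at \<open>(0, 0)\<close> and \<open>(1, 0)\<close>; the copies are then bent into disjoint thin lenses.\<close>

definition pt :: "nat => real \<times> real" where
	"pt k = (case gadget_points ! k of (x, y) => (real_of_int x / 4000, real_of_int y / 4000))"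

definition lens :: "(real \<times> real) set" where
	"lens = {(X, Y). 0 <= X & X <= 1 & \<bar>Y\<bar> <= X * (1 - X)}"

text \<open>Concavity of \<open>X * (1 - X)\<close>; the gain at a convex combination is exactly
  \<open>u * v * (X - X')^2\<close>.\<close>

lemma convex_lens: "convex lens"
proof (rule convexI)
	fix p q :: "real \<times> real" and u v :: real
	assume p: "p : lens" and q: "q : lens" and uv: "0 <= u" "0 <= v" "u + v = 1"
	obtain X Y X' Y' where pq: "p = (X, Y)" "q = (X', Y')" by (metis surj_pair)
	have c: "0 <= X" "X <= 1" "\<bar>Y\<bar> <= X * (1 - X)" "0 <= X'" "X' <= 1" "\<bar>Y'\<bar> <= X' * (1 - X')" using p q pq by (auto simp: lens_def)
	have v: "v = 1 - u" using uv by simp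
	have "\<bar>u * Y + v * Y'\<bar> <= u * \<bar>Y\<bar> + v * \<bar>Y'\<bar>" using uv by (metis abs_mult abs_of_nonneg abs_triangle_ineq)
	also have "\<dots> <= u * (X * (1 - X)) + v * (X' * (1 - X'))" using c uv by (intro add_mono mult_left_mono) auto
	also have "\<dots> <= (u * X + v * X') * (1 - (u * X + v * X'))"
	proof -
	have "(u * X + v * X') * (1 - (u * X + v * X')) - (u * (X * (1 - X)) + v * (X' * (1 - X'))) = u * v * (X - X')\<^sup>2"
		unfolding v by (simp add: power2_eq_square algebra_simps)
	moreover have "0 <= u * v * (X - X')\<^sup>2" using uv by simp
	ultimately show ?thesis by linarith
	qed
	finally have "\<bar>u * Y + v * Y'\<bar> <= (u * X + v * X') * (1 - (u * X + v * X'))" .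
	moreover have "0 <= u * X + v * X'" using c uv by simp
	moreover have "u * X + v * X' <= 1" using c uv convex_bound_le[of X 1 X' u v] by simp
	ultimately show "u *\<^sub>R p + v *\<^sub>R q : lens" by (simp add: pq lens_def)
qed

lemma gadget_points_lens:
	"list_all (%(x, y). 0 < x & x < 4000 & 4000 * \<bar>y\<bar> <= x * (4000 - x)) (take 56 gadget_points)"
	"length gadget_points = 58" "gadget_points ! 56 = (0, 0)" "gadget_points ! 57 = (4000, 0)" by (simp_all add: gadget_points_def)

lemma pt_56: "pt 56 = (0, 0)" and pt_57: "pt 57 = (1, 0)" by (simp_all add: pt_def gadget_points_lens)

lemma pt_inner:
	assumes "k < 56"
	shows "0 < fst (pt k)" "fst (pt k) < 1" "pt k : lens"
proof -
	obtain x y where xy: "gadget_points ! k = (x, y)" by (metis surj_pair)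
	have "take 56 gadget_points ! k : set (take 56 gadget_points)" using assms gadget_points_lens(2) by (intro nth_mem) simp
	then have "(x, y) : set (take 56 gadget_points)" using assms xy by simp
	then have *: "0 < x" "x < 4000" "4000 * \<bar>y\<bar> <= x * (4000 - x)" using gadget_points_lens(1) by (auto simp: list_all_iff)
	have "4000 * \<bar>real_of_int y\<bar> <= real_of_int x * (4000 - real_of_int x)"
	using *(3) by (metis (mono_tags, opaque_lifting) of_int_abs of_int_diff of_int_le_iff of_int_mult of_int_numeral)
	then have "\<bar>real_of_int y / 4000\<bar> <= real_of_int x / 4000 * (1 - real_of_int x / 4000)" by (simp add: field_simps)
	moreover have "0 < real_of_int x" "real_of_int x < 4000" using * by auto
	ultimately show "0 < fst (pt k)" "fst (pt k) < 1" "pt k : lens" using xy by (auto simp: pt_def lens_def)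
qed

lemma pt_lens: "k < 58 ==> pt k : lens"
proof -
	assume "k < 58"
	then consider "k < 56" | "k = 56" | "k = 57" by linarith
	then show ?thesis
	proof cases
	case 1 then show ?thesis by (rule pt_inner(3))
	qed (simp_all add: pt_56 pt_57 lens_def)
qed

lemma gadget_seg_points:
	"list_all (%(i, j, x1, y1, x2, y2). gadget_points ! i = (x1, y1) & gadget_points ! j = (x2, y2)) gadget_segs"
	by (simp add: gadget_segs_def gadget_points_def)

lemma gadget_seg_pairs:
	"list_all (%(k, l). (k, l) : set (map (%(i, j, _). (i, j)) gadget_segs) |
	 (l, k) : set (map (%(i, j, _). (i, j)) gadget_segs)) gadget_edges"
	by (simp add: gadget_segs_def gadget_edges_def inner_edges_def left_ends_def right_ends_def)

lemma gadget_segs_edges: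
	assumes "(k, l) : set gadget_edges"
	obtains i j x1 y1 x2 y2 where "(i, j, x1, y1, x2, y2) : set gadget_segs" "i = k & j = l | i = l & j = k"
	"(x1, y1) = gadget_points ! i" "(x2, y2) = gadget_points ! j"
proof -
	obtain i j x1 y1 x2 y2 where "(i, j, x1, y1, x2, y2) : set gadget_segs" "i = k & j = l | i = l & j = k"
	using gadget_seg_pairs assms by (auto simp: list_all_iff)
	moreover from this(1) have "(x1, y1) = gadget_points ! i" "(x2, y2) = gadget_points ! j" using gadget_seg_points by (auto simp: list_all_iff)
	ultimately show thesis using that by metis
qed

lemma distinct_gadget_points: "distinct gadget_points" by (simp add: gadget_points_def)

lemma pt_inj:
	assumes "k < 58" "l < 58" "pt k = pt l"
	shows "k = l"
proof -
	obtain x y x' y' where p: "gadget_points ! k = (x, y)" "gadget_points ! l = (x', y')" by (metis surj_pair)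
	have "gadget_points ! k = gadget_points ! l" using assms(3) p by (simp add: pt_def)
	then show ?thesis using nth_eq_iff_index_eq[OF distinct_gadget_points] assms(1,2) gadget_points_lens(2) by simp
qed

text \<open>No inner vertex is isolated. A vertex on a foreign edge would thus be a common point of
  two edges, so the test of pairs of segments also keeps vertices off edges.\<close>

lemma gadget_edge_at:
	assumes "m < 56"
	obtains k l where "(k, l) : set gadget_edges" "m : {k, l}"
proof -
	have "list_all (%m. m : set (map fst gadget_edges @ map snd gadget_edges)) [0,1,2,3,4,5,6,7,8,9,10,11,12,13,14,15,16,17,18,19,20,21,22,23,24,25,26,27,28,29,30,31,32,33,34,35,36,37,38,39,40,41,42,43,44,45,46,47,48,49,50,51,52,53,54,55::nat]"
	by (simp add: gadget_edges_def inner_edges_def left_ends_def right_ends_def)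
	moreover have "m : set [0,1,2,3,4,5,6,7,8,9,10,11,12,13,14,15,16,17,18,19,20,21,22,23,24,25,26,27,28,29,30,31,32,33,34,35,36,37,38,39,40,41,42,43,44,45,46,47,48,49,50,51,52,53,54,55]" using assms unfolding upt56[symmetric] by simp
	ultimately have "m : set (map fst gadget_edges @ map snd gadget_edges)" by (simp only: list_all_iff)
	then show thesis using that by auto
qed

lemma gadget_segs_oriented: "list_all (%(i, j, x1, y1, x2, y2). x1 <= x2) gadget_segs" by (simp add: gadget_segs_def)

definition cross :: "real \<times> real => real \<times> real => real \<times> real => real" where
	"cross p q r = (fst q - fst p) * (snd r - snd p) - (snd q - snd p) * (fst r - fst p)"

lemma cross_segment:
	assumes "z : closed_segment a b"
	obtains t where "0 <= t" "t <= 1" "z = (1 - t) *\<^sub>R a + t *\<^sub>R b"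
	"\<And>p q. cross p q z = (1 - t) * cross p q a + t * cross p q b"
proof -
	obtain t where t: "0 <= t" "t <= 1" "z = (1 - t) *\<^sub>R a + t *\<^sub>R b" using assms by (auto simp: closed_segment_def)
	have "cross p q z = (1 - t) * cross p q a + t * cross p q b" for p q unfolding t(3) cross_def by (simp add: algebra_simps)
	with t show thesis using that by blast
qed

lemma cross_on_segment: "z : closed_segment a b ==> cross a b z = 0"
proof -
	assume "z : closed_segment a b"
	then obtain t where "cross a b z = (1 - t) * cross a b a + t * cross a b b" using cross_segment by metis
	moreover have "cross a b a = 0" "cross a b b = 0" by (simp_all add: cross_def)
	ultimately show ?thesis by simp
qed

text \<open>Along the second segment \<open>cross a b\<close> is an affine function with the same
  sign at both ends, so it has no zero there, while it vanishes on the first segment.\<close>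

lemma segments_separated:
	assumes "cross a b c * cross a b d > 0"
	shows "closed_segment a b \<inter> closed_segment c d = {}"
proof (rule ccontr)
	assume "closed_segment a b \<inter> closed_segment c d ~= {}"
	then obtain z where z: "z : closed_segment a b" "z : closed_segment c d" by auto
	obtain t where t: "0 <= t" "t <= 1" "cross a b z = (1 - t) * cross a b c + t * cross a b d" using cross_segment[OF z(2)] by metis
	have 0: "(1 - t) * cross a b c + t * cross a b d = 0" using cross_on_segment[OF z(1)] t by simp
	consider "cross a b c > 0" "cross a b d > 0" | "cross a b c < 0" "cross a b d < 0" using assms by (auto simp: zero_less_mult_iff)
	then show False
	proof cases
	case 1
	then have "(1 - t) * (- cross a b c) + t * (- cross a b d) < 0" using t(1,2) by (intro convex_bound_lt) auto
	moreover have "(1 - t) * (- cross a b c) + t * (- cross a b d) = - ((1 - t) * cross a b c + t * cross a b d)" by (simp add: algebra_simps)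
	ultimately show False using 0 by simp
	next
	case 2
	then have "(1 - t) * cross a b c + t * cross a b d < 0" using t(1,2) by (intro convex_bound_lt) auto
	then show False using 0 by simp
	qed
qed

lemma segments_share:
	assumes "cross a b c ~= 0"
	shows "closed_segment a b \<inter> closed_segment a c = {a}"
proof -
	have "z = a" if z: "z : closed_segment a b" "z : closed_segment a c" for z
	proof -
	obtain t where t: "z = (1 - t) *\<^sub>R a + t *\<^sub>R c" "cross a b z = (1 - t) * cross a b a + t * cross a b c"
		using cross_segment[OF z(2)] by metis
	have "cross a b a = 0" by (simp add: cross_def)
	with t(2) cross_on_segment[OF z(1)] assms have "t = 0" by simp
	with t(1) show ?thesis by simp
	qed
	then show ?thesis by auto
qed

lemma segment_x:
	fixes z a b :: "real \<times> real"
	assumes "z : closed_segment a b" "fst a <= fst b"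
	shows "fst a <= fst z" "fst z <= fst b"
proof -
	obtain t where t: "0 <= t" "t <= 1" "z = (1 - t) *\<^sub>R a + t *\<^sub>R b" using assms by (auto simp: closed_segment_def)
	have z: "fst z = fst a + t * (fst b - fst a)" unfolding t(3) by (simp add: algebra_simps)
	have "0 <= t * (fst b - fst a)" using t assms by simp
	moreover have "t * (fst b - fst a) <= fst b - fst a" using t assms mult_right_mono[of t 1 "fst b - fst a"] by simp
	ultimately show "fst a <= fst z" "fst z <= fst b" using z by auto
qed

definition seg_at :: "seg => bool" where
	"seg_at = (%(i, j, x1, y1, x2, y2). (x1, y1) = gadget_points ! i & (x2, y2) = gadget_points ! j & x1 <= x2)"

lemma cross_orient:
	assumes "(x1, y1) = gadget_points ! i" "(x2, y2) = gadget_points ! j" "(x3, y3) = gadget_points ! k"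
	shows "cross (pt i) (pt j) (pt k) = real_of_int (orient x1 y1 x2 y2 x3 y3) / 16000000"
	by (simp add: cross_def pt_def orient_def assms[symmetric] field_simps)

lemma seg_cases:
	"(if p then True else if q1 then a & z1 else if q2 then b & z2 else if q3 then c else if q4 then d else e | f) ==>
	 p | (q1 & a) | (q2 & b) | (q3 & c) | (q4 & d) | e | f" by (auto split: if_splits)

lemma seg_ok_intersection:
	assumes "seg_at (i, j, x1, y1, x2, y2)" "seg_at (k, l, x3, y3, x4, y4)"
	"seg_ok (i, j, x1, y1, x2, y2) (k, l, x3, y3, x4, y4)"
	shows "closed_segment (pt i) (pt j) \<inter> closed_segment (pt k) (pt l) \<subseteq> pt ` ({i, j} \<inter> {k, l})"
proof -
	have p: "(x1, y1) = gadget_points ! i" "(x2, y2) = gadget_points ! j" "(x3, y3) = gadget_points ! k" "(x4, y4) = gadget_points ! l"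
	using assms by (auto simp: seg_at_def)
	note co = cross_orient[OF p(1) p(2) p(3)] cross_orient[OF p(1) p(2) p(4)]
	 cross_orient[OF p(3) p(4) p(1)] cross_orient[OF p(3) p(4) p(2)]
	have "x2 < x3 | (i = k & orient x1 y1 x2 y2 x4 y4 ~= 0) | (i = l & orient x1 y1 x2 y2 x3 y3 ~= 0)
	| (j = k & orient x1 y1 x2 y2 x4 y4 ~= 0) | (j = l & orient x1 y1 x2 y2 x3 y3 ~= 0)
	| orient x1 y1 x2 y2 x3 y3 * orient x1 y1 x2 y2 x4 y4 > 0
	| orient x3 y3 x4 y4 x1 y1 * orient x3 y3 x4 y4 x2 y2 > 0" using seg_cases[OF assms(3)[unfolded seg_ok.simps]] by blast
	then consider "x2 < x3" | "i = k" "orient x1 y1 x2 y2 x4 y4 ~= 0" | "i = l" "orient x1 y1 x2 y2 x3 y3 ~= 0"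
	| "j = k" "orient x1 y1 x2 y2 x4 y4 ~= 0" | "j = l" "orient x1 y1 x2 y2 x3 y3 ~= 0"
	| "orient x1 y1 x2 y2 x3 y3 * orient x1 y1 x2 y2 x4 y4 > 0"
	| "orient x3 y3 x4 y4 x1 y1 * orient x3 y3 x4 y4 x2 y2 > 0" by blast
	then show ?thesis
	proof cases
	case 1
	have x: "fst (pt i) = real_of_int x1 / 4000" "fst (pt j) = real_of_int x2 / 4000"
		"fst (pt k) = real_of_int x3 / 4000" "fst (pt l) = real_of_int x4 / 4000" by (simp_all add: pt_def p[symmetric])
	have le: "fst (pt i) <= fst (pt j)" "fst (pt k) <= fst (pt l)" "fst (pt j) < fst (pt k)" using assms(1,2) 1 unfolding x by (auto simp: seg_at_def)
	have False if "z : closed_segment (pt i) (pt j)" "z : closed_segment (pt k) (pt l)" for z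
		using segment_x(2)[OF that(1) le(1)] segment_x(1)[OF that(2) le(2)] le(3) by linarith
	then show ?thesis by blast
	next
	case 2
	then have "cross (pt i) (pt j) (pt l) ~= 0" using co by simp
	from segments_share[OF this] have "closed_segment (pt i) (pt j) \<inter> closed_segment (pt k) (pt l) = {pt i}" unfolding 2(1) .
	moreover have "i : {i, j} \<inter> {k, l}" using 2(1) by blast
	ultimately show ?thesis by blast
	next
	case 3
	then have "cross (pt i) (pt j) (pt k) ~= 0" using co by simp
	from segments_share[OF this] have "closed_segment (pt i) (pt j) \<inter> closed_segment (pt k) (pt l) = {pt i}"
		unfolding 3(1) closed_segment_commute[of "pt k" "pt l"] .
	moreover have "i : {i, j} \<inter> {k, l}" using 3(1) by blast
	ultimately show ?thesis by blast
	next
	case 4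
	have "cross (pt j) (pt i) (pt l) = - cross (pt i) (pt j) (pt l)" by (simp add: cross_def algebra_simps)
	then have "cross (pt j) (pt i) (pt l) ~= 0" using co 4 by simp
	from segments_share[OF this] have "closed_segment (pt i) (pt j) \<inter> closed_segment (pt k) (pt l) = {pt j}"
		unfolding 4(1) closed_segment_commute[of "pt i" "pt k"] .
	moreover have "j : {i, j} \<inter> {k, l}" using 4(1) by blast
	ultimately show ?thesis by blast
	next
	case 5
	have "cross (pt j) (pt i) (pt k) = - cross (pt i) (pt j) (pt k)" by (simp add: cross_def algebra_simps)
	then have "cross (pt j) (pt i) (pt k) ~= 0" using co 5 by simp
	from segments_share[OF this] have "closed_segment (pt i) (pt j) \<inter> closed_segment (pt k) (pt l) = {pt j}"
		unfolding 5(1) closed_segment_commute[of "pt i" "pt l"] closed_segment_commute[of "pt k" "pt l"] .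
	moreover have "j : {i, j} \<inter> {k, l}" using 5(1) by blast
	ultimately show ?thesis by blast
	next
	case 6
	then have "cross (pt i) (pt j) (pt k) * cross (pt i) (pt j) (pt l) > 0" unfolding co by (simp add: zero_less_mult_iff)
	from segments_separated[OF this] show ?thesis by blast
	next
	case 7
	then have "cross (pt k) (pt l) (pt i) * cross (pt k) (pt l) (pt j) > 0" unfolding co by (simp add: zero_less_mult_iff)
	from segments_separated[OF this] show ?thesis by blast
	qed
qed

lemma pairs_ok_nth: "pairs_ok ss ==> a < b ==> b < length ss ==> seg_ok (ss ! a) (ss ! b)"
proof (induction ss arbitrary: a b)
	case (Cons s ss)
	then show ?case by (cases a; cases b) (auto simp: list_all_iff)
qed simp

lemma gadget_edge_seg:
	assumes "(k, l) : set gadget_edges"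
	obtains a i j x1 y1 x2 y2 where "a < length gadget_segs" "gadget_segs ! a = (i, j, x1, y1, x2, y2)"
	"{i, j} = {k, l}" "seg_at (gadget_segs ! a)"
proof -
	obtain i j x1 y1 x2 y2 where *: "(i, j, x1, y1, x2, y2) : set gadget_segs" "i = k & j = l | i = l & j = k"
	"(x1, y1) = gadget_points ! i" "(x2, y2) = gadget_points ! j" by (rule gadget_segs_edges[OF assms])
	have "x1 <= x2" using gadget_segs_oriented *(1) by (auto simp: list_all_iff)
	then have "seg_at (i, j, x1, y1, x2, y2)" using *(3,4) unfolding seg_at_def prod.case by blast
	moreover obtain a where a: "a < length gadget_segs" "gadget_segs ! a = (i, j, x1, y1, x2, y2)" using *(1) by (metis in_set_conv_nth)
	moreover have "{i, j} = {k, l}" using *(2) by auto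
	ultimately show thesis using that[OF a] by simp
qed

lemma gadget_segment_intersection:
	assumes "(k, l) : set gadget_edges" "(m, n) : set gadget_edges" "{k, l} ~= {m, n}"
	shows "closed_segment (pt k) (pt l) \<inter> closed_segment (pt m) (pt n) \<subseteq> pt ` ({k, l} \<inter> {m, n})"
proof -
	obtain a i j x1 y1 x2 y2 where 1: "a < length gadget_segs" "gadget_segs ! a = (i, j, x1, y1, x2, y2)"
	"{i, j} = {k, l}" "seg_at (gadget_segs ! a)" by (rule gadget_edge_seg[OF assms(1)])
	obtain b i' j' x1' y1' x2' y2' where 2: "b < length gadget_segs" "gadget_segs ! b = (i', j', x1', y1', x2', y2')"
	"{i', j'} = {m, n}" "seg_at (gadget_segs ! b)" by (rule gadget_edge_seg[OF assms(2)])
	have cs: "closed_segment (pt k) (pt l) = closed_segment (pt i) (pt j)"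
	"closed_segment (pt m) (pt n) = closed_segment (pt i') (pt j')" using 1(3) 2(3) closed_segment_commute by (auto simp: doubleton_eq_iff)
	have "a ~= b" using 1(2,3) 2(2,3) assms(3) by auto
	then consider "a < b" | "b < a" by linarith
	then have "closed_segment (pt i) (pt j) \<inter> closed_segment (pt i') (pt j') \<subseteq> pt ` ({i, j} \<inter> {i', j'})"
	proof cases
	assume "a < b"
	from pairs_ok_nth[OF gadget_segs_ok this 2(1)]
	show ?thesis using seg_ok_intersection[OF 1(4)[unfolded 1(2)] 2(4)[unfolded 2(2)]] unfolding 1(2) 2(2) by blast
	next
	assume "b < a"
	from pairs_ok_nth[OF gadget_segs_ok this 1(1)]
	show ?thesis using seg_ok_intersection[OF 2(4)[unfolded 2(2)] 1(4)[unfolded 1(2)]] unfolding 1(2) 2(2) by blast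
	qed
	then show ?thesis unfolding cs 1(3)[symmetric] 2(3)[symmetric] .
qed

text \<open>The nine copies between two sites follow the parabolas
  \<open>c * X * (1 - X) / 10\<close> for c from -4 to 4, each in a lens of half-width
  \<open>X * (1 - X) / 100\<close>; the spacing exceeds the full width. Rows are drawn
  downwards.\<close>

fun bend :: "gadget => real \<times> real => real \<times> real" where
	"bend (y, x, e) (X, Y) =
	 (if e < 9 then (real x + X, X * (1 - X) * (real e - 4) / 10 + Y / 100 - real y)
		else (real x + (X * (1 - X) * (real e - 13) / 10 + Y / 100), - real y - X))"

definition place :: "nat \<times> nat => real \<times> real" where
	"place = (%(y, x). (real x, - real y))"

lemma place_inj: "place p = place q ==> p = q" by (cases p; cases q) (simp add: place_def)

lemma bend_ends: "bend (y, x, e) (0, 0) = place (y, x)" "bend g (1, 0) = place (target g)" by (simp_all add: place_def) (cases g; simp)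

lemma continuous_bend: "continuous_on A (bend g)"
proof -
	obtain y x e where g: "g = (y, x, e)" by (metis prod_cases3)
	have b: "bend g = (%p. if e < 9 then (real x + fst p, fst p * (1 - fst p) * (real e - 4) / 10 + snd p / 100 - real y)
		else (real x + (fst p * (1 - fst p) * (real e - 13) / 10 + snd p / 100), - real y - fst p))" by (auto simp: g fun_eq_iff)
	show ?thesis unfolding b by (cases "e < 9") (auto intro!: continuous_intros)
qed

text \<open>In total the deviation is at most \<open>41 / 100\<close> of \<open>X * (1 - X)\<close>.
  The copies along a side of the grid thus stay inside a diamond with that side as its diagonal, and
  diamonds of different sides do not overlap.\<close>

lemma offset_bound:
	fixes X Y c :: real
	assumes "0 < X" "X < 1" "\<bar>Y\<bar> <= X * (1 - X)" "\<bar>c\<bar> <= 4"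
	shows "\<bar>X * (1 - X) * c / 10 + Y / 100\<bar> < min X (1 - X)" "\<bar>X * (1 - X) * c / 10 + Y / 100\<bar> < 1 / 2"
proof -
	let ?w = "X * (1 - X)"
	have w: "0 < ?w" using assms by simp
	have "\<bar>?w * c\<bar> = ?w * \<bar>c\<bar>" by (subst abs_mult) (simp only: abs_of_pos[OF w])
	also have "\<dots> <= ?w * 4" using w assms(4) by (intro mult_left_mono) auto
	finally have "\<bar>?w * c\<bar> <= ?w * 4" .
	then have "\<bar>?w * c / 10 + Y / 100\<bar> <= ?w * 41 / 100" using assms(3) by (auto simp: abs_le_iff field_simps)
	moreover have "?w <= X" "?w <= 1 - X" using assms by (auto simp: mult_left_le mult_left_le_one_le)
	ultimately show "\<bar>?w * c / 10 + Y / 100\<bar> < min X (1 - X)" using w by linarith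
	then show "\<bar>?w * c / 10 + Y / 100\<bar> < 1 / 2" by linarith
qed

lemma int_offset:
	fixes a b :: nat and s t :: real
	assumes "real a + s = real b + t" "\<bar>s - t\<bar> < 1"
	shows "a = b" "s = t"
proof -
	have "\<bar>real a - real b\<bar> < 1" using assms by linarith
	then show "a = b" by linarith
	with assms(1) show "s = t" by simp
qed

text \<open>For two copies of the same direction, the integer parts are recovered first, since the
  remainders differ by less than 1; then \<open>same\<close> separates the copies. A horizontal and
  a vertical copy are kept apart by their diamonds.\<close>

lemma bend_inj:
	assumes "g : gadgets S" "g' : gadgets S" "z : lens" "z' : lens" "0 < fst z" "fst z < 1" "0 < fst z'" "fst z' < 1"
	and eq: "bend g z = bend g' z'"
	shows "g = g' & z = z'"
proof -
	obtain y x e y' x' e' X Y X' Y' where g: "g = (y, x, e)" "g' = (y', x', e')" "z = (X, Y)" "z' = (X', Y')" by (metis prod_cases3 surj_pair)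
	have X: "0 < X" "X < 1" "0 < X'" "X' < 1" "\<bar>Y\<bar> <= X * (1 - X)" "\<bar>Y'\<bar> <= X' * (1 - X')" "e < 18" "e' < 18"
	using assms g by (auto simp: lens_def gadgets_def)
	define c where "c = (if e < 9 then real e - 4 else real e - 13)"
	define c' where "c' = (if e' < 9 then real e' - 4 else real e' - 13)"
	have c: "\<bar>c\<bar> <= 4" "\<bar>c'\<bar> <= 4" using X by (auto simp: c_def c'_def abs_le_iff)
	define h where "h = X * (1 - X) * c / 10 + Y / 100"
	define h' where "h' = X' * (1 - X') * c' / 10 + Y' / 100"
	have h: "\<bar>h\<bar> < min X (1 - X)" "\<bar>h\<bar> < 1 / 2" "\<bar>h'\<bar> < min X' (1 - X')" "\<bar>h'\<bar> < 1 / 2"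
	unfolding h_def h'_def using offset_bound X c by auto
	have hb: "- X < h" "h < X" "X - 1 < h" "h < 1 - X" "- (1 / 2) < h" "h < 1 / 2"
	"- X' < h'" "h' < X'" "X' - 1 < h'" "h' < 1 - X'" "- (1 / 2) < h'" "h' < 1 / 2" using h by (auto simp: abs_less_iff)
	\<comment> \<open>At equal \<open>X\<close>, different centre lines are at least
	  \<open>X * (1 - X) / 10\<close> apart, whereas the terms in \<open>Y\<close> differ by at most
	  \<open>X * (1 - X) / 50\<close>.\<close>
	have same: "c = c' & Y = Y'" if "X = X'" "h = h'"
	proof -
	have w: "0 < X * (1 - X)" using X by simp
	have d: "X * (1 - X) * (c - c') * 10 = Y' - Y" using that unfolding h_def h'_def by (simp add: field_simps)
	have "\<bar>Y' - Y\<bar> <= X * (1 - X) * 2" using X that by auto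
	then have "X * (1 - X) * (10 * \<bar>c - c'\<bar>) <= X * (1 - X) * 2"
		using d w by (metis abs_mult abs_of_pos abs_numeral mult.assoc mult.commute zero_less_numeral)
	then have le: "10 * \<bar>c - c'\<bar> <= 2" using w by (simp only: mult_le_cancel_left_pos)
	have diff: "c = c' | 1 <= \<bar>c - c'\<bar>"
	proof -
		define m m' :: int where "m = (if e < 9 then int e - 4 else int e - 13)"
			and "m' = (if e' < 9 then int e' - 4 else int e' - 13)"
		have cm: "c = of_int m" "c' = of_int m'" by (simp_all add: c_def c'_def m_def m'_def)
		show ?thesis
		proof (cases "m = m'")
			case False
			then have "1 <= \<bar>m - m'\<bar>" by linarith
			then have "real_of_int 1 <= real_of_int \<bar>m - m'\<bar>" by (simp only: of_int_le_iff)
			then show ?thesis unfolding cm by simp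
		qed (simp add: cm)
	qed
	have "c = c'"
	proof (rule ccontr)
		assume "c ~= c'"
		with diff have "1 <= \<bar>c - c'\<bar>" by blast
		then have "(10::real) * 1 <= 10 * \<bar>c - c'\<bar>" by (intro mult_left_mono) simp_all
		from order_trans[OF this le] show False by simp
	qed
	with d show ?thesis by simp
	qed
	consider "e < 9" "e' < 9" | "~ e < 9" "~ e' < 9" | "e < 9" "~ e' < 9" | "~ e < 9" "e' < 9" by blast
	then show ?thesis
	proof cases
	case 1
	then have "real x + X = real x' + X'" "real y' + h = real y + h'" using eq g by (auto simp: h_def h'_def c_def c'_def)
	note eqs = this
	have "\<bar>X - X'\<bar> < 1" "\<bar>h - h'\<bar> < 1" using X(1-4) hb by (auto simp: abs_less_iff)
	then have "x = x'" "X = X'" "y' = y" "h = h'" using int_offset[OF eqs(1)] int_offset[OF eqs(2)] by blast+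
	with same 1 g show ?thesis by (auto simp: c_def c'_def)
	next
	case 2
	then have "real x + h = real x' + h'" "real y + X = real y' + X'" using eq g by (auto simp: h_def h'_def c_def c'_def)
	note eqs = this
	have "\<bar>X - X'\<bar> < 1" "\<bar>h - h'\<bar> < 1" using X(1-4) hb by (auto simp: abs_less_iff)
	then have "x = x'" "X = X'" "y = y'" "h = h'" using int_offset[OF eqs(1)] int_offset[OF eqs(2)] by blast+
	with same 2 X(7,8) g show ?thesis by (auto simp: c_def c'_def)
	next
	case 3
	then have *: "real x + X = real x' + h'" "real y' + X' + h = real y" using eq g by (auto simp: h_def h'_def c_def c'_def)
	have "x' = x | x' = Suc x" using *(1) X(1-4) hb(5-6,11-12) by linarith
	moreover have "y = y' | y = Suc y'" using *(2) X(1-4) hb(5-6,11-12) by linarith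
	ultimately have "real x' = real x | real x' = real x + 1" "real y = real y' | real y = real y' + 1" by auto
	then have False using * X(1-4) hb by (elim disjE) linarith+
	then show ?thesis ..
	next
	case 4
	then have *: "real x' + X' = real x + h" "real y + X + h' = real y'" using eq g by (auto simp: h_def h'_def c_def c'_def)
	have "x = x' | x = Suc x'" using *(1) X(1-4) hb(5-6,11-12) by linarith
	moreover have "y' = y | y' = Suc y" using *(2) X(1-4) hb(5-6,11-12) by linarith
	ultimately have "real x = real x' | real x = real x' + 1" "real y' = real y | real y' = real y + 1" by auto
	then have False using * X(1-4) hb by (elim disjE) linarith+
	then show ?thesis ..
	qed
qed

lemma bend_not_place:
	assumes "g : gadgets S" "z : lens" "0 < fst z" "fst z < 1"
	shows "bend g z ~= place p"
proof
	assume eq: "bend g z = place p"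
	obtain y x e X Y py px where g: "g = (y, x, e)" "z = (X, Y)" "p = (py, px)" by (metis prod_cases3 surj_pair)
	have X: "0 < X" "X < 1" using assms g by auto
	have "if e < 9 then real x + X = real px else - real y - X = - real py" using eq unfolding g by (cases "e < 9") (simp_all add: place_def)
	then have "real x + X = real px | real y + X = real py" by (cases "e < 9") (simp_all add: algebra_simps)
	then show False
	proof
	assume "real x + X = real px" then show False using int_offset(2)[of x X px 0] X by simp
	next
	assume "real y + X = real py" then show False using int_offset(2)[of y X py 0] X by simp
	qed
qed

lemma lens_ends: "z : lens ==> fst z = 0 ==> z = (0, 0)" "z : lens ==> fst z = 1 ==> z = (1, 0)" by (auto simp: lens_def)

lemma bend_hub:
	assumes "z : lens" "~ (0 < fst z & fst z < 1)"
	shows "z = (0, 0) | z = (1, 0)" using assms lens_ends[of z] by (auto simp: lens_def)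

lemma bend_inj_on: "g : gadgets S ==> inj_on (bend g) lens"
proof (rule inj_onI)
	fix z z' assume g: "g : gadgets S" and z: "z : lens" "z' : lens" and eq: "bend g z = bend g z'"
	obtain y x e where ge: "g = (y, x, e)" by (metis prod_cases3)
	have t: "target g ~= (y, x)" by (simp add: ge)
	let ?i = "%z::real \<times> real. 0 < fst z & fst z < 1"
	have ends: "z = (0,0) | z = (1,0)" "bend g z = place (if z = (0,0) then (y,x) else target g)"
	if "z : lens" "~ ?i z" for z using bend_hub[OF that] bend_ends(1)[of y x e] bend_ends(2)[where g = g] ge by auto
	have ne: "place (y, x) ~= place (target g)" using place_inj[of "(y, x)" "target g"] t by metis
	have np: "bend g z ~= place q" if "z : lens" "?i z" for z q by (rule bend_not_place[OF g that(1)]) (use that(2) in simp_all)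
	show "z = z'"
	proof (cases "?i z"; cases "?i z'")
	assume i: "?i z" "?i z'"
	from bend_inj[OF g g z i(1)[THEN conjunct1] i(1)[THEN conjunct2] i(2)[THEN conjunct1] i(2)[THEN conjunct2] eq]
	show ?thesis by (rule conjunct2)
	next
	assume i: "?i z" "~ ?i z'"
	from trans[OF eq ends(2)[OF z(2) i(2)]] show ?thesis using np[OF z(1) i(1)] by (rule notE[rotated])
	next
	assume i: "~ ?i z" "?i z'"
	from trans[OF eq[symmetric] ends(2)[OF z(1) i(1)]] show ?thesis using np[OF z(2) i(2)] by (rule notE[rotated])
	next
	assume i: "~ ?i z" "~ ?i z'"
	have "place (if z = (0,0) then (y,x) else target g) = place (if z' = (0,0) then (y,x) else target g)"
		using eq unfolding ends(2)[OF z(1) i(1)] ends(2)[OF z(2) i(2)] .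
	then have "z = (0, 0) \<longleftrightarrow> z' = (0, 0)" using ne by (simp split: if_splits)
	then show ?thesis using ends(1)[OF z(1) i(1)] ends(1)[OF z(2) i(2)] by auto
	qed
qed

text \<open>A hub is an end of many gadgets, so a vertex has no canonical description;
  \<open>bend_pt_eq\<close> shows that the choice does not matter and that distinct vertices get
  distinct points.\<close>

definition position :: "nat => nat => real \<times> real" where
	"position S v = (SOME p. EX g k. node_ok S g k & v = vtx S g k & p = bend g (pt k))"

lemma bend_pt_end:
	assumes "node_ok S g k" "~ k < 56"
	obtains p where "p : sites S" "vtx S g k = hub S p" "bend g (pt k) = place p"
proof -
	obtain y x e where g: "g = (y, x, e)" by (metis prod_cases3)
	consider "k = 56" | "k = 57" using vtx_end[OF assms] by blast
	then show thesis
	proof cases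
	case 1
	show thesis
	proof (rule that[of "(y, x)"])
		show "(y, x) : sites S" using assms(1) g by (simp add: node_ok_def gadgets_def sites_def)
		show "vtx S g k = hub S (y, x)" using 1 g by (simp add: vtx_56)
		show "bend g (pt k) = place (y, x)" using 1 g by (simp add: pt_56 bend_ends(1) del: bend.simps)
	qed
	next
	case 2
	show thesis
	proof (rule that[of "target g"])
		show "target g : sites S" using assms(1) 2 by (simp add: node_ok_def)
		show "vtx S g k = hub S (target g)" using 2 by (simp add: vtx_57)
		show "bend g (pt k) = place (target g)" using 2 by (simp add: pt_57 bend_ends(2) del: bend.simps)
	qed
	qed
qed

lemma bend_pt_eq:
	assumes "node_ok S g k" "node_ok S g' k'"
	shows "vtx S g k = vtx S g' k' \<longleftrightarrow> bend g (pt k) = bend g' (pt k')"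
proof (cases "k < 56"; cases "k' < 56")
	assume k: "k < 56" "k' < 56"
	have gg: "g : gadgets S" "g' : gadgets S" using assms by (auto simp: node_ok_def)
	show ?thesis
	proof
	assume "bend g (pt k) = bend g' (pt k')"
	from bend_inj[OF gg pt_inner(3)[OF k(1)] pt_inner(3)[OF k(2)] pt_inner(1,2)[OF k(1)] pt_inner(1,2)[OF k(2)] this]
	have "g = g'" "pt k = pt k'" by blast+
	moreover have "k = k'" by (rule pt_inj) (use k calculation in auto)
	ultimately show "vtx S g k = vtx S g' k'" by simp
	next
	assume "vtx S g k = vtx S g' k'"
	from vtx_inner_inj[OF gg k this] show "bend g (pt k) = bend g' (pt k')" by simp
	qed
next
	assume k: "k < 56" "~ k' < 56"
	obtain p where "vtx S g' k' = hub S p" "bend g' (pt k') = place p" by (rule bend_pt_end[OF assms(2) k(2)])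
	then show ?thesis using vtx_not_hub[of g S k p] bend_not_place[of g S "pt k" p] pt_inner k(1) assms by (auto simp: node_ok_def)
next
	assume k: "~ k < 56" "k' < 56"
	obtain p where "vtx S g k = hub S p" "bend g (pt k) = place p" by (rule bend_pt_end[OF assms(1) k(1)])
	then show ?thesis using vtx_not_hub[of g' S k' p] bend_not_place[of g' S "pt k'" p] pt_inner k(2) assms by (metis node_ok_def)
next
	assume k: "~ k < 56" "~ k' < 56"
	obtain p where "p : sites S" "vtx S g k = hub S p" "bend g (pt k) = place p" by (rule bend_pt_end[OF assms(1) k(1)])
	moreover obtain q where "q : sites S" "vtx S g' k' = hub S q" "bend g' (pt k') = place q" by (rule bend_pt_end[OF assms(2) k(2)])
	ultimately show ?thesis using hub_inj place_inj by metis
qed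

lemma position_vtx:
	assumes "node_ok S g k"
	shows "position S (vtx S g k) = bend g (pt k)" unfolding position_def
proof (rule someI2)
	show "EX g' k'. node_ok S g' k' & vtx S g k = vtx S g' k' & bend g (pt k) = bend g' (pt k')" using assms by blast
	fix p assume "EX g' k'. node_ok S g' k' & vtx S g k = vtx S g' k' & p = bend g' (pt k')"
	then obtain g' k' where "node_ok S g' k'" "vtx S g k = vtx S g' k'" "p = bend g' (pt k')" by blast
	then show "p = bend g (pt k)" using bend_pt_eq[OF assms] by simp
qed

definition curve :: "gadget => nat => nat => real => real \<times> real" where
	"curve g k l = bend g \<circ> linepath (pt k) (pt l)"

definition drawing :: "nat => nat set => real => real \<times> real" where
	"drawing S a = (SOME \<gamma>. EX g k l. a = {vtx S g k, vtx S g l} & (k, l) : set gadget_edges &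
	 node_ok S g k & node_ok S g l & \<gamma> = curve g k l)"

lemma drawingE:
	assumes "a : lattice_edges S"
	obtains g k l where "a = {vtx S g k, vtx S g l}" "(k, l) : set gadget_edges" "node_ok S g k" "node_ok S g l"
	"drawing S a = curve g k l"
proof -
	have "EX \<gamma> g k l. a = {vtx S g k, vtx S g l} & (k, l) : set gadget_edges &
	 node_ok S g k & node_ok S g l & \<gamma> = curve g k l" using assms by (auto simp: lattice_edges_def)
	from someI_ex[OF this] show thesis using that unfolding drawing_def by blast
qed

lemma segment_lens: "k < 58 ==> l < 58 ==> closed_segment (pt k) (pt l) \<subseteq> lens"
	using convex_lens pt_lens by (simp add: closed_segment_subset)

lemma segment_end:
	assumes "z : closed_segment (pt k) (pt l)" "k < 56" "l < 58" "~ (0 < fst z & fst z < 1)"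
	shows "~ l < 56 & z = pt l"
proof -
	obtain t where t: "0 <= t" "t <= 1" "z = (1 - t) *\<^sub>R pt k + t *\<^sub>R pt l" using assms(1) by (auto simp: closed_segment_def)
	have f: "fst z = (1 - t) * fst (pt k) + t * fst (pt l)" using t(3) by simp
	have k: "0 < fst (pt k)" "fst (pt k) < 1" using pt_inner assms by auto
	have l: "0 <= fst (pt l)" "fst (pt l) <= 1" using pt_lens[OF assms(3)] by (auto simp: lens_def)
	have "t = 1"
	proof (rule ccontr)
	assume "t ~= 1"
	then have "0 < 1 - t" using t by simp
	then have "0 < (1 - t) * fst (pt k)" "(1 - t) * fst (pt k) < 1 - t" using k by auto
	moreover have "0 <= t * fst (pt l)" "t * fst (pt l) <= t" using t l by (auto simp: mult_left_le)
	ultimately show False using f assms(4) by linarith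
	qed
	then have "z = pt l" using t by simp
	then show ?thesis using assms(4) pt_inner by auto
qed

lemma curve_image: "path_image (curve g k l) = bend g ` closed_segment (pt k) (pt l)"
	unfolding curve_def path_image_def image_comp[symmetric] linepath_image_01 ..

lemma vertex_cases:
	assumes "v < S * S * 1009"
	obtains g k where "node_ok S g k" "v = vtx S g k"
proof -
	define s where "s = v div 1009"
	have "s < S * S" using assms by (simp add: s_def div_less_iff_less_mult)
	then have S: "s div S < S" "s mod S < S" "(s div S) * S + s mod S = s"
	using less_mult_imp_div_less[of s S S] by (auto intro!: mod_less_divisor gr0I)
	show thesis
	proof (cases "v mod 1009 = 0")
	case True
	then have "v = s * 1009" using div_mult_mod_eq[of v 1009] by (simp add: s_def)
	moreover have "hub S (s div S, s mod S) = s * 1009" using S(3) by (simp only: hub_def prod.case)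
	ultimately have "v = vtx S (s div S, s mod S, 0) 56" by (simp only: vtx_56)
	moreover have "node_ok S (s div S, s mod S, 0) 56" using S by (simp add: node_ok_def gadgets_def)
	ultimately show thesis using that by blast
	next
	case False
	define o1 where "o1 = v mod 1009 - 1"
	have o1: "o1 < 1008" "v = s * 1009 + Suc o1" using False div_mult_mod_eq[of v 1009] mod_less_divisor[of 1009 v] by (auto simp: o1_def s_def)
	have "o1 div 56 < 18" using o1 by (simp add: div_less_iff_less_mult)
	then have "node_ok S (s div S, s mod S, o1 div 56) (o1 mod 56)" using S mod_less_divisor[of 56 o1] by (auto simp: node_ok_def gadgets_def)
	moreover have "v = vtx S (s div S, s mod S, o1 div 56) (o1 mod 56)" using o1 S by (simp add: vtx.simps)
	ultimately show thesis using that by blast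
	qed
qed

lemma arc_curve:
	assumes "node_ok S g k" "node_ok S g l" "k ~= l"
	shows "arc (curve g k l)"
proof -
	have k: "k < 58" "l < 58" "g : gadgets S" using assms by (auto simp: node_ok_def)
	have "pt k ~= pt l" using pt_inj[OF k(1,2)] assms(3) by blast
	then have a: "arc (linepath (pt k) (pt l))" by (rule arc_linepath)
	have "path (bend g \<circ> linepath (pt k) (pt l))" using continuous_bend by (rule path_continuous_image[OF path_linepath])
	moreover have "inj_on (bend g \<circ> linepath (pt k) (pt l)) {0..1}"
	proof (rule comp_inj_on)
	show "inj_on (linepath (pt k) (pt l)) {0..1}" using a by (simp add: arc_def)
	show "inj_on (bend g) (linepath (pt k) (pt l) ` {0..1})"
		unfolding linepath_image_01 by (rule inj_on_subset[OF bend_inj_on[OF k(3)] segment_lens[OF k(1,2)]])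
	qed
	ultimately show ?thesis by (simp add: curve_def arc_def)
qed

lemma curve_ends:
	"pathstart (curve g k l) = bend g (pt k)" "pathfinish (curve g k l) = bend g (pt l)"
	by (simp_all add: curve_def pathstart_def pathfinish_def linepath_def)

lemma lattice_planar: "planar {..<S * S * 1009} (lattice_edges S)" unfolding planar_def
proof (intro exI[of _ "position S"] exI[of _ "drawing S"] conjI ballI impI)
	show "inj_on (position S) {..<S * S * 1009}"
	proof (rule inj_onI)
	fix u v assume "u : {..<S * S * 1009}" "v : {..<S * S * 1009}" "position S u = position S v"
	moreover from this(1) obtain g k where u: "node_ok S g k" "u = vtx S g k" by (rule vertex_cases[OF lessThan_iff[THEN iffD1]])
	moreover from \<open>v : _\<close> obtain g' k' where v: "node_ok S g' k'" "v = vtx S g' k'" by (rule vertex_cases[OF lessThan_iff[THEN iffD1]])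
	ultimately show "u = v" using bend_pt_eq[OF u(1) v(1)] position_vtx[OF u(1)] position_vtx[OF v(1)] by simp
	qed
next
	fix a assume "a : lattice_edges S"
	then obtain g k l where a: "a = {vtx S g k, vtx S g l}" "(k, l) : set gadget_edges" "node_ok S g k" "node_ok S g l"
	"drawing S a = curve g k l" by (rule drawingE)
	have kl: "k ~= l" "k < 56" "l < 58" "g : gadgets S" using gadget_edge_nbr[OF a(2)] gadget_edge_bounds[OF a(2)] a(3) by (auto simp: node_ok_def)
	show "arc (drawing S a)" unfolding a(5) by (rule arc_curve[OF a(3,4) kl(1)])
	show "{pathstart (drawing S a), pathfinish (drawing S a)} = position S ` a" using a by (simp add: curve_ends position_vtx)
	have ends: "bend g (pt k) : path_image (curve g k l)" "bend g (pt l) : path_image (curve g k l)" by (auto simp: curve_image)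
	show "path_image (drawing S a) \<inter> position S ` {..<S * S * 1009} = position S ` a"
	proof
	show "position S ` a \<subseteq> path_image (drawing S a) \<inter> position S ` {..<S * S * 1009}"
	proof -
		have "a \<subseteq> {..<S * S * 1009}" using a(1) vtx_less[OF a(3)] vtx_less[OF a(4)] by simp
		moreover have "position S ` a \<subseteq> path_image (drawing S a)"
			using ends unfolding a(5) by (simp add: a(1) position_vtx[OF a(3)] position_vtx[OF a(4)])
		ultimately show ?thesis by blast
	qed
	show "path_image (drawing S a) \<inter> position S ` {..<S * S * 1009} \<subseteq> position S ` a"
	proof
		fix p assume "p : path_image (drawing S a) \<inter> position S ` {..<S * S * 1009}"
		then obtain z v where z: "z : closed_segment (pt k) (pt l)" "p = bend g z" and v: "v < S * S * 1009" "p = position S v"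
			using a(5) by (auto simp: curve_image)
		obtain g' m where m: "node_ok S g' m" "v = vtx S g' m" by (rule vertex_cases[OF v(1)])
		have p: "p = bend g' (pt m)" using v m position_vtx by simp
		have zl: "z : lens" using segment_lens[of k l] z(1) kl by auto
		have "v : a"
		proof (cases "0 < fst z & fst z < 1")
			case False
			then have "z = pt l" using segment_end[OF z(1) kl(2,3)] by blast
			then show ?thesis using p z(2) bend_pt_eq[OF a(4) m(1)] a(1) m(2) by simp
		next
			case True
			have "m < 56"
			proof (rule ccontr)
				assume "~ m < 56"
				then obtain q where "bend g' (pt m) = place q" by (rule bend_pt_end[OF m(1)])
				then show False using bend_not_place[OF kl(4) zl] True p z(2) by metis
			qed
			from bend_inj[OF kl(4) node_gadget[OF m(1)] zl pt_inner(3)[OF this] True[THEN conjunct1] True[THEN conjunct2]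
					pt_inner(1,2)[OF this] trans[OF z(2)[symmetric] p]]
			have gm: "g' = g" "z = pt m" by blast+
			\<comment> \<open>The vertex \<open>m\<close> has an edge of its own; if it were not an end of
			  the present edge, the two edges would meet in a point that is not a common end.\<close>
			have "m : {k, l}"
			proof (rule ccontr)
				assume nm: "m \<notin> {k, l}"
				obtain i j where ij: "(i, j) : set gadget_edges" "m : {i, j}" by (rule gadget_edge_at[OF \<open>m < 56\<close>])
				have "pt m : pt ` ({k, l} \<inter> {i, j})" using gadget_segment_intersection[OF a(2) ij(1)] nm ij(2) z(1) gm(2) by auto
				then obtain n where "n : {k, l}" "pt m = pt n" by auto
				moreover have "m = n" by (rule pt_inj) (use \<open>m < 56\<close> kl \<open>n : {k, l}\<close> \<open>pt m = pt n\<close> in auto)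
				ultimately show False using nm by blast
			qed
			then show ?thesis using gm m a(1) by auto
		qed
		then show "p : position S ` a" using v(2) by blast
	qed
	qed
next
	fix a b assume "a : lattice_edges S" and "b : lattice_edges S" and ab: "a ~= b"
	then obtain g k l g' m n where a: "a = {vtx S g k, vtx S g l}" "(k, l) : set gadget_edges" "node_ok S g k" "node_ok S g l"
	"drawing S a = curve g k l"
	and b: "b = {vtx S g' m, vtx S g' n}" "(m, n) : set gadget_edges" "node_ok S g' m" "node_ok S g' n"
	"drawing S b = curve g' m n" using drawingE[OF \<open>a : lattice_edges S\<close>] drawingE[OF \<open>b : lattice_edges S\<close>] by metis
	have kl: "k < 56" "l < 58" "g : gadgets S" and mn: "m < 56" "n < 58" "g' : gadgets S"
	using gadget_edge_bounds[OF a(2)] gadget_edge_bounds[OF b(2)] a(3) b(3) by (auto simp: node_ok_def)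
	have ends: "bend g (pt k) : path_image (curve g k l)" "bend g (pt l) : path_image (curve g k l)" for g k l by (auto simp: curve_image)
	show "path_image (drawing S a) \<inter> path_image (drawing S b) = position S ` (a \<inter> b)"
	proof
	have "position S ` a \<subseteq> path_image (drawing S a)" "position S ` b \<subseteq> path_image (drawing S b)"
		using a b ends by (auto simp: position_vtx)
	then show "position S ` (a \<inter> b) \<subseteq> path_image (drawing S a) \<inter> path_image (drawing S b)" by blast
	show "path_image (drawing S a) \<inter> path_image (drawing S b) \<subseteq> position S ` (a \<inter> b)"
	proof
		fix p assume "p : path_image (drawing S a) \<inter> path_image (drawing S b)"
		then obtain z z' where z: "z : closed_segment (pt k) (pt l)" "p = bend g z"
			and z': "z' : closed_segment (pt m) (pt n)" "p = bend g' z'" using a(5) b(5) by (auto simp: curve_image)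
		have "k < 58" "m < 58" using kl(1) mn(1) by simp_all
		then have zl: "z : lens" "z' : lens" using segment_lens[OF _ kl(2)] segment_lens[OF _ mn(2)] z(1) z'(1) by blast+
		let ?i = "%z::real \<times> real. 0 < fst z & fst z < 1"
		show "p : position S ` (a \<inter> b)"
		proof (cases "?i z"; cases "?i z'")
			assume i: "?i z" "?i z'"
			from bend_inj[OF kl(3) mn(3) zl i(1)[THEN conjunct1] i(1)[THEN conjunct2] i(2)[THEN conjunct1] i(2)[THEN conjunct2]
					trans[OF z(2)[symmetric] z'(2)]]
			have gz: "g' = g" "z' = z" by blast+
			have "{k, l} ~= {m, n}" using ab a(1) b(1) gz by auto
			then obtain q where q: "q : {k, l}" "q : {m, n}" "z = pt q" using gadget_segment_intersection[OF a(2) b(2)] z(1) z'(1) gz by blast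
			have "vtx S g q : a \<inter> b" using q a(1) b(1) gz by auto
			moreover have "node_ok S g q" using q(1) a(3,4) by auto
			then have "p = position S (vtx S g q)" using position_vtx[of S g q] z(2) q(3) by simp
			ultimately show ?thesis by blast
		next
			assume i: "?i z" "~ ?i z'"
			then have "z' = pt n" "~ n < 56" using segment_end[OF z'(1) mn(1,2)] by auto
			obtain q where "bend g' (pt n) = place q" by (rule bend_pt_end[OF b(4) \<open>~ n < 56\<close>])
			then have "p = place q" using z'(2) \<open>z' = pt n\<close> by simp
			then show ?thesis using bend_not_place[OF kl(3) zl(1)] i z(2) by metis
		next
			assume i: "~ ?i z" "?i z'"
			then have "z = pt l" "~ l < 56" using segment_end[OF z(1) kl(1,2)] by auto
			obtain q where "bend g (pt l) = place q" by (rule bend_pt_end[OF a(4) \<open>~ l < 56\<close>])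
			then have "p = place q" using z(2) \<open>z = pt l\<close> by simp
			then show ?thesis using bend_not_place[OF mn(3) zl(2)] i z'(2) by metis
		next
			assume "~ ?i z" "~ ?i z'"
			then have "z = pt l" "z' = pt n" using segment_end[OF z(1) kl(1,2)] segment_end[OF z'(1) mn(1,2)] by auto
			then have "vtx S g l = vtx S g' n" "p = position S (vtx S g l)" using bend_pt_eq[OF a(4) b(4)] z z' position_vtx[OF a(4)] by auto
			then show ?thesis using a(1) b(1) by auto
		qed
	qed
	qed
qed

section \<open>Certificates, the verifier and membership in NP\<close>

context verification
begin

lemma colour_eq: "colour i = sorted_list_of_set (L i) ! choice i" by (simp add: colour_def codes_def)

lemma conflict_free_iff:
	"(\<Sum>i<n. \<Sum>j<n. conflict i j) = 0 \<longleftrightarrow> (ALL i<n. ALL j<n. {i, j} : E --> colour i ~= colour j)"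
	by (auto simp: conflict_def)

lemma colourable:
	assumes "list_assignment {..<n} L" "ALL i<n. ALL j<n. {i, j} : E --> colour i ~= colour j"
	shows "(n, E, L) : list_colourable"
proof -
	have c: "colour i : L i" if "i < n" for i
	proof -
	have "finite (L i)" "card (L i) = 3" using three that by (simp_all add: regular_assignment_def)
	then have "set (sorted_list_of_set (L i)) = L i" "choice i < length (sorted_list_of_set (L i))" using choice_less[of i] by simp_all
	then show ?thesis unfolding colour_eq using nth_mem by blast
	qed
	have one: "1 <= colour i" if "i < n" for i
	proof -
	have "L i \<subseteq> {1..}" using assms(1) that by (simp add: list_assignment_def)
	then show ?thesis using c[OF that] by auto
	qed
	have "i < n & j < n" if "{i, j} : E" for i j
	proof -
	have "ALL e:E. e \<subseteq> {..<n} & card e = 2" using simple unfolding simple_graph_def by (rule conjunct2)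
	from bspec[OF this that] show ?thesis by simp
	qed
	then have "colouring {..<n} E colour" unfolding colouring_def lessThan_iff Ball_def using one assms(2) by blast
	moreover have "respects_lists {..<n} colour L" using c by (simp add: respects_lists_def)
	ultimately show ?thesis unfolding list_colourable_def by blast
qed

end

lemma certificate_exists:
	assumes "simple_graph {..<n} E" "regular_assignment 3 {..<n} L" "respects_lists {..<n} c L"
	shows "EX u. length u = 2 * n & (ALL i<n. verification.colour L u i = c i)"
proof -
	have "EX k<3. sorted_list_of_set (L i) ! k = c i" if "i < n" for i
	proof -
	have "finite (L i)" "card (L i) = 3" "c i : L i" using assms that by (simp_all add: regular_assignment_def respects_lists_def)
	then have "c i : set (sorted_list_of_set (L i))" "length (sorted_list_of_set (L i)) = 3" by simp_all
	then show ?thesis by (metis in_set_conv_nth)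
	qed
	then obtain ch where ch: "\<And>i. i < n ==> ch i < (3::nat) & sorted_list_of_set (L i) ! ch i = c i" by metis
	\<comment> \<open>The two bits of a vertex are True False, False True and False False for the
	  choices 0, 1 and 2, as \<open>choice\<close> reads them.\<close>
	define u where "u = map (%k. if even k then ch (k div 2) = 0 else ch (k div 2) = 1) [0..<2 * n]"
	interpret verification n E L u using assms by unfold_locales
	have l: "length u = 2 * n" by (simp add: u_def)
	have "colour i = c i" if i: "i < n" for i
	proof -
	have "u ! (2 * i) = (ch i = 0)" "u ! (2 * i + 1) = (ch i = 1)" using i by (simp_all add: u_def)
	moreover have "wu (2 * int i) = bit_symbol (u ! (2 * i))" "wu (2 * int i + 1) = bit_symbol (u ! (2 * i + 1))"
		using spells_nth[OF spells_word[of u], of "2 * i"] spells_nth[OF spells_word[of u], of "2 * i + 1"] i l by (simp_all add: algebra_simps)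
	ultimately have "choice i = ch i" unfolding choice_def using ch[OF i] by (auto simp: bit_symbol_def)
	then show ?thesis using ch[OF i] by (simp add: colour_eq)
	qed
	with l show ?thesis by blast
qed

lemma poly_nat_mono: "m <= n ==> poly (p :: nat poly) m <= poly p n" by (induction p) (simp_all add: mult_le_mono)

definition verifier_prep :: prog where
	"verifier_prep = transfer 0 [2, 6, 7, 8, 9, 10] ;; transfer 1 [11, 12] ;; writes [4, 5, 13, 14, 15, 16, 17] (%v. (1, Stay))"

lemma runs_verifier_prep:
	"runs verifier_prep (init_mem [x, u]) (40 * (length x + length u) + 200) (st (vtapes x u) (%_. 0))"
proof -
	let ?T1 = "%j. if j = 0 then word_tape [] else if j : set [2, 6, 7, 8, 9, 10] then word_tape x else init_mem [x, u] j"
	have r1: "runs (transfer 0 [2, 6, 7, 8, 9, 10]) (init_mem [x, u])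
		((length x + 1) * (2 * length [2::nat, 6, 7, 8, 9, 10] + 9) + 2 * length [2::nat, 6, 7, 8, 9, 10] + 9) ?T1"
	by (rule runs_transfer) (auto simp: ntapes_def init_mem_def)
	let ?T2 = "%j. if j = 1 then word_tape [] else if j : set [11, 12] then word_tape u else ?T1 j"
	have r2: "runs (transfer 1 [11, 12]) ?T1
		((length u + 1) * (2 * length [11::nat, 12] + 9) + 2 * length [11::nat, 12] + 9) ?T2"
	by (rule runs_transfer) (auto simp: ntapes_def init_mem_def)
	let ?is = "[4, 5, 13, 14, 15, 16, 17] :: nat list"
	let ?T3 = "%j. if j : set ?is then act_tape (1, Stay) (?T2 j) else ?T2 j"
	have r3: "runs (writes ?is (%v. (1, Stay))) ?T2 (Suc (length ?is)) ?T3" by (rule runs_writes) simp_all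
	have e: "?T3 = st (vtapes x u) (%_. 0)"
	proof
	fix j
	have v: "(vtapes x u j, 0) = (if j : {2, 6, 7, 8, 9, 10} then word_tape x else if j : {11, 12} then word_tape u
			else if j : {4, 5, 13, 14, 15, 16, 17} then act_tape (1, Stay) (word_tape []) else word_tape [])"
		unfolding vtapes_def by (auto simp: word_tape_def counter_def fun_eq_iff)
	show "?T3 j = st (vtapes x u) (%_. 0) j" unfolding st_def v by (auto simp: init_mem_def less_Suc_eq)
	qed
	have "runs verifier_prep (init_mem [x, u])
		((length x + 1) * (2 * length [2::nat, 6, 7, 8, 9, 10] + 9) + 2 * length [2::nat, 6, 7, 8, 9, 10] + 9 +
		 ((length u + 1) * (2 * length [11::nat, 12] + 9) + 2 * length [11::nat, 12] + 9 + Suc (length ?is))) ?T3"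
	unfolding verifier_prep_def by (rule runs_Seq[OF r1 runs_Seq[OF r2 r3]])
	then show ?thesis unfolding e by (rule runs_mono) simp
qed

lemma computes_within_unique:
	assumes "computes_within M ws t [a]" "computes_within M ws t [b]"
	shows "a = b" using assms by (auto simp: computes_within_def tape_output_def bit_symbol_def split: if_splits prod.splits)

theorem list_colouring_in_NP: "in_NP encode_input (restricted_to (regular_list_colouring_instances 3) G) list_colourable"
proof -
	\<comment> \<open>The initial clock is the time bound from \<open>verify_runs\<close>, so that it
	  suffices on every code.\<close>
	define pk :: "nat poly" where "pk = smult 300 ([:1, 1:] ^ 3)"
	have pk: "poly pk m = 300 * (m + 1) ^ 3" for m by (simp add: pk_def poly_power)
	obtain cl tc where cl: "wf_prog cl"
	"\<And>w h x. w 2 = fst (word_tape x) ==> w 4 = counter ==> w 5 = counter ==> h 2 = 0 ==> h 4 = 0 ==> h 5 = 0 ==>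
		 runs cl (st w h) (poly tc (length x)) (st w (h(4 := int (poly pk (length x)))))" using poly_program[of pk] by blast
	let ?k = "%x :: bool list. 300 * (length x + 1) ^ 3"
	let ?h = "%x :: bool list. (%_ :: nat. 0 :: int)(4 := int (?k x))"
	let ?cc = "ccost verify"
	\<comment> \<open>The head of tape 15 is at its mark 1 exactly if no conflict was counted; 2 and 1
	  are the symbols for True and False.\<close>
	define prog where "prog = verifier_prep ;; cl ;; clocked verify ;; Op 0 (%v. (if v 15 = 1 then 2 else 1, Stay))"
	have wf: "wf_prog prog" using cl(1) wf_clocked[OF moving_verify] by (auto simp: prog_def verifier_prep_def wf_transfer nsyms_def ntapes_def)
	define P where "P = [:200, 40:] + tc + smult ?cc (pk + 1) + smult 2 pk + 1"
	have P: "poly P m = 200 + 40 * m + poly tc m + ?cc * (300 * (m + 1) ^ 3 + 1) + 2 * (300 * (m + 1) ^ 3) + 1" for m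
	unfolding P_def poly_add poly_smult pk by simp
	have out: "computes_within (machine prog) [x, u] (poly P (length x + length u)) [h' 15 = 0]"
	if r: "exec (clocked verify) (st (vtapes x u) (?h x)) t (st (vtapes x u) h')"
		and h0: "h' 0 = 0" and t: "t <= ?cc * (?k x + 1) + 2 * ?k x" for x u t h'
	proof -
	let ?w = "vtapes x u"
	have r1: "runs cl (st ?w (%_. 0)) (poly tc (length x)) (st ?w (?h x))" unfolding pk[symmetric] by (rule cl(2)) (simp_all add: vtapes)
	have r2: "runs (clocked verify) (st ?w (?h x)) t (st ?w h')" using r unfolding runs_def by blast
	let ?T = "(st ?w h')(0 := act_tape (if view (st ?w h') 15 = 1 then 2 else 1, Stay) (st ?w h' 0))"
	have r3: "runs (Op 0 (%v. (if v 15 = 1 then 2 else 1, Stay))) (st ?w h') 1 ?T" by (rule runs_Op)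
	have r: "runs prog (init_mem [x, u]) (40 * (length x + length u) + 200 + (poly tc (length x) + (t + 1))) ?T"
		unfolding prog_def by (rule runs_Seq[OF runs_verifier_prep runs_Seq[OF r1 runs_Seq[OF r2 r3]]])
	have bound: "40 * m + 200 + (a + (s + 1)) <= 200 + 40 * m + a' + b' + 2 * k' + 1"
		if "a <= a'" "s <= b + 2 * k" "b <= b'" "k <= k'" for a a' b b' k k' m s :: nat using that by linarith
	have k: "?k x <= 300 * (length x + length u + 1) ^ 3" by (intro mult_le_mono2 power_mono) simp_all
	have b: "?cc * (?k x + 1) <= ?cc * (300 * (length x + length u + 1) ^ 3 + 1)" by (rule mult_le_mono2[OF add_le_mono1[OF k]])
	have "40 * (length x + length u) + 200 + (poly tc (length x) + (t + 1)) <= poly P (length x + length u)"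
		unfolding P by (rule bound[OF poly_nat_mono[OF le_add1] t b k])
	from runs_mono[OF r this] have "runs prog (init_mem [x, u]) (poly P (length x + length u)) ?T" .
	moreover have v: "view (st ?w h') 15 = counter (h' 15)" by (simp add: view_st look_def vtapes ntapes_def)
	have "tape_output (?T 0) [h' 15 = 0]" unfolding v by (simp add: st_def h0 tape_output_def vtapes_def counter_def bit_symbol_def)
	ultimately show ?thesis by (rule runs_computes[OF _ wf])
	qed
	\<comment> \<open>The relation is whatever the machine answers, so it is decided on all words by
	  construction. Its meaning is needed only on codes.\<close>
	define R where "R x u \<longleftrightarrow> computes_within (machine prog) [x, u] (poly P (length x + length u)) [True]" for x u
	have dec: "computes_within (machine prog) [x, u] (poly P (length x + length u)) [R x u]" for x u
	proof -
	have h4: "?h x 4 = int (?k x)" by simp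
	obtain t h' k' where e: "exec (clocked verify) (st (vtapes x u) (?h x)) t (st (vtapes x u) h')"
		"h' 0 = ?h x 0" "t + ?cc * k' <= ?cc * (?k x + 1)"
		using clocked_halts[where w = "vtapes x u" and h = "?h x" and k = "?k x", OF moving_verify vtapes(9) h4] by blast
	have c: "computes_within (machine prog) [x, u] (poly P (length x + length u)) [h' 15 = 0]"
	proof (rule out[OF e(1)])
		show "h' 0 = 0" using e(2) by simp
		show "t <= ?cc * (?k x + 1) + 2 * ?k x" by (rule order_trans[OF le_add1 order_trans[OF e(3) le_add1]])
	qed
	then have "R x u | computes_within (machine prog) [x, u] (poly P (length x + length u)) [False]" unfolding R_def by (cases "h' 15 = 0") simp_all
	then show ?thesis by (cases "R x u") (simp_all add: R_def)
	qed
	have correct: "R (encode_input (n, E, L)) u \<longleftrightarrow>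
		(ALL i<n. ALL j<n. {i, j} : E --> verification.colour L u i ~= verification.colour L u j)"
	if "simple_graph {..<n} E" "regular_assignment 3 {..<n} L" for n E L u
	proof -
	interpret verification n E L u using that by unfold_locales
	let ?f = "\<Sum>i<n. \<Sum>j<n. conflict i j"
	have "runs verify (st w (%_. 0)) (300 * K ^ 3) (st w (place_heads (%_. 0) n 0 ?f))" by (rule verify_runs) (rule refl)+
	then obtain t where t: "t <= 300 * K ^ 3" "exec verify (st w (%_. 0)) t (st w (place_heads (%_. 0) n 0 ?f))" unfolding runs_def by blast
	obtain h' where h': "st w (place_heads (%_. 0) n 0 ?f) = st w h'"
		"ALL k>=t. EX t' k'. t' <= 2 * t & k - t <= k' & k' <= k &
			 exec (clocked verify) (st w ((%_. 0)(4 := int k))) t' (st w (h'(4 := int k')))"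
		using clocked_sim[where w = w and h = "%_. 0", OF t(2) moving_verify refl vtapes(9)] by blast
	have eq: "h' = place_heads (%_. 0) n 0 ?f" using h'(1) by (simp add: st_def fun_eq_iff)
	obtain t' k' where t': "t' <= 2 * t"
		"exec (clocked verify) (st w ((%_. 0)(4 := int (300 * K ^ 3)))) t' (st w (h'(4 := int k')))" using h'(2)[rule_format, OF t(1)] by blast
	have c: "computes_within (machine prog) [x, u] (poly P (length x + length u)) [(h'(4 := int k')) 15 = 0]"
	proof (rule out[OF t'(2)])
		show "(h'(4 := int k')) 0 = 0" by (simp add: eq place_heads_def)
		show "t' <= ?cc * (?k x + 1) + 2 * ?k x" by (rule order_trans[OF t'(1) order_trans[OF mult_le_mono2[OF t(1), of 2] le_add2]])
	qed
	have f: "(h'(4 := int k')) 15 = int ?f" by (simp add: eq place_heads_def)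
	have "R x u = (?f = 0)" using computes_within_unique[OF dec c] unfolding f of_nat_eq_0_iff .
	then show ?thesis unfolding conflict_free_iff x_def .
	qed
	\<comment> \<open>A code is longer than its number of vertices, so twice its length leaves room for
	  two bits per vertex.\<close>
	define A where "A = {x. EX u. length u <= poly [:0, 2:] (length x) & R x u}"
	have "2 <= tapes (machine prog)" by (simp add: machine_def ntapes_def)
	then have "polytime_decidable2 R" unfolding polytime_decidable2_def using wf_machine[OF wf] dec by blast
	then have A: "A : NP" unfolding NP_def A_def by blast
	have "encode_input (n, E, L) : A \<longleftrightarrow> (n, E, L) : list_colourable"
	if "(n, E, L) : restricted_to (regular_list_colouring_instances 3) G" for n E L
	proof -
	have i: "simple_graph {..<n} E" "list_assignment {..<n} L" "regular_assignment 3 {..<n} L"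
		using that by (simp_all add: restricted_to_def regular_list_colouring_instances_def)
	show ?thesis
	proof
		assume "encode_input (n, E, L) : A"
		then obtain u where u: "R (encode_input (n, E, L)) u" unfolding A_def by blast
		interpret verification n E L u using i by unfold_locales
		show "(n, E, L) : list_colourable" by (rule colourable[OF i(2) correct[OF i(1,3), THEN iffD1, OF u]])
	next
		assume "(n, E, L) : list_colourable"
		then obtain c where c: "colouring {..<n} E c" "respects_lists {..<n} c L" unfolding list_colourable_def by blast
		obtain u where u: "length u = 2 * n" "ALL i<n. verification.colour L u i = c i" using certificate_exists[OF i(1,3) c(2)] by blast
		interpret verification n E L u using i by unfold_locales
		have "ALL i<n. ALL j<n. {i, j} : E --> colour i ~= colour j" using c(1) u(2) unfolding colouring_def by simp
		then have "R (encode_input (n, E, L)) u" by (rule correct[OF i(1,3), THEN iffD2])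
		moreover have "length u <= poly [:0, 2:] (length (encode_input (n, E, L)))" using n_less(1) u(1) unfolding x_def by simp
		ultimately show "encode_input (n, E, L) : A" unfolding A_def by blast
	qed
	qed
	with A show ?thesis unfolding in_NP_def by (metis prod_cases3)
qed

section \<open>NP-hardness\<close>

lemma list_colouring_NP_hard:
	"NP_hard encode_input
	 (restricted_to (regular_list_colouring_instances 3)
			(%V E. planar V E & ~ has_cycle_of_length E 4 & ~ has_cycle_of_length E 5 &
						 ~ intersecting_triangles E))
	 list_colourable" unfolding NP_hard_def
proof
	fix A assume "A : NP"
	then obtain R q where R: "polytime_decidable2 R" "\<And>x. x : A \<longleftrightarrow> (EX u. length u <= poly q (length x) & R x u)"
	unfolding NP_def by blast
	obtain M p where M: "wf_tm M" "2 <= tapes M" "\<And>x u. computes_within M [x, u] (poly p (length x + length u)) [R x u]"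
	using R(1) unfolding polytime_decidable2_def by blast
	\<comment> \<open>The side of the square must exceed the running time on all admissible
	  certificates, bound their length, and be at least 2.\<close>
	define pN where "pN = pcompose p ([:0, 1:] + q) + q + [:2:]"
	have pN: "poly pN n = poly p (n + poly q n) + poly q n + 2" for n by (simp add: pN_def poly_pcompose)
	have N: "1 < poly pN n" "poly q n <= poly pN n" for n unfolding pN by simp_all
	have "EX i : restricted_to (regular_list_colouring_instances 3)
			(%V E. planar V E & ~ has_cycle_of_length E 4 & ~ has_cycle_of_length E 5 & ~ intersecting_triangles E).
		encode_input (lattice_instance M q pN w) = encode_input i & (w : A \<longleftrightarrow> i : list_colourable)" for w
	proof -
	let ?N = "poly pN (length w)" and ?Q = "poly q (length w)"
	interpret grid: clause_grid M w ?N ?Q using N by unfold_locales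
	let ?S = "6 * width M * ((2 * ?N + 1) * (2 * ?N + 1))"
	let ?i = "(?S * ?S * 1009, lattice_edges ?S, lattice_lists ?S (cell_grid grid.cells))"
	have i: "lattice_instance M q pN w = ?i" by (simp only: lattice_instance_def Let_def)
	have time: "computes_within M [w, u] (poly p (length w + length u)) [R w u] & poly p (length w + length u) < ?N"
		if "length u <= ?Q" for u using M(3)[of w u] poly_nat_mono[of "length w + length u" "length w + ?Q" p] that unfolding pN by simp
	have "?i : list_colourable \<longleftrightarrow> (EX h. csp_solution ?S (cell_grid grid.cells) h)" by (rule lattice_colourable_iff)
	also have "\<dots> \<longleftrightarrow> w : A" using grid.grid_solvable_iff clauses_satisfiable_iff[where x = w and N = ?N and Q = ?Q and
				T = "%u. poly p (length w + length u)" and R = "R w", OF M(1,2) N time] unfolding grid.W_def grid.clauses_at_def R(2) by blast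
	finally have "w : A \<longleftrightarrow> ?i : list_colourable" by blast
	moreover have "?i : restricted_to (regular_list_colouring_instances 3)
			(%V E. planar V E & ~ has_cycle_of_length E 4 & ~ has_cycle_of_length E 5 & ~ intersecting_triangles E)"
		unfolding restricted_to_def regular_list_colouring_instances_def
		using lattice_simple[of ?S] lattice_regular[of ?S "cell_grid grid.cells"] lattice_planar[of ?S]
			lattice_no_short_cycles[of ?S] lattice_no_intersecting[of ?S] by blast
	ultimately show ?thesis unfolding i by blast
	qed
	then show "EX f. polytime_computable f & (ALL w. EX i : restricted_to (regular_list_colouring_instances 3)
			(%V E. planar V E & ~ has_cycle_of_length E 4 & ~ has_cycle_of_length E 5 & ~ intersecting_triangles E).
		f w = encode_input i & (w : A \<longleftrightarrow> i : list_colourable))"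
	by (intro exI[of _ "%x. encode_input (lattice_instance M q pN x)"] conjI allI lattice_instance_computable[OF N])
qed

theorem theorem7:
  "NP_complete encode_input
     (restricted_to (regular_list_colouring_instances 3)
        (\<lambda>V E. planar V E \<and> \<not> has_cycle_of_length E 4 \<and> \<not> has_cycle_of_length E 5 \<and>
               \<not> intersecting_triangles E))
     list_colourable"
  unfolding NP_complete_def using list_colouring_in_NP list_colouring_NP_hard by blast

end
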